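(* Let $G\cong C_{k_1}\times\dots\times C_{k_N}$ be a finite Abelian group, where $N\ge 0$, $k_1,\dots,k_N\ge 2$ and $C_{k_\alpha}$ is the cyclic group of order $k_\alpha$; let $m=k_1\cdots k_N=|G|$ and let $t^{(\alpha)}\in G$ be a generator of the factor $C_{k_\alpha}$, $\alpha=1,\dots,N$. Let $n\ge1$, let $\widetilde{G}_n=G^n\rtimes S_n$, let $\underline{\lambda}$ be an $m$-partition of size $n$ and $\mathcal{T}$ a standard $m$-tableau of shape $\underline{\lambda}$. For $i=1,\dots,n$ set $\mathrm{p}_i:=\mathrm{p}(\mathcal{T}|i)$ and $\mathrm{c}_i:=\mathrm{c}(\mathcal{T}|i)$. Then the idempotent $E_{\mathcal{T}}$ of $\mathbb{C}\widetilde{G}_n$ corresponding to $\mathcal{T}$ is obtained by the following consecutive evaluations (first all variables $v^{(\alpha)}_i$ simultaneously, then $u_1$, then $u_2$, ..., and finally $u_n$; in particular the rational function obtained at each step is non-singular at the next evaluation point): $$E_{\mathcal{T}}=\frac{1}{\mathsf{F}'^{G}_{\underline{\lambda}}\,\mathsf{F}_{\underline{\lambda}}}\,\Phi'(u_1,\dots,u_n,\underline{v_1},\dots,\underline{v_n})\Big|_{v^{(\alpha)}_i=\xi^{(\alpha)}_{\mathrm{p}_i},\ i=1,\dots,n,\ \alpha=1,\dots,N}\Big|_{u_1=\mathrm{c}_1}\cdots\Big|_{u_n=\mathrm{c}_n}\ .$$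
   Context: **The group $G$.** $G$ is Abelian, so it has exactly $m=|G|$ irreducible complex representations $\rho_1,\dots,\rho_m$, all one-dimensional; each is determined by the values $\xi^{(\alpha)}_\nu:=\rho_\nu(t^{(\alpha)})$, $\alpha=1,\dots,N$, where $\xi^{(\alpha)}_\nu$ is a $k_\alpha$-th root of unity. $S^{(\alpha)}$ denotes the set of all $k_\alpha$-th roots of unity. **The wreath product.** $S_n$ acts on $G^n$ by permuting the copies of $G$, and $\widetilde{G}_n=G^n\rtimes S_n$ has multiplication $(a,\sigma)(a',\sigma')=(a\,\sigma(a'),\sigma\sigma')$. $s_i:=(1_{G^n},\pi_i)$ where $\pi_i$ is the transposition $(i,i+1)$, $i=1,\dots,n-1$. For $g\in\mathbb{C}G$ and $j=1,\dots,n$, $g_j\in\mathbb{C}\widetilde{G}_n$ denotes the image of $g$ under the algebra morphism $\mathbb{C}G\to\mathbb{C}G^n\subset\mathbb{C}\widetilde{G}_n$ placing $g$ in the $j$-th copy. In particular $t^{(\alpha)}_j$ is defined. For $i\ne j$, $e_{i,j}:=\frac{1}{|G|}\sum_{g\in G}g_i\,(g^{-1})_j$. The Jucys--Murphy elements are $\widetilde{j}_1:=0$, $\widetilde{j}_{i+1}:=s_i\widetilde{j}_is_i+e_{i,i+1}s_i$ for $i=1,\dots,n-1$. The elements $g_k$ ($g\in G$) and $\widetilde{j}_k$, $k=1,\dots,n$, all commute with one another. **Baxterized elements.** $s_i(c,c'):=s_i+\frac{e_{i,i+1}}{c-c'}$, and $$t^{(\alpha)}_i(v):=\frac{\prod_{\xi\in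 S^{(\alpha)}}(v-\xi)}{v-t^{(\alpha)}_i}=v^{k_\alpha-1}+v^{k_\alpha-2}t^{(\alpha)}_i+\dots+v\,(t^{(\alpha)}_i)^{k_\alpha-2}+(t^{(\alpha)}_i)^{k_\alpha-1}.$$ **The function $\Phi'$.** $\underline{v_i}=(v_i^{(1)},\dots,v_i^{(N)})$ are $N$-tuples of variables. Put $\Gamma'(\underline{v_1},\dots,\underline{v_n}):=\prod_{i=1}^n\prod_{\alpha=1}^N t^{(\alpha)}_i(v^{(\alpha)}_i)$, $\phi_1(u):=1$ and, for $k=2,\dots,n$, $$\phi_k(u_1,\dots,u_{k-1},u):=s_{k-1}(u,u_{k-1})s_{k-2}(u,u_{k-2})\cdots s_1(u,u_1)\cdot s_1s_2\cdots s_{k-1},$$ $$\Phi'(u_1,\dots,u_n,\underline{v_1},\dots,\underline{v_n}):=\phi_n(u_1,\dots,u_n)\,\phi_{n-1}(u_1,\dots,u_{n-1})\cdots\phi_1(u_1)\,\Gamma'(\underline{v_1},\dots,\underline{v_n}).$$ **Multi-partitions and multi-tableaux.** An $m$-partition of size $n$ is an $m$-tuple $\underline{\lambda}=(\lambda^{(1)},\dots,\lambda^{(m)})$ of partitions (identified with Young diagrams) with $\sum_k|\lambda^{(k)}|=n$. An $m$-node of $\underline\lambda$ is $\underline{\theta}=(\theta,k)$ with $\theta$ a node of $\lambda^{(k)}$; its position is $\mathrm{p}(\underline{\theta}):=k$, and if $\theta$ lies in row $x$ and column $y$ its classical content is $\mathrm{c}(\underline{\theta}):=y-x$. Its hook length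 $h_{\underline{\lambda}}(\underline{\theta})$ is the usual hook length of $\theta$ in $\lambda^{(k)}$. A standard $m$-tableau of shape $\underline{\lambda}$ is a bijective filling of the $m$-nodes of $\underline{\lambda}$ by $1,\dots,n$, increasing along rows and columns of each diagram. $\mathrm{p}(\mathcal{T}|i)$ and $\mathrm{c}(\mathcal{T}|i)$ are the position and classical content of the $m$-node with number $i$. Set $$\mathsf{F}'^{G}_{\underline{\lambda}}:=\prod_{\underline{\theta}\in\underline{\lambda}}\ \prod_{\alpha=1}^N\ \prod_{\xi\in S^{(\alpha)},\ \xi\ne\xi^{(\alpha)}_{\mathrm{p}(\underline{\theta})}}\bigl(\xi^{(\alpha)}_{\mathrm{p}(\underline{\theta})}-\xi\bigr),\qquad \mathsf{F}_{\underline{\lambda}}:=\prod_{\underline{\theta}\in\underline{\lambda}}h_{\underline{\lambda}}(\underline{\theta}).$$ **The idempotents $E_{\mathcal{T}}$ (known facts).** The irreducible representations $V_{\underline{\lambda}}$ of $\widetilde{G}_n$ are indexed by the $m$-partitions $\underline{\lambda}$ of $n$, and $V_{\underline{\lambda}}=\bigoplus_{\mathcal{T}}W_{\mathcal{T}}$, the sum over standard $m$-tableaux of shape $\underline{\lambda}$, where $W_{\mathcal{T}}$ is one-dimensional and is the common eigenspace in $V_{\underline\lambda}$ on which $g_k$ acts by $\rho_{\mathrm{p}(\mathcal{T}|k)}(g)$ and $\widetilde{j}_k$ acts by $\mathrm{c}(\mathcal{T}|k)$, for all $g\in G$ and all $k$. Distinct standard $m$-tableaux of size $n$ give distinct systems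 of eigenvalues. $E_{\mathcal{T}}\in\mathbb{C}\widetilde{G}_n$ is the idempotent corresponding to $W_{\mathcal{T}}$: it acts on $V_{\underline{\lambda}}$ as the projector onto $W_{\mathcal{T}}$ along the other summands $W_{\mathcal{T}'}$, and as $0$ on $V_{\underline{\mu}}$ for $\underline{\mu}\ne\underline{\lambda}$. *)

theory Defs
  imports
    "HOL-Algebra.Product_Groups"
    "HOL-Algebra.Sym_Groups"
    "HOL-Algebra.Module"
    "HOL-Computational_Algebra.Fraction_Field"
    "HOL-Library.Nat_Bijection"
    "HOL-Library.Poly_Mapping"
    "Jordan_Normal_Form.Matrix"
begin

section \<open>Rational functions in the spectral variables\<close>

text \<open>
  \<open>UVar i\<close> is the variable $u_i$ and \<open>VVar i \<alpha>\<close> is the variable $v_i^{(\alpha)}$.  The linear order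
  on variables is arbitrary; it is only there because the library proves that a ring of
  polynomials (a \<open>poly_mapping\<close> type) is an integral domain for linearly ordered variables.
\<close>

datatype variable = UVar nat | VVar nat nat

fun variable_code :: "variable \<Rightarrow> nat" where
  "variable_code (UVar i) = prod_encode (0, i)"
| "variable_code (VVar i \<alpha>) = prod_encode (Suc \<alpha>, i)"

lemma variable_code_inject: "variable_code x = variable_code y \<longleftrightarrow> x = y"
  by (cases x; cases y) auto

instantiation variable :: linorder
begin

definition less_eq_variable :: "variable \<Rightarrow> variable \<Rightarrow> bool" where
  "x \<le> y \<longleftrightarrow> variable_code x \<le> variable_code y"

definition less_variable :: "variable \<Rightarrow> variable \<Rightarrow> bool" where
  "x < y \<longleftrightarrow> variable_code x < variable_code y"

instance
  by intro_classes
    (auto simp: less_eq_variable_def less_variable_def variable_code_inject[symmetric])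

end

type_synonym mpoly = "(variable \<Rightarrow>\<^sub>0 nat) \<Rightarrow>\<^sub>0 complex"

type_synonym ratfun = "mpoly fract"

definition poly_const :: "complex \<Rightarrow> mpoly" where
  "poly_const c = Poly_Mapping.single 0 c"

definition poly_var :: "variable \<Rightarrow> mpoly" where
  "poly_var x = Poly_Mapping.single (Poly_Mapping.single x 1) 1"

definition rat_const :: "complex \<Rightarrow> ratfun" where
  "rat_const c = Fract (poly_const c) 1"

definition rat_var :: "variable \<Rightarrow> ratfun" where
  "rat_var x = Fract (poly_var x) 1"

text \<open>
  A partial assignment \<open>\<zeta>\<close> replaces, simultaneously, each variable of its domain by a complex
  number; the other variables stay.
\<close>

definition poly_subst :: "(variable \<rightharpoonup> complex) \<Rightarrow> mpoly \<Rightarrow> mpoly" where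
  "poly_subst \<zeta> p =
     (\<Sum>e\<in>Poly_Mapping.keys p. poly_const (Poly_Mapping.lookup p e) *
        (\<Prod>x\<in>Poly_Mapping.keys e.
           (case \<zeta> x of None \<Rightarrow> poly_var x | Some c \<Rightarrow> poly_const c) ^ Poly_Mapping.lookup e x))"

text \<open>
  A rational function is non-singular at \<open>\<zeta>\<close> if it can be written with a denominator that does not
  become the zero polynomial under the substitution.  The value does not depend on that choice.
\<close>

definition rat_nonsingular :: "(variable \<rightharpoonup> complex) \<Rightarrow> ratfun \<Rightarrow> bool" where
  "rat_nonsingular \<zeta> r \<longleftrightarrow> (\<exists>p q. r = Fract p q \<and> poly_subst \<zeta> q \<noteq> 0)"

definition rat_eval :: "(variable \<rightharpoonup> complex) \<Rightarrow> ratfun \<Rightarrow> ratfun" where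
  "rat_eval \<zeta> r =
     (THE s. \<exists>p q. r = Fract p q \<and> poly_subst \<zeta> q \<noteq> 0 \<and>
                   s = Fract (poly_subst \<zeta> p) (poly_subst \<zeta> q))"

text \<open>Consecutive evaluations, in the order of the list, of a function with values in rational
  functions (an element of a group algebra over the field of rational functions).\<close>

fun eval_along :: "(variable \<rightharpoonup> complex) list \<Rightarrow> ('x \<Rightarrow> ratfun) \<Rightarrow> 'x \<Rightarrow> ratfun" where
  "eval_along [] f = f"
| "eval_along (\<zeta> # \<zeta>s) f = eval_along \<zeta>s (\<lambda>x. rat_eval \<zeta> (f x))"

fun nonsingular_along :: "(variable \<rightharpoonup> complex) list \<Rightarrow> ('x \<Rightarrow> ratfun) \<Rightarrow> bool" where
  "nonsingular_along [] f \<longleftrightarrow> True"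
| "nonsingular_along (\<zeta> # \<zeta>s) f \<longleftrightarrow>
     (\<forall>x. rat_nonsingular \<zeta> (f x)) \<and> nonsingular_along \<zeta>s (\<lambda>x. rat_eval \<zeta> (f x))"


section \<open>Group algebras and the wreath product\<close>

text \<open>The group algebra of a finite group: functions vanishing outside the group, with
  convolution.\<close>

definition group_algebra :: "('x, 'b) monoid_scheme \<Rightarrow> ('k::comm_ring_1, 'x \<Rightarrow> 'k) module" where
  "group_algebra H =
     \<lparr>carrier = {f. \<forall>x. x \<notin> carrier H \<longrightarrow> f x = 0},
      monoid.mult = (\<lambda>f g x. \<Sum>(y, z)\<in>{(y, z) \<in> carrier H \<times> carrier H. y \<otimes>\<^bsub>H\<^esub> z = x}. f y * g z),
      one = (\<lambda>x. if x = \<one>\<^bsub>H\<^esub> then 1 else 0),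
      zero = (\<lambda>x. 0),
      add = (\<lambda>f g x. f x + g x),
      smult = (\<lambda>c f x. c * f x)\<rparr>"

definition group_elem :: "'x \<Rightarrow> 'x \<Rightarrow> 'k::comm_ring_1" where
  "group_elem h = (\<lambda>x. if x = h then 1 else 0)"

definition ordered_prod :: "('a, 'b) monoid_scheme \<Rightarrow> 'a list \<Rightarrow> 'a" where
  "ordered_prod R xs = foldr (\<lambda>x y. x \<otimes>\<^bsub>R\<^esub> y) xs \<one>\<^bsub>R\<^esub>"

type_synonym 'g wreath = "(nat \<Rightarrow> 'g) \<times> (nat \<Rightarrow> nat)"

text \<open>A permutation moves the entry at place \<open>i\<close> to place \<open>\<sigma> i\<close>, whence the inverse below.\<close>

definition wreath_product :: "('g, 'b) monoid_scheme \<Rightarrow> nat \<Rightarrow> 'g wreath monoid" where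
  "wreath_product G n =
     \<lparr>carrier = carrier (product_group {1..n} (\<lambda>_. G)) \<times> carrier (sym_group n),
      monoid.mult = (\<lambda>(a, \<sigma>) (b, \<tau>).
        (a \<otimes>\<^bsub>product_group {1..n} (\<lambda>_. G)\<^esub> (\<lambda>i\<in>{1..n}. b (Hilbert_Choice.inv \<sigma> i)),
         \<sigma> \<otimes>\<^bsub>sym_group n\<^esub> \<tau>)),
      one = (\<one>\<^bsub>product_group {1..n} (\<lambda>_. G)\<^esub>, \<one>\<^bsub>sym_group n\<^esub>)\<rparr>"

abbreviation wreath_algebra ::
  "('g, 'b) monoid_scheme \<Rightarrow> nat \<Rightarrow> ('k::comm_ring_1, 'g wreath \<Rightarrow> 'k) module" where
  "wreath_algebra G n \<equiv> group_algebra (wreath_product G n)"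

definition place :: "('g, 'b) monoid_scheme \<Rightarrow> nat \<Rightarrow> nat \<Rightarrow> 'g \<Rightarrow> 'g wreath \<Rightarrow> 'k::comm_ring_1" where
  "place G n j g = group_elem (\<lambda>i\<in>{1..n}. if i = j then g else \<one>\<^bsub>G\<^esub>, id)"

definition s_elem :: "('g, 'b) monoid_scheme \<Rightarrow> nat \<Rightarrow> nat \<Rightarrow> 'g wreath \<Rightarrow> 'k::comm_ring_1" where
  "s_elem G n i =
     group_elem (\<one>\<^bsub>product_group {1..n} (\<lambda>_. G)\<^esub>, Transposition.transpose i (Suc i))"

definition e_elem :: "('g, 'b) monoid_scheme \<Rightarrow> nat \<Rightarrow> nat \<Rightarrow> nat \<Rightarrow> 'g wreath \<Rightarrow> 'k::field" where
  "e_elem G n i j =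
     (1 / of_nat (card (carrier G))) \<odot>\<^bsub>wreath_algebra G n\<^esub>
       (\<Oplus>\<^bsub>wreath_algebra G n\<^esub>g\<in>carrier G.
          place G n i g \<otimes>\<^bsub>wreath_algebra G n\<^esub> place G n j (inv\<^bsub>G\<^esub> g))"

text \<open>Jucys--Murphy elements; the value at \<open>0\<close> is irrelevant.\<close>

fun jm_elem :: "('g, 'b) monoid_scheme \<Rightarrow> nat \<Rightarrow> nat \<Rightarrow> 'g wreath \<Rightarrow> 'k::field" where
  "jm_elem G n 0 = \<zero>\<^bsub>wreath_algebra G n\<^esub>"
| "jm_elem G n (Suc 0) = \<zero>\<^bsub>wreath_algebra G n\<^esub>"
| "jm_elem G n (Suc (Suc i)) =
     (s_elem G n (Suc i) \<otimes>\<^bsub>wreath_algebra G n\<^esub> jm_elem G n (Suc i)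
        \<otimes>\<^bsub>wreath_algebra G n\<^esub> s_elem G n (Suc i))
     \<oplus>\<^bsub>wreath_algebra G n\<^esub>
     (e_elem G n (Suc i) (Suc (Suc i)) \<otimes>\<^bsub>wreath_algebra G n\<^esub> s_elem G n (Suc i))"


section \<open>Baxterized elements and the fusion function\<close>

definition s_baxter ::
  "('g, 'b) monoid_scheme \<Rightarrow> nat \<Rightarrow> nat \<Rightarrow> 'k::field \<Rightarrow> 'k \<Rightarrow> 'g wreath \<Rightarrow> 'k" where
  "s_baxter G n i c c' =
     s_elem G n i \<oplus>\<^bsub>wreath_algebra G n\<^esub>
       ((1 / (c - c')) \<odot>\<^bsub>wreath_algebra G n\<^esub> e_elem G n i (Suc i))"

text \<open>\<open>t_baxter G n q h i v\<close> is $v^{q-1} + v^{q-2} h_i + \dots + h_i^{q-1}$, for \<open>h\<close> of order \<open>q\<close>.\<close>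

definition t_baxter ::
  "('g, 'b) monoid_scheme \<Rightarrow> nat \<Rightarrow> nat \<Rightarrow> 'g \<Rightarrow> nat \<Rightarrow> 'k::field \<Rightarrow> 'g wreath \<Rightarrow> 'k" where
  "t_baxter G n q h i v =
     (\<Oplus>\<^bsub>wreath_algebra G n\<^esub>r\<in>{..<q}.
        (v ^ (q - 1 - r)) \<odot>\<^bsub>wreath_algebra G n\<^esub> (place G n i h [^]\<^bsub>wreath_algebra G n\<^esub> r))"

text \<open>The factors of the following product commute with one another.\<close>

definition Gamma_fun ::
  "('g, 'b) monoid_scheme \<Rightarrow> nat \<Rightarrow> nat \<Rightarrow> (nat \<Rightarrow> nat) \<Rightarrow> (nat \<Rightarrow> 'g) \<Rightarrow> 'g wreath \<Rightarrow> ratfun" where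
  "Gamma_fun G n N k t =
     ordered_prod (wreath_algebra G n)
       [t_baxter G n (k \<alpha>) (t \<alpha>) i (rat_var (VVar i \<alpha>)). i \<leftarrow> [1..<Suc n], \<alpha> \<leftarrow> [1..<Suc N]]"

definition phi_fun :: "('g, 'b) monoid_scheme \<Rightarrow> nat \<Rightarrow> nat \<Rightarrow> 'g wreath \<Rightarrow> ratfun" where
  "phi_fun G n l =
     ordered_prod (wreath_algebra G n)
       ([s_baxter G n j (rat_var (UVar l)) (rat_var (UVar j)). j \<leftarrow> rev [1..<l]]
        @ [s_elem G n j. j \<leftarrow> [1..<l]])"

definition Phi_fun ::
  "('g, 'b) monoid_scheme \<Rightarrow> nat \<Rightarrow> nat \<Rightarrow> (nat \<Rightarrow> nat) \<Rightarrow> (nat \<Rightarrow> 'g) \<Rightarrow> 'g wreath \<Rightarrow> ratfun" where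
  "Phi_fun G n N k t =
     ordered_prod (wreath_algebra G n) [phi_fun G n l. l \<leftarrow> rev [1..<Suc n]]
       \<otimes>\<^bsub>wreath_algebra G n\<^esub> Gamma_fun G n N k t"


section \<open>Multi-partitions and multi-tableaux\<close>

definition partition :: "nat list \<Rightarrow> bool" where
  "partition l \<longleftrightarrow> sorted_wrt (\<ge>) l \<and> 0 \<notin> set l"

definition diagram :: "nat list \<Rightarrow> (nat \<times> nat) set" where
  "diagram l = {(x, y). 1 \<le> x \<and> x \<le> length l \<and> 1 \<le> y \<and> y \<le> l ! (x - 1)}"

definition multipartitions :: "nat \<Rightarrow> nat \<Rightarrow> (nat \<Rightarrow> nat list) set" where
  "multipartitions m n =
     {\<Lambda> \<in> (\<Pi>\<^sub>E p\<in>{1..m}. {l. partition l}). (\<Sum>p\<in>{1..m}. sum_list (\<Lambda> p)) = n}"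

text \<open>A node \<open>((x, y), p)\<close>: row, column, position.\<close>

type_synonym mnode = "(nat \<times> nat) \<times> nat"

definition mnodes :: "nat \<Rightarrow> (nat \<Rightarrow> nat list) \<Rightarrow> mnode set" where
  "mnodes m \<Lambda> = {(\<theta>, p). p \<in> {1..m} \<and> \<theta> \<in> diagram (\<Lambda> p)}"

definition position :: "mnode \<Rightarrow> nat" where
  "position \<theta> = snd \<theta>"

definition content :: "mnode \<Rightarrow> int" where
  "content \<theta> = int (snd (fst \<theta>)) - int (fst (fst \<theta>))"

fun hook_length :: "(nat \<Rightarrow> nat list) \<Rightarrow> mnode \<Rightarrow> nat" where
  "hook_length \<Lambda> ((x, y), p) =
     card {(x', y') \<in> diagram (\<Lambda> p). (x' = x \<and> y \<le> y') \<or> (y' = y \<and> x \<le> x')}"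

text \<open>Tableaux are extensional functions, so that distinct elements are distinct fillings.\<close>

definition standard_tableaux :: "nat \<Rightarrow> nat \<Rightarrow> (nat \<Rightarrow> nat list) \<Rightarrow> (mnode \<Rightarrow> nat) set" where
  "standard_tableaux m n \<Lambda> =
     {T \<in> extensional (mnodes m \<Lambda>).
        bij_betw T (mnodes m \<Lambda>) {1..n} \<and>
        (\<forall>x y y' p. ((x, y), p) \<in> mnodes m \<Lambda> \<and> ((x, y'), p) \<in> mnodes m \<Lambda> \<and> y < y'
           \<longrightarrow> T ((x, y), p) < T ((x, y'), p)) \<and>
        (\<forall>x x' y p. ((x, y), p) \<in> mnodes m \<Lambda> \<and> ((x', y), p) \<in> mnodes m \<Lambda> \<and> x < x'
           \<longrightarrow> T ((x, y), p) < T ((x', y), p))}"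

definition node_at :: "nat \<Rightarrow> (nat \<Rightarrow> nat list) \<Rightarrow> (mnode \<Rightarrow> nat) \<Rightarrow> nat \<Rightarrow> mnode" where
  "node_at m \<Lambda> T i = inv_into (mnodes m \<Lambda>) T i"

definition tab_position :: "nat \<Rightarrow> (nat \<Rightarrow> nat list) \<Rightarrow> (mnode \<Rightarrow> nat) \<Rightarrow> nat \<Rightarrow> nat" where
  "tab_position m \<Lambda> T i = position (node_at m \<Lambda> T i)"

definition tab_content :: "nat \<Rightarrow> (nat \<Rightarrow> nat list) \<Rightarrow> (mnode \<Rightarrow> nat) \<Rightarrow> nat \<Rightarrow> int" where
  "tab_content m \<Lambda> T i = content (node_at m \<Lambda> T i)"


section \<open>Representations and the idempotents of standard tableaux\<close>

text \<open>One-dimensional complex representations, normalised outside the group.\<close>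

definition linear_characters :: "('g, 'b) monoid_scheme \<Rightarrow> ('g \<Rightarrow> complex) set" where
  "linear_characters G =
     {\<chi> \<in> extensional (carrier G).
        (\<forall>g\<in>carrier G. \<chi> g \<noteq> 0) \<and>
        (\<forall>g\<in>carrier G. \<forall>h\<in>carrier G. \<chi> (g \<otimes>\<^bsub>G\<^esub> h) = \<chi> g * \<chi> h)}"

definition representation ::
  "('x, 'b) monoid_scheme \<Rightarrow> nat \<Rightarrow> ('x \<Rightarrow> complex mat) \<Rightarrow> bool" where
  "representation H d R \<longleftrightarrow>
     (\<forall>x\<in>carrier H. R x \<in> carrier_mat d d) \<and> R \<one>\<^bsub>H\<^esub> = 1\<^sub>m d \<and>
     (\<forall>x\<in>carrier H. \<forall>y\<in>carrier H. R (x \<otimes>\<^bsub>H\<^esub> y) = R x * R y)"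

definition invariant_subspace ::
  "('x, 'b) monoid_scheme \<Rightarrow> nat \<Rightarrow> ('x \<Rightarrow> complex mat) \<Rightarrow> complex vec set \<Rightarrow> bool" where
  "invariant_subspace H d R W \<longleftrightarrow>
     W \<subseteq> carrier_vec d \<and> 0\<^sub>v d \<in> W \<and>
     (\<forall>v\<in>W. \<forall>w\<in>W. v + w \<in> W) \<and> (\<forall>c. \<forall>v\<in>W. c \<cdot>\<^sub>v v \<in> W) \<and>
     (\<forall>x\<in>carrier H. \<forall>v\<in>W. R x *\<^sub>v v \<in> W)"

definition irreducible_representation ::
  "('x, 'b) monoid_scheme \<Rightarrow> nat \<Rightarrow> ('x \<Rightarrow> complex mat) \<Rightarrow> bool" where
  "irreducible_representation H d R \<longleftrightarrow>
     representation H d R \<and> 0 < d \<and>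
     (\<forall>W. invariant_subspace H d R W \<longrightarrow> W = {0\<^sub>v d} \<or> W = carrier_vec d)"

text \<open>The matrix by which an element of the group algebra acts.\<close>

definition action ::
  "('x, 'b) monoid_scheme \<Rightarrow> nat \<Rightarrow> ('x \<Rightarrow> complex mat) \<Rightarrow> ('x \<Rightarrow> complex) \<Rightarrow> complex mat" where
  "action H d R a = mat d d (\<lambda>(i, j). \<Sum>x\<in>carrier H. a x * (R x $$ (i, j)))"

text \<open>The common eigenspace $W_T$, for \<open>T\<close> of shape \<open>\<Lambda>\<close>; \<open>\<rho> 1, \<dots>, \<rho> m\<close> are the irreducible
  representations of \<open>G\<close>.\<close>

definition tableau_eigenspace ::
  "('g, 'b) monoid_scheme \<Rightarrow> nat \<Rightarrow> nat \<Rightarrow> (nat \<Rightarrow> 'g \<Rightarrow> complex) \<Rightarrow>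
   nat \<Rightarrow> ('g wreath \<Rightarrow> complex mat) \<Rightarrow> (nat \<Rightarrow> nat list) \<Rightarrow> (mnode \<Rightarrow> nat) \<Rightarrow> complex vec set" where
  "tableau_eigenspace G n m \<rho> d R \<Lambda> T =
     {v \<in> carrier_vec d. \<forall>i\<in>{1..n}.
        (\<forall>g\<in>carrier G. action (wreath_product G n) d R (place G n i g) *\<^sub>v v
                         = \<rho> (tab_position m \<Lambda> T i) g \<cdot>\<^sub>v v) \<and>
        action (wreath_product G n) d R (jm_elem G n i) *\<^sub>v v
          = of_int (tab_content m \<Lambda> T i) \<cdot>\<^sub>v v}"

text \<open>
  \<open>shape_representation G n m \<rho> \<Lambda> d R\<close>: the representation \<open>R\<close>, of degree \<open>d\<close>, is (a matrix form
  of) the irreducible representation $V_\Lambda$, i.e. it is irreducible and it is the direct sum of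
  the common eigenspaces $W_T$, each one-dimensional, over the standard tableaux of shape \<open>\<Lambda>\<close>.
  As distinct standard tableaux have distinct systems of eigenvalues, this determines \<open>\<Lambda>\<close> from \<open>R\<close>.
\<close>

definition shape_representation ::
  "('g, 'b) monoid_scheme \<Rightarrow> nat \<Rightarrow> nat \<Rightarrow> (nat \<Rightarrow> 'g \<Rightarrow> complex) \<Rightarrow> (nat \<Rightarrow> nat list) \<Rightarrow>
   nat \<Rightarrow> ('g wreath \<Rightarrow> complex mat) \<Rightarrow> bool" where
  "shape_representation G n m \<rho> \<Lambda> d R \<longleftrightarrow>
     irreducible_representation (wreath_product G n) d R \<and>
     (\<forall>T\<in>standard_tableaux m n \<Lambda>. \<exists>w. w \<noteq> 0\<^sub>v d \<and>
        tableau_eigenspace G n m \<rho> d R \<Lambda> T = {c \<cdot>\<^sub>v w | c. True} \<and> w \<in> carrier_vec d) \<and>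
     (\<forall>v\<in>carrier_vec d.
        \<exists>!w. w \<in> (\<Pi>\<^sub>E T\<in>standard_tableaux m n \<Lambda>. tableau_eigenspace G n m \<rho> d R \<Lambda> T) \<and>
             v = finsum_vec TYPE(complex) d w (standard_tableaux m n \<Lambda>))"

text \<open>The idempotent $E_T$ of the group algebra that corresponds to $W_T$.\<close>

definition tableau_idempotent ::
  "('g, 'b) monoid_scheme \<Rightarrow> nat \<Rightarrow> nat \<Rightarrow> (nat \<Rightarrow> 'g \<Rightarrow> complex) \<Rightarrow> (nat \<Rightarrow> nat list) \<Rightarrow>
   (mnode \<Rightarrow> nat) \<Rightarrow> 'g wreath \<Rightarrow> complex" where
  "tableau_idempotent G n m \<rho> \<Lambda> T =
     (THE E. E \<in> carrier (wreath_algebra G n) \<and>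
        (\<forall>d R. shape_representation G n m \<rho> \<Lambda> d R \<longrightarrow>
           (\<forall>w\<in>tableau_eigenspace G n m \<rho> d R \<Lambda> T. action (wreath_product G n) d R E *\<^sub>v w = w) \<and>
           (\<forall>T'\<in>standard_tableaux m n \<Lambda> - {T}. \<forall>w\<in>tableau_eigenspace G n m \<rho> d R \<Lambda> T'.
              action (wreath_product G n) d R E *\<^sub>v w = 0\<^sub>v d)) \<and>
        (\<forall>M\<in>multipartitions m n - {\<Lambda>}. \<forall>d R. shape_representation G n m \<rho> M d R \<longrightarrow>
           action (wreath_product G n) d R E = 0\<^sub>m d d))"


section \<open>Normalising constants and evaluation points\<close>

definition unity_roots :: "nat \<Rightarrow> complex set" where
  "unity_roots q = {z. z ^ q = 1}"

definition F_G :: "nat \<Rightarrow> nat \<Rightarrow> (nat \<Rightarrow> nat) \<Rightarrow> (nat \<Rightarrow> 'g) \<Rightarrow> (nat \<Rightarrow> 'g \<Rightarrow> complex) \<Rightarrow>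
    (nat \<Rightarrow> nat list) \<Rightarrow> complex" where
  "F_G m N k t \<rho> \<Lambda> =
     (\<Prod>\<theta>\<in>mnodes m \<Lambda>. \<Prod>\<alpha>\<in>{1..N}.
        \<Prod>\<xi>\<in>unity_roots (k \<alpha>) - {\<rho> (position \<theta>) (t \<alpha>)}. \<rho> (position \<theta>) (t \<alpha>) - \<xi>)"

definition F_hook :: "nat \<Rightarrow> (nat \<Rightarrow> nat list) \<Rightarrow> complex" where
  "F_hook m \<Lambda> = (\<Prod>\<theta>\<in>mnodes m \<Lambda>. of_nat (hook_length \<Lambda> \<theta>))"

definition v_assignment :: "nat \<Rightarrow> nat \<Rightarrow> (nat \<Rightarrow> nat \<Rightarrow> complex) \<Rightarrow> variable \<rightharpoonup> complex" where
  "v_assignment n N z =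
     (\<lambda>x. case x of UVar i \<Rightarrow> None
        | VVar i \<alpha> \<Rightarrow> if i \<in> {1..n} \<and> \<alpha> \<in> {1..N} then Some (z i \<alpha>) else None)"

text \<open>All the variables $v_i^{(\alpha)}$ at once, then $u_1$, then $u_2$, \dots, and finally $u_n$.\<close>

definition evaluation_sequence ::
  "nat \<Rightarrow> nat \<Rightarrow> nat \<Rightarrow> (nat \<Rightarrow> 'g) \<Rightarrow> (nat \<Rightarrow> 'g \<Rightarrow> complex) \<Rightarrow> (nat \<Rightarrow> nat list) \<Rightarrow>
   (mnode \<Rightarrow> nat) \<Rightarrow> (variable \<rightharpoonup> complex) list" where
  "evaluation_sequence n m N t \<rho> \<Lambda> T =
     v_assignment n N (\<lambda>i \<alpha>. \<rho> (tab_position m \<Lambda> T i) (t \<alpha>)) #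
     [[UVar i \<mapsto> of_int (tab_content m \<Lambda> T i)]. i \<leftarrow> [1..<Suc n]]"

end

theory Submission
  imports
    Defs
    "HOL-Library.Function_Algebras"
    "HOL-Computational_Algebra.Fundamental_Theorem_Algebra"
begin

text \<open>
  Work in the left regular module.  On a common eigenvector of the $g_j$ and the Jucys--Murphy
  elements, with characters $\chi_i$ and contents $c_i$, the operator $\phi_{l+1}(c_1, \dots, c_l, u)$
  is the scalar $\frac{u}{u - b} \prod_i (1 - (u - c_i)^{-2})$, where $b$ is the eigenvalue of
  $\widetilde{j}_{l+1}$ and $i$ runs over the indices with $\chi_i = \chi_{l+1}$.  Decompose $1$
  into components $E_\beta$ in the weight spaces.  The values of the $v$ variables make $\Gamma'$ kill
  the components with other characters than those of $T$.  The numerator then depends only on the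
  row lengths of the tableau built so far and vanishes at $u = c_{l+1}$, so evaluating there kills
  every component except those with $b = c_{l+1}$, where the zero cancels the pole; the remaining
  factors multiply to the hook product.  What survives is $E_T$.

  That $E_T$ is determined by its defining property needs that the representations $V_\Lambda$ separate
  the elements of the group algebra.  Inductively every weight of the regular module is the weight of
  a standard tableau: otherwise the same scalar would have a pole that the action on the group algebra
  does not have.  A weight vector then generates, through the intertwiners of Young's seminormal
  form, an irreducible module with one line for each standard tableau of its shape.
\<close>

section \<open>Modules over the wreath product\<close>

text \<open>Two copies of the module are used, with complex coefficients for spectra and
  orthogonality and with rational functions for the evaluations; hence the arbitrary field. The
  scalar formula has no direct induction over eigenvectors, since s_l v need not be an eigenvector
  of J_l; it is proved in resolvent form, for the operator applied to (u - J_{l+1}) v, with no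
  hypothesis on J_{l+1}. The obstacle is E_T itself: it is specified only by its action on every
  V_\<Lambda>, so enough of these modules must be constructed. The pole argument serves as the
  branching rule. Take the delta function at a group element in the support of a weight vector. Up
  to group elements that send a chosen point to smaller places, the operator with parameter u fixes
  its weight component, so one inner product is constant in u; expanded over the eigenvalues of
  J_{l+1}, it has a pole at each eigenvalue that occurs unless the numerator vanishes there. The
  zeros of the numerator are the contents of addable nodes. The same fraction with one zero removed
  is the ratio of the hook products after and before a node is added, by Frobenius' formula.\<close>

locale wreath_module = vector_space scale + comm_group G
  for scale :: "'k::field \<Rightarrow> 'v::ab_group_add \<Rightarrow> 'v" (infixr "*s" 75)
    and G :: "('g, 'b) monoid_scheme" (structure) +
  fixes n :: nat and S :: "nat \<Rightarrow> 'v \<Rightarrow> 'v" and Y :: "'g \<Rightarrow> nat \<Rightarrow> 'v \<Rightarrow> 'v"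
  assumes finite_G: "finite (carrier G)"
    and card_G: "of_nat (card (carrier G)) \<noteq> (0::'k)"
    and S_add: "S i (v + w) = S i v + S i w"
    and S_scale: "S i (a *s v) = a *s S i v"
    and Y_add: "Y g i (v + w) = Y g i v + Y g i w"
    and Y_scale: "Y g i (a *s v) = a *s Y g i v"
    and S_S: "1 \<le> i \<Longrightarrow> i < n \<Longrightarrow> S i (S i v) = v"
    and S_far: "1 \<le> i \<Longrightarrow> Suc i < j \<Longrightarrow> j < n \<Longrightarrow> S i (S j v) = S j (S i v)"
    and S_braid: "1 \<le> i \<Longrightarrow> Suc i < n \<Longrightarrow>
      S i (S (Suc i) (S i v)) = S (Suc i) (S i (S (Suc i) v))"
    and S_Y: "1 \<le> i \<Longrightarrow> i < n \<Longrightarrow> g \<in> carrier G \<Longrightarrow> 1 \<le> j \<Longrightarrow> j \<le> n \<Longrightarrow>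
      S i (Y g j v) = Y g (Transposition.transpose i (Suc i) j) (S i v)"
    and Y_Y: "g \<in> carrier G \<Longrightarrow> h \<in> carrier G \<Longrightarrow> 1 \<le> i \<Longrightarrow> i \<le> n \<Longrightarrow> 1 \<le> j \<Longrightarrow> j \<le> n \<Longrightarrow>
      Y g i (Y h j v) = Y h j (Y g i v)"
    and Y_mult: "g \<in> carrier G \<Longrightarrow> h \<in> carrier G \<Longrightarrow> 1 \<le> i \<Longrightarrow> i \<le> n \<Longrightarrow>
      Y (g \<otimes> h) i v = Y g i (Y h i v)"
    and Y_one: "1 \<le> i \<Longrightarrow> i \<le> n \<Longrightarrow> Y \<one> i v = v"
begin

lemma S_0 [simp]: "S i 0 = 0"
  using S_add[of i 0 0] by simp

lemma S_minus: "S i (- v) = - S i v"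
  using S_add[of i v "- v"] by (simp add: eq_neg_iff_add_eq_0 add.commute)

lemma S_diff: "S i (v - w) = S i v - S i w"
  using S_add[of i v "- w"] by (simp add: S_minus)

lemma S_sum: "S i (sum f A) = (\<Sum>x\<in>A. S i (f x))"
  by (induction A rule: infinite_finite_induct) (auto simp: S_add)

lemma Y_0 [simp]: "Y g i 0 = 0"
  using Y_add[of g i 0 0] by simp

lemma Y_minus: "Y g i (- v) = - Y g i v"
  using Y_add[of g i v "- v"] by (simp add: eq_neg_iff_add_eq_0 add.commute)

lemma Y_diff: "Y g i (v - w) = Y g i v - Y g i w"
  using Y_add[of g i v "- w"] by (simp add: Y_minus)

lemma Y_sum: "Y g i (sum f A) = (\<Sum>x\<in>A. Y g i (f x))"
  by (induction A rule: infinite_finite_induct) (auto simp: Y_add)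

text \<open>Only e_{i,i+1} is modelled: the Jucys-Murphy recursion and the Baxterized elements use
  adjacent places only.\<close>

definition E :: "nat \<Rightarrow> 'v \<Rightarrow> 'v" where
  "E i v = (1 / of_nat (card (carrier G))) *s (\<Sum>g\<in>carrier G. Y g i (Y (inv g) (Suc i) v))"

lemma E_add: "E i (v + w) = E i v + E i w"
  by (simp add: E_def Y_add sum.distrib scale_right_distrib)

lemma E_scale: "E i (a *s v) = a *s E i v"
  by (simp add: E_def Y_scale scale_sum_right mult.commute)

lemma E_0 [simp]: "E i 0 = 0"
  using E_add[of i 0 0] by simp

lemma E_minus: "E i (- v) = - E i v"
  using E_add[of i v "- v"] by (simp add: eq_neg_iff_add_eq_0 add.commute)

lemma E_diff: "E i (v - w) = E i v - E i w"
  using E_add[of i v "- w"] by (simp add: E_minus)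

lemma sum_inv: "(\<Sum>g\<in>carrier G. f (inv g)) = (\<Sum>g\<in>carrier G. f g)"
  by (rule sum.reindex_bij_witness[of _ "\<lambda>g. inv g" "\<lambda>g. inv g"]) auto

text \<open>Conjugation by s_i exchanges the two places; replacing g by its inverse in the sum, and
  commuting the places, undoes this.\<close>

lemma S_E: assumes "1 \<le> i" "i < n" shows "S i (E i v) = E i (S i v)"
proof -
  have "S i (\<Sum>g\<in>carrier G. Y g i (Y (inv g) (Suc i) v))
      = (\<Sum>g\<in>carrier G. Y g (Suc i) (Y (inv g) i (S i v)))"
    unfolding S_sum using assms by (intro sum.cong) (auto simp: S_Y)
  also have "\<dots> = (\<Sum>g\<in>carrier G. Y (inv g) (Suc i) (Y (inv (inv g)) i (S i v)))"
    by (rule sum_inv[symmetric])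
  also have "\<dots> = (\<Sum>g\<in>carrier G. Y g i (Y (inv g) (Suc i) (S i v)))"
    using assms by (intro sum.cong refl) (subst Y_Y, auto)
  finally show ?thesis by (simp add: E_def S_scale)
qed

lemma S_E_far:
  assumes "1 \<le> i" "i < n" "1 \<le> j" "j < n" "Suc i < j \<or> Suc j < i"
  shows "S i (E j v) = E j (S i v)"
proof -
  have "S i (Y g j (Y (inv g) (Suc j) v)) = Y g j (Y (inv g) (Suc j) (S i v))"
    if "g \<in> carrier G" for g
    using assms that by (auto simp: S_Y Transposition.transpose_def)
  then show ?thesis by (simp add: E_def S_scale S_sum)
qed

lemma Y_E:
  assumes "h \<in> carrier G" "1 \<le> i" "i < n" "1 \<le> j" "j \<le> n"
  shows "Y h j (E i v) = E i (Y h j v)"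
proof -
  have "Y h j (Y g i (Y (inv g) (Suc i) v)) = Y g i (Y (inv g) (Suc i) (Y h j v))"
    if "g \<in> carrier G" for g
    using assms that Y_Y[of h g j i] Y_Y[of h "inv g" j "Suc i" v] by auto
  then show ?thesis by (simp add: E_def Y_scale Y_sum)
qed

text \<open>Translating the summation variable absorbs h: after averaging over G the two places are
  interchangeable. This is what lets g_i commute with the e-term of the Jucys-Murphy
  recursion.\<close>

lemma Y_E_shift:
  assumes "h \<in> carrier G" "1 \<le> i" "i < n"
  shows "Y h i (E i v) = Y h (Suc i) (E i v)"
proof -
  have "Y h i (\<Sum>g\<in>carrier G. Y g i (Y (inv g) (Suc i) v))
      = (\<Sum>g\<in>carrier G. Y (h \<otimes> g) i (Y (inv g) (Suc i) v))"
    unfolding Y_sum using assms by (intro sum.cong) (auto simp: Y_mult)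
  also have "\<dots> = (\<Sum>g\<in>carrier G. Y g i (Y (h \<otimes> inv g) (Suc i) v))"
    by (rule sum.reindex_bij_witness[of _ "\<lambda>g. inv h \<otimes> g" "\<lambda>g. h \<otimes> g"])
      (use assms in \<open>auto simp: inv_mult_group m_assoc[symmetric]\<close>,
        auto simp: m_comm m_assoc[symmetric] simp: m_ac)
  also have "\<dots> = (\<Sum>g\<in>carrier G. Y g i (Y h (Suc i) (Y (inv g) (Suc i) v)))"
    using assms by (intro sum.cong) (auto simp: Y_mult)
  also have "\<dots> = (\<Sum>g\<in>carrier G. Y h (Suc i) (Y g i (Y (inv g) (Suc i) v)))"
    using assms by (intro sum.cong) (auto simp: Y_Y)
  finally show ?thesis by (simp add: E_def Y_scale Y_sum)
qed

text \<open>s_i s_{i+1} carries the places (i, i+1) to (i+1, i+2).\<close>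

lemma S_S_E:
  assumes "1 \<le> i" "Suc i < n"
  shows "S i (S (Suc i) (E i v)) = E (Suc i) (S i (S (Suc i) v))"
proof -
  have "S i (S (Suc i) (Y g i (Y (inv g) (Suc i) v)))
      = Y g (Suc i) (Y (inv g) (Suc (Suc i)) (S i (S (Suc i) v)))" if "g \<in> carrier G" for g
    using assms that by (auto simp: S_Y Transposition.transpose_def)
  then show ?thesis by (simp add: E_def S_scale S_sum)
qed

text \<open>Both conjugates are e_{i,i+2}.\<close>

lemma E_S_E:
  assumes "1 \<le> i" "Suc i < n"
  shows "S (Suc i) (E i (S (Suc i) v)) = S i (E (Suc i) (S i v))"
proof -
  have "S (Suc i) (E i (S (Suc i) v)) = S i (S i (S (Suc i) (E i (S (Suc i) v))))"
    using assms by (simp add: S_S)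
  also have "\<dots> = S i (E (Suc i) (S i v))"
    using assms by (simp add: S_S_E S_S)
  finally show ?thesis .
qed

section \<open>Jucys-Murphy operators and their commutation\<close>

fun J :: "nat \<Rightarrow> 'v \<Rightarrow> 'v" where
  "J 0 v = 0"
| "J (Suc 0) v = 0"
| "J (Suc (Suc i)) v = S (Suc i) (J (Suc i) (S (Suc i) v)) + E (Suc i) (S (Suc i) v)"

lemma J_add: "J k (v + w) = J k v + J k w"
  by (induction k v arbitrary: w rule: J.induct) (auto simp: S_add E_add)

lemma J_scale: "J k (a *s v) = a *s J k v"
  by (induction k v rule: J.induct) (auto simp: S_scale E_scale S_add scale_right_distrib)

lemma J_0 [simp]: "J i 0 = 0"
  using J_add[of i 0 0] by simp

lemma J_minus: "J i (- v) = - J i v"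
  using J_add[of i v "- v"] by (simp add: eq_neg_iff_add_eq_0 add.commute)

lemma J_diff: "J i (v - w) = J i v - J i w"
  using J_add[of i v "- w"] by (simp add: J_minus)

lemma J_sum: "J i (sum f A) = (\<Sum>x\<in>A. J i (f x))"
  by (induction A rule: infinite_finite_induct) (auto simp: J_add)

lemma J_Suc: "1 \<le> i \<Longrightarrow> J (Suc i) v = S i (J i (S i v)) + E i (S i v)"
  by (cases i) auto

lemma S_J_gt: "k < i \<Longrightarrow> i < n \<Longrightarrow> S i (J k v) = J k (S i v)"
proof (induction k v rule: J.induct)
  case (3 j v)
  have "S i (S (Suc j) x) = S (Suc j) (S i x)" for x
    using 3 S_far[of "Suc j" i x] by simp
  then show ?case using 3 by (simp add: S_add S_E_far)
qed auto

text \<open>For k > i + 2 the recursion lowers k. In the critical case k = i + 2, expanding J_k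
  twice gives three terms: the first commutes with s_i by the braid relation, and s_i exchanges the
  other two.\<close>

lemma S_J_lt: "1 \<le> i \<Longrightarrow> Suc i < k \<Longrightarrow> k \<le> n \<Longrightarrow> S i (J k v) = J k (S i v)"
proof (induction k v rule: J.induct)
  case (3 j v)
  show ?case
  proof (cases "i < j")
    case True
    have "S i (S (Suc j) x) = S (Suc j) (S i x)" for x
      using 3 True S_far[of i "Suc j" x] by simp
    then show ?thesis using 3 True by (simp add: S_add S_E_far)
  next
    case False
    then have ij: "i = j" using 3 by simp
    then have j: "1 \<le> j" "Suc j < n" using 3 by auto
    let ?s = "S j" and ?t = "S (Suc j)" and ?K = "J j" and ?e = "E j" and ?f = "E (Suc j)"
    have tK: "?t (?K x) = ?K (?t x)" for x using j by (intro S_J_gt) auto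
    have JJ: "J (Suc (Suc j)) x = ?t (?s (?K (?s (?t x)))) + ?t (?e (?s (?t x))) + ?f (?t x)" for x
      using j by (simp add: J_Suc S_add)
    have a1: "?s (?t (?s (?K (?s (?t v))))) = ?t (?s (?K (?s (?t (?s v)))))"
      using j by (simp add: S_braid tK)
    have a2: "?s (?t (?e (?s (?t v)))) = ?f (?t (?s v))"
      using j by (simp add: S_S_E S_braid S_S)
    have a3: "?t (?e (?s (?t (?s v)))) = ?s (?f (?t v))"
      using j E_S_E[of j "?s (?t v)"] by (simp add: S_braid S_S)
    show ?thesis unfolding ij JJ S_add a1 a2 a3 by (simp add: add_ac)
  qed
qed auto

lemma S_J:
  assumes "1 \<le> i" "i < n" "k \<le> n" "k \<noteq> i" "k \<noteq> Suc i"
  shows "S i (J k v) = J k (S i v)"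
  using assms by (cases "k < i") (auto intro: S_J_gt S_J_lt)

text \<open>Moving g_i through the outer transposition changes i to \<open>i'\<close>. In the
  conjugated term the second transposition restores i; in the e-term \<open>Y_E_shift\<close>
  does.\<close>

lemma Y_J: "g \<in> carrier G \<Longrightarrow> 1 \<le> i \<Longrightarrow> i \<le> n \<Longrightarrow> k \<le> n \<Longrightarrow> Y g i (J k v) = J k (Y g i v)"
proof (induction k v arbitrary: i rule: J.induct)
  case (3 j v)
  let ?t = "S (Suc j)"
  define i' where "i' = Transposition.transpose (Suc j) (Suc (Suc j)) i"
  have i': "1 \<le> i'" "i' \<le> n" and ii: "Transposition.transpose (Suc j) (Suc (Suc j)) i' = i"
    using 3 by (auto simp: i'_def Transposition.transpose_def)
  have YS: "Y g i (?t x) = ?t (Y g i' x)" for x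
    using 3 i' by (simp add: S_Y ii)
  have SY: "?t (Y g i x) = Y g i' (?t x)" for x
    using 3 by (simp add: S_Y i'_def)
  have 1: "Y g i (?t (J (Suc j) (?t v))) = ?t (J (Suc j) (?t (Y g i v)))"
    using 3 i' by (simp add: YS SY)
  have "Y g i' (E (Suc j) x) = Y g i (E (Suc j) x)" for x
    using 3 Y_E_shift[of g "Suc j" x] by (auto simp: i'_def Transposition.transpose_def)
  then have 2: "Y g i (E (Suc j) (?t v)) = E (Suc j) (?t (Y g i v))"
    using 3 i' by (simp add: SY) (metis Y_E Suc_le_lessD le_simps(3) zero_less_Suc One_nat_def)
  show ?case using 1 2 by (simp add: Y_add)
qed auto

lemma E_J: "1 \<le> i \<Longrightarrow> i < n \<Longrightarrow> k \<le> n \<Longrightarrow> E i (J k v) = J k (E i v)"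
  by (simp add: E_def J_scale J_sum Y_J)

text \<open>J_i is built from s_j and e_{j,j+1} with j < i, all of which commute with J_k.\<close>

lemma J_J: "i < k \<Longrightarrow> k \<le> n \<Longrightarrow> J i (J k v) = J k (J i v)"
  by (induction i v rule: J.induct) (auto simp: S_J_lt E_J J_add)

lemma J_commute: "i \<le> n \<Longrightarrow> k \<le> n \<Longrightarrow> J i (J k v) = J k (J i v)"
  by (metis J_J linorder_neqE_nat)

text \<open>Together with \<open>J_Suc_S\<close>, these are exchange relations of degenerate affine
  Hecke type; the intertwiners below get their weights from them.\<close>

lemma J_S: "1 \<le> i \<Longrightarrow> i < n \<Longrightarrow> J i (S i v) = S i (J (Suc i) v) - E i v"
  by (simp add: J_Suc S_add S_S S_E)

lemma J_Suc_S: "1 \<le> i \<Longrightarrow> i < n \<Longrightarrow> J (Suc i) (S i v) = S i (J i v) + E i v"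
  by (simp add: J_Suc S_S)

section \<open>Characters of G and the eigenvalues of E\<close>

definition is_char :: "('g \<Rightarrow> 'k) \<Rightarrow> bool" where
  "is_char \<chi> \<longleftrightarrow> (\<forall>g\<in>carrier G. \<chi> g \<noteq> 0) \<and> (\<forall>g\<in>carrier G. \<forall>h\<in>carrier G. \<chi> (g \<otimes> h) = \<chi> g * \<chi> h)"

definition same :: "('g \<Rightarrow> 'k) \<Rightarrow> ('g \<Rightarrow> 'k) \<Rightarrow> bool" where
  "same \<chi> \<psi> \<longleftrightarrow> (\<forall>g\<in>carrier G. \<chi> g = \<psi> g)"

definition eig :: "('g \<Rightarrow> 'k) \<Rightarrow> nat \<Rightarrow> 'v \<Rightarrow> bool" where
  "eig \<chi> i v \<longleftrightarrow> (\<forall>g\<in>carrier G. Y g i v = \<chi> g *s v)"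

lemma is_char_one: assumes "is_char \<chi>" shows "\<chi> \<one> = 1"
proof -
  have "\<chi> \<one> * \<chi> \<one> = \<chi> \<one> * 1" using assms unfolding is_char_def by (metis l_one one_closed mult.right_neutral)
  then show ?thesis using assms unfolding is_char_def by (metis mult_cancel_left one_closed)
qed

lemma is_char_inv: "is_char \<chi> \<Longrightarrow> g \<in> carrier G \<Longrightarrow> \<chi> g * \<chi> (inv g) = 1"
  using is_char_one[of \<chi>] unfolding is_char_def by (metis inv_closed r_inv)

text \<open>If the characters differ at h, translation by h multiplies the sum by \<chi> h / \<psi>
  h, which is not 1.\<close>

lemma char_orthogonal:
  assumes "is_char \<chi>" "is_char \<psi>"
  shows "(\<Sum>g\<in>carrier G. \<chi> g * \<psi> (inv g)) = (if same \<chi> \<psi> then of_nat (card (carrier G)) else 0)"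
proof (cases "same \<chi> \<psi>")
  case True
  then have "(\<Sum>g\<in>carrier G. \<chi> g * \<psi> (inv g)) = (\<Sum>g\<in>carrier G. 1)"
    using is_char_inv[OF assms(2)] by (intro sum.cong) (auto simp: same_def)
  then show ?thesis using True by simp
next
  case False
  then obtain h where h: "h \<in> carrier G" "\<chi> h \<noteq> \<psi> h" by (auto simp: same_def)
  let ?s = "\<Sum>g\<in>carrier G. \<chi> g * \<psi> (inv g)"
  have "?s = (\<Sum>g\<in>carrier G. \<chi> (h \<otimes> g) * \<psi> (inv (h \<otimes> g)))"
    by (rule sum.reindex_bij_witness[of _ "\<lambda>g. h \<otimes> g" "\<lambda>g. inv h \<otimes> g"])
      (use h in \<open>auto simp: m_assoc[symmetric]\<close>)
  also have "\<dots> = (\<Sum>g\<in>carrier G. (\<chi> h * \<psi> (inv h)) * (\<chi> g * \<psi> (inv g)))"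
    using assms h by (intro sum.cong refl) (simp add: inv_mult is_char_def)
  also have "\<dots> = (\<chi> h * \<psi> (inv h)) * ?s" by (simp add: sum_distrib_left)
  finally have "(1 - \<chi> h * \<psi> (inv h)) * ?s = 0" by (simp add: algebra_simps)
  moreover have "\<chi> h * \<psi> (inv h) \<noteq> 1"
  proof
    assume "\<chi> h * \<psi> (inv h) = 1"
    then have "\<chi> h * (\<psi> h * \<psi> (inv h)) = \<psi> h" by (simp add: algebra_simps)
    then show False using is_char_inv[OF assms(2) h(1)] h by simp
  qed
  ultimately show ?thesis using False by simp
qed

lemma E_eig:
  assumes "1 \<le> i" "i < n" "is_char \<chi>" "is_char \<psi>" "eig \<chi> i v" "eig \<psi> (Suc i) v"
  shows "E i v = (if same \<chi> \<psi> then 1 else 0) *s v"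
proof -
  have "(\<Sum>g\<in>carrier G. Y g i (Y (inv g) (Suc i) v)) = (\<Sum>g\<in>carrier G. (\<chi> g * \<psi> (inv g)) *s v)"
    using assms by (intro sum.cong refl) (simp add: eig_def Y_scale mult.commute)
  also have "\<dots> = (if same \<chi> \<psi> then of_nat (card (carrier G)) else 0) *s v"
    using char_orthogonal[OF assms(3,4)] by (simp add: scale_sum_left[symmetric])
  finally show ?thesis using card_G by (simp add: E_def)
qed

section \<open>Baxterized operators and the fusion scalar\<close>

definition bax :: "nat \<Rightarrow> 'k \<Rightarrow> 'k \<Rightarrow> 'v \<Rightarrow> 'v" where
  "bax i u c v = S i v + (1 / (u - c)) *s E i v"

text \<open>\<open>fus l c u\<close> is the action of \<open>\<phi>_{l+1}(c_1, \<dots>, c_l, u)\<close>.\<close>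

primrec fus :: "nat \<Rightarrow> (nat \<Rightarrow> 'k) \<Rightarrow> 'k \<Rightarrow> 'v \<Rightarrow> 'v" where
  "fus 0 c u v = v"
| "fus (Suc l) c u v = bax (Suc l) u (c (Suc l)) (fus l c u (S (Suc l) v))"

lemma bax_add: "bax i u c (v + w) = bax i u c v + bax i u c w"
  by (simp add: bax_def S_add E_add scale_right_distrib)

lemma bax_scale: "bax i u c (a *s v) = a *s bax i u c v"
  by (simp add: bax_def S_scale E_scale scale_right_distrib mult.commute)

lemma fus_add: "fus l c u (v + w) = fus l c u v + fus l c u w"
  by (induction l arbitrary: v w) (auto simp: S_add bax_add)

lemma fus_scale: "fus l c u (a *s v) = a *s fus l c u v"
  by (induction l arbitrary: v) (auto simp: S_scale bax_scale)

lemma fus_0 [simp]: "fus l c u 0 = 0"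
  using fus_add[of l c u 0 0] by simp

lemma fus_minus: "fus l c u (- v) = - fus l c u v"
  using fus_add[of l c u v "- v"] by (simp add: eq_neg_iff_add_eq_0 add.commute)

lemma fus_diff: "fus l c u (v - w) = fus l c u v - fus l c u w"
  using fus_add[of l c u v "- w"] by (simp add: fus_minus)

lemma fus_sum: "fus l c u (sum f A) = (\<Sum>x\<in>A. fus l c u (f x))"
  by (induction A rule: infinite_finite_induct) (auto simp: fus_add)

text \<open>Each factor is the scalar of s_i(u,c) s_i(c,u) = 1 - e / (u - c)^2, where e is 1 or 0 as
  the characters agree or not.\<close>

definition ffac :: "nat \<Rightarrow> (nat \<Rightarrow> 'g \<Rightarrow> 'k) \<Rightarrow> (nat \<Rightarrow> 'k) \<Rightarrow> ('g \<Rightarrow> 'k) \<Rightarrow> 'k \<Rightarrow> 'k" where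
  "ffac l \<chi> c \<psi> u = u * (\<Prod>i\<in>{1..l}. if same (\<chi> i) \<psi> then 1 - 1 / (u - c i)\<^sup>2 else 1)"

text \<open>No eigenvalue of J_{l+1} is assumed, because the induction passes to w = s_{l+1} v,
  which keeps the weights 1..l but need not be an eigenvector of J_{l+1}. Conjugation turns u -
  J_{l+2} into u - J_{l+1} up to an e-term.\<close>

lemma fus_resolvent:
  assumes "l < n" "\<And>i. i \<in> {1..l} \<Longrightarrow> J i v = c i *s v \<and> eig (\<chi> i) i v \<and> is_char (\<chi> i) \<and> u \<noteq> c i"
    "is_char \<psi>" "eig \<psi> (Suc l) v"
  shows "fus l c u (u *s v - J (Suc l) v) = ffac l \<chi> c \<psi> u *s v"
  using assms
proof (induction l arbitrary: v)
  case 0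
  then show ?case by (simp add: ffac_def)
next
  case (Suc l)
  let ?s = "S (Suc l)" and ?c = "c (Suc l)"
  define w where "w = ?s v"
  define \<delta> :: 'k where "\<delta> = (if same (\<chi> (Suc l)) \<psi> then 1 else 0)"
  define f where "f = ffac l \<chi> c \<psi> u"
  have sw: "?s w = v" using Suc by (simp add: w_def S_S)
  have Ev: "E (Suc l) v = \<delta> *s v"
    using Suc.prems E_eig[of "Suc l" "\<chi> (Suc l)" \<psi> v] by (simp add: \<delta>_def)
  have Ew: "E (Suc l) w = \<delta> *s w"
    using Ev Suc.prems by (simp add: w_def S_E[symmetric] S_scale)
  have uc: "u - ?c \<noteq> 0" using Suc.prems(2)[of "Suc l"] by simp
  have IHw: "fus l c u (u *s w - J (Suc l) w) = f *s w"
    unfolding f_def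
  proof (rule Suc.IH)
    fix i assume i: "i \<in> {1..l}"
    then have "i \<in> {1..Suc l}" by simp
    note * = Suc.prems(2)[OF this]
    have "J i w = c i *s w"
      using * i Suc.prems(1) by (simp add: w_def S_J_gt[symmetric] S_scale)
    moreover have "Y g i w = \<chi> i g *s w" if "g \<in> carrier G" for g
      using * i Suc.prems(1) that S_Y[of "Suc l" g i v]
      by (simp add: w_def eig_def S_scale Transposition.transpose_def)
    ultimately show "J i w = c i *s w \<and> eig (\<chi> i) i w \<and> is_char (\<chi> i) \<and> u \<noteq> c i"
      using * by (simp add: eig_def)
  next
    have "Y g (Suc l) w = \<psi> g *s w" if "g \<in> carrier G" for g
      using Suc.prems that S_Y[of "Suc l" g "Suc (Suc l)" v]
      by (simp add: w_def eig_def S_scale)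
    then show "eig \<psi> (Suc l) w" by (simp add: eig_def)
  qed (use Suc.prems in auto)
  \<comment> \<open>If the characters at l + 1 agree, v itself meets the induction hypothesis, and
    J_{l+1} v = c_{l+1} v allows division by u - c_{l+1}. Otherwise \<delta> = 0 and nothing is
    claimed.\<close>
  have IHv: "\<delta> *s fus l c u v = (\<delta> * f / (u - ?c)) *s v"
  proof (cases "same (\<chi> (Suc l)) \<psi>")
    case True
    have Jv: "J (Suc l) v = ?c *s v" using Suc.prems(2)[of "Suc l"] by simp
    have "fus l c u (u *s v - J (Suc l) v) = f *s v"
      unfolding f_def
    proof (rule Suc.IH)
      show "eig \<psi> (Suc l) v" using True Suc.prems(2)[of "Suc l"] by (auto simp: eig_def same_def)
    qed (use Suc.prems in auto)
    then have "(u - ?c) *s fus l c u v = f *s v"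
      by (simp add: Jv scale_left_diff_distrib[symmetric] fus_scale)
    then have "fus l c u v = (f / (u - ?c)) *s v"
      using uc by (metis divide_inverse_commute left_inverse scale_one scale_scale)
    then show ?thesis using True by (simp add: \<delta>_def)
  qed (simp add: \<delta>_def)
  have dd: "\<delta> * \<delta> = \<delta>" by (simp add: \<delta>_def)
  \<comment> \<open>From J_{l+2} = s J_{l+1} s + e s and s e = e s one gets s J_{l+2} v = J_{l+1} w
    + e v.\<close>
  have "?s (u *s v - J (Suc (Suc l)) v) = (u *s w - J (Suc l) w) - \<delta> *s v"
    using Suc.prems(1) by (simp add: S_diff S_scale S_add S_S S_E w_def[symmetric] sw Ev)
  then have "fus l c u (?s (u *s v - J (Suc (Suc l)) v)) = f *s w - (\<delta> * f / (u - ?c)) *s v"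
    by (simp only: fus_diff[of l c u "u *s w - J (Suc l) w"] IHw fus_scale[of l c u \<delta>] IHv)
  then have "fus (Suc l) c u (u *s v - J (Suc (Suc l)) v)
      = bax (Suc l) u ?c (f *s w - (\<delta> * f / (u - ?c)) *s v)" by simp
  also have "\<dots> = f *s v - (\<delta> * f / (u - ?c)) *s w
      + (1 / (u - ?c)) *s ((f * \<delta>) *s w - (\<delta> * f / (u - ?c)) *s (\<delta> *s v))"
    by (simp add: bax_def S_diff E_diff S_scale E_scale sw Ev Ew w_def[symmetric])
  \<comment> \<open>The two terms in w cancel.\<close>
  also have "\<dots> = (f - \<delta> * \<delta> * f / (u - ?c)\<^sup>2) *s v"
    by (simp add: scale_right_diff_distrib scale_left_diff_distrib power2_eq_square mult_ac)
  also have "f - \<delta> * \<delta> * f / (u - ?c)\<^sup>2 = ffac (Suc l) \<chi> c \<psi> u"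
    by (simp add: dd f_def ffac_def) (simp add: \<delta>_def algebra_simps)
  finally show ?case .
qed

lemma fus_eigen:
  assumes "l < n" "\<And>i. i \<in> {1..l} \<Longrightarrow> J i v = c i *s v \<and> eig (\<chi> i) i v \<and> is_char (\<chi> i) \<and> u \<noteq> c i"
    "is_char \<psi>" "eig \<psi> (Suc l) v" "J (Suc l) v = b *s v" "u \<noteq> b"
  shows "fus l c u v = (ffac l \<chi> c \<psi> u / (u - b)) *s v"
proof -
  have "(u - b) *s fus l c u v = ffac l \<chi> c \<psi> u *s v"
    using fus_resolvent[OF assms(1-4)] assms(5)
    by (simp add: scale_left_diff_distrib[symmetric] fus_scale)
  then show ?thesis
    using assms(6) by (metis divide_inverse_commute eq_iff_diff_eq_0 left_inverse scale_one scale_scale)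
qed

end

section \<open>Weight vectors and seminormal intertwiners\<close>

locale weighted_module = wreath_module scale G n S Y
  for scale :: "'k::field \<Rightarrow> 'v::ab_group_add \<Rightarrow> 'v" (infixr "*s" 75)
    and G :: "('g, 'b) monoid_scheme" (structure) and n S Y +
  fixes m :: nat and \<rho> :: "nat \<Rightarrow> 'g \<Rightarrow> 'k"
  assumes rho_char: "p \<in> {1..m} \<Longrightarrow> is_char (\<rho> p)"
    and rho_distinct: "p \<in> {1..m} \<Longrightarrow> q \<in> {1..m} \<Longrightarrow> same (\<rho> p) (\<rho> q) \<Longrightarrow> p = q"
begin

abbreviation tr :: "nat \<Rightarrow> nat \<Rightarrow> nat" where
  "tr i \<equiv> Transposition.transpose i (Suc i)"

definition wt :: "(nat \<Rightarrow> nat) \<Rightarrow> (nat \<Rightarrow> 'k) \<Rightarrow> 'v \<Rightarrow> bool" where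
  "wt p c v \<longleftrightarrow> (\<forall>i\<in>{1..n}. eig (\<rho> (p i)) i v \<and> J i v = c i *s v)"

text \<open>Young's seminormal diagonal entry of s_i: the reciprocal axial distance, or 0 between
  different characters.\<close>

definition kap :: "(nat \<Rightarrow> nat) \<Rightarrow> (nat \<Rightarrow> 'k) \<Rightarrow> nat \<Rightarrow> 'k" where
  "kap p c i = (if p i = p (Suc i) then 1 / (c (Suc i) - c i) else 0)"

text \<open>Removing the diagonal part of s_i leaves the component in the weight space with entries
  i and i + 1 exchanged.\<close>

definition psi :: "(nat \<Rightarrow> nat) \<Rightarrow> (nat \<Rightarrow> 'k) \<Rightarrow> nat \<Rightarrow> 'v \<Rightarrow> 'v" where
  "psi p c i v = S i v - kap p c i *s v"

lemma psi_scale: "psi p c i (a *s v) = a *s psi p c i v"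
  by (simp add: psi_def S_scale scale_right_diff_distrib mult.commute)

lemma S_psi: "S i v = psi p c i v + kap p c i *s v"
  by (simp add: psi_def)

lemma wt_cong:
  "(\<And>i. i \<in> {1..n} \<Longrightarrow> p i = p' i \<and> c i = c' i) \<Longrightarrow> wt p c v \<longleftrightarrow> wt p' c' v"
  by (auto simp: wt_def)

lemma wt_scale: "wt p c v \<Longrightarrow> wt p c (a *s v)"
  by (simp add: wt_def eig_def Y_scale J_scale mult.commute)

lemma wt_E:
  assumes "wt p c v" "p \<in> {1..n} \<rightarrow> {1..m}" "1 \<le> i" "i < n"
  shows "E i v = (if p i = p (Suc i) then 1 else 0) *s v"
proof -
  have p: "p i \<in> {1..m}" "p (Suc i) \<in> {1..m}" using assms by (auto simp: Pi_iff)
  have "same (\<rho> (p i)) (\<rho> (p (Suc i))) \<longleftrightarrow> p i = p (Suc i)"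
    using rho_distinct[OF p] by (auto simp: same_def)
  then show ?thesis
    using E_eig[OF assms(3,4) rho_char[OF p(1)] rho_char[OF p(2)]] assms by (auto simp: wt_def)
qed

text \<open>\<open>kap\<close> times the difference of the contents is the eigenvalue of E, so the
  E-term of the exchange relations cancels against the correction. The last hypothesis excludes the
  default value 1 / 0 = 0, for which this fails.\<close>

lemma psi_wt:
  assumes "wt p c v" "p \<in> {1..n} \<rightarrow> {1..m}" "1 \<le> i" "i < n"
    and "p i = p (Suc i) \<Longrightarrow> c i \<noteq> c (Suc i)"
  shows "wt (p \<circ> tr i) (c \<circ> tr i) (psi p c i v)"
  unfolding wt_def
proof (intro ballI conjI)
  fix k assume k: "k \<in> {1..n}"
  have k': "tr i k \<in> {1..n}" using k assms by (auto simp: Transposition.transpose_def)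
  have Y: "Y g (tr i k) v = \<rho> (p (tr i k)) g *s v" if "g \<in> carrier G" for g
    using assms(1) k' that unfolding wt_def eig_def by blast
  have Yk: "Y g k v = \<rho> (p k) g *s v" if "g \<in> carrier G" for g
    using assms(1) k that unfolding wt_def eig_def by blast
  have Jk: "J k v = c k *s v" using assms(1) k by (simp add: wt_def)
  have Ji: "J i v = c i *s v" "J (Suc i) v = c (Suc i) *s v" using assms by (auto simp: wt_def)
  note Ev = wt_E[OF assms(1-4)]
  show "eig (\<rho> ((p \<circ> tr i) k)) k (psi p c i v)"
    unfolding eig_def
  proof
    fix g assume g: "g \<in> carrier G"
    have "S i (Y g (tr i k) v) = Y g k (S i v)"
      using S_Y[OF assms(3,4) g, of "tr i k" v] k' by simp
    then have 1: "Y g k (S i v) = \<rho> (p (tr i k)) g *s S i v"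
      by (simp add: Y[OF g] S_scale)
    have 2: "kap p c i *s Y g k v = kap p c i *s (\<rho> (p (tr i k)) g *s v)"
      using Yk[OF g] by (auto simp: kap_def Transposition.transpose_def)
    show "Y g k (psi p c i v) = \<rho> ((p \<circ> tr i) k) g *s psi p c i v"
      by (simp add: psi_def Y_diff Y_scale 1 2 scale_right_diff_distrib mult.commute)
  qed
  consider "k = i" | "k = Suc i" | "k \<noteq> i" "k \<noteq> Suc i" by blast
  then show "J k (psi p c i v) = (c \<circ> tr i) k *s psi p c i v"
  proof cases
    case 1
    have "J i (S i v) = c (Suc i) *s S i v - E i v"
      using assms by (simp add: J_S Ji S_scale)
    moreover have "kap p c i * c (Suc i) = kap p c i * c i + (if p i = p (Suc i) then 1 else 0)"
      using assms(5) by (auto simp: kap_def field_simps)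
    ultimately show ?thesis
      by (simp add: 1 psi_def J_diff J_scale Ji Ev scale_right_diff_distrib mult.commute scale_left_distrib)
  next
    case 2
    have "J (Suc i) (S i v) = c i *s S i v + E i v"
      using assms by (simp add: J_Suc_S Ji S_scale)
    moreover have "kap p c i * c (Suc i) = kap p c i * c i + (if p i = p (Suc i) then 1 else 0)"
      using assms(5) by (auto simp: kap_def field_simps)
    ultimately show ?thesis
      by (simp add: 2 psi_def J_diff J_scale Ji Ev scale_right_diff_distrib mult.commute scale_left_distrib)
  next
    case 3
    then show ?thesis
      using assms k S_J[of i k v]
      by (simp add: psi_def J_diff J_scale Jk S_scale[symmetric] Transposition.transpose_def
          scale_right_diff_distrib mult.commute)
  qed
qed

text \<open>Exchanging the weights reverses the sign of \<open>kap\<close>, so the composite is (s_i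
  + \<open>kap\<close>)(s_i - \<open>kap\<close>).\<close>

lemma psi_psi:
  assumes "1 \<le> i" "i < n"
  shows "psi (p \<circ> tr i) (c \<circ> tr i) i (psi p c i v) = (1 - (kap p c i)\<^sup>2) *s v"
proof -
  have "kap (p \<circ> tr i) (c \<circ> tr i) i = - kap p c i"
    by (auto simp: kap_def minus_divide_right)
  then show ?thesis using assms
    by (simp add: psi_def S_diff S_scale S_S scale_right_diff_distrib scale_left_diff_distrib power2_eq_square)
qed

lemma psi_far:
  assumes "1 \<le> i" "Suc i < j" "j < n"
  shows "psi (p \<circ> tr i) (c \<circ> tr i) j (psi p c i v) = psi (p \<circ> tr j) (c \<circ> tr j) i (psi p c j v)"
proof -
  have "kap (p \<circ> tr i) (c \<circ> tr i) j = kap p c j" "kap (p \<circ> tr j) (c \<circ> tr j) i = kap p c i"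
    using assms by (auto simp: kap_def Transposition.transpose_def)
  then show ?thesis using assms
    by (simp add: psi_def S_diff S_scale S_far[of i j] scale_right_diff_distrib mult.commute)
qed



text \<open>Expansion leaves the braid relation of the s_i and one scalar identity between three
  reciprocal axial distances.\<close>

lemma psi_braid:
  assumes i: "1 \<le> i" "Suc i < n"
    and "p i = p (Suc i) \<Longrightarrow> c i \<noteq> c (Suc i)"
    and "p (Suc i) = p (Suc (Suc i)) \<Longrightarrow> c (Suc i) \<noteq> c (Suc (Suc i))"
    and "p i = p (Suc (Suc i)) \<Longrightarrow> c i \<noteq> c (Suc (Suc i))"
  shows "psi (p \<circ> tr i \<circ> tr (Suc i)) (c \<circ> tr i \<circ> tr (Suc i)) i
        (psi (p \<circ> tr i) (c \<circ> tr i) (Suc i) (psi p c i v))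
     = psi (p \<circ> tr (Suc i) \<circ> tr i) (c \<circ> tr (Suc i) \<circ> tr i) (Suc i)
        (psi (p \<circ> tr (Suc i)) (c \<circ> tr (Suc i)) i (psi p c (Suc i) v))"
proof -
  define \<alpha> where "\<alpha> = kap p c i"
  define \<gamma> where "\<gamma> = kap p c (Suc i)"
  define \<beta> where "\<beta> = (if p i = p (Suc (Suc i)) then 1 / (c (Suc (Suc i)) - c i) else 0)"
  have *: "kap (p \<circ> tr i) (c \<circ> tr i) (Suc i) = \<beta>"
    "kap (p \<circ> tr (Suc i)) (c \<circ> tr (Suc i)) i = \<beta>"
    "kap (p \<circ> tr i \<circ> tr (Suc i)) (c \<circ> tr i \<circ> tr (Suc i)) i = \<gamma>"
    "kap (p \<circ> tr (Suc i) \<circ> tr i) (c \<circ> tr (Suc i) \<circ> tr i) (Suc i) = \<alpha>"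
    by (auto simp: kap_def \<alpha>_def \<beta>_def \<gamma>_def Transposition.transpose_def)
  \<comment> \<open>For distances a, b and a + b this is 1/(ab) = 1/(a(a+b)) + 1/((a+b)b). If the
    three positions are not all equal, every product vanishes.\<close>
  have eq: "\<alpha> * \<gamma> = \<alpha> * \<beta> + \<beta> * \<gamma>"
  proof (cases "p i = p (Suc i) \<and> p (Suc i) = p (Suc (Suc i))")
    case True
    then have "c (Suc i) - c i \<noteq> 0" "c (Suc (Suc i)) - c (Suc i) \<noteq> 0" "c (Suc (Suc i)) - c i \<noteq> 0"
      using assms by auto
    moreover have "1 / a * (1 / b) = 1 / a * (1 / (a + b)) + 1 / (a + b) * (1 / b)"
      if "a \<noteq> 0" "b \<noteq> 0" "a + b \<noteq> 0" for a b :: 'k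
      using that by (simp add: divide_simps)
    from this[of "c (Suc i) - c i" "c (Suc (Suc i)) - c (Suc i)"]
    have "c (Suc i) - c i \<noteq> 0 \<Longrightarrow> c (Suc (Suc i)) - c (Suc i) \<noteq> 0 \<Longrightarrow> c (Suc (Suc i)) - c i \<noteq> 0 \<Longrightarrow>
      1 / (c (Suc i) - c i) * (1 / (c (Suc (Suc i)) - c (Suc i)))
      = 1 / (c (Suc i) - c i) * (1 / (c (Suc (Suc i)) - c i))
        + 1 / (c (Suc (Suc i)) - c i) * (1 / (c (Suc (Suc i)) - c (Suc i)))"
      by simp
    ultimately show ?thesis using True
      by (simp only: \<alpha>_def \<beta>_def \<gamma>_def kap_def simp_thms if_True)
  qed (auto simp: \<alpha>_def \<beta>_def \<gamma>_def kap_def)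
  have eq': "\<alpha> * (\<gamma> * a) = \<alpha> * (\<beta> * a) + \<beta> * (\<gamma> * a)" for a
    using eq by (metis distrib_right mult.assoc)
  show ?thesis
    unfolding psi_def * \<alpha>_def[symmetric] \<gamma>_def[symmetric] using i
    by (simp add: S_add S_diff S_scale S_S S_braid scale_right_diff_distrib scale_left_diff_distrib
        scale_left_distrib scale_right_distrib mult_ac eq eq' algebra_simps)
qed

end

section \<open>Row lengths and addable nodes\<close>

text \<open>Multi-diagrams as finite order ideals of nodes, all positions together; growing a
  diagram is then an \<open>insert\<close>, with no list of rows to update.\<close>

definition lower :: "mnode set \<Rightarrow> bool" where
  "lower D \<longleftrightarrow> finite D \<and> (\<forall>x y p. ((x, y), p) \<in> D \<longrightarrow> 1 \<le> x \<and> 1 \<le> y \<and>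
     (\<forall>x' y'. 1 \<le> x' \<and> x' \<le> x \<and> 1 \<le> y' \<and> y' \<le> y \<longrightarrow> ((x', y'), p) \<in> D))"

lemma lower_finite: "lower D \<Longrightarrow> finite D"
  by (simp add: lower_def)

lemma lower_pos:
  assumes "lower D" "((x, y), p) \<in> D" shows "1 \<le> x" "1 \<le> y"
  using assms(1)[unfolded lower_def, THEN conjunct2, rule_format, OF assms(2)] by simp_all

lemma lowerD:
  assumes "lower D" "((x, y), p) \<in> D" "1 \<le> x'" "x' \<le> x" "1 \<le> y'" "y' \<le> y"
  shows "((x', y'), p) \<in> D"
  using assms(1)[unfolded lower_def, THEN conjunct2, THEN spec, THEN spec, THEN spec, THEN mp, OF assms(2)]
    assms(3-6) by simp

definition rowlen :: "mnode set \<Rightarrow> nat \<Rightarrow> nat \<Rightarrow> nat" where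
  "rowlen D p x = card {y. ((x, y), p) \<in> D}"

lemma initial_segment:
  assumes "finite A" "\<And>a::nat. a \<in> A \<Longrightarrow> 1 \<le> a" "\<And>a b. a \<in> A \<Longrightarrow> 1 \<le> b \<Longrightarrow> b \<le> a \<Longrightarrow> b \<in> A"
  shows "A = {1..card A}"
proof (cases "A = {}")
  case False
  then have "Max A \<in> A" using assms(1) by simp
  have "A \<subseteq> {1..Max A}" using assms(1,2) by auto
  moreover have "{1..Max A} \<subseteq> A" using assms(3)[OF \<open>Max A \<in> A\<close>] by auto
  ultimately have "A = {1..Max A}" by blast
  then show ?thesis by (metis card_atLeastAtMost diff_Suc_1 One_nat_def)
qed simp

lemma finite_row: "finite D \<Longrightarrow> finite {y. ((x, y), p) \<in> D}"
  by (rule finite_subset[of _ "(\<lambda>t. snd (fst t)) ` D"]) force+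

lemma mem_lower_iff: "lower D \<Longrightarrow> ((x, y), p) \<in> D \<longleftrightarrow> 1 \<le> x \<and> 1 \<le> y \<and> y \<le> rowlen D p x"
proof -
  assume D: "lower D"
  have "{y. ((x, y), p) \<in> D} = {1..rowlen D p x}"
    unfolding rowlen_def
  proof (rule initial_segment)
    show "finite {y. ((x, y), p) \<in> D}" using D by (simp add: finite_row lower_finite)
  next
    fix a assume "a \<in> {y. ((x, y), p) \<in> D}"
    then show "1 \<le> a" using lower_pos[OF D] by simp
  next
    fix a b assume "a \<in> {y. ((x, y), p) \<in> D}" "1 \<le> b" "b \<le> a"
    then show "b \<in> {y. ((x, y), p) \<in> D}"
      using lowerD[OF D, of x a p x b] lower_pos[OF D, of x a p] by simp
  qed
  then have "((x, y), p) \<in> D \<longleftrightarrow> 1 \<le> y \<and> y \<le> rowlen D p x" by auto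
  moreover have "((x, y), p) \<in> D \<Longrightarrow> 1 \<le> x" using lower_pos[OF D] by simp
  ultimately show ?thesis by blast
qed

lemma row_antimono: "lower D \<Longrightarrow> 1 \<le> x \<Longrightarrow> x \<le> x' \<Longrightarrow> rowlen D p x' \<le> rowlen D p x"
  unfolding rowlen_def
  by (intro card_mono finite_row lower_finite) (auto intro: lowerD dest: lower_pos)

text \<open>One bound L serves all positions, so that products over rows can run over 1..L with
  empty rows allowed.\<close>

lemma row_bound:
  assumes "lower D" shows "\<exists>L. \<forall>p x. L < x \<longrightarrow> rowlen D p x = 0"
proof -
  have fin: "finite ((\<lambda>t. fst (fst t)) ` D)" using assms by (simp add: lower_finite)
  have "rowlen D p x = 0" if "Max (insert 0 ((\<lambda>t. fst (fst t)) ` D)) < x" for p x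
  proof -
    have "((x, y), p) \<notin> D" for y
    proof
      assume "((x, y), p) \<in> D"
      then have "x \<in> (\<lambda>t. fst (fst t)) ` D" by force
      then have "x \<le> Max (insert 0 ((\<lambda>t. fst (fst t)) ` D))" using fin by simp
      then show False using that by simp
    qed
    then show ?thesis by (simp add: rowlen_def)
  qed
  then show ?thesis by blast
qed

definition addable :: "mnode set \<Rightarrow> mnode \<Rightarrow> bool" where
  "addable D \<theta> \<longleftrightarrow> \<theta> \<notin> D \<and> lower D \<and> lower (insert \<theta> D)"

text \<open>Two addable nodes are incomparable, as the smaller of two comparable ones would already
  belong to D. So one lies strictly above and strictly to the right of the other, and each
  coordinate adds at least 1 to the difference of contents.\<close>

lemma addable_content:
  assumes "addable D \<theta>" "addable D \<theta>'" "position \<theta> = position \<theta>'" "\<theta> \<noteq> \<theta>'"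
  shows "\<bar>Defs.content \<theta> - Defs.content \<theta>'\<bar> \<ge> 2"
proof -
  obtain x y p x' y' where \<theta>: "\<theta> = ((x, y), p)" "\<theta>' = ((x', y'), p)"
    using assms(3) by (metis position_def prod.collapse)
  have pos: "1 \<le> x" "1 \<le> y" "1 \<le> x'" "1 \<le> y'"
    using assms lower_pos[of "insert \<theta> D" x y p] lower_pos[of "insert \<theta>' D" x' y' p]
    unfolding addable_def \<theta> by simp_all
  have *: "\<not> (a \<le> a' \<and> b \<le> b')"
    if "addable D ((a, b), p)" "addable D ((a', b'), p)" "((a, b), p) \<noteq> ((a', b'), p)" "1 \<le> a" "1 \<le> b"
    for a b a' b'
  proof
    assume "a \<le> a' \<and> b \<le> b'"
    then have "((a, b), p) \<in> insert ((a', b'), p) D"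
      using that lowerD[of "insert ((a', b'), p) D" a' b' p a b] by (simp add: addable_def)
    then show False using that by (auto simp: addable_def)
  qed
  have "\<not> (x \<le> x' \<and> y \<le> y')" "\<not> (x' \<le> x \<and> y' \<le> y)"
    using *[of x y x' y'] *[of x' y' x y] assms pos unfolding \<theta> by auto
  then show ?thesis by (auto simp: Defs.content_def \<theta>)
qed

lemma addable_row:
  assumes "addable D ((x, y), p)"
  shows "1 \<le> x" "y = Suc (rowlen D p x)" "\<And>a. 1 \<le> a \<Longrightarrow> a < x \<Longrightarrow> y \<le> rowlen D p a"
    "rowlen (insert ((x, y), p) D) q z = (if q = p \<and> z = x then Suc (rowlen D q z) else rowlen D q z)"
proof -
  have D: "lower D" "lower (insert ((x, y), p) D)" "((x, y), p) \<notin> D"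
    using assms by (auto simp: addable_def)
  have "{b. ((z, b), q) \<in> insert ((x, y), p) D} =
      (if q = p \<and> z = x then insert y {b. ((z, b), q) \<in> D} else {b. ((z, b), q) \<in> D})" for q z
    by auto
  then have r: "rowlen (insert ((x, y), p) D) q z = (if q = p \<and> z = x then Suc (rowlen D q z) else rowlen D q z)" for q z
    using D(3) finite_row[OF lower_finite[OF D(1)], of x p] unfolding rowlen_def by simp
  show "rowlen (insert ((x, y), p) D) q z = (if q = p \<and> z = x then Suc (rowlen D q z) else rowlen D q z)"
    by (rule r)
  have "1 \<le> x \<and> 1 \<le> y \<and> y \<le> rowlen (insert ((x, y), p) D) p x"
    using mem_lower_iff[OF D(2), of x y p] by simp
  moreover have "\<not> (1 \<le> x \<and> 1 \<le> y \<and> y \<le> rowlen D p x)"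
    using mem_lower_iff[OF D(1), of x y p] D(3) by simp
  ultimately show x: "1 \<le> x" "y = Suc (rowlen D p x)" by (auto simp: r)
  show "y \<le> rowlen D p a" if "1 \<le> a" "a < x" for a
    using row_antimono[OF D(2) that(1), of x p] that x(2) unfolding r by simp
qed

text \<open>\<open>bet r x\<close> is \<open>\<lambda>\<^sub>x - x\<close> for the row lengths \<open>r = \<lambda>\<close>.\<close>

definition bet :: "(nat \<Rightarrow> nat) \<Rightarrow> nat \<Rightarrow> int" where
  "bet r x = int (r x) - int x"

text \<open>\<open>bet r x\<close> is the content at column \<open>r x\<close> of row x and
  \<open>bet r x + 1\<close> that of the cell after it; u + L vanishes at the content -L of the
  first cell of row L + 1.\<close>

definition rowfrac :: "nat \<Rightarrow> (nat \<Rightarrow> nat) \<Rightarrow> 'k::field \<Rightarrow> 'k" where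
  "rowfrac L r u = (u + of_nat L) * (\<Prod>x\<in>{1..L}. (u - of_int (bet r x + 1)) / (u - of_int (bet r x)))"

text \<open>Each factor is (w - 1)(w + 1) / w^2 with w = u minus the content, so the product
  telescopes along the row. Avoiding all integers keeps the denominators nonzero; an indeterminate
  and a nonzero imaginary number both do so.\<close>

lemma row_telescope:
  fixes u :: "'k::field"
  assumes u: "\<And>z. u \<noteq> of_int z"
  shows "(\<Prod>y\<in>{1..r}. 1 - 1 / (u - of_int (int y - int x))\<^sup>2)
    = (u - of_int (int r - int x + 1)) / (u - of_int (int r - int x)) * ((u + of_nat x) / (u + of_nat x - 1))"
proof (induction r)
  case 0
  have "u + of_nat x \<noteq> 0" "u + of_nat x - 1 \<noteq> 0"
    using u[of "- int x"] u[of "1 - int x"] by (auto simp: eq_neg_iff_add_eq_0 eq_diff_eq algebra_simps)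
  moreover have "u - of_int (int 0 - int x + 1) = u + of_nat x - 1" "u - of_int (int 0 - int x) = u + of_nat x"
    by simp_all
  ultimately show ?case by simp
next
  case (Suc r)
  define w where "w = u - of_int (int (Suc r) - int x)"
  have w: "w \<noteq> 0" "w + 1 \<noteq> 0"
    using u[of "int (Suc r) - int x"] u[of "int r - int x"] by (auto simp: w_def algebra_simps)
  have e: "u - of_int (int r - int x + 1) = w" "u - of_int (int r - int x) = w + 1"
    "u - of_int (int (Suc r) - int x + 1) = w - 1" "u - of_int (int (Suc r) - int x) = w"
    by (auto simp: w_def algebra_simps)
  have "1 - 1 / w\<^sup>2 = (w - 1) * (w + 1) / (w * w)"
    using w by (simp add: field_simps power2_eq_square)
  moreover have "w / (w + 1) * ((w - 1) * (w + 1) / (w * w)) = (w - 1) / w"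
    using w by simp
  ultimately have step: "w / (w + 1) * (1 - 1 / w\<^sup>2) = (w - 1) / w" by simp
  have "(\<Prod>y\<in>{1..Suc r}. 1 - 1 / (u - of_int (int y - int x))\<^sup>2)
    = (\<Prod>y\<in>{1..r}. 1 - 1 / (u - of_int (int y - int x))\<^sup>2) * (1 - 1 / w\<^sup>2)"
    by (simp add: w_def)
  also have "\<dots> = (1 - 1 / w\<^sup>2) * (w / (w + 1) * ((u + of_nat x) / (u + of_nat x - 1)))"
    unfolding Suc.IH e by (simp only: mult.commute)
  also have "\<dots> = (w - 1) / w * ((u + of_nat x) / (u + of_nat x - 1))"
    unfolding step[symmetric] by (simp only: mult_ac)
  finally show ?case unfolding e .
qed

text \<open>The second factors (u + x) / (u + x - 1) of the rows telescope over x to (u + L) /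
  u.\<close>

lemma rowfrac_eq:
  fixes u :: "'k::field"
  assumes u: "\<And>z. u \<noteq> of_int z"
  shows "u * (\<Prod>x\<in>{1..L}. \<Prod>y\<in>{1..r x}. 1 - 1 / (u - of_int (int y - int x))\<^sup>2) = rowfrac L r u"
proof -
  have *: "u * (\<Prod>x\<in>{1..L}. (u + of_nat x) / (u + of_nat x - 1)) = u + of_nat L"
  proof (induction L)
    case (Suc L)
    have "u + of_nat L \<noteq> 0" using u[of "- int L"] by (auto simp: eq_neg_iff_add_eq_0)
    have "u * (\<Prod>x\<in>{1..Suc L}. (u + of_nat x) / (u + of_nat x - 1))
      = (u * (\<Prod>x\<in>{1..L}. (u + of_nat x) / (u + of_nat x - 1))) * ((u + of_nat (Suc L)) / (u + of_nat (Suc L) - 1))"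
      by simp
    also have "\<dots> = (u + of_nat L) * ((u + of_nat (Suc L)) / (u + of_nat L))"
      unfolding Suc by (simp add: algebra_simps)
    also have "\<dots> = u + of_nat (Suc L)" using \<open>u + of_nat L \<noteq> 0\<close> by simp
    finally show ?case .
  qed simp
  have "u * (\<Prod>x\<in>{1..L}. \<Prod>y\<in>{1..r x}. 1 - 1 / (u - of_int (int y - int x))\<^sup>2)
    = (u * (\<Prod>x\<in>{1..L}. (u + of_nat x) / (u + of_nat x - 1)))
      * (\<Prod>x\<in>{1..L}. (u - of_int (bet r x + 1)) / (u - of_int (bet r x)))"
    by (simp only: row_telescope[OF u] prod.distrib bet_def mult_ac)
  then show ?thesis unfolding * rowfrac_def .
qed

lemma prod_position:
  assumes D: "lower D" and L: "\<And>x. L < x \<Longrightarrow> rowlen D q x = 0"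
  shows "(\<Prod>\<theta>\<in>{\<theta>\<in>D. position \<theta> = q}. f \<theta>) = (\<Prod>x\<in>{1..L}. \<Prod>y\<in>{1..rowlen D q x}. f ((x, y), q))"
proof -
  have "(\<Prod>x\<in>{1..L}. \<Prod>y\<in>{1..rowlen D q x}. f ((x, y), q))
      = (\<Prod>(x, y)\<in>(SIGMA x:{1..L}. {1..rowlen D q x}). f ((x, y), q))"
    by (simp add: prod.Sigma)
  also have "\<dots> = (\<Prod>\<theta>\<in>{\<theta>\<in>D. position \<theta> = q}. f \<theta>)"
  proof (rule prod.reindex_bij_witness[of _ "fst" "\<lambda>t. (t, q)"])
    fix \<theta> assume "\<theta> \<in> {\<theta> \<in> D. position \<theta> = q}"
    moreover obtain x y p where \<theta>: "\<theta> = ((x, y), p)" by (metis prod.collapse)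
    ultimately have "((x, y), q) \<in> D" "p = q" by (auto simp: position_def)
    then have *: "1 \<le> x \<and> 1 \<le> y \<and> y \<le> rowlen D q x" "p = q" using mem_lower_iff[OF D] by auto
    then have "x \<le> L" using L[of x] by (cases "L < x") auto
    then show "fst \<theta> \<in> (SIGMA x:{1..L}. {1..rowlen D q x})" "(fst \<theta>, q) = \<theta>"
      using * \<theta> by auto
  next
    fix a assume "a \<in> (SIGMA x:{1..L}. {1..rowlen D q x})"
    then show "(a, q) \<in> {\<theta> \<in> D. position \<theta> = q}"
      by (cases a) (auto simp: mem_lower_iff[OF D] position_def)
  qed auto
  finally show ?thesis by simp
qed

lemma prod_resolvent:
  fixes u :: "'k::field"
  assumes D: "lower D" and L: "\<And>x. L < x \<Longrightarrow> rowlen D q x = 0" and u: "\<And>z. u \<noteq> of_int z"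
  shows "u * (\<Prod>\<theta>\<in>{\<theta>\<in>D. position \<theta> = q}. 1 - 1 / (u - of_int (Defs.content \<theta>))\<^sup>2) = rowfrac L (rowlen D q) u"
proof -
  have "(\<Prod>\<theta>\<in>{\<theta>\<in>D. position \<theta> = q}. 1 - 1 / (u - of_int (Defs.content \<theta>))\<^sup>2)
     = (\<Prod>x\<in>{1..L}. \<Prod>y\<in>{1..rowlen D q x}. 1 - 1 / (u - of_int (int y - int x))\<^sup>2)"
    by (subst prod_position[OF D L]) (auto simp: Defs.content_def)
  then show ?thesis using rowfrac_eq[OF u] by simp
qed

text \<open>The zeros of \<open>rowfrac\<close> before cancellation.\<close>

definition shifted :: "nat \<Rightarrow> (nat \<Rightarrow> nat) \<Rightarrow> int set" where
  "shifted L r = insert (- int L) ((\<lambda>x. bet r x + 1) ` {1..L})"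

text \<open>\<open>bet r\<close> is strictly decreasing, so all zeros and poles are simple and the
  common ones cancel as sets. The quotient is stated cross-multiplied, ready for a comparison of
  polynomials.\<close>

lemma rowfrac_reduced:
  fixes u :: "'k::field"
  assumes anti: "\<And>a b. 1 \<le> a \<Longrightarrow> a \<le> b \<Longrightarrow> r b \<le> r a"
    and u: "\<And>z. u \<noteq> of_int z"
  shows "rowfrac L r u * (\<Prod>z\<in>bet r ` {1..L} - shifted L r. u - of_int z)
    = (\<Prod>z\<in>shifted L r - bet r ` {1..L}. u - of_int z)"
proof -
  let ?R = "bet r ` {1..L}" and ?P = "shifted L r"
  have dec: "bet r b < bet r a" if "1 \<le> a" "a < b" for a b
    using anti[of a b] that by (simp add: bet_def)
  have inj: "inj_on (bet r) {1..L}"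
    by (rule inj_onI) (metis atLeastAtMost_iff dec less_irrefl linorder_neqE_nat)
  have nin: "- int L \<notin> (\<lambda>x. bet r x + 1) ` {1..L}"
    by (auto simp: bet_def)
  have inj': "inj_on (\<lambda>x. bet r x + 1) {1..L}"
  proof (rule inj_onI)
    fix x y assume "x \<in> {1..L}" "y \<in> {1..L}" "bet r x + 1 = bet r y + 1"
    then show "x = y" using inj_onD[OF inj, of x y] by linarith
  qed
  have P: "(\<Prod>z\<in>?P. u - of_int z) = (u + of_nat L) * (\<Prod>x\<in>{1..L}. u - of_int (bet r x + 1))"
  proof -
    have "(\<Prod>z\<in>?P. u - of_int z) = (u - of_int (- int L)) * (\<Prod>z\<in>(\<lambda>x. bet r x + 1) ` {1..L}. u - of_int z)"
      unfolding shifted_def by (rule prod.insert[OF _ nin]) simp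
    then show ?thesis by (simp only: prod.reindex[OF inj'] o_def of_int_minus of_int_of_nat_eq diff_minus_eq_add)
  qed
  have R: "(\<Prod>z\<in>?R. u - of_int z) = (\<Prod>x\<in>{1..L}. u - of_int (bet r x))"
    by (simp only: prod.reindex[OF inj] o_def)
  have nz: "(\<Prod>z\<in>A. u - of_int z) \<noteq> 0" for A
    by (cases "finite A") (auto simp: prod_zero_iff u)
  have fin: "finite ?P" "finite ?R" by (auto simp: shifted_def)
  have "rowfrac L r u = (\<Prod>z\<in>?P. u - of_int z) / (\<Prod>z\<in>?R. u - of_int z)"
    by (simp only: rowfrac_def P R prod_dividef times_divide_eq_right)
  moreover have "(\<Prod>z\<in>?P. u - of_int z) = (\<Prod>z\<in>?P - ?R. u - of_int z) * (\<Prod>z\<in>?P \<inter> ?R. u - of_int z)"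
    using prod.Int_Diff[OF fin(1), of "\<lambda>z. u - of_int z" ?R] by (simp add: mult.commute)
  moreover have "(\<Prod>z\<in>?R. u - of_int z) = (\<Prod>z\<in>?R - ?P. u - of_int z) * (\<Prod>z\<in>?P \<inter> ?R. u - of_int z)"
    using prod.Int_Diff[OF fin(2), of "\<lambda>z. u - of_int z" ?P] by (simp add: mult.commute Int_commute)
  ultimately have "rowfrac L r u = (\<Prod>z\<in>?P - ?R. u - of_int z) / (\<Prod>z\<in>?R - ?P. u - of_int z)"
    using nz by (simp del: of_int_diff)
  then show ?thesis using nz by (simp del: One_nat_def)
qed

text \<open>The zero of row x cancels against the pole of row x - 1 exactly when the two rows have
  equal length; a surviving zero therefore marks a row that is shorter than its predecessor.\<close>

lemma addable_zero:
  assumes D: "lower D" and L: "\<And>x. L < x \<Longrightarrow> rowlen D q x = 0"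
    and b: "b \<in> shifted L (rowlen D q) - bet (rowlen D q) ` {1..L}"
  shows "\<exists>\<theta>. addable D \<theta> \<and> position \<theta> = q \<and> Defs.content \<theta> = b"
proof -
  let ?r = "rowlen D q"
  \<comment> \<open>The extra zero -L belongs to the empty row x = L + 1.\<close>
  obtain x where x: "1 \<le> x" "x \<le> Suc L" "b = bet ?r x + 1"
    using b L[of "Suc L"] by (auto simp: shifted_def bet_def intro: that[of "Suc L"])
  have y: "Suc (?r x) \<le> ?r a" if "1 \<le> a" "a < x" for a
  proof -
    have le: "?r x \<le> ?r (x - 1)" "?r (x - 1) \<le> ?r a"
      using that x row_antimono[OF D, of "x - 1" x q] row_antimono[OF D, of a "x - 1" q] by auto
    have "x - 1 \<in> {1..L}" using that x by auto
    then have "b \<noteq> bet ?r (x - 1)" using b by auto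
    then have "?r x \<noteq> ?r (x - 1)" using x that by (auto simp: bet_def)
    then show ?thesis using le by simp
  qed
  have "lower (insert ((x, Suc (?r x)), q) D)"
    unfolding lower_def
  proof (intro conjI allI impI)
    show "finite (insert ((x, Suc (?r x)), q) D)" using D by (simp add: lower_finite)
    fix a c p assume m: "((a, c), p) \<in> insert ((x, Suc (?r x)), q) D"
    then show "1 \<le> a" "1 \<le> c" using x(1) lower_pos[OF D, of a c p] by auto
    fix a' c' assume a': "1 \<le> a' \<and> a' \<le> a \<and> 1 \<le> c' \<and> c' \<le> c"
    show "((a', c'), p) \<in> insert ((x, Suc (?r x)), q) D"
    proof (cases "((a, c), p) \<in> D")
      case True
      then show ?thesis using lowerD[OF D True, of a' c'] a' by simp
    next
      case False
      then have e: "a = x" "c = Suc (?r x)" "p = q" using m by simp_all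
      show ?thesis
      proof (cases "a' < x")
        case True
        then have "c' \<le> ?r a'" using y[of a'] a' e by linarith
        then show ?thesis using a' e by (simp add: mem_lower_iff[OF D])
      next
        case False
        then have "a' = x" "c' \<le> ?r x \<or> c' = Suc (?r x)" using a' e by auto
        then show ?thesis using a' e by (auto simp: mem_lower_iff[OF D])
      qed
    qed
  qed
  moreover have "((x, Suc (?r x)), q) \<notin> D" by (simp add: mem_lower_iff[OF D])
  ultimately have "addable D ((x, Suc (?r x)), q)" using D by (simp add: addable_def)
  then show ?thesis using x by (intro exI[of _ "((x, Suc (?r x)), q)"]) (auto simp: position_def Defs.content_def bet_def)
qed

section \<open>The hook product along a path\<close>

text \<open>Arm plus leg plus 1; the corner is counted in the second term, at a = x.\<close>

definition hk :: "nat \<Rightarrow> (nat \<Rightarrow> nat) \<Rightarrow> nat \<Rightarrow> nat \<Rightarrow> nat" where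
  "hk L r x y = (r x - y) + card {a\<in>{x..L}. y \<le> r a}"

text \<open>Frobenius' partition of an interval: the hook lengths of row x and its distances to the
  later rows are all different and together exhaust 1..r x + L - x.\<close>

lemma hook_row:
  assumes anti: "\<And>a b. 1 \<le> a \<Longrightarrow> a \<le> b \<Longrightarrow> r b \<le> r a" and x: "1 \<le> x" "x \<le> L"
  shows "(\<Prod>y\<in>{1..r x}. hk L r x y) * (\<Prod>b\<in>{x<..L}. nat (bet r x - bet r b)) = fact (r x + L - x)"
proof -
  define N where "N = r x + L - x"
  define d where "d b = nat (bet r x - bet r b)" for b
  let ?Y = "{1..r x}" and ?B = "{x<..L}"
  have rb: "r b \<le> r x" if "b \<in> ?B" for b using anti[of x b] that x by simp
  have d: "d b + r b + x = r x + b" if "b \<in> ?B" for b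
    using rb[OF that] that unfolding d_def bet_def by auto
  have hk_less: "hk L r x y' < hk L r x y" if "y < y'" "y' \<le> r x" for y y'
  proof -
    have "card {a\<in>{x..L}. y' \<le> r a} \<le> card {a\<in>{x..L}. y \<le> r a}"
      using that by (intro card_mono) auto
    then show ?thesis using that by (simp add: hk_def)
  qed
  have inj1: "inj_on (hk L r x) ?Y"
  proof (rule inj_onI)
    fix y y' assume "y \<in> ?Y" "y' \<in> ?Y" "hk L r x y = hk L r x y'"
    then show "y = y'" using hk_less[of y y'] hk_less[of y' y] by (cases y y' rule: linorder_cases) auto
  qed
  have inj2: "inj_on d ?B"
  proof (rule inj_onI)
    fix b b' assume b: "b \<in> ?B" "b' \<in> ?B" "d b = d b'"
    have e: "r b + b' = r b' + b" using d[OF b(1)] d[OF b(2)] b(3) by linarith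
    show "b = b'"
    proof (cases b b' rule: linorder_cases)
      case less
      then have "r b' \<le> r b" using anti[of b b'] b x by simp
      then show ?thesis using e less by linarith
    next
      case greater
      then have "r b \<le> r b'" using anti[of b' b] b x by simp
      then show ?thesis using e greater by linarith
    qed
  qed
  have ran1: "hk L r x y \<in> {1..N}" if y: "y \<in> ?Y" for y
  proof -
    have "x \<in> {a\<in>{x..L}. y \<le> r a}" using x y by simp
    then have "{a\<in>{x..L}. y \<le> r a} \<noteq> {}" by blast
    then have "0 < card {a\<in>{x..L}. y \<le> r a}" unfolding card_gt_0_iff by simp
    moreover have "card {a\<in>{x..L}. y \<le> r a} \<le> card {x..L}" by (intro card_mono) auto
    ultimately show ?thesis using x y unfolding hk_def N_def atLeastAtMost_iff card_atLeastAtMost by linarith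
  qed
  have ran2: "d b \<in> {1..N}" if "b \<in> ?B" for b
    using d[OF that] rb[OF that] that x by (auto simp: N_def)
  \<comment> \<open>If y \<le> r b, the leg below y reaches row b and the hook exceeds
    \<open>d b\<close>; otherwise the leg stops above row b and the hook is smaller than
    \<open>d b\<close>.\<close>
  have disj: "hk L r x y \<noteq> d b" if y: "y \<in> ?Y" and b: "b \<in> ?B" for y b
  proof (cases "y \<le> r b")
    case True
    have "y \<le> r a" if "x \<le> a" "a \<le> b" for a
      using anti[of a b] that x True by simp
    then have "{x..b} \<subseteq> {a\<in>{x..L}. y \<le> r a}" using b by auto
    then have "card {x..b} \<le> card {a\<in>{x..L}. y \<le> r a}" by (intro card_mono) auto
    then have "r x - y + (Suc b - x) \<le> hk L r x y" by (simp add: hk_def)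
    then show ?thesis using d[OF b] rb[OF b] True b y by auto
  next
    case False
    have "\<not> y \<le> r a" if "b \<le> a" for a
      using anti[of b a] that x False b by simp
    then have "{a\<in>{x..L}. y \<le> r a} \<subseteq> {x..<b}" by (auto simp: not_le[symmetric])
    then have "card {a\<in>{x..L}. y \<le> r a} \<le> card {x..<b}" by (intro card_mono) auto
    then have "hk L r x y \<le> r x - y + (b - x)" by (simp add: hk_def)
    then show ?thesis using d[OF b] rb[OF b] False b y by auto
  qed
  \<comment> \<open>There are r x hooks and L - x distances, as many as the interval has
    elements.\<close>
  have "hk L r x ` ?Y \<union> d ` ?B = {1..N}"
  proof (rule card_subset_eq)
    show "hk L r x ` ?Y \<union> d ` ?B \<subseteq> {1..N}" using ran1 ran2 by blast
    have "card (hk L r x ` ?Y \<union> d ` ?B) = card (hk L r x ` ?Y) + card (d ` ?B)"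
      using disj by (intro card_Un_disjoint) blast+
    also have "\<dots> = N"
      by (simp only: card_image[OF inj1] card_image[OF inj2]) (use x in \<open>simp add: N_def\<close>)
    finally show "card (hk L r x ` ?Y \<union> d ` ?B) = card {1..N}" by simp
  qed simp
  then have "fact N = \<Prod>(hk L r x ` ?Y \<union> d ` ?B)" by (simp only: fact_prod of_nat_id id_def)
  also have "\<dots> = \<Prod>(hk L r x ` ?Y) * \<Prod>(d ` ?B)"
    using disj by (intro prod.union_disjoint) blast+
  also have "\<dots> = (\<Prod>y\<in>?Y. hk L r x y) * (\<Prod>b\<in>?B. d b)"
    by (simp only: prod.reindex[OF inj1] prod.reindex[OF inj2] o_def)
  finally show ?thesis by (simp add: d_def N_def)
qed

text \<open>Frobenius' formula for the hook product in terms of the beta-numbers r x + L - x: their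
  factorials over the product of their differences.\<close>

definition Hnum :: "nat \<Rightarrow> (nat \<Rightarrow> nat) \<Rightarrow> 'k::field_char_0" where
  "Hnum L r = (\<Prod>x\<in>{1..L}. fact (r x + L - x)) /
     (\<Prod>x\<in>{1..L}. \<Prod>b\<in>{x<..L}. of_int (bet r x - bet r b))"

lemma bet_less:
  assumes "\<And>a b. 1 \<le> a \<Longrightarrow> a \<le> b \<Longrightarrow> r b \<le> r a" "1 \<le> a" "a < b"
  shows "bet r b < bet r a"
  using assms(1)[OF assms(2), of b] assms(3) unfolding bet_def by simp

lemma prod_hk:
  assumes anti: "\<And>a b. 1 \<le> a \<Longrightarrow> a \<le> b \<Longrightarrow> r b \<le> r a"
  shows "(\<Prod>x\<in>{1..L}. \<Prod>y\<in>{1..r x}. of_nat (hk L r x y)) = (Hnum L r :: 'k::field_char_0)"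
proof -
  have "(\<Prod>y\<in>{1..r x}. of_nat (hk L r x y))
      = (fact (r x + L - x) :: 'k) / (\<Prod>b\<in>{x<..L}. of_int (bet r x - bet r b))"
    if x: "x \<in> {1..L}" for x
  proof -
    have pos: "0 < bet r x - bet r b" if "b \<in> {x<..L}" for b
      using bet_less[of r x b, OF anti] that x by simp
    have "(fact (r x + L - x) :: 'k) = of_nat (fact (r x + L - x))" by simp
    also have "\<dots> = (\<Prod>y\<in>{1..r x}. of_nat (hk L r x y)) * (\<Prod>b\<in>{x<..L}. of_nat (nat (bet r x - bet r b)))"
      using hook_row[of r x L, OF anti] x by (simp flip: of_nat_prod of_nat_mult)
    also have "(\<Prod>b\<in>{x<..L}. of_nat (nat (bet r x - bet r b))) = (\<Prod>b\<in>{x<..L}. of_int (bet r x - bet r b) :: 'k)"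
      using pos by (intro prod.cong refl) (simp add: less_imp_le flip: of_int_diff)
    finally have "(fact (r x + L - x) :: 'k) = (\<Prod>y\<in>{1..r x}. of_nat (hk L r x y)) * (\<Prod>b\<in>{x<..L}. of_int (bet r x - bet r b))" .
    moreover have "(\<Prod>b\<in>{x<..L}. of_int (bet r x - bet r b) :: 'k) \<noteq> 0"
      unfolding prod_zero_iff[OF finite_greaterThanAtMost] of_int_eq_0_iff using pos by force
    ultimately show ?thesis by (simp only: nonzero_mult_div_cancel_right not_False_eq_True)
  qed
  then have "(\<Prod>x\<in>{1..L}. \<Prod>y\<in>{1..r x}. of_nat (hk L r x y))
    = (\<Prod>x\<in>{1..L}. (fact (r x + L - x) :: 'k) / (\<Prod>b\<in>{x<..L}. of_int (bet r x - bet r b)))"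
    by (intro prod.cong refl)
  then show ?thesis by (simp only: Hnum_def prod_dividef)
qed

text \<open>The cofactor of u - (\<open>bet r x\<close> + 1) in \<open>rowfrac\<close>. Its value at
  that zero is the factor by which the hook product grows when row x gets one more node.\<close>

definition rowrest :: "nat \<Rightarrow> (nat \<Rightarrow> nat) \<Rightarrow> nat \<Rightarrow> 'k::field \<Rightarrow> 'k" where
  "rowrest L r x u = (u + of_nat L) *
     (\<Prod>a\<in>{1..L} - {x}. (u - of_int (bet r a + 1)) / (u - of_int (bet r a))) / (u - of_int (bet r x))"

lemma rowfrac_rest:
  "x \<in> {1..L} \<Longrightarrow> rowfrac L r u = (u - of_int (bet r x + 1)) * rowrest L r x u"
  unfolding rowfrac_def rowrest_def by (subst prod.remove[of _ x]) (auto simp del: One_nat_def of_int_add)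

text \<open>Isolates the pairs that involve row x and keeps the order inside each pair.\<close>

lemma vandermonde_split:
  fixes d :: "nat \<Rightarrow> nat \<Rightarrow> 'k::field"
  assumes x: "x \<in> {1..L}"
  shows "(\<Prod>a\<in>{1..L}. \<Prod>b\<in>{a<..L}. d a b) =
    (\<Prod>a\<in>{1..L} - {x}. \<Prod>b\<in>{a<..L} - {x}. d a b) *
    (\<Prod>a\<in>{1..L} - {x}. if a < x then d a x else d x a)"
proof -
  have 1: "(\<Prod>b\<in>{a<..L}. d a b) = (\<Prod>b\<in>{a<..L} - {x}. d a b) * (if a < x then d a x else 1)" for a
    using x prod.remove[of "{a<..L}" x "d a"] by (auto simp: mult.commute)
  have "(\<Prod>a\<in>{1..L}. \<Prod>b\<in>{a<..L}. d a b) = (\<Prod>b\<in>{x<..L}. d x b) * (\<Prod>a\<in>{1..L} - {x}. \<Prod>b\<in>{a<..L}. d a b)"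
    using x by (intro prod.remove) auto
  also have "(\<Prod>b\<in>{x<..L}. d x b) = (\<Prod>a\<in>{1..L} - {x}. if a < x then 1 else d x a)"
    using x by (intro prod.mono_neutral_cong_left) auto
  also have "(\<Prod>a\<in>{1..L} - {x}. \<Prod>b\<in>{a<..L}. d a b)
      = (\<Prod>a\<in>{1..L} - {x}. \<Prod>b\<in>{a<..L} - {x}. d a b) * (\<Prod>a\<in>{1..L} - {x}. if a < x then d a x else 1)"
    unfolding 1 by (rule prod.distrib)
  finally have "(\<Prod>a\<in>{1..L}. \<Prod>b\<in>{a<..L}. d a b) = (\<Prod>a\<in>{1..L} - {x}. \<Prod>b\<in>{a<..L} - {x}. d a b) *
     ((\<Prod>a\<in>{1..L} - {x}. if a < x then d a x else 1) * (\<Prod>a\<in>{1..L} - {x}. if a < x then 1 else d x a))"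
    by (simp only: mult_ac)
  also have "(\<Prod>a\<in>{1..L} - {x}. if a < x then d a x else 1) * (\<Prod>a\<in>{1..L} - {x}. if a < x then 1 else d x a)
     = (\<Prod>a\<in>{1..L} - {x}. if a < x then d a x else d x a)"
    unfolding prod.distrib[symmetric] by (intro prod.cong) auto
  finally show ?thesis .
qed

text \<open>Only the beta-number of row x changes, by 1. Its factorial contributes c + L, where c is
  the content of the new node, and the differences that involve row x contribute the remaining
  quotients.\<close>

lemma Hnum_step:
  fixes r :: "nat \<Rightarrow> nat"
  assumes anti: "\<And>a b. 1 \<le> a \<Longrightarrow> a \<le> b \<Longrightarrow> r b \<le> r a"
    and anti': "\<And>a b. 1 \<le> a \<Longrightarrow> a \<le> b \<Longrightarrow> (r(x := Suc (r x))) b \<le> (r(x := Suc (r x))) a"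
    and x: "x \<in> {1..L}"
  shows "Hnum L (r(x := Suc (r x))) = (Hnum L r * rowrest L r x (of_int (bet r x + 1)) :: 'k::field_char_0)"
proof -
  let ?r = "r(x := Suc (r x))"
  define c :: int where "c = bet r x + 1"
  define K where "K = {1..L} - {x}"
  have bx: "bet ?r x = c" "bet r x = c - 1" by (auto simp: c_def bet_def)
  have bne: "bet ?r a = bet r a" if "a \<noteq> x" for a using that by (simp add: bet_def)
  \<comment> \<open>Strict decrease of the row data after and before the addition keeps c and c - 1,
    respectively, away from the other rows.\<close>
  have nz: "c - bet r a \<noteq> 0" "c - 1 - bet r a \<noteq> 0" if a: "a \<in> K" for a
  proof -
    have "a \<noteq> x" "1 \<le> a" using a by (auto simp: K_def)
    then have "bet ?r a \<noteq> bet ?r x" "bet r a \<noteq> bet r x"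
      using bet_less[of ?r a x, OF anti'] bet_less[of ?r x a, OF anti']
        bet_less[of r a x, OF anti] bet_less[of r x a, OF anti] x by (cases a x rule: linorder_cases, force+)+
    then show "c - bet r a \<noteq> 0" "c - 1 - bet r a \<noteq> 0" using bx bne[OF \<open>a \<noteq> x\<close>] by auto
  qed
  define F :: 'k where "F = (\<Prod>a\<in>K. fact (r a + L - a))"
  define C :: 'k where "C = (\<Prod>a\<in>K. \<Prod>b\<in>{a<..L} - {x}. of_int (bet r a - bet r b))"
  define V :: "int \<Rightarrow> 'k" where "V z = (\<Prod>a\<in>K. if a < x then of_int (bet r a - z) else of_int (z - bet r a))" for z
  have fact1: "(\<Prod>a\<in>{1..L}. fact (r a + L - a) :: 'k) = fact (r x + L - x) * F"
    using x unfolding F_def K_def by (intro prod.remove) auto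
  have "(\<Prod>a\<in>{1..L}. fact (?r a + L - a) :: 'k) = fact (?r x + L - x) * (\<Prod>a\<in>K. fact (?r a + L - a))"
    using x unfolding K_def by (intro prod.remove) auto
  also have "(\<Prod>a\<in>K. fact (?r a + L - a)) = F" unfolding F_def by (intro prod.cong) (auto simp: K_def)
  also have "fact (?r x + L - x) = (of_int c + of_nat L) * (fact (r x + L - x) :: 'k)"
  proof -
    have "?r x + L - x = Suc (r x + L - x)" using x by auto
    moreover have "(of_nat (Suc (r x + L - x)) :: 'k) = of_int c + of_nat L"
      using x by (simp add: c_def bet_def of_nat_diff)
    ultimately show ?thesis by (simp only: fact_Suc)
  qed
  finally have fact2: "(\<Prod>a\<in>{1..L}. fact (?r a + L - a)) = (of_int c + of_nat L) * (fact (r x + L - x) :: 'k) * F" .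
  have van1: "(\<Prod>a\<in>{1..L}. \<Prod>b\<in>{a<..L}. of_int (bet r a - bet r b)) = C * V (c - 1)"
    unfolding vandermonde_split[OF x] C_def V_def K_def bx ..
  have van2: "(\<Prod>a\<in>{1..L}. \<Prod>b\<in>{a<..L}. of_int (bet ?r a - bet ?r b)) = C * V c"
    unfolding vandermonde_split[OF x] C_def V_def K_def bx
    by (intro arg_cong2[of _ _ _ _ "(*)"] prod.cong refl) (auto simp: bne)
  have fin: "finite K" by (simp add: K_def)
  have Vz: "V z \<noteq> 0" if "\<And>a. a \<in> K \<Longrightarrow> z \<noteq> bet r a" for z
    unfolding V_def prod_zero_iff[OF fin] using that by (auto simp flip: of_int_diff split: if_splits)
  have Vz: "V c \<noteq> 0" "V (c - 1) \<noteq> 0"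
    by (rule Vz, use nz in force)+
  have "V (c - 1) / V c = (\<Prod>a\<in>K. (of_int c - of_int (bet r a + 1)) / (of_int c - of_int (bet r a)))"
    unfolding V_def prod_dividef[symmetric]
  proof (intro prod.cong refl)
    fix a assume "a \<in> K"
    \<comment> \<open>Reversing the difference in numerator and denominator does not change the
      quotient, so rows above and below x contribute alike.\<close>
    have "of_int (bet r a - (c - 1)) / of_int (bet r a - c) = (of_int (c - 1 - bet r a) / of_int (c - bet r a) :: 'k)"
      by (metis minus_diff_eq minus_divide_divide of_int_minus)
    then show "(if a < x then of_int (bet r a - (c - 1)) else of_int (c - 1 - bet r a)) /
         (if a < x then of_int (bet r a - c) else of_int (c - bet r a))
         = (of_int c - of_int (bet r a + 1)) / (of_int c - of_int (bet r a) :: 'k)"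
      by (simp add: algebra_simps)
  qed
  moreover have "rowrest L r x (of_int c) = (of_int c + of_nat L) *
      (\<Prod>a\<in>K. (of_int c - of_int (bet r a + 1)) / (of_int c - of_int (bet r a) :: 'k))"
    by (simp add: rowrest_def K_def bx)
  ultimately have rr: "rowrest L r x (of_int c) = (of_int c + of_nat L) * (V (c - 1) / V c)" by simp
  have "Hnum L ?r = (of_int c + of_nat L) * (fact (r x + L - x) :: 'k) * F / (C * V c)"
    unfolding Hnum_def fact2 van2 ..
  also have "\<dots> = fact (r x + L - x) * F / (C * V (c - 1)) * ((of_int c + of_nat L) * (V (c - 1) / V c))"
    using Vz by simp
  also have "\<dots> = Hnum L r * rowrest L r x (of_int c)"
    unfolding Hnum_def fact1 van1 rr ..
  finally show ?thesis by (simp add: c_def)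
qed

text \<open>A standard tableau as a growth sequence: \<nu> i is the node that receives i, and the
  shape after k steps is an image of \<nu>.\<close>

definition is_path :: "nat \<Rightarrow> (nat \<Rightarrow> mnode) \<Rightarrow> nat \<Rightarrow> bool" where
  "is_path m \<nu> k \<longleftrightarrow> (\<forall>i\<in>{1..k}. addable (\<nu> ` {1..<i}) (\<nu> i) \<and> position (\<nu> i) \<in> {1..m})"

lemma is_path_mono: "is_path m \<nu> k \<Longrightarrow> l \<le> k \<Longrightarrow> is_path m \<nu> l"
  by (auto simp: is_path_def)

lemma image_Suc: "\<nu> ` {1..Suc k} = insert (\<nu> (Suc k)) (\<nu> ` {1..k})"
  by (simp add: atLeastAtMostSuc_conv)

lemma is_path_Suc:
  "is_path m \<nu> (Suc k) \<longleftrightarrow> is_path m \<nu> k \<and> addable (\<nu> ` {1..k}) (\<nu> (Suc k)) \<and> position (\<nu> (Suc k)) \<in> {1..m}"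
  by (auto simp: is_path_def atLeastAtMostSuc_conv atLeastLessThanSuc_atLeastAtMost)

lemma lower_empty: "lower {}" by (simp add: lower_def)

lemma is_path_lower: "is_path m \<nu> k \<Longrightarrow> lower (\<nu> ` {1..k})"
  by (cases k) (auto simp only: lower_empty is_path_Suc image_Suc addable_def, simp add: lower_empty)

lemma is_path_inj: "is_path m \<nu> k \<Longrightarrow> inj_on \<nu> {1..k}"
proof (induction k)
  case (Suc k)
  then show ?case
    by (auto simp: is_path_Suc addable_def atLeastAtMostSuc_conv simp del: image_Suc_atLeastAtMost)
qed simp

lemma is_path_cong: "(\<And>i. i \<in> {1..k} \<Longrightarrow> \<nu> i = \<nu>' i) \<Longrightarrow> is_path m \<nu> k \<longleftrightarrow> is_path m \<nu>' k"
proof (induction k)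
  case (Suc k)
  have "\<nu> ` {1..k} = \<nu>' ` {1..k}" using Suc.prems by (intro image_cong) auto
  then show ?case using Suc by (simp add: is_path_Suc)
qed (simp add: is_path_def)

text \<open>Among the nodes addable to one diagram, those at the same position have different
  contents.\<close>

lemma is_path_unique:
  assumes "is_path m \<nu> k" "is_path m \<nu>' k"
    "\<And>i. i \<in> {1..k} \<Longrightarrow> position (\<nu> i) = position (\<nu>' i) \<and> Defs.content (\<nu> i) = Defs.content (\<nu>' i)"
  shows "i \<in> {1..k} \<Longrightarrow> \<nu> i = \<nu>' i"
  using assms
proof (induction k arbitrary: i)
  case (Suc k)
  have IH: "\<nu> j = \<nu>' j" if "j \<in> {1..k}" for j
    using Suc.IH[OF that] Suc.prems by (auto simp: is_path_Suc)
  then have e: "\<nu> ` {1..k} = \<nu>' ` {1..k}" by (intro image_cong) auto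
  have "\<nu> (Suc k) = \<nu>' (Suc k)"
    using addable_content[of "\<nu> ` {1..k}" "\<nu> (Suc k)" "\<nu>' (Suc k)"] Suc.prems e
    by (force simp: is_path_Suc)
  then show ?case using IH Suc.prems(1) by (cases "i = Suc k") auto
qed simp

text \<open>Each step multiplies the Frobenius product of one position by its \<open>rowrest\<close>
  value and leaves the other positions alone; the empty diagram gives 1.\<close>

lemma path_hook:
  assumes "is_path m \<nu> k" "\<And>p x. L < x \<Longrightarrow> rowlen (\<nu> ` {1..k}) p x = 0"
  shows "(\<Prod>i\<in>{1..k}. rowrest L (rowlen (\<nu> ` {1..<i}) (position (\<nu> i))) (fst (fst (\<nu> i))) (of_int (Defs.content (\<nu> i))))
    = (\<Prod>p\<in>{1..m}. Hnum L (rowlen (\<nu> ` {1..k}) p) :: 'k::field_char_0)"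
  using assms
proof (induction k)
  case 0
  have "Hnum L (rowlen {} p) = (1::'k)" for p
    using prod_hk[of "rowlen {} p" L, where 'k = 'k] by (simp add: rowlen_def)
  then show ?case by simp
next
  case (Suc k)
  define D where "D = \<nu> ` {1..k}"
  obtain x y q where \<theta>: "\<nu> (Suc k) = ((x, y), q)" by (metis prod.collapse)
  have add: "addable D ((x, y), q)" and q: "q \<in> {1..m}"
    using Suc.prems(1) \<theta> by (auto simp: is_path_Suc D_def position_def)
  have D': "\<nu> ` {1..Suc k} = insert ((x, y), q) D" using image_Suc[of \<nu> k] \<theta> by (simp add: D_def)
  note row = addable_row[OF add]
  have D: "lower D" "lower (insert ((x, y), q) D)" using add by (auto simp: addable_def)
  have L': "rowlen D p z = 0" if "L < z" for p z
    using Suc.prems(2)[OF that, of p] unfolding D' row(4) by (auto split: if_splits)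
  have "x \<le> L"
  proof (rule ccontr)
    assume "\<not> x \<le> L"
    then have "rowlen (\<nu> ` {1..Suc k}) q x = 0" using Suc.prems(2)[of x q] by simp
    then show False unfolding D' row(4) by simp
  qed
  then have x: "x \<in> {1..L}" using row(1) by simp
  have re: "rowlen (insert ((x, y), q) D) q = (rowlen D q)(x := Suc (rowlen D q x))"
    by (rule ext) (simp add: row(4))
  have rp: "rowlen (insert ((x, y), q) D) p = rowlen D p" if "p \<noteq> q" for p
    using that by (intro ext) (simp add: row(4))
  have c: "Defs.content ((x, y), q) = bet (rowlen D q) x + 1" using row(2) by (simp add: Defs.content_def bet_def)
  have step: "Hnum L (rowlen (insert ((x, y), q) D) q)
      = (Hnum L (rowlen D q) * rowrest L (rowlen D q) x (of_int (Defs.content ((x, y), q))) :: 'k)"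
    unfolding re c
    by (rule Hnum_step[OF _ _ x]) (use row_antimono[OF D(1)] row_antimono[OF D(2), of _ _ q] in \<open>simp_all add: re del: fun_upd_apply\<close>)
  have "(\<Prod>p\<in>{1..m}. Hnum L (rowlen (insert ((x, y), q) D) p) :: 'k)
    = Hnum L (rowlen (insert ((x, y), q) D) q) * (\<Prod>p\<in>{1..m} - {q}. Hnum L (rowlen (insert ((x, y), q) D) p))"
    using q by (intro prod.remove) auto
  also have "(\<Prod>p\<in>{1..m} - {q}. Hnum L (rowlen (insert ((x, y), q) D) p) :: 'k) = (\<Prod>p\<in>{1..m} - {q}. Hnum L (rowlen D p))"
    by (intro prod.cong) (auto simp: rp)
  also have "Hnum L (rowlen (insert ((x, y), q) D) q) * (\<Prod>p\<in>{1..m} - {q}. Hnum L (rowlen D p))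
     = (\<Prod>p\<in>{1..m}. Hnum L (rowlen D p)) * (rowrest L (rowlen D q) x (of_int (Defs.content ((x, y), q))) :: 'k)"
    unfolding step using q by (subst (2) prod.remove[of _ q]) (auto simp: mult_ac)
  finally have 1: "(\<Prod>p\<in>{1..m}. Hnum L (rowlen (\<nu> ` {1..Suc k}) p) :: 'k)
     = (\<Prod>p\<in>{1..m}. Hnum L (rowlen D p)) * rowrest L (rowlen D q) x (of_int (Defs.content ((x, y), q)))"
    unfolding D' .
  have 2: "(\<Prod>i\<in>{1..k}. rowrest L (rowlen (\<nu> ` {1..<i}) (position (\<nu> i))) (fst (fst (\<nu> i))) (of_int (Defs.content (\<nu> i))))
    = (\<Prod>p\<in>{1..m}. Hnum L (rowlen D p) :: 'k)"
    unfolding D_def by (rule Suc.IH) (use Suc.prems(1) L' in \<open>auto simp: is_path_Suc D_def\<close>)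
  show ?case
    unfolding 1 2[symmetric] by (simp add: \<theta> D_def position_def atLeastLessThanSuc_atLeastAtMost)
qed

section \<open>Standard tableaux as paths\<close>

lemma mem_mnodes:
  "((x, y), p) \<in> mnodes m \<Lambda> \<longleftrightarrow> p \<in> {1..m} \<and> (x, y) \<in> diagram (\<Lambda> p)"
  by (auto simp: mnodes_def)

lemma card_diagram: "finite (diagram l) \<and> card (diagram l) = sum_list l"
proof -
  have bij: "bij_betw (\<lambda>(i, y). (Suc i, y)) (SIGMA i:{..<length l}. {1..l ! i}) (diagram l)"
    by (rule bij_betw_byWitness[of _ "\<lambda>(x, y). (x - 1, y)"]) (auto simp: diagram_def)
  have "card (SIGMA i:{..<length l}. {1..l ! i}) = sum_list l"
    by (simp add: sum_list_sum_nth atLeast0LessThan)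
  then show ?thesis using bij_betw_same_card[OF bij] bij_betw_finite[OF bij] by simp
qed

lemma card_mnodes: "finite (mnodes m \<Lambda>) \<and> card (mnodes m \<Lambda>) = (\<Sum>p\<in>{1..m}. sum_list (\<Lambda> p))"
proof -
  have bij: "bij_betw (\<lambda>(p, \<theta>). (\<theta>, p)) (SIGMA p:{1..m}. diagram (\<Lambda> p)) (mnodes m \<Lambda>)"
    by (rule bij_betw_byWitness[of _ "\<lambda>(\<theta>, p). (p, \<theta>)"]) (auto simp: mnodes_def)
  have "card (SIGMA p:{1..m}. diagram (\<Lambda> p)) = (\<Sum>p\<in>{1..m}. sum_list (\<Lambda> p))"
    using card_diagram by (subst card_SigmaI) auto
  moreover have "finite (SIGMA p:{1..m}. diagram (\<Lambda> p))" using card_diagram by auto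
  ultimately show ?thesis using bij_betw_same_card[OF bij] bij_betw_finite[OF bij] by simp
qed

lemma partition_nth: "partition l \<Longrightarrow> i \<le> j \<Longrightarrow> j < length l \<Longrightarrow> l ! j \<le> l ! i"
  unfolding partition_def using sorted_wrt_nth_less[of "(\<ge>)" l i j] by (cases "i = j") auto

lemma lower_mnodes:
  assumes "\<Lambda> \<in> multipartitions m n" shows "lower (mnodes m \<Lambda>)"
  unfolding lower_def
proof (intro conjI allI impI)
  show "finite (mnodes m \<Lambda>)" using card_mnodes by blast
  fix x y p assume xy: "((x, y), p) \<in> mnodes m \<Lambda>"
  then show "1 \<le> x" "1 \<le> y" by (auto simp: mem_mnodes diagram_def)
  fix x' y' assume *: "1 \<le> x' \<and> x' \<le> x \<and> 1 \<le> y' \<and> y' \<le> y"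
  have p: "p \<in> {1..m}" "x \<le> length (\<Lambda> p)" "y \<le> \<Lambda> p ! (x - 1)" using xy by (auto simp: mem_mnodes diagram_def)
  have "partition (\<Lambda> p)" using assms p by (auto simp: multipartitions_def)
  then have "\<Lambda> p ! (x - 1) \<le> \<Lambda> p ! (x' - 1)" using * p by (intro partition_nth) auto
  then show "((x', y'), p) \<in> mnodes m \<Lambda>" using * p by (auto simp: mem_mnodes diagram_def)
qed

definition node_le :: "mnode \<Rightarrow> mnode \<Rightarrow> bool" where
  "node_le \<theta> \<theta>' \<longleftrightarrow> position \<theta> = position \<theta>' \<and> fst (fst \<theta>) \<le> fst (fst \<theta>') \<and> snd (fst \<theta>) \<le> snd (fst \<theta>')"

lemma node_le_simp [simp]: "node_le ((x, y), p) ((x', y'), p') \<longleftrightarrow> p = p' \<and> x \<le> x' \<and> y \<le> y'"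
  by (simp add: node_le_def position_def)

text \<open>Row and column growth combine through the corner (x', y), which lies in the
  diagram.\<close>

lemma std_mono:
  assumes L: "\<Lambda> \<in> multipartitions m n" and T: "T \<in> standard_tableaux m n \<Lambda>"
    and mem: "\<theta> \<in> mnodes m \<Lambda>" "\<theta>' \<in> mnodes m \<Lambda>" and le: "node_le \<theta> \<theta>'" "\<theta> \<noteq> \<theta>'"
  shows "T \<theta> < T \<theta>'"
proof -
  obtain x y p x' y' where \<theta>: "\<theta> = ((x, y), p)" "\<theta>' = ((x', y'), p)"
    using le(1) by (metis node_le_simp prod.collapse)
  have xy: "x \<le> x'" "y \<le> y'" using le \<theta> by auto
  have "1 \<le> x" "1 \<le> y" using lower_pos[OF lower_mnodes[OF L]] mem \<theta> by auto
  then have mid: "((x', y), p) \<in> mnodes m \<Lambda>"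
    using lowerD[OF lower_mnodes[OF L], of x' y' p x' y] mem \<theta> xy by simp
  have "T ((x, y), p) \<le> T ((x', y), p)"
    using T mem mid xy \<theta> by (cases "x = x'") (auto simp: standard_tableaux_def intro: less_imp_le)
  moreover have "T ((x', y), p) \<le> T ((x', y'), p)"
    using T mem mid xy \<theta> by (cases "y = y'") (auto simp: standard_tableaux_def intro: less_imp_le)
  moreover have "T \<theta> \<noteq> T \<theta>'"
    using T mem le(2) by (auto simp: standard_tableaux_def bij_betw_def inj_on_def)
  ultimately show ?thesis using \<theta> by simp
qed

lemma std_intro:
  assumes "T \<in> extensional (mnodes m \<Lambda>)" "bij_betw T (mnodes m \<Lambda>) {1..n}"
    "\<And>\<theta> \<theta>'. \<theta> \<in> mnodes m \<Lambda> \<Longrightarrow> \<theta>' \<in> mnodes m \<Lambda> \<Longrightarrow> node_le \<theta> \<theta>' \<Longrightarrow> \<theta> \<noteq> \<theta>' \<Longrightarrow> T \<theta> < T \<theta>'"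
  shows "T \<in> standard_tableaux m n \<Lambda>"
  unfolding standard_tableaux_def using assms by simp

context
  fixes m n :: nat and \<Lambda> T
  assumes \<Lambda>: "\<Lambda> \<in> multipartitions m n" and T: "T \<in> standard_tableaux m n \<Lambda>"
begin

lemma T_bij: "bij_betw T (mnodes m \<Lambda>) {1..n}"
  using T by (simp add: standard_tableaux_def)

lemma node_at_mem: "i \<in> {1..n} \<Longrightarrow> node_at m \<Lambda> T i \<in> mnodes m \<Lambda>"
  unfolding node_at_def using T_bij by (metis bij_betw_imp_surj_on inv_into_into)

lemma T_node_at: "i \<in> {1..n} \<Longrightarrow> T (node_at m \<Lambda> T i) = i"
  unfolding node_at_def using T_bij by (metis bij_betw_imp_surj_on f_inv_into_f)

lemma node_at_T: "\<theta> \<in> mnodes m \<Lambda> \<Longrightarrow> node_at m \<Lambda> T (T \<theta>) = \<theta>"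
  unfolding node_at_def using T_bij by (metis bij_betw_def inv_into_f_f)

lemma T_range: "\<theta> \<in> mnodes m \<Lambda> \<Longrightarrow> T \<theta> \<in> {1..n}"
  using T_bij by (auto simp: bij_betw_def)

lemma node_at_image:
  assumes i: "i \<le> Suc n"
  shows "node_at m \<Lambda> T ` {1..<i} = {\<theta>\<in>mnodes m \<Lambda>. T \<theta> < i}"
proof (intro subset_antisym subsetI)
  fix \<theta> assume "\<theta> \<in> {\<theta>\<in>mnodes m \<Lambda>. T \<theta> < i}"
  then have "\<theta> = node_at m \<Lambda> T (T \<theta>)" "T \<theta> \<in> {1..<i}" using node_at_T T_range by auto
  then show "\<theta> \<in> node_at m \<Lambda> T ` {1..<i}" by blast
qed (use i in \<open>auto simp: T_node_at node_at_mem\<close>)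

lemma node_at_image_all: "node_at m \<Lambda> T ` {1..n} = mnodes m \<Lambda>"
  using node_at_image[of "Suc n"] T_range by (auto simp: atLeastLessThanSuc_atLeastAtMost less_Suc_eq_le)

lemma lower_below: "lower {\<theta>\<in>mnodes m \<Lambda>. T \<theta> < i}"
  unfolding lower_def
proof (intro conjI allI impI)
  show "finite {\<theta>\<in>mnodes m \<Lambda>. T \<theta> < i}" using card_mnodes[of m \<Lambda>] by simp
  fix x y p assume xy: "((x, y), p) \<in> {\<theta>\<in>mnodes m \<Lambda>. T \<theta> < i}"
  then show "1 \<le> x" "1 \<le> y" using lower_pos[OF lower_mnodes[OF \<Lambda>], of x y p] by auto
  fix x' y' assume *: "1 \<le> x' \<and> x' \<le> x \<and> 1 \<le> y' \<and> y' \<le> y"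
  have mem: "((x', y'), p) \<in> mnodes m \<Lambda>"
    using lowerD[OF lower_mnodes[OF \<Lambda>], of x y p x' y'] xy * by simp
  have "T ((x', y'), p) \<le> T ((x, y), p)"
    using std_mono[OF \<Lambda> T mem, of "((x, y), p)"] xy * by (cases "(x', y') = (x, y)") auto
  then show "((x', y'), p) \<in> {\<theta>\<in>mnodes m \<Lambda>. T \<theta> < i}" using mem xy by simp
qed

lemma tableau_path: "is_path m (node_at m \<Lambda> T) n"
  unfolding is_path_def
proof
  fix i assume i: "i \<in> {1..n}"
  have e: "insert (node_at m \<Lambda> T i) (node_at m \<Lambda> T ` {1..<i}) = node_at m \<Lambda> T ` {1..<Suc i}"
    using i by (auto simp: atLeastLessThanSuc)
  have "addable (node_at m \<Lambda> T ` {1..<i}) (node_at m \<Lambda> T i)"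
    unfolding addable_def e using i node_at_image[of i] node_at_image[of "Suc i"] lower_below T_node_at[OF i] by auto
  moreover have "position (node_at m \<Lambda> T i) \<in> {1..m}"
    using node_at_mem[OF i] by (auto simp: mnodes_def position_def)
  ultimately show "addable (node_at m \<Lambda> T ` {1..<i}) (node_at m \<Lambda> T i) \<and> position (node_at m \<Lambda> T i) \<in> {1..m}" ..
qed

lemma node_at_inj: "inj_on (node_at m \<Lambda> T) {1..n}"
  by (rule inj_on_inverseI[of _ T]) (rule T_node_at)

text \<open>Comparable nodes with consecutive entries must be neighbours; incomparable ones differ
  in both coordinates, in opposite directions.\<close>

lemma consecutive_content:
  assumes i: "1 \<le> i" "i < n" and pos: "position (node_at m \<Lambda> T i) = position (node_at m \<Lambda> T (Suc i))"
  shows "if node_le (node_at m \<Lambda> T i) (node_at m \<Lambda> T (Suc i))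
    then \<bar>Defs.content (node_at m \<Lambda> T (Suc i)) - Defs.content (node_at m \<Lambda> T i)\<bar> = 1
    else \<bar>Defs.content (node_at m \<Lambda> T (Suc i)) - Defs.content (node_at m \<Lambda> T i)\<bar> \<ge> 2"
proof -
  obtain x y p x' y' where \<theta>: "node_at m \<Lambda> T i = ((x, y), p)" "node_at m \<Lambda> T (Suc i) = ((x', y'), p)"
    using pos by (metis position_def prod.collapse)
  have mem: "((x, y), p) \<in> mnodes m \<Lambda>" "((x', y'), p) \<in> mnodes m \<Lambda>"
    using node_at_mem[of i] node_at_mem[of "Suc i"] i \<theta> by auto
  have TT: "T ((x, y), p) = i" "T ((x', y'), p) = Suc i"
    using T_node_at[of i] T_node_at[of "Suc i"] i \<theta> by auto
  have ge: "1 \<le> x" "1 \<le> y" "1 \<le> x'" "1 \<le> y'" using lower_pos[OF lower_mnodes[OF \<Lambda>]] mem by auto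
  have ne: "(x, y) \<noteq> (x', y')" using TT by auto
  have nback: "\<not> (x' \<le> x \<and> y' \<le> y)"
    using std_mono[OF \<Lambda> T mem(2,1)] ne TT by auto
  \<comment> \<open>A further node of the rectangle would need an entry strictly between i and i +
    1.\<close>
  have between: "a = x \<and> b = y \<or> a = x' \<and> b = y'"
    if "x \<le> a" "a \<le> x'" "y \<le> b" "b \<le> y'" for a b
  proof (rule ccontr)
    assume c: "\<not> (a = x \<and> b = y \<or> a = x' \<and> b = y')"
    have m: "((a, b), p) \<in> mnodes m \<Lambda>"
      using lowerD[OF lower_mnodes[OF \<Lambda>] mem(2), of a b] that ge by simp
    have "T ((x, y), p) < T ((a, b), p)" "T ((a, b), p) < T ((x', y'), p)"
      using std_mono[OF \<Lambda> T mem(1) m] std_mono[OF \<Lambda> T m mem(2)] that c by auto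
    then show False using TT by simp
  qed
  show ?thesis
  proof (cases "x \<le> x' \<and> y \<le> y'")
    case True
    have "x' = x \<and> y' = Suc y \<or> x' = Suc x \<and> y' = y"
      using between[of x "Suc y"] between[of "Suc x" y] True ne by (cases "x = x'"; cases "y = y'") auto
    then show ?thesis using True \<theta> by (auto simp: Defs.content_def)
  next
    case False
    then show ?thesis using nback \<theta> by (auto simp: Defs.content_def)
  qed
qed

text \<open>Both paths coincide up to step i - 1, so their nodes at step i are addable to the same
  diagram; the contents would differ by exactly 1, which \<open>addable_content\<close>
  forbids.\<close>

lemma no_swapped_path:
  assumes i: "1 \<le> i" "i < n" and le: "node_le (node_at m \<Lambda> T i) (node_at m \<Lambda> T (Suc i))"
    and \<nu>: "is_path m \<nu> n"
    and sw: "\<And>k. k \<in> {1..n} \<Longrightarrow>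
      position (\<nu> k) = position (node_at m \<Lambda> T (Transposition.transpose i (Suc i) k)) \<and>
      Defs.content (\<nu> k) = Defs.content (node_at m \<Lambda> T (Transposition.transpose i (Suc i) k))"
  shows False
proof -
  let ?\<nu> = "node_at m \<Lambda> T"
  have eq: "\<nu> k = ?\<nu> k" if "k \<in> {1..i - 1}" for k
  proof (rule is_path_unique[OF _ _ _ that])
    show "is_path m \<nu> (i - 1)" "is_path m ?\<nu> (i - 1)"
      using is_path_mono[OF \<nu>] is_path_mono[OF tableau_path] i by auto
    show "position (\<nu> k) = position (?\<nu> k) \<and> Defs.content (\<nu> k) = Defs.content (?\<nu> k)" if "k \<in> {1..i - 1}" for k
      using sw[of k] that i by (auto simp: Transposition.transpose_def)
  qed
  have im: "\<nu> ` {1..<i} = ?\<nu> ` {1..<i}" by (intro image_cong eq) auto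
  have "addable (?\<nu> ` {1..<i}) (\<nu> i)" "addable (?\<nu> ` {1..<i}) (?\<nu> i)"
    using \<nu>[unfolded is_path_def, rule_format, of i] tableau_path[unfolded is_path_def, rule_format, of i] i im
    by auto
  then have *: "position (\<nu> i) = position (?\<nu> i) \<Longrightarrow> \<nu> i \<noteq> ?\<nu> i \<Longrightarrow> \<bar>Defs.content (\<nu> i) - Defs.content (?\<nu> i)\<bar> \<ge> 2"
    using addable_content by blast
  have pos: "position (?\<nu> i) = position (?\<nu> (Suc i))" using le by (simp add: node_le_def)
  have c: "\<bar>Defs.content (?\<nu> (Suc i)) - Defs.content (?\<nu> i)\<bar> = 1"
    using consecutive_content[OF i pos] le by simp
  show False using * sw[of i] i pos c by (cases "\<nu> i = ?\<nu> i") auto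
qed

text \<open>The swap changes the order of entries only for the pair i, i + 1, whose nodes are
  incomparable here.\<close>

lemma tableau_swap:
  assumes i: "1 \<le> i" "i < n" and nle: "\<not> node_le (node_at m \<Lambda> T i) (node_at m \<Lambda> T (Suc i))"
  defines "T' \<equiv> restrict (Transposition.transpose i (Suc i) \<circ> T) (mnodes m \<Lambda>)"
  shows "T' \<in> standard_tableaux m n \<Lambda>"
    and "k \<in> {1..n} \<Longrightarrow> node_at m \<Lambda> T' k = node_at m \<Lambda> T (Transposition.transpose i (Suc i) k)"
proof -
  let ?t = "Transposition.transpose i (Suc i)"
  have perm: "bij_betw ?t {1..n} {1..n}"
    using i by (intro bij_betw_byWitness[of _ ?t]) (auto simp: Transposition.transpose_def)
  have bij: "bij_betw T' (mnodes m \<Lambda>) {1..n}"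
    using bij_betw_trans[OF T_bij perm] bij_betw_cong[of "mnodes m \<Lambda>" T' "?t \<circ> T"] by (simp add: T'_def)
  show std: "T' \<in> standard_tableaux m n \<Lambda>"
  proof (rule std_intro[OF _ bij])
    show "T' \<in> extensional (mnodes m \<Lambda>)" by (simp add: T'_def)
    fix \<theta> \<theta>' assume mem: "\<theta> \<in> mnodes m \<Lambda>" "\<theta>' \<in> mnodes m \<Lambda>" and le: "node_le \<theta> \<theta>'" "\<theta> \<noteq> \<theta>'"
    have "T \<theta> < T \<theta>'" by (rule std_mono[OF \<Lambda> T mem le])
    moreover have "\<not> (T \<theta> = i \<and> T \<theta>' = Suc i)"
      using nle le node_at_T[OF mem(1)] node_at_T[OF mem(2)] by auto
    ultimately show "T' \<theta> < T' \<theta>'" using mem by (auto simp: T'_def Transposition.transpose_def)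
  qed
  assume k: "k \<in> {1..n}"
  then have tk: "?t k \<in> {1..n}" using i by (auto simp: Transposition.transpose_def)
  have "T' (node_at m \<Lambda> T (?t k)) = k"
    using node_at_mem[OF tk] T_node_at[OF tk] by (simp add: T'_def)
  then show "node_at m \<Lambda> T' k = node_at m \<Lambda> T (?t k)"
    using node_at_mem[OF tk] bij unfolding node_at_def by (metis bij_betw_def inv_into_f_f)
qed

end

text \<open>The partitions are read off the final diagram, with the number of rows counted in its
  first column; the entry of a node is the step at which it was added.\<close>

lemma path_tableau:
  assumes \<nu>: "is_path m \<nu> n"
  shows "\<exists>\<Lambda>\<in>multipartitions m n. \<exists>T\<in>standard_tableaux m n \<Lambda>. \<forall>i\<in>{1..n}. node_at m \<Lambda> T i = \<nu> i"
proof -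
  define D where "D = \<nu> ` {1..n}"
  have D: "lower D" unfolding D_def by (rule is_path_lower[OF \<nu>])
  have inj: "inj_on \<nu> {1..n}" by (rule is_path_inj[OF \<nu>])
  have pos: "p \<in> {1..m}" if "((x, y), p) \<in> D" for x y p
    using that \<nu> unfolding D_def is_path_def position_def by (metis imageE snd_conv)
  define len where "len p = card {x. ((x, 1), p) \<in> D}" for p
  have len: "((x, 1), p) \<in> D \<longleftrightarrow> 1 \<le> x \<and> x \<le> len p" for x p
  proof -
    have "{x. ((x, 1), p) \<in> D} = {1..len p}"
      unfolding len_def
    proof (rule initial_segment)
      show "finite {x. ((x, 1), p) \<in> D}"
        by (rule finite_subset[of _ "(\<lambda>t. fst (fst t)) ` D"]) (force, simp add: lower_finite[OF D])
    next
      fix a assume "a \<in> {x. ((x, 1), p) \<in> D}"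
      then show "1 \<le> a" using lower_pos[OF D] by simp
    next
      fix a b assume "a \<in> {x. ((x, 1), p) \<in> D}" "1 \<le> b" "b \<le> a"
      then show "b \<in> {x. ((x, 1), p) \<in> D}" using lowerD[OF D, of a 1 p b 1] by simp
    qed
    then show ?thesis by auto
  qed
  have lenrow: "x \<le> len p" if "1 \<le> x" "1 \<le> rowlen D p x" for x p
    using mem_lower_iff[OF D, of x 1 p] len[of x p] that by simp
  define \<Lambda> where "\<Lambda> = restrict (\<lambda>p. map (rowlen D p) [1..<Suc (len p)]) {1..m}"
  have diag: "(x, y) \<in> diagram (\<Lambda> p) \<longleftrightarrow> ((x, y), p) \<in> D" if p: "p \<in> {1..m}" for x y p
  proof -
    have "(x, y) \<in> diagram (\<Lambda> p) \<longleftrightarrow> 1 \<le> x \<and> x \<le> len p \<and> 1 \<le> y \<and> y \<le> rowlen D p x"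
      using p by (auto simp: diagram_def \<Lambda>_def simp del: upt_Suc)
    also have "\<dots> \<longleftrightarrow> ((x, y), p) \<in> D"
      using mem_lower_iff[OF D, of x y p] lenrow[of x p] by auto
    finally show ?thesis .
  qed
  have nodes: "mnodes m \<Lambda> = D"
  proof (rule Set.set_eqI, clarify)
    fix x y p
    show "((x, y), p) \<in> mnodes m \<Lambda> \<longleftrightarrow> ((x, y), p) \<in> D"
      using diag[of p x y] pos[of x y p] unfolding mem_mnodes by blast
  qed
  have "partition (\<Lambda> p)" if p: "p \<in> {1..m}" for p
    unfolding partition_def
  proof
    show "sorted_wrt (\<ge>) (\<Lambda> p)"
      using p row_antimono[OF D] by (auto simp: \<Lambda>_def sorted_wrt_iff_nth_less simp del: upt_Suc)
    have "1 \<le> rowlen D p x" if "1 \<le> x" "x \<le> len p" for x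
      using len[of x p] mem_lower_iff[OF D, of x 1 p] that by simp
    then show "0 \<notin> set (\<Lambda> p)" using p by (force simp: \<Lambda>_def simp del: upt_Suc)
  qed
  moreover have "(\<Sum>p\<in>{1..m}. sum_list (\<Lambda> p)) = n"
    using card_mnodes[of m \<Lambda>] card_image[OF inj] by (simp add: nodes D_def)
  ultimately have \<Lambda>: "\<Lambda> \<in> multipartitions m n" by (auto simp: multipartitions_def \<Lambda>_def)
  define T where "T = restrict (inv_into {1..n} \<nu>) D"
  have T\<nu>: "T (\<nu> i) = i" if "i \<in> {1..n}" for i using that inj by (simp add: T_def D_def)
  have \<nu>T: "\<nu> (T \<theta>) = \<theta>" "T \<theta> \<in> {1..n}" if "\<theta> \<in> D" for \<theta>
    using that by (auto simp: D_def T\<nu>)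
  have bij: "bij_betw T (mnodes m \<Lambda>) {1..n}"
    unfolding nodes by (rule bij_betw_byWitness[of _ \<nu>]) (use T\<nu> \<nu>T in \<open>auto simp: D_def\<close>)
  have T: "T \<in> standard_tableaux m n \<Lambda>"
  proof (rule std_intro[OF _ bij])
    show "T \<in> extensional (mnodes m \<Lambda>)" by (simp add: T_def nodes)
    fix \<theta> \<theta>' assume mem: "\<theta> \<in> mnodes m \<Lambda>" "\<theta>' \<in> mnodes m \<Lambda>" and le: "node_le \<theta> \<theta>'" "\<theta> \<noteq> \<theta>'"
    obtain x y p x' y' where \<theta>: "\<theta> = ((x, y), p)" "\<theta>' = ((x', y'), p)"
      using le(1) by (metis node_le_simp prod.collapse)
    have d: "\<theta> \<in> D" "\<theta>' \<in> D" using mem nodes by auto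
    have "T \<theta> \<noteq> T \<theta>'" using \<nu>T d le by metis
    \<comment> \<open>The diagram after step T \<theta>' contains \<theta>', hence also the smaller
      node \<theta>, which was therefore added no later.\<close>
    moreover have "\<not> T \<theta>' < T \<theta>"
    proof
      assume lt: "T \<theta>' < T \<theta>"
      have low: "lower (\<nu> ` {1..T \<theta>'})"
        by (rule is_path_lower[OF is_path_mono[OF \<nu>]]) (use \<nu>T d in auto)
      have "\<theta>' \<in> \<nu> ` {1..T \<theta>'}" using \<nu>T[OF d(2)] by (intro image_eqI[of _ _ "T \<theta>'"]) auto
      then have "\<theta> \<in> \<nu> ` {1..T \<theta>'}"
        using lowerD[OF low, of x' y' p x y] lower_pos[OF D, of x y p] le d \<theta> by simp
      then obtain j where "j \<in> {1..T \<theta>'}" "\<theta> = \<nu> j" by auto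
      then show False using lt T\<nu>[of j] \<nu>T[OF d(2)] by auto
    qed
    ultimately show "T \<theta> < T \<theta>'" by simp
  qed
  have "node_at m \<Lambda> T i = \<nu> i" if i: "i \<in> {1..n}" for i
    using node_at_T[OF \<Lambda> T, of "\<nu> i"] T\<nu>[OF i] i by (simp add: nodes D_def)
  then show ?thesis using \<Lambda> T by blast
qed

text \<open>Nodes are grouped by position, and each hook splits into the arm without its corner and
  the leg with it.\<close>

lemma F_hook_eq:
  assumes \<Lambda>: "\<Lambda> \<in> multipartitions m n" and L: "\<And>p x. L < x \<Longrightarrow> rowlen (mnodes m \<Lambda>) p x = 0"
  shows "F_hook m \<Lambda> = (\<Prod>p\<in>{1..m}. Hnum L (rowlen (mnodes m \<Lambda>) p))"
proof -
  let ?D = "mnodes m \<Lambda>"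
  have D: "lower ?D" by (rule lower_mnodes[OF \<Lambda>])
  have hook: "hook_length \<Lambda> ((x, y), p) = hk L (rowlen ?D p) x y" if mem: "((x, y), p) \<in> ?D" for x y p
  proof -
    let ?r = "rowlen ?D p"
    have p: "p \<in> {1..m}" using mem by (simp add: mem_mnodes)
    have diag: "(a, b) \<in> diagram (\<Lambda> p) \<longleftrightarrow> 1 \<le> a \<and> 1 \<le> b \<and> b \<le> ?r a" for a b
      using mem_lower_iff[OF D, of a b p] p by (simp add: mem_mnodes)
    have xy: "1 \<le> x" "1 \<le> y" "y \<le> ?r x" using mem_lower_iff[OF D, of x y p] mem by auto
    have le: "a \<le> L" if "1 \<le> ?r a" for a using L[of a p] that by (cases "L < a") auto
    have "{(x', y') \<in> diagram (\<Lambda> p). (x' = x \<and> y \<le> y') \<or> (y' = y \<and> x \<le> x')}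
        = Pair x ` {y<..?r x} \<union> (\<lambda>a. (a, y)) ` {a\<in>{x..L}. y \<le> ?r a}"
      using xy le by (auto simp: diag image_iff)
    moreover have "card (Pair x ` {y<..?r x} \<union> (\<lambda>a. (a, y)) ` {a\<in>{x..L}. y \<le> ?r a})
        = card (Pair x ` {y<..?r x}) + card ((\<lambda>a. (a, y)) ` {a\<in>{x..L}. y \<le> ?r a})"
      by (intro card_Un_disjoint) auto
    moreover have "card (Pair x ` {y<..?r x}) = ?r x - y" by (subst card_image) (auto simp: inj_on_def)
    moreover have "card ((\<lambda>a. (a, y)) ` {a\<in>{x..L}. y \<le> ?r a}) = card {a\<in>{x..L}. y \<le> ?r a}"
      by (subst card_image) (auto simp: inj_on_def)
    ultimately show ?thesis by (simp add: hk_def)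
  qed
  have "F_hook m \<Lambda> = (\<Prod>p\<in>{1..m}. \<Prod>\<theta>\<in>{\<theta>\<in>?D. position \<theta> = p}. of_nat (hook_length \<Lambda> \<theta>))"
    unfolding F_hook_def
    by (rule prod.group[symmetric, OF lower_finite[OF D]]) (auto simp: mnodes_def position_def)
  also have "\<dots> = (\<Prod>p\<in>{1..m}. Hnum L (rowlen ?D p))"
  proof (intro prod.cong refl)
    fix p
    have "(\<Prod>\<theta>\<in>{\<theta>\<in>?D. position \<theta> = p}. of_nat (hook_length \<Lambda> \<theta>) :: complex)
       = (\<Prod>x\<in>{1..L}. \<Prod>y\<in>{1..rowlen ?D p x}. of_nat (hook_length \<Lambda> ((x, y), p)))"
      by (rule prod_position[OF D]) (rule L)
    also have "\<dots> = (\<Prod>x\<in>{1..L}. \<Prod>y\<in>{1..rowlen ?D p x}. of_nat (hk L (rowlen ?D p) x y))"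
      using mem_lower_iff[OF D] by (intro prod.cong refl) (simp only: hook atLeastAtMost_iff simp_thms)
    also have "\<dots> = Hnum L (rowlen ?D p)" by (rule prod_hk) (rule row_antimono[OF D])
    finally show "(\<Prod>\<theta>\<in>{\<theta>\<in>?D. position \<theta> = p}. of_nat (hook_length \<Lambda> \<theta>) :: complex) = Hnum L (rowlen ?D p)" .
  qed
  finally show ?thesis .
qed

section \<open>Evaluation of rational functions\<close>

lemma poly_mapping_sum_single:
  "p = (\<Sum>e\<in>Poly_Mapping.keys p. Poly_Mapping.single e (Poly_Mapping.lookup p e))"
proof (rule poly_mapping_eqI)
  fix x
  have "Poly_Mapping.lookup (\<Sum>e\<in>A. Poly_Mapping.single e (Poly_Mapping.lookup p e)) x
      = (\<Sum>e\<in>A. if e = x then Poly_Mapping.lookup p e else 0)" for A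
    by (induction A rule: infinite_finite_induct) (auto simp: lookup_add lookup_single when_def)
  then show "Poly_Mapping.lookup p x =
      Poly_Mapping.lookup (\<Sum>e\<in>Poly_Mapping.keys p. Poly_Mapping.single e (Poly_Mapping.lookup p e)) x"
    by (simp add: sum.delta' in_keys_iff)
qed

lemma poly_const_0 [simp]: "poly_const 0 = 0" by (simp add: poly_const_def)
lemma poly_const_1 [simp]: "poly_const 1 = 1" by (simp add: poly_const_def)
lemma poly_const_add: "poly_const (a + b) = poly_const a + poly_const b"
  by (simp add: poly_const_def single_add)
lemma poly_const_mult: "poly_const (a * b) = poly_const a * poly_const b"
  by (simp add: poly_const_def mult_single)
lemma poly_const_eq_iff [simp]: "poly_const a = poly_const b \<longleftrightarrow> a = b"
  unfolding poly_const_def by (metis lookup_single_eq)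

text \<open>The monomial part of \<open>poly_subst\<close>, split off because it is multiplicative
  in the exponent. Different key sets are compared on a common superset, where exponent 0
  contributes 1.\<close>

definition mon_subst :: "(variable \<rightharpoonup> complex) \<Rightarrow> (variable \<Rightarrow>\<^sub>0 nat) \<Rightarrow> mpoly" where
  "mon_subst \<zeta> e = (\<Prod>x\<in>Poly_Mapping.keys e.
     (case \<zeta> x of None \<Rightarrow> poly_var x | Some c \<Rightarrow> poly_const c) ^ Poly_Mapping.lookup e x)"

lemma mon_subst_superset:
  assumes "finite A" "Poly_Mapping.keys e \<subseteq> A"
  shows "mon_subst \<zeta> e = (\<Prod>x\<in>A.
     (case \<zeta> x of None \<Rightarrow> poly_var x | Some c \<Rightarrow> poly_const c) ^ Poly_Mapping.lookup e x)"
  unfolding mon_subst_def using assms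
  by (intro prod.mono_neutral_left) (auto simp: in_keys_iff)

lemma mon_subst_add: "mon_subst \<zeta> (e + e') = mon_subst \<zeta> e * mon_subst \<zeta> e'"
proof -
  let ?A = "Poly_Mapping.keys e \<union> Poly_Mapping.keys e'"
  have "mon_subst \<zeta> (e + e') = (\<Prod>x\<in>?A.
     (case \<zeta> x of None \<Rightarrow> poly_var x | Some c \<Rightarrow> poly_const c) ^ Poly_Mapping.lookup (e + e') x)"
    by (rule mon_subst_superset) (auto dest: keys_add[THEN subsetD])
  also have "\<dots> = mon_subst \<zeta> e * mon_subst \<zeta> e'"
    by (simp only: mon_subst_superset[of ?A e] mon_subst_superset[of ?A e'] finite_Un finite_keys
        Un_upper1 Un_upper2 lookup_add power_add prod.distrib simp_thms)
  finally show ?thesis .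
qed

lemma poly_subst_superset:
  assumes "finite A" "Poly_Mapping.keys p \<subseteq> A"
  shows "poly_subst \<zeta> p = (\<Sum>e\<in>A. poly_const (Poly_Mapping.lookup p e) * mon_subst \<zeta> e)"
  unfolding poly_subst_def mon_subst_def[symmetric] using assms
  by (intro sum.mono_neutral_left) (auto simp: in_keys_iff)

lemma poly_subst_add: "poly_subst \<zeta> (p + q) = poly_subst \<zeta> p + poly_subst \<zeta> q"
proof -
  let ?A = "Poly_Mapping.keys p \<union> Poly_Mapping.keys q"
  have "poly_subst \<zeta> (p + q) = (\<Sum>e\<in>?A. poly_const (Poly_Mapping.lookup (p + q) e) * mon_subst \<zeta> e)"
    by (rule poly_subst_superset) (auto dest: keys_add[THEN subsetD])
  also have "\<dots> = poly_subst \<zeta> p + poly_subst \<zeta> q"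
    by (simp only: poly_subst_superset[of ?A p] poly_subst_superset[of ?A q] finite_Un finite_keys
        Un_upper1 Un_upper2 lookup_add poly_const_add distrib_right sum.distrib simp_thms)
  finally show ?thesis .
qed

lemma poly_subst_0 [simp]: "poly_subst \<zeta> 0 = 0"
  by (simp add: poly_subst_def)

lemma poly_subst_sum: "poly_subst \<zeta> (sum f A) = (\<Sum>x\<in>A. poly_subst \<zeta> (f x))"
  by (induction A rule: infinite_finite_induct) (auto simp: poly_subst_add)

lemma poly_subst_single: "poly_subst \<zeta> (Poly_Mapping.single e c) = poly_const c * mon_subst \<zeta> e"
  by (cases "c = 0") (simp_all add: poly_subst_def mon_subst_def)

lemma poly_subst_mult: "poly_subst \<zeta> (p * q) = poly_subst \<zeta> p * poly_subst \<zeta> q"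
proof -
  let ?l = "Poly_Mapping.lookup" and ?k = "Poly_Mapping.keys"
  have "p * q = (\<Sum>e\<in>?k p. Poly_Mapping.single e (?l p e)) * (\<Sum>e\<in>?k q. Poly_Mapping.single e (?l q e))"
    using poly_mapping_sum_single[of p] poly_mapping_sum_single[of q] by simp
  also have "\<dots> = (\<Sum>e\<in>?k p. \<Sum>e'\<in>?k q. Poly_Mapping.single (e + e') (?l p e * ?l q e'))"
    by (simp add: sum_product mult_single)
  finally have "poly_subst \<zeta> (p * q) = (\<Sum>e\<in>?k p. \<Sum>e'\<in>?k q.
      (poly_const (?l p e) * mon_subst \<zeta> e) * (poly_const (?l q e') * mon_subst \<zeta> e'))"
    by (simp add: poly_subst_sum poly_subst_single poly_const_mult mon_subst_add mult_ac)
  also have "\<dots> = poly_subst \<zeta> p * poly_subst \<zeta> q"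
    by (simp only: poly_subst_def mon_subst_def[symmetric] sum_product)
  finally show ?thesis .
qed

lemma poly_subst_const [simp]: "poly_subst \<zeta> (poly_const c) = poly_const c"
  by (simp add: poly_const_def poly_subst_single[unfolded poly_const_def] mon_subst_def mult_single)

lemma poly_subst_1 [simp]: "poly_subst \<zeta> 1 = 1"
  using poly_subst_const[of \<zeta> 1] by simp

lemma poly_subst_var: "poly_subst \<zeta> (poly_var x) = (case \<zeta> x of None \<Rightarrow> poly_var x | Some c \<Rightarrow> poly_const c)"
  by (simp add: poly_var_def poly_subst_single mon_subst_def split: option.split)

text \<open>A relational form of \<open>rat_eval\<close>, in which regularity and value propagate together.\<close>

definition evals :: "(variable \<rightharpoonup> complex) \<Rightarrow> ratfun \<Rightarrow> ratfun \<Rightarrow> bool" where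
  "evals \<zeta> r s \<longleftrightarrow> (\<exists>p q. r = Fract p q \<and> poly_subst \<zeta> q \<noteq> 0 \<and> s = Fract (poly_subst \<zeta> p) (poly_subst \<zeta> q))"

text \<open>Cross-multiplied equality of fractions survives the substitution, which is a ring
  homomorphism; this makes the \<open>THE\<close> in \<open>rat_eval\<close> meaningful.\<close>

lemma evals_unique: assumes "evals \<zeta> r s" "evals \<zeta> r s'" shows "s = s'"
proof -
  obtain p q p' q' where *: "r = Fract p q" "poly_subst \<zeta> q \<noteq> 0" "s = Fract (poly_subst \<zeta> p) (poly_subst \<zeta> q)"
    "r = Fract p' q'" "poly_subst \<zeta> q' \<noteq> 0" "s' = Fract (poly_subst \<zeta> p') (poly_subst \<zeta> q')"
    using assms unfolding evals_def by blast
  then have "q \<noteq> 0" "q' \<noteq> 0" by auto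
  then have "p * q' = p' * q" using * by (simp add: eq_fract)
  then have "poly_subst \<zeta> p * poly_subst \<zeta> q' = poly_subst \<zeta> p' * poly_subst \<zeta> q"
    by (metis poly_subst_mult)
  then show ?thesis using * by (simp add: eq_fract)
qed

lemma evalsD: assumes "evals \<zeta> r s" shows "rat_nonsingular \<zeta> r" "rat_eval \<zeta> r = s"
proof -
  show "rat_nonsingular \<zeta> r" using assms unfolding evals_def rat_nonsingular_def by blast
  have "rat_eval \<zeta> r = (THE s. evals \<zeta> r s)" unfolding rat_eval_def evals_def ..
  also have "\<dots> = s" using assms by (blast intro: the_equality evals_unique)
  finally show "rat_eval \<zeta> r = s" .
qed

lemma evals_const: "evals \<zeta> (rat_const c) (rat_const c)"
  unfolding evals_def rat_const_def by (intro exI[of _ "poly_const c"] exI[of _ 1]) simp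

lemma evals_var_None: "\<zeta> x = None \<Longrightarrow> evals \<zeta> (rat_var x) (rat_var x)"
  unfolding evals_def rat_var_def by (intro exI[of _ "poly_var x"] exI[of _ 1]) (simp add: poly_subst_var)

lemma evals_var_Some: "\<zeta> x = Some c \<Longrightarrow> evals \<zeta> (rat_var x) (rat_const c)"
  unfolding evals_def rat_var_def rat_const_def
  by (intro exI[of _ "poly_var x"] exI[of _ 1]) (simp add: poly_subst_var)

lemma evals_add: assumes "evals \<zeta> r s" "evals \<zeta> r' s'" shows "evals \<zeta> (r + r') (s + s')"
proof -
  obtain p q p' q' where *: "r = Fract p q" "poly_subst \<zeta> q \<noteq> 0" "s = Fract (poly_subst \<zeta> p) (poly_subst \<zeta> q)"
    "r' = Fract p' q'" "poly_subst \<zeta> q' \<noteq> 0" "s' = Fract (poly_subst \<zeta> p') (poly_subst \<zeta> q')"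
    using assms unfolding evals_def by blast
  then have nz: "q \<noteq> 0" "q' \<noteq> 0" by auto
  show ?thesis unfolding evals_def
    by (intro exI[of _ "p * q' + p' * q"] exI[of _ "q * q'"])
      (use * nz in \<open>simp add: poly_subst_mult poly_subst_add\<close>)
qed

lemma evals_mult: assumes "evals \<zeta> r s" "evals \<zeta> r' s'" shows "evals \<zeta> (r * r') (s * s')"
proof -
  obtain p q p' q' where *: "r = Fract p q" "poly_subst \<zeta> q \<noteq> 0" "s = Fract (poly_subst \<zeta> p) (poly_subst \<zeta> q)"
    "r' = Fract p' q'" "poly_subst \<zeta> q' \<noteq> 0" "s' = Fract (poly_subst \<zeta> p') (poly_subst \<zeta> q')"
    using assms unfolding evals_def by blast
  show ?thesis unfolding evals_def
    by (intro exI[of _ "p * p'"] exI[of _ "q * q'"]) (use * in \<open>simp add: poly_subst_mult\<close>)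
qed

lemma evals_inverse: assumes "evals \<zeta> r s" "s \<noteq> 0" shows "evals \<zeta> (inverse r) (inverse s)"
proof -
  obtain p q where *: "r = Fract p q" "poly_subst \<zeta> q \<noteq> 0" "s = Fract (poly_subst \<zeta> p) (poly_subst \<zeta> q)"
    using assms unfolding evals_def by blast
  then have "poly_subst \<zeta> p \<noteq> 0" using assms(2) by (auto simp: fract_collapse)
  then show ?thesis unfolding evals_def by (intro exI[of _ q] exI[of _ p]) (simp add: *)
qed

lemma evals_0: "evals \<zeta> 0 0"
  using evals_const[of \<zeta> 0] by (simp add: rat_const_def fract_collapse)

lemma evals_1: "evals \<zeta> 1 1"
  using evals_const[of \<zeta> 1] by (simp add: rat_const_def fract_collapse)

lemma evals_minus: assumes "evals \<zeta> r s" shows "evals \<zeta> (- r) (- s)"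
proof -
  have "poly_const (-1) = -1"
    using poly_const_add[of "-1" 1] by (simp add: eq_neg_iff_add_eq_0)
  then have "rat_const (-1) = -1"
    by (simp add: rat_const_def One_fract_def)
  then show ?thesis using evals_mult[OF evals_const[of \<zeta> "-1"] assms] by simp
qed

lemma evals_diff: "evals \<zeta> r s \<Longrightarrow> evals \<zeta> r' s' \<Longrightarrow> evals \<zeta> (r - r') (s - s')"
  using evals_add[OF _ evals_minus] by fastforce

lemma evals_divide: "evals \<zeta> r s \<Longrightarrow> evals \<zeta> r' s' \<Longrightarrow> s' \<noteq> 0 \<Longrightarrow> evals \<zeta> (r / r') (s / s')"
  by (simp add: divide_inverse evals_mult evals_inverse)

lemma evals_sum: "(\<And>x. x \<in> A \<Longrightarrow> evals \<zeta> (f x) (g x)) \<Longrightarrow> evals \<zeta> (sum f A) (sum g A)"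
  by (induction A rule: infinite_finite_induct) (auto intro: evals_add evals_0)

lemma evals_prod: "(\<And>x. x \<in> A \<Longrightarrow> evals \<zeta> (f x) (g x)) \<Longrightarrow> evals \<zeta> (prod f A) (prod g A)"
  by (induction A rule: infinite_finite_induct) (auto intro: evals_mult evals_1)

lemma evals_power: "evals \<zeta> r s \<Longrightarrow> evals \<zeta> (r ^ k) (s ^ k)"
  by (induction k) (auto intro: evals_mult evals_1)

lemma rat_const_0 [simp]: "rat_const 0 = 0" by (simp add: rat_const_def fract_collapse)
lemma rat_const_1 [simp]: "rat_const 1 = 1" by (simp add: rat_const_def fract_collapse)
lemma rat_const_add: "rat_const (a + b) = rat_const a + rat_const b"
  by (simp add: rat_const_def poly_const_add)
lemma rat_const_mult: "rat_const (a * b) = rat_const a * rat_const b"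
  by (simp add: rat_const_def poly_const_mult)
lemma rat_const_eq_iff [simp]: "rat_const a = rat_const b \<longleftrightarrow> a = b"
  by (simp add: rat_const_def eq_fract)
lemma rat_const_minus: "rat_const (- a) = - rat_const a"
  using rat_const_add[of a "- a"] by (simp add: eq_neg_iff_add_eq_0 add.commute)
lemma rat_const_diff: "rat_const (a - b) = rat_const a - rat_const b"
  using rat_const_add[of a "- b"] by (simp add: rat_const_minus)
lemma rat_const_inverse: "rat_const (inverse a) = inverse (rat_const a)"
  by (cases "a = 0") (auto simp: rat_const_mult[symmetric] intro: inverse_unique[symmetric])
lemma rat_const_divide: "rat_const (a / b) = rat_const a / rat_const b"
  by (simp add: divide_inverse rat_const_mult rat_const_inverse)
lemma rat_const_sum: "rat_const (sum f A) = (\<Sum>x\<in>A. rat_const (f x))"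
  by (induction A rule: infinite_finite_induct) (auto simp: rat_const_add)
lemma rat_const_prod: "rat_const (prod f A) = (\<Prod>x\<in>A. rat_const (f x))"
  by (induction A rule: infinite_finite_induct) (auto simp: rat_const_mult)
lemma rat_const_power: "rat_const (a ^ k) = rat_const a ^ k"
  by (induction k) (auto simp: rat_const_mult)
lemma rat_const_of_nat: "rat_const (of_nat k) = of_nat k"
  by (induction k) (auto simp: rat_const_add)
lemma rat_const_of_int: "rat_const (of_int k) = of_int k"
  by (cases k rule: int_cases2) (auto simp: rat_const_of_nat rat_const_minus)

lemma rat_var_neq_const: "rat_var x \<noteq> rat_const c"
proof
  assume "rat_var x = rat_const c"
  then have "poly_var x = poly_const c" by (simp add: rat_var_def rat_const_def eq_fract)
  then have "poly_subst [x \<mapsto> c + 1] (poly_var x) = poly_subst [x \<mapsto> c + 1] (poly_const c)" by simp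
  then show False by (simp add: poly_subst_var)
qed

lemma rat_var_inject: "rat_var x = rat_var y \<longleftrightarrow> x = y"
proof
  assume "rat_var x = rat_var y"
  then have "poly_var x = poly_var y" by (simp add: rat_var_def eq_fract)
  then have "poly_subst [x \<mapsto> 0, y \<mapsto> 1] (poly_var x) = poly_subst [x \<mapsto> 0, y \<mapsto> 1] (poly_var y)" by simp
  then show "x = y" by (auto simp: poly_subst_var split: if_splits)
qed simp

section \<open>Joint eigenspaces\<close>

locale operator_space = vector_space scale
  for scale :: "'k::field \<Rightarrow> 'v::ab_group_add \<Rightarrow> 'v"
begin

definition lin :: "('v \<Rightarrow> 'v) \<Rightarrow> bool" where
  "lin x \<longleftrightarrow> (\<forall>v w. x (v + w) = x v + x w) \<and> (\<forall>a v. x (scale a v) = scale a (x v))"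

lemma lin_add: "lin x \<Longrightarrow> x (v + w) = x v + x w" by (simp add: lin_def)
lemma lin_scale: "lin x \<Longrightarrow> x (scale a v) = scale a (x v)" by (simp add: lin_def)
lemma lin_0: "lin x \<Longrightarrow> x 0 = 0" using lin_scale[of x 0 0] by simp
lemma lin_diff: "lin x \<Longrightarrow> x (v - w) = x v - x w"
  using lin_add[of x "v - w" w] by (simp add: algebra_simps)
lemma lin_sum: "lin x \<Longrightarrow> x (sum f A) = (\<Sum>a\<in>A. x (f a))"
  by (induction A rule: infinite_finite_induct) (auto simp: lin_add lin_0)

text \<open>In this locale a polynomial in an operator is a fold of x - c over its list of
  roots.\<close>

definition shift :: "('v \<Rightarrow> 'v) \<Rightarrow> 'k \<Rightarrow> 'v \<Rightarrow> 'v" where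
  "shift x c v = x v - scale c v"

lemma shift_commute: "lin x \<Longrightarrow> shift x c (shift x d v) = shift x d (shift x c v)"
  by (simp add: shift_def lin_diff lin_scale algebra_simps)

lemma fold_shift: "lin x \<Longrightarrow> fold (shift x) cs (shift x c v) = shift x c (fold (shift x) cs v)"
proof (induction cs arbitrary: v)
  case (Cons d cs)
  then show ?case using shift_commute[OF Cons.prems, of d c v] by simp
qed simp

lemma shift_add: "lin x \<Longrightarrow> shift x c (v + w) = shift x c v + shift x c w"
  by (simp add: shift_def lin_add scale_right_distrib)

lemma shift_scale: "lin x \<Longrightarrow> shift x c (scale a v) = scale a (shift x c v)"
  by (simp add: shift_def lin_scale scale_right_diff_distrib mult.commute)

lemma fold_shift_0: "lin x \<Longrightarrow> fold (shift x) cs 0 = 0"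
  by (induction cs) (auto simp: shift_def lin_0)

lemma fold_shift_add: "lin x \<Longrightarrow> fold (shift x) cs (v + w) = fold (shift x) cs v + fold (shift x) cs w"
  by (induction cs arbitrary: v w) (auto simp: shift_add)

lemma fold_shift_scale: "lin x \<Longrightarrow> fold (shift x) cs (scale a v) = scale a (fold (shift x) cs v)"
  by (induction cs arbitrary: v) (auto simp: shift_scale)

lemma fold_shift_sum: "lin x \<Longrightarrow> fold (shift x) cs (sum f A) = (\<Sum>a\<in>A. fold (shift x) cs (f a))"
  by (induction A rule: infinite_finite_induct) (auto simp: fold_shift_add fold_shift_0)

lemma shift_closed: "subspace U \<Longrightarrow> x ` U \<subseteq> U \<Longrightarrow> v \<in> U \<Longrightarrow> shift x c v \<in> U"
  unfolding shift_def by (auto intro: subspace_diff subspace_scale)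

lemma fold_shift_closed: "subspace U \<Longrightarrow> x ` U \<subseteq> U \<Longrightarrow> v \<in> U \<Longrightarrow> fold (shift x) cs v \<in> U"
  by (induction cs arbitrary: v) (auto simp: shift_closed)

text \<open>The factors commute, so two equal ones can be brought together, and the semisimplicity
  hypothesis \<open>ss\<close> drops one of them.\<close>

lemma fold_shift_remdups:
  assumes x: "lin x" and U: "subspace U" "x ` U \<subseteq> U"
    and ss: "\<And>c v. v \<in> U \<Longrightarrow> shift x c (shift x c v) = 0 \<Longrightarrow> shift x c v = 0"
  shows "v \<in> U \<Longrightarrow> fold (shift x) cs v = 0 \<Longrightarrow> fold (shift x) (remdups cs) v = 0"
proof (induction cs arbitrary: v)
  case (Cons c cs)
  have IH: "fold (shift x) (remdups cs) (shift x c v) = 0"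
    using Cons shift_closed[OF U] by simp
  show ?case
  proof (cases "c \<in> set cs")
    case True
    then obtain as bs where ab: "remdups cs = as @ c # bs"
      by (metis set_remdups split_list)
    define y where "y = fold (shift x) bs (fold (shift x) as v)"
    have y: "y \<in> U" unfolding y_def using Cons.prems fold_shift_closed[OF U] by blast
    have r: "fold (shift x) (remdups cs) v = shift x c y"
      by (simp add: ab y_def fold_shift[OF x])
    have "shift x c (shift x c y) = 0" using IH by (simp add: fold_shift[OF x] r)
    then show ?thesis using ss[OF y] r True by simp
  next
    case False
    then show ?thesis using IH by simp
  qed
qed simp

lemma split_eigen:
  assumes x: "lin x" and U: "subspace U" "x ` U \<subseteq> U"
  shows "distinct cs \<Longrightarrow> v \<in> U \<Longrightarrow> fold (shift x) cs v = 0 \<Longrightarrow>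
    \<exists>w. (\<forall>c\<in>set cs. w c \<in> U \<and> x (w c) = scale c (w c)) \<and> v = (\<Sum>c\<in>set cs. w c)"
proof (induction cs arbitrary: v)
  case (Cons d cs)
  obtain w where w: "\<And>c. c \<in> set cs \<Longrightarrow> w c \<in> U \<and> x (w c) = scale c (w c)"
    "shift x d v = (\<Sum>c\<in>set cs. w c)"
    using Cons.IH[of "shift x d v"] Cons.prems shift_closed[OF U] by auto
  \<comment> \<open>Solves (x - d) y = (x - d) v on the eigencomponents with c \<noteq> d, so that v
    - y is the missing d-eigenvector.\<close>
  define y where "y = (\<Sum>c\<in>set cs. scale (1 / (c - d)) (w c))"
  define w' where "w' c = (if c = d then v - y else scale (1 / (c - d)) (w c))" for c
  have yU: "y \<in> U" unfolding y_def using w U by (intro subspace_sum subspace_scale) auto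
  have "shift x d y = (\<Sum>c\<in>set cs. w c)"
  proof -
    have "shift x d y = (\<Sum>c\<in>set cs. scale (1 / (c - d)) (x (w c)) - scale d (scale (1 / (c - d)) (w c)))"
      by (simp add: y_def shift_def lin_sum[OF x] lin_scale[OF x] scale_sum_right sum_subtractf)
    also have "\<dots> = (\<Sum>c\<in>set cs. w c)"
    proof (intro sum.cong refl)
      fix c assume c: "c \<in> set cs"
      then have "c - d \<noteq> 0" using Cons.prems by auto
      have "1 / (c - d) * c - d * (1 / (c - d)) = 1"
        using \<open>c - d \<noteq> 0\<close> by (simp add: diff_divide_distrib[symmetric])
      moreover have "scale (1 / (c - d)) (x (w c)) - scale d (scale (1 / (c - d)) (w c))
          = scale (1 / (c - d) * c - d * (1 / (c - d))) (w c)"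
        using w(1)[OF c] by (simp only: scale_scale scale_left_diff_distrib)
      ultimately show "scale (1 / (c - d)) (x (w c)) - scale d (scale (1 / (c - d)) (w c)) = w c"
        by simp
    qed
    finally show ?thesis .
  qed
  then have "shift x d (v - y) = 0" using w(2) by (simp add: shift_def lin_diff[OF x] algebra_simps)
  then have "x (v - y) = scale d (v - y)" by (simp add: shift_def)
  then have 1: "\<forall>c\<in>set (d # cs). w' c \<in> U \<and> x (w' c) = scale c (w' c)"
    using w(1) U yU Cons.prems by (auto simp: w'_def lin_scale[OF x] intro: subspace_diff subspace_scale)
  have "(\<Sum>c\<in>set cs. w' c) = y" unfolding y_def w'_def using Cons.prems by (intro sum.cong) auto
  then have "v = (\<Sum>c\<in>set (d # cs). w' c)" using Cons.prems by (simp add: w'_def)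
  then show ?case using 1 by blast
qed simp

text \<open>One operator at a time: by commutation each joint eigenspace found so far is stable
  under the next operator. U is a parameter because the decomposition is later needed inside several
  stable subspaces.\<close>

lemma joint_eigen:
  assumes "finite I" and "\<And>a. a \<in> I \<Longrightarrow> lin (x a)"
    and "\<And>a. a \<in> I \<Longrightarrow> distinct (cs a)"
    and "\<And>a u. a \<in> I \<Longrightarrow> u \<in> U \<Longrightarrow> fold (shift (x a)) (cs a) u = 0"
    and "\<And>a b u. a \<in> I \<Longrightarrow> b \<in> I \<Longrightarrow> u \<in> U \<Longrightarrow> x a (x b u) = x b (x a u)"
    and U: "subspace U" and "\<And>a. a \<in> I \<Longrightarrow> x a ` U \<subseteq> U" and v: "v \<in> U"
  shows "\<exists>w. (\<forall>\<beta>\<in>PiE I (\<lambda>a. set (cs a)). w \<beta> \<in> U \<and> (\<forall>a\<in>I. x a (w \<beta>) = scale (\<beta> a) (w \<beta>)))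
    \<and> v = (\<Sum>\<beta>\<in>PiE I (\<lambda>a. set (cs a)). w \<beta>)"
  using assms(1-5,7)
proof (induction I rule: finite_induct)
  case empty
  then show ?case using v by (intro exI[of _ "\<lambda>_. v"]) auto
next
  case (insert a I)
  let ?C = "\<lambda>a. set (cs a)"
  have "\<exists>w. (\<forall>\<beta>\<in>PiE I ?C. w \<beta> \<in> U \<and> (\<forall>b\<in>I. x b (w \<beta>) = scale (\<beta> b) (w \<beta>)))
      \<and> v = (\<Sum>\<beta>\<in>PiE I ?C. w \<beta>)"
  proof (rule insert.IH)
    show "lin (x b)" if "b \<in> I" for b using insert.prems(1)[of b] that by simp
    show "distinct (cs b)" if "b \<in> I" for b using insert.prems(2)[of b] that by simp
    show "fold (shift (x b)) (cs b) u = 0" if "b \<in> I" "u \<in> U" for b u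
      using insert.prems(3)[of b u] that by simp
    show "x b (x d u) = x d (x b u)" if "b \<in> I" "d \<in> I" "u \<in> U" for b d u
      by (rule insert.prems(4)) (use that in simp_all)
    show "x b ` U \<subseteq> U" if "b \<in> I" for b using insert.prems(5)[of b] that by simp
  qed
  then obtain w where w: "\<And>\<beta>. \<beta> \<in> PiE I ?C \<Longrightarrow> w \<beta> \<in> U \<and> (\<forall>b\<in>I. x b (w \<beta>) = scale (\<beta> b) (w \<beta>))"
    "v = (\<Sum>\<beta>\<in>PiE I ?C. w \<beta>)" by blast
  have la: "lin (x a)" using insert.prems(1)[of a] by simp
  have "\<exists>w'. (\<forall>c\<in>?C a. w' c \<in> {u\<in>U. \<forall>b\<in>I. x b u = scale (\<beta> b) u} \<and> x a (w' c) = scale c (w' c))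
      \<and> w \<beta> = (\<Sum>c\<in>?C a. w' c)" if \<beta>: "\<beta> \<in> PiE I ?C" for \<beta>
  proof (rule split_eigen[OF la])
    have lb: "lin (x b)" if "b \<in> I" for b using insert.prems(1)[of b] that by simp
    show "subspace {u\<in>U. \<forall>b\<in>I. x b u = scale (\<beta> b) u}"
      using U lb by (auto simp: subspace_def lin_0 lin_add lin_scale scale_right_distrib mult.commute)
    show "x a ` {u\<in>U. \<forall>b\<in>I. x b u = scale (\<beta> b) u} \<subseteq> {u\<in>U. \<forall>b\<in>I. x b u = scale (\<beta> b) u}"
    proof safe
      fix u assume u: "u \<in> U" "\<forall>b\<in>I. x b u = scale (\<beta> b) u"
      show "x a u \<in> U" using insert.prems(5)[of a] u by auto
      fix b assume "b \<in> I"
      then show "x b (x a u) = scale (\<beta> b) (x a u)"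
        using insert.prems(4)[of b a u] u lin_scale[OF la] by simp
    qed
    show "w \<beta> \<in> {u\<in>U. \<forall>b\<in>I. x b u = scale (\<beta> b) u}" using w \<beta> by simp
    show "fold (shift (x a)) (cs a) (w \<beta>) = 0"
      using insert.prems(3)[of a "w \<beta>"] w(1)[OF \<beta>] by simp
    show "distinct (cs a)" using insert.prems(2)[of a] by simp
  qed
  then have "\<forall>\<beta>\<in>PiE I ?C. \<exists>w'. (\<forall>c\<in>?C a. w' c \<in> {u\<in>U. \<forall>b\<in>I. x b u = scale (\<beta> b) u} \<and> x a (w' c) = scale c (w' c))
      \<and> w \<beta> = (\<Sum>c\<in>?C a. w' c)" by (rule ballI)
  from bchoice[OF this] obtain w' where w'all: "\<forall>\<beta>\<in>PiE I ?C.
      (\<forall>c\<in>?C a. w' \<beta> c \<in> {u\<in>U. \<forall>b\<in>I. x b u = scale (\<beta> b) u} \<and> x a (w' \<beta> c) = scale c (w' \<beta> c))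
      \<and> w \<beta> = (\<Sum>c\<in>?C a. w' \<beta> c)" ..
  have w': "\<And>\<beta> c. \<beta> \<in> PiE I ?C \<Longrightarrow> c \<in> ?C a \<Longrightarrow>
      w' \<beta> c \<in> {u\<in>U. \<forall>b\<in>I. x b u = scale (\<beta> b) u} \<and> x a (w' \<beta> c) = scale c (w' \<beta> c)"
    "\<And>\<beta>. \<beta> \<in> PiE I ?C \<Longrightarrow> w \<beta> = (\<Sum>c\<in>?C a. w' \<beta> c)"
    using bspec[OF w'all] by (fast, fast)
  \<comment> \<open>A weight on \<open>insert a I\<close> is a weight on I together with a value at
    a.\<close>
  define W where "W \<gamma> = w' (restrict \<gamma> I) (\<gamma> a)" for \<gamma>
  have upd: "restrict (\<beta>(a := c)) I = \<beta>" if "\<beta> \<in> PiE I ?C" for \<beta> c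
    using that insert.hyps by (auto simp: restrict_def PiE_def extensional_def fun_eq_iff)
  have "v = (\<Sum>\<beta>\<in>PiE I ?C. \<Sum>c\<in>?C a. w' \<beta> c)" using w(2) w'(2) by simp
  also have "\<dots> = (\<Sum>(c, \<beta>)\<in>?C a \<times> PiE I ?C. w' \<beta> c)"
    by (subst sum.swap) (simp add: sum.cartesian_product)
  also have "\<dots> = (\<Sum>(c, \<beta>)\<in>?C a \<times> PiE I ?C. W (\<beta>(a := c)))"
    by (intro sum.cong) (auto simp: W_def upd)
  also have "\<dots> = (\<Sum>\<gamma>\<in>PiE (insert a I) ?C. W \<gamma>)"
    unfolding PiE_insert_eq using inj_combinator[OF insert.hyps(2), of ?C]
    by (subst sum.reindex) (auto simp: case_prod_beta)
  finally have v: "v = (\<Sum>\<gamma>\<in>PiE (insert a I) ?C. W \<gamma>)" .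
  have "W \<gamma> \<in> U \<and> (\<forall>b\<in>insert a I. x b (W \<gamma>) = scale (\<gamma> b) (W \<gamma>))" if \<gamma>: "\<gamma> \<in> PiE (insert a I) ?C" for \<gamma>
  proof -
    have "restrict \<gamma> I \<in> PiE I ?C" "\<gamma> a \<in> ?C a" using \<gamma> by auto
    from w'(1)[OF this] show ?thesis by (auto simp: W_def)
  qed
  then show ?case using v by blast
qed

end

section \<open>Annihilating polynomials on the group algebra\<close>

definition fscale :: "'k::field \<Rightarrow> ('x \<Rightarrow> 'k) \<Rightarrow> 'x \<Rightarrow> 'k" where
  "fscale c v = (\<lambda>x. c * v x)"

interpretation fs: operator_space "fscale :: 'k::field \<Rightarrow> ('x \<Rightarrow> 'k) \<Rightarrow> 'x \<Rightarrow> 'k"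
  by unfold_locales (auto simp: fscale_def fun_eq_iff algebra_simps)

text \<open>The ambient vector space is the full function type, and the group algebra is this
  subspace; so linear operators need no carrier.\<close>

definition supp_in :: "'x set \<Rightarrow> ('x \<Rightarrow> 'k::zero) set" where
  "supp_in H = {v. \<forall>x. x \<notin> H \<longrightarrow> v x = 0}"

lemma subspace_supp_in: "fs.subspace (supp_in H)"
  by (simp add: fs.subspace_def supp_in_def fscale_def)

lemma sum_fun_apply: "(\<Sum>i\<in>A. f i) x = (\<Sum>i\<in>A. f i x)"
  by (induction A rule: infinite_finite_induct) auto

lemma supp_in_delta:
  assumes "finite H" "v \<in> supp_in H"
  shows "v = (\<Sum>h\<in>H. fscale (v h) (group_elem h))"
proof
  fix x
  have "(\<Sum>h\<in>H. fscale (v h) (group_elem h)) x = (\<Sum>h\<in>H. if h = x then v h else 0)"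
    unfolding sum_fun_apply by (intro sum.cong) (auto simp: fscale_def group_elem_def)
  then show "v x = (\<Sum>h\<in>H. fscale (v h) (group_elem h)) x"
    using assms by (auto simp: supp_in_def)
qed

text \<open>The polynomial p in the operator x, applied to v, with an explicit cut-off; every N that
  is at least the degree gives the same vector.\<close>

definition opoly :: "(('x \<Rightarrow> 'k::field) \<Rightarrow> ('x \<Rightarrow> 'k)) \<Rightarrow> nat \<Rightarrow> 'k poly \<Rightarrow> ('x \<Rightarrow> 'k) \<Rightarrow> 'x \<Rightarrow> 'k" where
  "opoly x N p v = (\<Sum>i\<le>N. fscale (coeff p i) ((x ^^ i) v))"

lemma opoly_mono: "degree p \<le> N \<Longrightarrow> N \<le> M \<Longrightarrow> opoly x M p v = opoly x N p v"
  unfolding opoly_def by (intro sum.mono_neutral_right) (auto simp: coeff_eq_0)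

lemma opoly_linear_factor:
  assumes x: "fs.lin x" and N: "degree q \<le> N"
  shows "opoly x (Suc N) ([:-c, 1:] * q) v = fs.shift x c (opoly x N q v)"
proof -
  have "opoly x (Suc N) ([:-c, 1:] * q) v
      = (\<Sum>i\<le>Suc N. fscale (coeff (pCons 0 q) i) ((x ^^ i) v)) - fscale c (\<Sum>i\<le>Suc N. fscale (coeff q i) ((x ^^ i) v))"
    by (simp add: opoly_def fs.scale_sum_right sum_subtractf[symmetric] fs.scale_left_diff_distrib[symmetric]
        del: sum.atMost_Suc)
  also have "(\<Sum>i\<le>Suc N. fscale (coeff q i) ((x ^^ i) v)) = opoly x N q v"
    using opoly_mono[of q N "Suc N" x v] N by (simp add: opoly_def)
  also have "(\<Sum>i\<le>Suc N. fscale (coeff (pCons 0 q) i) ((x ^^ i) v)) = x (opoly x N q v)"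
    by (subst sum.atMost_Suc_shift) (simp add: opoly_def fs.lin_sum[OF x] fs.lin_scale[OF x])
  finally show ?thesis by (simp add: fs.shift_def fun_eq_iff)
qed

lemma opoly_roots:
  assumes x: "fs.lin x"
  shows "opoly x (length cs) (\<Prod>c\<leftarrow>cs. [:-c, 1:]) v = fold (fs.shift x) cs v"
proof (induction cs)
  case Nil
  then show ?case by (simp add: opoly_def)
next
  case (Cons c cs)
  have "degree (\<Prod>c\<leftarrow>cs. [:-c, 1:]) \<le> length cs"
  proof (induction cs)
    case (Cons c cs)
    have "degree [:-c, 1:] = 1" by simp
    then show ?case using degree_mult_le[of "[:-c, 1:]" "\<Prod>c\<leftarrow>cs. [:-c, 1:]"] Cons
      by (simp only: list.map prod_list.Cons list.size)
  qed simp
  then show ?case using Cons opoly_linear_factor[OF x] by (simp add: fs.fold_shift[OF x])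
qed

text \<open>The vector v and its first |H| iterates lie in a space of dimension |H|, so they satisfy
  a linear relation.\<close>

lemma linear_recurrence:
  fixes x :: "('x \<Rightarrow> 'k::field) \<Rightarrow> ('x \<Rightarrow> 'k)"
  assumes H: "finite H" and v: "v \<in> supp_in H" and xH: "x ` supp_in H \<subseteq> supp_in H"
  shows "\<exists>p N. p \<noteq> 0 \<and> degree p \<le> N \<and> opoly x N p v = 0"
proof (cases "inj_on (\<lambda>i. (x ^^ i) v) {..card H}")
  \<comment> \<open>Dependence is a property of sets, so equal iterates are treated apart, by the
    polynomial X^j - X^i.\<close>
  case False
  then obtain i j where ij: "i < j" "(x ^^ i) v = (x ^^ j) v"
    unfolding inj_on_def by (metis linorder_neqE_nat)
  let ?p = "monom 1 j - monom 1 i :: 'k poly"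
  have c: "coeff ?p l = (if l = j then 1 else if l = i then -1 else 0)" for l using ij by auto
  then have "?p \<noteq> 0" by (metis coeff_0 zero_neq_one)
  moreover have "degree ?p \<le> j" using ij by (intro degree_diff_le) (auto simp: degree_monom_eq)
  moreover have "opoly x j ?p v = (\<Sum>l\<in>{i, j}. fscale (coeff ?p l) ((x ^^ l) v))"
    unfolding opoly_def using ij by (intro sum.mono_neutral_right) auto
  then have "opoly x j ?p v = 0" using ij by simp
  ultimately show ?thesis by blast
next
  case True
  let ?f = "\<lambda>i. (x ^^ i) v" and ?S = "(\<lambda>i. (x ^^ i) v) ` {..card H}"
  have mem: "?f i \<in> supp_in H" for i using v xH by (induction i) auto
  have span: "?S \<subseteq> fs.span (group_elem ` H)"
  proof safe
    fix i
    have "?f i = (\<Sum>h\<in>H. fscale (?f i h) (group_elem h))" by (rule supp_in_delta[OF H mem])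
    also have "\<dots> \<in> fs.span (group_elem ` H)"
      by (intro fs.span_sum fs.span_scale fs.span_base) auto
    finally show "?f i \<in> fs.span (group_elem ` H)" .
  qed
  have "fs.dependent ?S"
  proof (rule ccontr)
    assume "fs.independent ?S"
    from fs.independent_span_bound[OF _ this span] H
    have "card ?S \<le> card (group_elem ` H :: ('x \<Rightarrow> 'k) set)" by auto
    also have "\<dots> \<le> card H" by (rule card_image_le[OF H])
    finally show False using card_image[OF True] by simp
  qed
  then obtain u w where u: "w \<in> ?S" "u w \<noteq> 0" "(\<Sum>y\<in>?S. fscale (u y) y) = 0"
    using fs.dependent_finite[of ?S] by auto
  define p where "p = (\<Sum>i\<le>card H. monom (u (?f i)) i)"
  have cp: "coeff p i = (if i \<le> card H then u (?f i) else 0)" for i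
    by (simp add: p_def coeff_sum)
  have "p \<noteq> 0" using u(1,2) cp by (metis (no_types, lifting) atMost_iff coeff_0 imageE)
  moreover have "degree p \<le> card H" by (rule degree_le) (simp add: cp)
  moreover have "opoly x (card H) p v = (\<Sum>i\<le>card H. fscale (u (?f i)) (?f i))"
    unfolding opoly_def by (intro sum.cong) (auto simp: cp)
  then have "opoly x (card H) p v = 0" using u(3) by (simp add: sum.reindex[OF True] o_def)
  ultimately show ?thesis by blast
qed

lemma annihilating_roots:
  fixes x :: "('x \<Rightarrow> complex) \<Rightarrow> ('x \<Rightarrow> complex)"
  assumes H: "finite H" and v: "v \<in> supp_in H" and xH: "x ` supp_in H \<subseteq> supp_in H" and x: "fs.lin x"
  shows "\<exists>cs. fold (fs.shift x) cs v = 0"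
proof -
  obtain p N where p: "p \<noteq> 0" "degree p \<le> N" "opoly x N p v = 0"
    using linear_recurrence[OF H v xH] by blast
  obtain A where A: "size A = degree p" "p = smult (lead_coeff p) (\<Prod>c\<in>#A. [:-c, 1:])"
    using alg_closed_imp_factorization[OF p(1)] by blast
  obtain cs where cs: "mset cs = A" using ex_mset by blast
  define q where "q = (\<Prod>c\<leftarrow>cs. [:-c, 1:])"
  have q: "p = smult (lead_coeff p) q"
    using A(2) cs by (metis (no_types, lifting) prod_mset_prod_list mset_map q_def)
  then have dq: "degree q = degree p" using p(1) by (metis degree_smult_eq leading_coeff_0_iff)
  have len: "length cs = degree p" using A(1) cs by auto
  have "opoly x N p v = fscale (lead_coeff p) (opoly x N q v)"
    by (subst (1) q) (simp add: opoly_def fs.scale_sum_right)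
  then have "opoly x N q v = 0" using p(1,3) by simp
  then have "opoly x (degree p) q v = 0" using opoly_mono[of q "degree p" N x v] dq p(2) by simp
  then have "fold (fs.shift x) cs v = 0" using opoly_roots[OF x, of cs v] len by (simp add: q_def)
  then show ?thesis by blast
qed

section \<open>Normal operators are diagonalizable\<close>

definition ip :: "'x set \<Rightarrow> ('x \<Rightarrow> complex) \<Rightarrow> ('x \<Rightarrow> complex) \<Rightarrow> complex" where
  "ip H v w = (\<Sum>h\<in>H. cnj (v h) * w h)"

lemma ip_add_right: "ip H v (w + w') = ip H v w + ip H v w'"
  by (simp add: ip_def algebra_simps sum.distrib)
lemma ip_scale_right: "ip H v (fscale a w) = a * ip H v w"
  by (simp add: ip_def fscale_def sum_distrib_left mult_ac)
lemma ip_cnj: "cnj (ip H v w) = ip H w v"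
  by (simp add: ip_def mult.commute)
lemma ip_add_left: "ip H (v + v') w = ip H v w + ip H v' w"
  by (simp add: ip_def algebra_simps sum.distrib)
lemma ip_scale_left: "ip H (fscale a v) w = cnj a * ip H v w"
  by (simp add: ip_def fscale_def sum_distrib_left mult_ac)
lemma ip_0 [simp]: "ip H v 0 = 0" "ip H 0 v = 0" "ip H v (\<lambda>_. 0) = 0" "ip H (\<lambda>_. 0) v = 0"
  by (simp_all add: ip_def)
lemma ip_diff_right: "ip H v (w - w') = ip H v w - ip H v w'"
  by (simp add: ip_def algebra_simps sum_subtractf)
lemma ip_diff_left: "ip H (v - v') w = ip H v w - ip H v' w"
  by (simp add: ip_def algebra_simps sum_subtractf)
lemma ip_sum_right: "ip H v (sum f A) = (\<Sum>a\<in>A. ip H v (f a))"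
  unfolding ip_def sum_fun_apply sum_distrib_left by (rule sum.swap)
lemma ip_sum_left: "ip H (sum f A) v = (\<Sum>a\<in>A. ip H (f a) v)"
  unfolding ip_def sum_fun_apply cnj_sum sum_distrib_right by (rule sum.swap)

lemma ip_eq_0:
  assumes "finite H" "v \<in> supp_in H" "ip H v v = 0" shows "v = 0"
proof
  have "ip H v v = of_real (\<Sum>h\<in>H. (cmod (v h))\<^sup>2)"
    unfolding ip_def of_real_sum by (intro sum.cong refl) (metis complex_norm_square mult.commute)
  then have "(\<Sum>h\<in>H. (cmod (v h))\<^sup>2) = 0" using assms(3) by (metis of_real_eq_0_iff)
  then have "\<forall>h\<in>H. v h = 0" using assms(1) by (simp add: sum_nonneg_eq_0_iff)
  then show "v h = 0 h" for h using assms(2) by (cases "h \<in> H") (auto simp: supp_in_def)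
qed

text \<open>Put z = (x - c) v and z' = (x' - \<open>cnj c\<close>) z. Normality turns <z', z'> into
  <z, (x' - \<open>cnj c\<close>)(x - c) z> = 0, and then <z, z> = <v, z'> = 0.\<close>

lemma normal_semisimple:
  assumes H: "finite H" and x: "fs.lin x" "fs.lin x'" "x ` supp_in H \<subseteq> supp_in H" "x' ` supp_in H \<subseteq> supp_in H"
    and adj: "\<And>v w. v \<in> supp_in H \<Longrightarrow> w \<in> supp_in H \<Longrightarrow> ip H (x v) w = ip H v (x' w)"
    and normal: "\<And>v. v \<in> supp_in H \<Longrightarrow> x (x' v) = x' (x v)"
    and v: "v \<in> supp_in H" and 0: "fs.shift x c (fs.shift x c v) = 0"
  shows "fs.shift x c v = 0"
proof -
  let ?U = "supp_in H :: ('a \<Rightarrow> complex) set"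
  have adj': "ip H (x' v) w = ip H v (x w)" if "v \<in> ?U" "w \<in> ?U" for v w
    using adj[OF that(2,1)] by (metis ip_cnj)
  have sadj: "ip H (fs.shift x c v) w = ip H v (fs.shift x' (cnj c) w)" if "v \<in> ?U" "w \<in> ?U" for v w c
    using that by (simp add: fs.shift_def ip_diff_left ip_diff_right ip_scale_left ip_scale_right adj)
  have sadj': "ip H (fs.shift x' (cnj c) v) w = ip H v (fs.shift x c w)" if "v \<in> ?U" "w \<in> ?U" for v w c
    using that by (simp add: fs.shift_def ip_diff_left ip_diff_right ip_scale_left ip_scale_right adj')
  have cl: "fs.shift x c v \<in> ?U" "fs.shift x' c v \<in> ?U" if "v \<in> ?U" for v c
    using that fs.shift_closed[OF subspace_supp_in] x by blast+
  define z where "z = fs.shift x c v"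
  define z' where "z' = fs.shift x' (cnj c) z"
  have zU: "z \<in> ?U" "z' \<in> ?U" using v cl by (auto simp: z_def z'_def)
  have "ip H z' z' = ip H z (fs.shift x c z')" unfolding z'_def[of ] using sadj' zU cl by (simp add: z'_def)
  also have "fs.shift x c z' = fs.shift x' (cnj c) (fs.shift x c z)"
    unfolding z'_def fs.shift_def fs.lin_diff[OF x(1)] fs.lin_diff[OF x(2)] fs.lin_scale[OF x(1)]
      fs.lin_scale[OF x(2)] normal[OF zU(1)]
    by (simp add: fscale_def fun_eq_iff algebra_simps)
  also have "\<dots> = 0" using 0 fs.lin_0[OF x(2)] by (simp add: z_def fs.shift_def)
  finally have "z' = 0" using ip_eq_0[OF H zU(2)] by simp
  moreover have "ip H z z = ip H v z'" unfolding z'_def by (subst (1) z_def) (rule sadj[OF v zU(1)])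
  ultimately have "ip H z z = 0" by simp
  then show ?thesis using ip_eq_0[OF H zU(1)] by (simp add: z_def)
qed

text \<open>Every basis vector \<open>group_elem h\<close> has an annihilating list of roots; the
  concatenation annihilates everything, and semisimplicity removes repetitions.\<close>

lemma normal_diagonalizable:
  fixes x x' :: "('x \<Rightarrow> complex) \<Rightarrow> ('x \<Rightarrow> complex)"
  assumes H: "finite H" and x: "fs.lin x" "fs.lin x'" "x ` supp_in H \<subseteq> supp_in H" "x' ` supp_in H \<subseteq> supp_in H"
    and adj: "\<And>v w. v \<in> supp_in H \<Longrightarrow> w \<in> supp_in H \<Longrightarrow> ip H (x v) w = ip H v (x' w)"
    and normal: "\<And>v. v \<in> supp_in H \<Longrightarrow> x (x' v) = x' (x v)"
  shows "\<exists>cs. distinct cs \<and> (\<forall>v\<in>supp_in H. fold (fs.shift x) cs v = 0)"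
proof -
  let ?U = "supp_in H :: ('x \<Rightarrow> complex) set"
  have "\<exists>cs. fold (fs.shift x) cs (group_elem h) = 0" if "h \<in> H" for h
    by (rule annihilating_roots[OF H _ x(3,1)]) (use that in \<open>auto simp: supp_in_def group_elem_def\<close>)
  then obtain cs where cs: "\<And>h. h \<in> H \<Longrightarrow> fold (fs.shift x) (cs h) (group_elem h) = 0" by metis
  obtain hs where hs: "set hs = H" using finite_list[OF H] by blast
  define ds where "ds = concat (map cs hs)"
  have "fold (fs.shift x) (concat (map cs hs)) (group_elem h) = 0" if "h \<in> set hs" "set hs \<subseteq> H" for h hs
    using that
  proof (induction hs)
    case (Cons g hs)
    have comm: "fold (fs.shift x) as (fold (fs.shift x) bs v) = fold (fs.shift x) bs (fold (fs.shift x) as v)" for as bs v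
      by (induction bs arbitrary: v) (auto simp: fs.fold_shift[OF x(1)])
    show ?case
    proof (cases "h = g")
      case True
      then show ?thesis using cs Cons.prems by (simp add: fs.fold_shift_0[OF x(1)])
    next
      case False
      then have "fold (fs.shift x) (concat (map cs hs)) (group_elem h) = 0" using Cons by auto
      then show ?thesis by (simp add: comm[of "concat (map cs hs)"] fs.fold_shift_0[OF x(1)])
    qed
  qed simp
  then have ds: "fold (fs.shift x) ds (group_elem h) = 0" if "h \<in> H" for h
    using that hs unfolding ds_def by blast
  have "fold (fs.shift x) ds v = 0" if v: "v \<in> ?U" for v
    by (subst supp_in_delta[OF H v])
      (simp add: fs.fold_shift_sum[OF x(1)] fs.fold_shift_scale[OF x(1)] ds)
  then have "fold (fs.shift x) (remdups ds) v = 0" if "v \<in> ?U" for v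
    using fs.fold_shift_remdups[OF x(1) subspace_supp_in x(3)] normal_semisimple[OF H x adj normal] that by blast
  then show ?thesis by (intro exI[of _ "remdups ds"]) auto
qed

section \<open>The regular module\<close>

text \<open>Left translation. Values outside the group are kept, so that the action laws hold for
  every function and not only on the group algebra.\<close>

definition act :: "('x, 'b) monoid_scheme \<Rightarrow> 'x \<Rightarrow> ('x \<Rightarrow> 'k) \<Rightarrow> 'x \<Rightarrow> 'k" where
  "act H h v = (\<lambda>x. if x \<in> carrier H then v (inv\<^bsub>H\<^esub> h \<otimes>\<^bsub>H\<^esub> x) else v x)"

context group begin

lemma act_mult: "h \<in> carrier G \<Longrightarrow> g \<in> carrier G \<Longrightarrow> act G (h \<otimes> g) v = act G h (act G g v)"
  by (auto simp: act_def fun_eq_iff inv_mult_group m_assoc)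

lemma act_one: "act G \<one> v = v"
  by (auto simp: act_def fun_eq_iff)

lemma act_inv: "h \<in> carrier G \<Longrightarrow> act G h (act G (inv h) v) = v" "h \<in> carrier G \<Longrightarrow> act G (inv h) (act G h v) = v"
  by (simp_all add: act_mult[symmetric] act_one)

lemma act_supp: "h \<in> carrier G \<Longrightarrow> v \<in> supp_in (carrier G) \<Longrightarrow> act G h v \<in> supp_in (carrier G)"
  by (simp add: act_def supp_in_def)

lemma act_group_elem: "h \<in> carrier G \<Longrightarrow> g \<in> carrier G \<Longrightarrow> act G h (group_elem g) = group_elem (h \<otimes> g)"
  by (auto simp: act_def group_elem_def fun_eq_iff inv_solve_left')

lemma ip_act:
  assumes h: "h \<in> carrier G"
  shows "ip (carrier G) (act G h v) (act G h w) = ip (carrier G) v w"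
  unfolding ip_def
  by (rule sum.reindex_bij_witness[of _ "\<lambda>x. h \<otimes> x" "\<lambda>x. inv h \<otimes> x"])
    (use h in \<open>auto simp: act_def m_assoc[symmetric]\<close>)

lemma ip_act_left: "h \<in> carrier G \<Longrightarrow> ip (carrier G) (act G h v) w = ip (carrier G) v (act G (inv h) w)"
  using ip_act[of h v "act G (inv h) w"] by (simp add: act_inv)

end

lemma act_add: "act H h (v + w) = act H h v + act H h (w :: 'x \<Rightarrow> 'k::field)"
  by (auto simp: act_def fun_eq_iff)

lemma act_fscale: "act H h (fscale a v) = fscale a (act H h v)"
  by (auto simp: act_def fun_eq_iff fscale_def)

lemma act_sum: "act H h (sum f A) = (\<Sum>a\<in>A. act H h (f a :: 'x \<Rightarrow> 'k::field))"
  by (auto simp: act_def fun_eq_iff sum_fun_apply)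

section \<open>Convolution on a finite group\<close>

locale finite_group = group G for G :: "('x, 'b) monoid_scheme" (structure) +
  assumes fin: "finite (carrier G)"
begin

abbreviation conv :: "('x \<Rightarrow> 'k::field) \<Rightarrow> ('x \<Rightarrow> 'k) \<Rightarrow> 'x \<Rightarrow> 'k" where
  "conv a v \<equiv> a \<otimes>\<^bsub>group_algebra G\<^esub> v"

abbreviation "A \<equiv> supp_in (carrier G)"

lemma carrier_group_algebra: "carrier (group_algebra G) = A"
  by (simp add: group_algebra_def supp_in_def)

text \<open>The sum over factorisations y z = x becomes a sum over y, so convolution is a
  combination of translations. Associativity and the other algebra laws are derived from this
  form.\<close>

lemma conv_act:
  assumes v: "v \<in> A"
  shows "conv a v = (\<Sum>y\<in>carrier G. fscale (a y) (act G y v))"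
proof
  fix x
  have "conv a v x = (\<Sum>(y, z)\<in>{(y, z) \<in> carrier G \<times> carrier G. y \<otimes> z = x}. a y * v z)"
    by (simp add: group_algebra_def)
  also have "\<dots> = (\<Sum>y\<in>carrier G. a y * act G y v x)"
  proof (cases "x \<in> carrier G")
    case True
    show ?thesis
      by (rule sum.reindex_bij_witness[of _ "\<lambda>y. (y, inv y \<otimes> x)" fst])
        (use True in \<open>auto simp: m_assoc[symmetric] act_def\<close>)
  next
    case False
    then have e: "{(y, z) \<in> carrier G \<times> carrier G. y \<otimes> z = x} = {}" by auto
    show ?thesis unfolding e sum.empty using False v by (simp add: act_def supp_in_def)
  qed
  finally show "conv a v x = (\<Sum>y\<in>carrier G. fscale (a y) (act G y v)) x"
    by (simp add: sum_fun_apply fscale_def)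
qed

lemma conv_closed [intro]: "v \<in> A \<Longrightarrow> conv a v \<in> A"
  unfolding conv_act by (intro fs.subspace_sum fs.subspace_scale subspace_supp_in act_supp) auto

lemma group_elem_closed [intro]: "h \<in> carrier G \<Longrightarrow> group_elem h \<in> A"
  by (auto simp: supp_in_def group_elem_def)

lemma conv_group_elem: "h \<in> carrier G \<Longrightarrow> v \<in> A \<Longrightarrow> conv (group_elem h) v = act G h v"
proof -
  assume h: "h \<in> carrier G" and v: "v \<in> A"
  have "(\<Sum>y\<in>carrier G. fscale (group_elem h y) (act G y v)) = (\<Sum>y\<in>carrier G. if y = h then act G y v else 0)"
    by (intro sum.cong) (auto simp: group_elem_def)
  then show ?thesis using h v fin by (simp add: conv_act)
qed

lemma conv_one_left: "v \<in> A \<Longrightarrow> conv \<one>\<^bsub>group_algebra G\<^esub> v = v"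
  using conv_group_elem[of \<one> v] by (simp add: group_algebra_def group_elem_def act_one)

lemma one_eq: "\<one>\<^bsub>group_algebra G\<^esub> = group_elem \<one>"
  by (simp add: group_algebra_def group_elem_def)

lemma conv_one_right: "a \<in> A \<Longrightarrow> conv a (group_elem \<one>) = a"
  by (subst conv_act) (auto simp: act_group_elem supp_in_delta[OF fin, symmetric])

lemma conv_add_left: "v \<in> A \<Longrightarrow> conv (a + b) v = conv a v + conv b v"
  by (simp add: conv_act fs.scale_left_distrib sum.distrib)

lemma conv_scale_left: "v \<in> A \<Longrightarrow> conv (fscale c a) v = fscale c (conv a v)"
  by (simp add: conv_act fs.scale_sum_right) (simp add: fscale_def)

lemma conv_scale_right: "v \<in> A \<Longrightarrow> conv a (fscale c v) = fscale c (conv a v)"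
  using fs.subspace_scale[OF subspace_supp_in, of v "carrier G" c]
  by (simp add: conv_act act_fscale fs.scale_sum_right mult.commute)

lemma conv_sum_right:
  assumes "\<And>i. i \<in> I \<Longrightarrow> f i \<in> A" shows "conv a (sum f I) = (\<Sum>i\<in>I. conv a (f i))"
proof -
  have "sum f I \<in> A" by (rule fs.subspace_sum[OF subspace_supp_in assms])
  then have "conv a (sum f I) = (\<Sum>y\<in>carrier G. \<Sum>i\<in>I. fscale (a y) (act G y (f i)))"
    by (simp only: conv_act act_sum fs.scale_sum_right)
  also have "\<dots> = (\<Sum>i\<in>I. \<Sum>y\<in>carrier G. fscale (a y) (act G y (f i)))" by (rule sum.swap)
  also have "\<dots> = (\<Sum>i\<in>I. conv a (f i))" using assms by (intro sum.cong refl) (simp only: conv_act)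
  finally show ?thesis .
qed

lemma conv_sum_left:
  assumes "v \<in> A" shows "conv (sum f I) v = (\<Sum>i\<in>I. conv (f i) v)"
proof -
  have "conv (sum f I) v = (\<Sum>y\<in>carrier G. \<Sum>i\<in>I. fscale (f i y) (act G y v))"
    by (simp only: conv_act[OF assms] sum_fun_apply fs.scale_sum_left)
  also have "\<dots> = (\<Sum>i\<in>I. \<Sum>y\<in>carrier G. fscale (f i y) (act G y v))" by (rule sum.swap)
  finally show ?thesis by (simp only: conv_act[OF assms])
qed

lemma act_conv: assumes "h \<in> carrier G" "b \<in> A" "v \<in> A"
  shows "act G h (conv b v) = conv (act G h b) v"
proof -
  have "act G h (conv b v) = (\<Sum>y\<in>carrier G. fscale (b y) (act G (h \<otimes> y) v))"
    using assms by (simp add: conv_act act_sum act_fscale act_mult)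
  also have "\<dots> = (\<Sum>y\<in>carrier G. fscale (act G h b y) (act G y v))"
    by (rule sum.reindex_bij_witness[of _ "\<lambda>x. inv h \<otimes> x" "\<lambda>x. h \<otimes> x"])
      (use assms in \<open>auto simp: act_def m_assoc[symmetric]\<close>)
  finally show ?thesis using assms by (simp add: conv_act)
qed

lemma conv_assoc:
  assumes "b \<in> A" "v \<in> A" shows "conv (conv a b) v = conv a (conv b v)"
proof -
  have "conv (conv a b) v = (\<Sum>y\<in>carrier G. fscale (a y) (conv (act G y b) v))"
    using assms by (simp add: conv_act[OF assms(1)] conv_sum_left conv_scale_left)
  also have "\<dots> = (\<Sum>y\<in>carrier G. fscale (a y) (act G y (conv b v)))"
    using assms by (simp add: act_conv)
  also have "\<dots> = conv a (conv b v)" using assms by (subst conv_act) auto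
  finally show ?thesis .
qed

lemma ordered_prod_closed:
  fixes xs :: "('x \<Rightarrow> 'k::field) list"
  shows "set xs \<subseteq> A \<Longrightarrow> ordered_prod (group_algebra G) xs \<in> A"
proof (induction xs)
  case Nil
  then show ?case by (simp add: ordered_prod_def one_eq group_elem_closed)
next
  case (Cons x xs)
  then show ?case by (simp add: ordered_prod_def conv_closed)
qed

lemma conv_ordered_prod:
  fixes xs :: "('x \<Rightarrow> 'k::field) list"
  shows "set xs \<subseteq> A \<Longrightarrow> v \<in> A \<Longrightarrow> conv (ordered_prod (group_algebra G) xs) v = foldr conv xs v"
proof (induction xs)
  case Nil
  then show ?case by (simp add: ordered_prod_def conv_one_left)
next
  case (Cons x xs)
  then show ?case
    using ordered_prod_closed[of xs] conv_assoc[of "ordered_prod (group_algebra G) xs" v x]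
    by (simp add: ordered_prod_def)
qed

lemma abelian_monoid_group_algebra: "abelian_monoid (group_algebra G :: ('k::field, 'x \<Rightarrow> 'k) module)"
proof
  show "monoid.mult (add_monoid (group_algebra G)) x y \<in> carrier (add_monoid (group_algebra G))"
    if "x \<in> carrier (add_monoid (group_algebra G))" "y \<in> carrier (add_monoid (group_algebra G))"
    for x y :: "'x \<Rightarrow> 'k" using that by (auto simp: group_algebra_def)
qed (auto simp: group_algebra_def add_ac)

lemma finsum_group_algebra:
  "finite I \<Longrightarrow> (\<And>i. i \<in> I \<Longrightarrow> f i \<in> A) \<Longrightarrow> finsum (group_algebra G) f I = (\<Sum>i\<in>I. f i :: 'x \<Rightarrow> 'k::field)"
proof (induction I rule: finite_induct)
  case empty
  interpret abelian_monoid "group_algebra G :: ('k, 'x \<Rightarrow> 'k) module" by (rule abelian_monoid_group_algebra)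
  show ?case by (simp add: finsum_empty) (simp add: group_algebra_def zero_fun_def)
next
  case (insert i I)
  interpret am: abelian_monoid "group_algebra G :: ('k, 'x \<Rightarrow> 'k) module" by (rule abelian_monoid_group_algebra)
  have "finsum (group_algebra G) f (insert i I) = f i \<oplus>\<^bsub>group_algebra G\<^esub> finsum (group_algebra G) f I"
    using insert by (intro am.finsum_insert) (auto simp: carrier_group_algebra)
  then show ?case using insert by (simp add: group_algebra_def plus_fun_def)
qed

lemma add_eq: "a \<oplus>\<^bsub>group_algebra G\<^esub> b = a + b"
  by (simp add: group_algebra_def plus_fun_def)

lemma smult_eq: "c \<odot>\<^bsub>group_algebra G\<^esub> a = fscale c a"
  by (simp add: group_algebra_def fscale_def)

lemma zero_eq: "\<zero>\<^bsub>group_algebra G\<^esub> = 0"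
  by (simp add: group_algebra_def zero_fun_def)

end

section \<open>The wreath product as a group\<close>

context group begin

lemma carrier_wreath:
  "carrier (wreath_product G n) = (\<Pi>\<^sub>E i\<in>{1..n}. carrier G) \<times> {p. p permutes {1..n}}"
  by (simp add: wreath_product_def sym_group_def)

lemma one_wreath: "\<one>\<^bsub>wreath_product G n\<^esub> = (\<lambda>i\<in>{1..n}. \<one>, id)"
  by (simp add: wreath_product_def sym_group_def)

lemma mult_wreath:
  "(a, \<sigma>) \<otimes>\<^bsub>wreath_product G n\<^esub> (b, \<tau>) =
    (\<lambda>i\<in>{1..n}. a i \<otimes> b (if inv' \<sigma> i \<in> UNIV then inv' \<sigma> i else i), \<sigma> \<circ> \<tau>)"
  if "inv' = (Hilbert_Choice.inv :: (nat \<Rightarrow> nat) \<Rightarrow> nat \<Rightarrow> nat)"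
  using that by (auto simp: wreath_product_def sym_group_def fun_eq_iff)

lemma wreath_group_axioms:
  assumes x: "x \<in> carrier (wreath_product G n)" and y: "y \<in> carrier (wreath_product G n)"
    and z: "z \<in> carrier (wreath_product G n)"
  shows "x \<otimes>\<^bsub>wreath_product G n\<^esub> y \<in> carrier (wreath_product G n)"
    and "(x \<otimes>\<^bsub>wreath_product G n\<^esub> y) \<otimes>\<^bsub>wreath_product G n\<^esub> z
      = x \<otimes>\<^bsub>wreath_product G n\<^esub> (y \<otimes>\<^bsub>wreath_product G n\<^esub> z)"
    and "\<one>\<^bsub>wreath_product G n\<^esub> \<otimes>\<^bsub>wreath_product G n\<^esub> x = x"
    and "\<exists>y\<in>carrier (wreath_product G n). y \<otimes>\<^bsub>wreath_product G n\<^esub> x = \<one>\<^bsub>wreath_product G n\<^esub>"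
proof -
  let ?W = "wreath_product G n"
  let ?i = "Hilbert_Choice.inv :: (nat \<Rightarrow> nat) \<Rightarrow> nat \<Rightarrow> nat"
  have m: "(a, \<sigma>) \<otimes>\<^bsub>?W\<^esub> (b, \<tau>) = (\<lambda>i\<in>{1..n}. a i \<otimes> b (?i \<sigma> i), \<sigma> \<circ> \<tau>)" for a \<sigma> b \<tau>
    using mult_wreath[OF refl] by simp
  have pin: "?i \<sigma> i \<in> {1..n}" if "\<sigma> permutes {1..n}" "i \<in> {1..n}" for \<sigma> i
    using permutes_in_image[OF permutes_inv[OF that(1)]] that(2) by blast
  obtain a \<sigma> where xx: "x = (a, \<sigma>)" by (cases x)
  obtain b \<tau> where yy: "y = (b, \<tau>)" by (cases y)
  obtain c \<upsilon> where zz: "z = (c, \<upsilon>)" by (cases z)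
  have a: "a i \<in> carrier G" "b i \<in> carrier G" "c i \<in> carrier G" if "i \<in> {1..n}" for i
    using x y z that by (auto simp: carrier_wreath xx yy zz PiE_iff)
  have p: "\<sigma> permutes {1..n}" "\<tau> permutes {1..n}" "\<upsilon> permutes {1..n}"
    using x y z by (auto simp: carrier_wreath xx yy zz)
  show "x \<otimes>\<^bsub>?W\<^esub> y \<in> carrier ?W"
    using a p pin[OF p(1)] by (auto simp: xx yy m carrier_wreath permutes_compose)
  have "?i (\<sigma> \<circ> \<tau>) = ?i \<tau> \<circ> ?i \<sigma>"
    using p by (simp add: o_inv_distrib permutes_bij)
  then show "(x \<otimes>\<^bsub>?W\<^esub> y) \<otimes>\<^bsub>?W\<^esub> z = x \<otimes>\<^bsub>?W\<^esub> (y \<otimes>\<^bsub>?W\<^esub> z)"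
    using a pin[OF p(1)] pin[OF p(2)] by (auto simp: xx yy zz m fun_eq_iff m_assoc)
  have ae: "a \<in> extensional {1..n}" using x by (auto simp: carrier_wreath xx PiE_def)
  show "\<one>\<^bsub>?W\<^esub> \<otimes>\<^bsub>?W\<^esub> x = x"
  proof -
    have "(\<lambda>i\<in>{1..n}. \<one> \<otimes> a i) = a"
      using ae a by (intro ext) (auto simp: restrict_def extensional_def)
    moreover have "(\<lambda>i\<in>{1..n}. (\<lambda>i\<in>{1..n}. \<one>) i \<otimes> a i) = (\<lambda>i\<in>{1..n}. \<one> \<otimes> a i)"
      by (intro restrict_ext) simp
    ultimately show ?thesis by (simp only: one_wreath xx m inv_id id_apply id_o)
  qed
  show "\<exists>y\<in>carrier ?W. y \<otimes>\<^bsub>?W\<^esub> x = \<one>\<^bsub>?W\<^esub>"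
  proof (intro bexI)
    have s: "\<sigma> i \<in> {1..n}" if "i \<in> {1..n}" for i using permutes_in_image[OF p(1)] that by blast
    \<comment> \<open>A left inverse of (a, \<sigma>): in the product, entry i of the first factor
      meets a at \<sigma> i.\<close>
    show "(\<lambda>i\<in>{1..n}. inv (a (\<sigma> i)), ?i \<sigma>) \<in> carrier ?W"
      using a s permutes_inv[OF p(1)] by (auto simp: carrier_wreath)
    have "?i (?i \<sigma>) = \<sigma>" using p(1) by (simp add: permutes_inv_inv)
    moreover have "?i \<sigma> \<circ> \<sigma> = id" using p(1) by (simp add: permutes_inv_o)
    ultimately show "(\<lambda>i\<in>{1..n}. inv (a (\<sigma> i)), ?i \<sigma>) \<otimes>\<^bsub>?W\<^esub> x = \<one>\<^bsub>?W\<^esub>"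
      using a s by (auto simp: xx m one_wreath fun_eq_iff)
  qed
qed

lemma group_wreath: "group (wreath_product G n)"
proof (rule groupI)
  show "\<one>\<^bsub>wreath_product G n\<^esub> \<in> carrier (wreath_product G n)"
    by (auto simp: one_wreath carrier_wreath permutes_id)
qed (blast intro: wreath_group_axioms)+

definition pl :: "nat \<Rightarrow> 'a \<Rightarrow> nat \<Rightarrow> 'a wreath" where
  "pl n g j = (\<lambda>i\<in>{1..n}. if i = j then g else \<one>, id)"

definition sw :: "nat \<Rightarrow> nat \<Rightarrow> 'a wreath" where
  "sw n i = (\<lambda>j\<in>{1..n}. \<one>, Transposition.transpose i (Suc i))"

lemma place_eq: "place G n j g = group_elem (pl n g j)"
  by (simp add: place_def pl_def)

lemma s_elem_eq: "s_elem G n i = group_elem (sw n i)"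
  by (simp add: s_elem_def sw_def)

lemma pl_carrier: "g \<in> carrier G \<Longrightarrow> pl n g j \<in> carrier (wreath_product G n)"
  by (auto simp: pl_def carrier_wreath permutes_id)

lemma sw_carrier: "1 \<le> i \<Longrightarrow> i < n \<Longrightarrow> sw n i \<in> carrier (wreath_product G n)"
  by (auto simp: sw_def carrier_wreath permutes_swap_id)

lemma mult_wreath':
  "(a, \<sigma>) \<otimes>\<^bsub>wreath_product G n\<^esub> (b, \<tau>) = (\<lambda>i\<in>{1..n}. a i \<otimes> b (Hilbert_Choice.inv \<sigma> i), \<sigma> \<circ> \<tau>)"
  using mult_wreath[OF refl] by simp

lemma sw_sw: "1 \<le> i \<Longrightarrow> i < n \<Longrightarrow> sw n i \<otimes>\<^bsub>wreath_product G n\<^esub> sw n i = \<one>\<^bsub>wreath_product G n\<^esub>"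
  by (auto simp: sw_def mult_wreath' one_wreath fun_eq_iff Transposition.transpose_def)

lemma sw_mult: "1 \<le> i \<Longrightarrow> i < n \<Longrightarrow>
  sw n i \<otimes>\<^bsub>wreath_product G n\<^esub> (\<lambda>j\<in>{1..n}. \<one>, \<tau>) = (\<lambda>j\<in>{1..n}. \<one>, Transposition.transpose i (Suc i) \<circ> \<tau>)"
  by (auto simp: sw_def mult_wreath' fun_eq_iff Transposition.transpose_def)

lemma sw_pl: "1 \<le> i \<Longrightarrow> i < n \<Longrightarrow> g \<in> carrier G \<Longrightarrow> 1 \<le> j \<Longrightarrow> j \<le> n \<Longrightarrow>
  sw n i \<otimes>\<^bsub>wreath_product G n\<^esub> pl n g j
    = pl n g (Transposition.transpose i (Suc i) j) \<otimes>\<^bsub>wreath_product G n\<^esub> sw n i"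
  by (auto simp: sw_def pl_def mult_wreath' fun_eq_iff inv_id Transposition.transpose_def split: if_splits)

lemma pl_mult: "g \<in> carrier G \<Longrightarrow> h \<in> carrier G \<Longrightarrow>
  pl n g i \<otimes>\<^bsub>wreath_product G n\<^esub> pl n h i = pl n (g \<otimes> h) i"
  by (auto simp: pl_def mult_wreath' fun_eq_iff inv_id)

lemma pl_one: "pl n \<one> i = \<one>\<^bsub>wreath_product G n\<^esub>"
  by (auto simp: pl_def one_wreath fun_eq_iff)

lemma finite_wreath: "finite (carrier G) \<Longrightarrow> finite (carrier (wreath_product G n))"
  by (simp add: carrier_wreath finite_PiE finite_permutations)

lemma wreath_decompose:
  assumes "(a, \<sigma>) \<in> carrier (wreath_product G n)"
  shows "(a, \<sigma>) = (a, id) \<otimes>\<^bsub>wreath_product G n\<^esub> (\<lambda>i\<in>{1..n}. \<one>, \<sigma>)"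
  using assms by (auto simp: carrier_wreath mult_wreath' inv_id fun_eq_iff PiE_iff extensional_def)

end

lemma (in comm_group) pl_comm: "g \<in> carrier G \<Longrightarrow> h \<in> carrier G \<Longrightarrow>
  pl n g i \<otimes>\<^bsub>wreath_product G n\<^esub> pl n h j = pl n h j \<otimes>\<^bsub>wreath_product G n\<^esub> pl n g i"
  by (auto simp: pl_def mult_wreath' fun_eq_iff inv_id m_comm)

text \<open>Translation is a homomorphism, so each relation reduces to an identity between group
  elements.\<close>

lemma (in comm_group) wreath_module_act:
  assumes fin: "finite (carrier G)" and card: "of_nat (card (carrier G)) \<noteq> (0::'k::field)"
  shows "wreath_module (fscale :: 'k \<Rightarrow> ('a wreath \<Rightarrow> 'k) \<Rightarrow> 'a wreath \<Rightarrow> 'k) G n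
    (\<lambda>i. act (wreath_product G n) (sw n i)) (\<lambda>g i. act (wreath_product G n) (pl n g i))"
proof -
  let ?W = "wreath_product G n"
  interpret W: group ?W by (rule group_wreath)
  let ?e = "\<lambda>\<tau>. (\<lambda>j\<in>{1..n}. \<one>, \<tau> :: nat \<Rightarrow> nat) :: 'a wreath"
  note [simp] = act_add act_fscale W.act_mult[symmetric] sw_carrier pl_carrier
  have ee: "sw n i = ?e (Transposition.transpose i (Suc i))" for i by (simp add: sw_def)
  have far: "Transposition.transpose i (Suc i) \<circ> Transposition.transpose j (Suc j)
      = Transposition.transpose j (Suc j) \<circ> Transposition.transpose i (Suc i)" if "Suc i < j" for i j :: nat
    using that by (auto simp: fun_eq_iff Transposition.transpose_def)
  have braid: "Transposition.transpose i (Suc i) \<circ> (Transposition.transpose (Suc i) (Suc (Suc i)) \<circ> Transposition.transpose i (Suc i))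
      = Transposition.transpose (Suc i) (Suc (Suc i)) \<circ> (Transposition.transpose i (Suc i) \<circ> Transposition.transpose (Suc i) (Suc (Suc i)))" for i :: nat
    by (auto simp: fun_eq_iff Transposition.transpose_def)
  show ?thesis
  proof unfold_locales
    fix i j :: nat and v :: "'a wreath \<Rightarrow> 'k"
    show "act ?W (sw n i) (act ?W (sw n i) v) = v" if "1 \<le> i" "i < n"
      using that by (simp add: sw_sw W.act_one)
    show "act ?W (sw n i) (act ?W (sw n j) v) = act ?W (sw n j) (act ?W (sw n i) v)"
      if "1 \<le> i" "Suc i < j" "j < n"
    proof -
      have "sw n i \<otimes>\<^bsub>?W\<^esub> sw n j = sw n j \<otimes>\<^bsub>?W\<^esub> sw n i"
        using that far[of i j] sw_mult[of i n "Transposition.transpose j (Suc j)"]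
          sw_mult[of j n "Transposition.transpose i (Suc i)"] unfolding ee by simp
      then show ?thesis using that by simp
    qed
    show "act ?W (sw n i) (act ?W (sw n (Suc i)) (act ?W (sw n i) v))
      = act ?W (sw n (Suc i)) (act ?W (sw n i) (act ?W (sw n (Suc i)) v))" if "1 \<le> i" "Suc i < n"
    proof -
      have "sw n i \<otimes>\<^bsub>?W\<^esub> (sw n (Suc i) \<otimes>\<^bsub>?W\<^esub> sw n i) = sw n (Suc i) \<otimes>\<^bsub>?W\<^esub> (sw n i \<otimes>\<^bsub>?W\<^esub> sw n (Suc i))"
        using that braid[of i] sw_mult[of i n] sw_mult[of "Suc i" n] unfolding ee by simp
      then show ?thesis using that by simp
    qed
    show "act ?W (sw n i) (act ?W (pl n g j) v)
        = act ?W (pl n g (Transposition.transpose i (Suc i) j)) (act ?W (sw n i) v)"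
      if "1 \<le> i" "i < n" "g \<in> carrier G" "1 \<le> j" "j \<le> n" for g
      using that by (simp add: sw_pl)
    show "act ?W (pl n g i) (act ?W (pl n h j) v) = act ?W (pl n h j) (act ?W (pl n g i) v)"
      if "g \<in> carrier G" "h \<in> carrier G" for g h
      using that pl_comm[of g h n i j] by simp
    show "act ?W (pl n (g \<otimes> h) i) v = act ?W (pl n g i) (act ?W (pl n h i) v)"
      if "g \<in> carrier G" "h \<in> carrier G" for g h
      using that by (simp add: pl_mult)
    show "act ?W (pl n \<one> i) v = v" by (simp add: pl_one W.act_one)
  qed (use fin card in simp_all)
qed

text \<open>The type parameter lets one group carry complex and rational-function coefficients side
  by side.\<close>

locale wreath_field = comm_group G for G :: "('g, 'b) monoid_scheme" (structure) +
  fixes n :: nat and field_type :: "'k::field itself"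
  assumes finG: "finite (carrier G)" and cardG: "of_nat (card (carrier G)) \<noteq> (0::'k)"
begin

abbreviation "W \<equiv> wreath_product G n"

sublocale wg: finite_group W
  by (intro finite_group.intro finite_group_axioms.intro group_wreath finite_wreath finG)

sublocale wm: wreath_module "fscale :: 'k \<Rightarrow> ('g wreath \<Rightarrow> 'k) \<Rightarrow> 'g wreath \<Rightarrow> 'k" G n
    "\<lambda>i. act W (sw n i)" "\<lambda>g i. act W (pl n g i)"
  by (rule wreath_module_act[OF finG cardG])

abbreviation "A \<equiv> supp_in (carrier W) :: ('g wreath \<Rightarrow> 'k) set"

lemma lin_act: "fs.lin (act W h :: ('g wreath \<Rightarrow> 'k) \<Rightarrow> _)"
  by (simp add: fs.lin_def act_add act_fscale)

lemma lin_J: "fs.lin (wm.J i)"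
  by (simp add: fs.lin_def wm.J_add wm.J_scale)

lemma E_closed:
  assumes "fs.subspace U" "\<And>g j v. g \<in> carrier G \<Longrightarrow> v \<in> U \<Longrightarrow> act W (pl n g j) v \<in> U" "v \<in> U"
  shows "wm.E i v \<in> U"
  unfolding wm.E_def using assms by (intro fs.subspace_scale fs.subspace_sum) auto

text \<open>J_i involves only the s_j with j < i. This matters for a subspace that is stable under
  s_1, ..., s_{k-1} but need not be stable under s_k.\<close>

lemma J_closed:
  assumes U: "fs.subspace U" and Y: "\<And>g j v. g \<in> carrier G \<Longrightarrow> v \<in> U \<Longrightarrow> act W (pl n g j) v \<in> U"
  shows "v \<in> U \<Longrightarrow> (\<And>j v. 1 \<le> j \<Longrightarrow> j < i \<Longrightarrow> v \<in> U \<Longrightarrow> act W (sw n j) v \<in> U) \<Longrightarrow> wm.J i v \<in> U"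
proof (induction i v rule: wm.J.induct)
  case (3 i v)
  have s: "act W (sw n (Suc i)) u \<in> U" if "u \<in> U" for u using 3(3)[of "Suc i" u] that by simp
  have "wm.J (Suc i) (act W (sw n (Suc i)) v) \<in> U"
    by (rule 3(1)) (use s 3 in simp_all)
  then show ?case unfolding wm.J.simps
    by (intro fs.subspace_add[OF U] s E_closed[OF U Y]) (use 3 in simp_all)
qed (use fs.subspace_0[OF U] in simp_all)

lemma act_A: "h \<in> carrier W \<Longrightarrow> v \<in> A \<Longrightarrow> act W h v \<in> A" by (rule wg.act_supp)

lemma Y_A: "g \<in> carrier G \<Longrightarrow> v \<in> A \<Longrightarrow> act W (pl n g j) v \<in> A"
  by (rule act_A) (rule pl_carrier)

lemma S_A: "1 \<le> j \<Longrightarrow> j < n \<Longrightarrow> v \<in> A \<Longrightarrow> act W (sw n j) v \<in> A"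
  by (rule act_A) (rule sw_carrier)

lemma E_A: "v \<in> A \<Longrightarrow> wm.E i v \<in> A"
  by (rule E_closed[OF subspace_supp_in]) (rule Y_A)

lemma J_A: "i \<le> n \<Longrightarrow> v \<in> A \<Longrightarrow> wm.J i v \<in> A"
  by (rule J_closed[OF subspace_supp_in]) (auto intro: Y_A S_A)

lemma place_A: "g \<in> carrier G \<Longrightarrow> (place G n j g :: 'g wreath \<Rightarrow> 'k) \<in> A"
  by (simp add: place_eq wg.group_elem_closed pl_carrier)

lemma place_conv: "g \<in> carrier G \<Longrightarrow> v \<in> A \<Longrightarrow> wg.conv (place G n j g) v = act W (pl n g j) v"
  by (simp add: place_eq wg.conv_group_elem pl_carrier)

lemma s_A: "1 \<le> i \<Longrightarrow> i < n \<Longrightarrow> (s_elem G n i :: 'g wreath \<Rightarrow> 'k) \<in> A"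
  by (simp add: s_elem_eq wg.group_elem_closed sw_carrier)

lemma s_conv: "1 \<le> i \<Longrightarrow> i < n \<Longrightarrow> v \<in> A \<Longrightarrow> wg.conv (s_elem G n i) v = act W (sw n i) v"
  by (simp add: s_elem_eq wg.conv_group_elem sw_carrier)

lemma e_elem_eq: "(e_elem G n i j :: 'g wreath \<Rightarrow> 'k) = fscale (1 / of_nat (card (carrier G)))
    (\<Sum>g\<in>carrier G. wg.conv (place G n i g) (place G n j (inv g)))"
  unfolding e_elem_def wg.smult_eq
  by (subst wg.finsum_group_algebra[OF finG]) (auto intro: wg.conv_closed place_A)

lemma e_A: "(e_elem G n i j :: 'g wreath \<Rightarrow> 'k) \<in> A"
  unfolding e_elem_eq
  by (intro fs.subspace_scale fs.subspace_sum subspace_supp_in wg.conv_closed place_A) auto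

lemma e_conv: "v \<in> A \<Longrightarrow> wg.conv (e_elem G n i (Suc i)) v = wm.E i v"
proof -
  assume v: "v \<in> A"
  have "wg.conv (wg.conv (place G n i g) (place G n (Suc i) (inv g))) v = act W (pl n g i) (act W (pl n (inv g) (Suc i)) v)"
    if g: "g \<in> carrier G" for g
    unfolding wg.conv_assoc[OF place_A[OF inv_closed[OF g]] v] using g v by (simp add: place_conv Y_A)
  then show ?thesis
    unfolding e_elem_eq wg.conv_scale_left[OF v] wg.conv_sum_left[OF v] wm.E_def by simp
qed

lemma jm_A_conv:
  "i \<le> n \<Longrightarrow> (jm_elem G n i :: 'g wreath \<Rightarrow> 'k) \<in> A \<and> (\<forall>v\<in>A. wg.conv (jm_elem G n i) v = wm.J i v)"
proof (induction i rule: induct_nat_012[case_names zero one step])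
  case zero
  have "wg.conv (0 :: 'g wreath \<Rightarrow> 'k) v = 0" if "v \<in> A" for v
    using wg.conv_scale_left[OF that, of 0 0] by simp
  then show ?case
    unfolding jm_elem.simps wg.zero_eq wm.J.simps using fs.subspace_0[OF subspace_supp_in] by blast
next
  case one
  have "wg.conv (0 :: 'g wreath \<Rightarrow> 'k) v = 0" if "v \<in> A" for v
    using wg.conv_scale_left[OF that, of 0 0] by simp
  then show ?case
    unfolding jm_elem.simps wg.zero_eq wm.J.simps using fs.subspace_0[OF subspace_supp_in] by blast
next
  case (step i)
  have i: "1 \<le> Suc i" "Suc i < n" using step by auto
  have IH: "jm_elem G n (Suc i) \<in> A" "\<And>v. v \<in> A \<Longrightarrow> wg.conv (jm_elem G n (Suc i)) v = wm.J (Suc i) v"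
    using step by auto
  note sA = s_A[OF i]
  have m1: "wg.conv (wg.conv (s_elem G n (Suc i)) (jm_elem G n (Suc i))) (s_elem G n (Suc i)) \<in> A"
    "wg.conv (e_elem G n (Suc i) (Suc (Suc i))) (s_elem G n (Suc i)) \<in> A"
    using sA by auto
  have "wg.conv (jm_elem G n (Suc (Suc i))) v = wm.J (Suc (Suc i)) v" if v: "v \<in> A" for v
  proof -
    have sv: "wg.conv (s_elem G n (Suc i)) v \<in> A" by (rule wg.conv_closed[OF v])
    have Jv: "wm.J (Suc i) (act W (sw n (Suc i)) v) \<in> A"
      by (rule J_A) (use i S_A[OF i v] in simp_all)
    show ?thesis
      unfolding jm_elem.simps wg.add_eq wg.conv_add_left[OF v] wg.conv_assoc[OF sA v]
        wg.conv_assoc[OF IH(1) sv] IH(2)[OF sv] e_conv[OF sv] wm.J.simps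
      by (simp only: s_conv[OF i v] s_conv[OF i Jv])
  qed
  moreover have "(jm_elem G n (Suc (Suc i)) :: 'g wreath \<Rightarrow> 'k) \<in> A"
    unfolding jm_elem.simps wg.add_eq by (rule fs.subspace_add[OF subspace_supp_in m1])
  ultimately show ?case by blast
qed

lemma jm_A: "i \<le> n \<Longrightarrow> (jm_elem G n i :: 'g wreath \<Rightarrow> 'k) \<in> A"
  using jm_A_conv by blast

lemma jm_conv: "i \<le> n \<Longrightarrow> v \<in> A \<Longrightarrow> wg.conv (jm_elem G n i) v = wm.J i v"
  using jm_A_conv by blast

lemma bax_A: "1 \<le> i \<Longrightarrow> i < n \<Longrightarrow> (s_baxter G n i c c' :: 'g wreath \<Rightarrow> 'k) \<in> A"
  unfolding s_baxter_def wg.add_eq wg.smult_eq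
  by (intro fs.subspace_add[OF subspace_supp_in] fs.subspace_scale[OF subspace_supp_in] s_A e_A)

lemma bax_conv: "1 \<le> i \<Longrightarrow> i < n \<Longrightarrow> v \<in> A \<Longrightarrow> wg.conv (s_baxter G n i c c') v = wm.bax i c c' v"
  by (simp add: s_baxter_def wg.add_eq wg.smult_eq wg.conv_add_left wg.conv_scale_left s_conv e_conv wm.bax_def)

lemma bax_op_A: "1 \<le> i \<Longrightarrow> i < n \<Longrightarrow> v \<in> A \<Longrightarrow> wm.bax i c c' v \<in> A"
  unfolding wm.bax_def
  by (intro fs.subspace_add[OF subspace_supp_in] fs.subspace_scale[OF subspace_supp_in] S_A E_A)

lemma fus_A: "l < n \<Longrightarrow> v \<in> A \<Longrightarrow> wm.fus l c u v \<in> A"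
proof (induction l arbitrary: v)
  case (Suc l)
  then show ?case unfolding wm.fus.simps by (intro bax_op_A Suc.IH S_A) auto
qed simp

text \<open>Only the term of \<open>fus l c u\<close> that takes the transposition \<open>s_i\<close> in every factor fixes \<open>l + 1\<close>.\<close>

lemma fus_support:
  assumes z: "l < n" "y \<in> A" "\<And>x. y x \<noteq> 0 \<Longrightarrow> snd x z = Suc l"
  shows "wm.fus l c u y - y \<in> {v\<in>A. \<forall>x. v x \<noteq> 0 \<longrightarrow> snd x z \<le> l}"
  using assms
proof (induction l arbitrary: y)
  case 0
  then show ?case by (simp add: supp_in_def)
next
  case (Suc l)
  \<comment> \<open>Functions supported where z is sent to at most l; the action of G^n does not
    change the image of z.\<close>
  let ?U = "\<lambda>l. {v\<in>A. \<forall>x. v x \<noteq> 0 \<longrightarrow> snd x z \<le> l}"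
  let ?S = "act W (sw n (Suc l))"
  have sub: "fs.subspace (?U l)" for l
    using subspace_supp_in[of "carrier W"] by (auto simp: fs.subspace_def fscale_def) (metis add_0)
  have l: "1 \<le> Suc l" "Suc l < n" using Suc by auto
  have sinv: "inv\<^bsub>W\<^esub> (sw n (Suc l)) = sw n (Suc l)"
    using wg.inv_equality[of "sw n (Suc l)" "sw n (Suc l)"] sw_carrier[OF l] sw_sw[OF l] by simp
  have Sx: "?S v x = v (sw n (Suc l) \<otimes>\<^bsub>W\<^esub> x)" if "x \<in> carrier W" for v :: "'g wreath \<Rightarrow> 'k" and x
    using that by (simp add: act_def sinv)
  have snd_sw: "snd (sw n (Suc l) \<otimes>\<^bsub>W\<^esub> x) z = Transposition.transpose (Suc l) (Suc (Suc l)) (snd x z)" for x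
    by (cases x) (simp add: sw_def mult_wreath')
  have nz: "x \<in> carrier W" if "v x \<noteq> 0" "v \<in> A" for v x using that unfolding supp_in_def by blast
  have pl_snd: "snd (inv\<^bsub>W\<^esub> (pl n g j) \<otimes>\<^bsub>W\<^esub> x) z = snd x z" if "g \<in> carrier G" for g j x
  proof -
    have "inv\<^bsub>W\<^esub> (pl n g j) = pl n (inv g) j"
      by (rule wg.inv_equality) (use that in \<open>simp_all add: pl_mult pl_one pl_carrier\<close>)
    then show ?thesis by (cases x) (simp add: pl_def mult_wreath' inv_id)
  qed
  have Ysub: "act W (pl n g j) v \<in> ?U l'" if "g \<in> carrier G" "v \<in> ?U l'" for g j v l'
  proof -
    have "snd x z \<le> l'" if x: "act W (pl n g j) v x \<noteq> 0" for x
    proof (cases "x \<in> carrier W")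
      case True
      then have "v (inv\<^bsub>W\<^esub> (pl n g j) \<otimes>\<^bsub>W\<^esub> x) \<noteq> 0" using x by (simp add: act_def)
      then have "snd (inv\<^bsub>W\<^esub> (pl n g j) \<otimes>\<^bsub>W\<^esub> x) z \<le> l'" using \<open>v \<in> ?U l'\<close> by blast
      then show ?thesis using pl_snd[OF \<open>g \<in> carrier G\<close>] by simp
    next
      case False
      then have "v x \<noteq> 0" using x by (simp add: act_def)
      then show ?thesis using \<open>v \<in> ?U l'\<close> by blast
    qed
    then show ?thesis using that Y_A[of g v j] by blast
  qed
  have EU: "wm.E i v \<in> ?U l'" if "v \<in> ?U l'" for i v l'
    by (rule E_closed[OF sub _ that]) (rule Ysub)
  \<comment> \<open>The induction hypothesis applies to s_{l+1} y, whose support sends z to l + 1,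
    and controls the error made there.\<close>
  define r where "r = wm.fus l c u (?S y) - ?S y"
  have SyA: "?S y \<in> A" using S_A[OF l Suc.prems(2)] .
  have r: "r \<in> ?U l"
    unfolding r_def
  proof (rule Suc.IH)
    fix x assume x: "?S y x \<noteq> 0"
    have xc: "x \<in> carrier W" by (rule nz[OF x SyA])
    then have "Transposition.transpose (Suc l) (Suc (Suc l)) (snd x z) = Suc (Suc l)"
      using Suc.prems(3)[of "sw n (Suc l) \<otimes>\<^bsub>W\<^esub> x"] x by (simp add: Sx snd_sw)
    then show "snd x z = Suc l" by (auto simp: Transposition.transpose_def split: if_splits)
  qed (use Suc.prems SyA in auto)
  have Sy: "?S y \<in> ?U (Suc l)"
  proof -
    have "snd x z \<le> Suc l" if x: "?S y x \<noteq> 0" for x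
    proof -
      have "Transposition.transpose (Suc l) (Suc (Suc l)) (snd x z) = Suc (Suc l)"
        using Suc.prems(3)[of "sw n (Suc l) \<otimes>\<^bsub>W\<^esub> x"] x nz[OF x SyA] by (simp add: Sx snd_sw)
      then show ?thesis by (auto simp: Transposition.transpose_def split: if_splits)
    qed
    then show ?thesis using SyA by auto
  qed
  have Sr: "?S r \<in> ?U (Suc l)"
  proof -
    have SrA: "?S r \<in> A" using r by (intro S_A[OF l]) auto
    have "snd x z \<le> Suc l" if x: "?S r x \<noteq> 0" for x
    proof -
      have "Transposition.transpose (Suc l) (Suc (Suc l)) (snd x z) \<le> l"
      proof -
        have "r (sw n (Suc l) \<otimes>\<^bsub>W\<^esub> x) \<noteq> 0" using x nz[OF x SrA] by (simp add: Sx)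
        then have "snd (sw n (Suc l) \<otimes>\<^bsub>W\<^esub> x) z \<le> l" using r by blast
        then show ?thesis by (simp only: snd_sw)
      qed
      then show ?thesis by (auto simp: Transposition.transpose_def split: if_splits)
    qed
    then show ?thesis using SrA by auto
  qed
  have r': "r \<in> ?U (Suc l)" using r le_SucI by blast
  \<comment> \<open>The outer s_{l+1} turns s_{l+1} y back into y. In all other terms z goes to at
    most l + 1, as E moves no place and s_{l+1} fixes the places up to l.\<close>
  have f: "wm.fus l c u (?S y) = ?S y + r" by (simp add: r_def)
  have "wm.fus (Suc l) c u y = ?S (?S y) + ?S r + fscale (1 / (u - c (Suc l))) (wm.E (Suc l) (?S y) + wm.E (Suc l) r)"
    by (simp only: wm.fus.simps f wm.bax_def wm.S_add wm.E_add)
  then have "wm.fus (Suc l) c u y - y = ?S r + fscale (1 / (u - c (Suc l))) (wm.E (Suc l) (?S y) + wm.E (Suc l) r)"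
    using wm.S_S[OF l, of y] by (simp only: add_diff_cancel_left' add.assoc)
  also have "\<dots> \<in> ?U (Suc l)"
    by (intro fs.subspace_add[OF sub] fs.subspace_scale[OF sub] Sr EU Sy r')
  finally show ?case .
qed

end

text \<open>C holds the possible poles of the sum, N the zeros and M the poles of f. Clearing
  denominators gives two polynomials that agree on the infinite set X. At b the right side vanishes
  because b is in C, and on the left only the term of b itself can survive; as \<open>r b\<close> is
  nonzero, b is a root of the numerator.\<close>

lemma pole_is_zero:
  fixes C N M :: "complex set"
  assumes fin: "finite C" "finite N" "finite M" and b: "b \<in> C" "r b \<noteq> 0" and X: "infinite X"
    and eq: "\<And>u. u \<in> X \<Longrightarrow> u \<notin> C \<and> f u * (\<Prod>z\<in>M. u - z) = (\<Prod>z\<in>N. u - z) \<and>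
      (\<Sum>b'\<in>C. r b' * (f u / (u - b'))) = w"
  shows "b \<in> N"
proof -
  let ?l = "\<lambda>z::complex. [:- z, 1:]"
  define P where "P = (\<Prod>z\<in>N. ?l z) * (\<Sum>b'\<in>C. smult (r b') (\<Prod>b''\<in>C - {b'}. ?l b''))"
  define Q where "Q = smult w ((\<Prod>z\<in>M. ?l z) * (\<Prod>b''\<in>C. ?l b''))"
  have "poly P u = poly Q u" if u: "u \<in> X" for u
  proof -
    have uC: "u \<notin> C" using eq[OF u] by blast
    have *: "(\<Prod>b''\<in>C. u - b'') / (u - b') = (\<Prod>b''\<in>C - {b'}. u - b'')" if "b' \<in> C" for b'
      using that uC fin(1) by (subst prod.remove[of C b']) auto
    have "poly P u = (\<Prod>z\<in>N. u - z) * (\<Sum>b'\<in>C. r b' * (\<Prod>b''\<in>C - {b'}. u - b''))"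
      by (simp add: P_def poly_prod poly_sum)
    also have "\<dots> = (\<Sum>b'\<in>C. (\<Prod>z\<in>M. u - z) * (\<Prod>b''\<in>C. u - b'') * (r b' * (f u / (u - b'))))"
      unfolding sum_distrib_left
    proof (intro sum.cong refl)
      fix b' assume b': "b' \<in> C"
      show "(\<Prod>z\<in>N. u - z) * (r b' * (\<Prod>b''\<in>C - {b'}. u - b''))
        = (\<Prod>z\<in>M. u - z) * (\<Prod>b''\<in>C. u - b'') * (r b' * (f u / (u - b')))"
        using eq[OF u] *[OF b', symmetric] by (simp add: mult_ac)
    qed
    also have "\<dots> = (\<Prod>z\<in>M. u - z) * (\<Prod>b''\<in>C. u - b'') * w"
      using eq[OF u] by (simp only: sum_distrib_left[symmetric])
    also have "\<dots> = poly Q u" by (simp add: Q_def poly_prod)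
    finally show ?thesis .
  qed
  then have "X \<subseteq> {u. poly (P - Q) u = 0}" by auto
  then have "P = Q" using X poly_roots_finite[of "P - Q"] finite_subset by auto
  then have "poly P b = poly Q b" by simp
  moreover have "poly Q b = 0" using b fin by (simp add: Q_def poly_prod)
  moreover have "poly P b = (\<Prod>z\<in>N. b - z) * (r b * (\<Prod>b''\<in>C - {b}. b - b''))"
  proof -
    have "(\<Sum>b'\<in>C. r b' * (\<Prod>b''\<in>C - {b'}. b - b'')) = (\<Sum>b'\<in>{b}. r b' * (\<Prod>b''\<in>C - {b'}. b - b''))"
      by (rule sum.mono_neutral_right) (use b fin in auto)
    then show ?thesis by (simp add: P_def poly_prod poly_sum)
  qed
  moreover have "(\<Prod>b''\<in>C - {b}. b - b'') \<noteq> 0" using fin by auto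
  ultimately have "(\<Prod>z\<in>N. b - z) = 0" using b by simp
  then show ?thesis using fin by auto
qed

section \<open>Weights of the regular module\<close>

locale wreath_characters = wreath_field G n "TYPE(complex)" for G :: "('g, 'b) monoid_scheme" (structure) and n +
  fixes m :: nat and \<rho> :: "nat \<Rightarrow> 'g \<Rightarrow> complex"
  assumes rho: "bij_betw \<rho> {1..m} (linear_characters G)"
begin

lemma rho_linear: "p \<in> {1..m} \<Longrightarrow> \<rho> p \<in> linear_characters G"
  using rho by (auto simp: bij_betw_def)

lemma rho_is_char: "p \<in> {1..m} \<Longrightarrow> wm.is_char (\<rho> p)"
  using rho_linear[of p] by (simp add: linear_characters_def wm.is_char_def)

lemma rho_inject:
  assumes "p \<in> {1..m}" "q \<in> {1..m}" "\<And>g. g \<in> carrier G \<Longrightarrow> \<rho> p g = \<rho> q g" shows "p = q"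
proof -
  have "\<rho> p \<in> extensional (carrier G)" "\<rho> q \<in> extensional (carrier G)"
    using rho_linear[OF assms(1)] rho_linear[OF assms(2)] by (simp_all add: linear_characters_def)
  then have "\<rho> p = \<rho> q" using assms(3) by (rule extensionalityI)
  then show ?thesis by (rule inj_onD[OF bij_betw_imp_inj_on[OF rho] _ assms(1,2)])
qed

sublocale cm: weighted_module "fscale :: complex \<Rightarrow> ('g wreath \<Rightarrow> complex) \<Rightarrow> 'g wreath \<Rightarrow> complex" G n
    "\<lambda>i. act W (sw n i)" "\<lambda>g i. act W (pl n g i)" m \<rho>
proof unfold_locales
  show "wm.is_char (\<rho> p)" if "p \<in> {1..m}" for p using rho_is_char[OF that] .
  show "p = q" if "p \<in> {1..m}" "q \<in> {1..m}" "wm.same (\<rho> p) (\<rho> q)" for p q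
    using rho_inject that by (auto simp: wm.same_def)
qed

section \<open>The commuting family, its adjoints and its joint weights\<close>

abbreviation ipw :: "('g wreath \<Rightarrow> complex) \<Rightarrow> ('g wreath \<Rightarrow> complex) \<Rightarrow> complex" where
  "ipw \<equiv> ip (carrier W)"

text \<open>One index type for both kinds of commuting operators, so that \<open>joint_eigen\<close>
  applies to all of them at once.\<close>

fun weight_op :: "('g \<times> nat) + nat \<Rightarrow> ('g wreath \<Rightarrow> complex) \<Rightarrow> 'g wreath \<Rightarrow> complex" where
  "weight_op (Inl (g, i)) v = act W (pl n g i) v"
| "weight_op (Inr i) v = wm.J i v"

text \<open>G acts at all n places, but only the first k Jucys-Murphy operators are taken: the step
  from k to k + 1 uses a subspace that need not be stable under the later ones.\<close>

definition ops :: "nat \<Rightarrow> (('g \<times> nat) + nat) set" where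
  "ops k = Inl ` (carrier G \<times> {1..n}) \<union> Inr ` {1..k}"

lemma finite_ops: "finite (ops k)" by (simp add: ops_def finG)

lemma ops_cases:
  assumes "a \<in> ops k"
  obtains g i where "a = Inl (g, i)" "g \<in> carrier G" "i \<in> {1..n}" | i where "a = Inr i" "i \<in> {1..k}"
  using assms by (auto simp: ops_def)

lemma op_lin: "fs.lin (weight_op a)"
proof (cases a)
  case (Inl x)
  then show ?thesis using lin_act by (cases x) (simp add: fs.lin_def)
next
  case (Inr i)
  then show ?thesis using lin_J[of i] by (simp add: fs.lin_def)
qed

lemma op_A: "a \<in> ops n \<Longrightarrow> v \<in> A \<Longrightarrow> weight_op a v \<in> A"
  by (erule ops_cases) (simp_all add: Y_A J_A)

lemma op_comm: "a \<in> ops n \<Longrightarrow> b \<in> ops n \<Longrightarrow> weight_op a (weight_op b v) = weight_op b (weight_op a v)"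
  by (erule ops_cases; erule ops_cases) (simp_all add: wm.Y_Y wm.Y_J wm.J_commute)

lemma sw_inv: "1 \<le> i \<Longrightarrow> i < n \<Longrightarrow> inv\<^bsub>W\<^esub> (sw n i) = sw n i"
  by (rule wg.inv_equality) (simp_all add: sw_sw sw_carrier)

lemma pl_inv: "g \<in> carrier G \<Longrightarrow> inv\<^bsub>W\<^esub> (pl n g j) = pl n (inv g) j"
  by (rule wg.inv_equality) (simp_all add: pl_mult pl_one pl_carrier)

lemma S_adj: "1 \<le> i \<Longrightarrow> i < n \<Longrightarrow> ipw (act W (sw n i) v) w = ipw v (act W (sw n i) w)"
  by (simp add: wg.ip_act_left sw_carrier sw_inv)

lemma Y_adj: "g \<in> carrier G \<Longrightarrow> ipw (act W (pl n g i) v) w = ipw v (act W (pl n (inv g) i) w)"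
  by (simp add: wg.ip_act_left pl_carrier pl_inv)

text \<open>Taking adjoints replaces g by its inverse, which only permutes the summands.\<close>

lemma E_adj: assumes "1 \<le> i" "i < n" shows "ipw (wm.E i v) w = ipw v (wm.E i w)"
proof -
  have 1: "ipw (act W (pl n g i) (act W (pl n (inv g) (Suc i)) v)) w
      = ipw v (act W (pl n (inv g) i) (act W (pl n (inv (inv g)) (Suc i)) w))" if "g \<in> carrier G" for g
    using that assms wm.Y_Y[of g "inv g" "Suc i" i w] by (simp add: Y_adj)
  have "(\<Sum>g\<in>carrier G. ipw (act W (pl n g i) (act W (pl n (inv g) (Suc i)) v)) w)
      = (\<Sum>g\<in>carrier G. ipw v (act W (pl n (inv g) i) (act W (pl n (inv (inv g)) (Suc i)) w)))"
    by (intro sum.cong refl 1)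
  also have "\<dots> = (\<Sum>g\<in>carrier G. ipw v (act W (pl n g i) (act W (pl n (inv g) (Suc i)) w)))"
    by (rule wm.sum_inv)
  finally show ?thesis
    unfolding wm.E_def ip_scale_left ip_scale_right ip_sum_left ip_sum_right by simp
qed

lemma J_adj: "i \<le> n \<Longrightarrow> ipw (wm.J i v) w = ipw v (wm.J i w)"
proof (induction i v arbitrary: w rule: wm.J.induct)
  case (3 i v)
  have i: "1 \<le> Suc i" "Suc i < n" using 3 by auto
  have "ipw (act W (sw n (Suc i)) (wm.J (Suc i) (act W (sw n (Suc i)) v))) w
     = ipw v (act W (sw n (Suc i)) (wm.J (Suc i) (act W (sw n (Suc i)) w)))"
    unfolding S_adj[OF i] by (subst 3(1)) (use i in \<open>simp_all add: S_adj\<close>)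
  moreover have "ipw (wm.E (Suc i) (act W (sw n (Suc i)) v)) w = ipw v (wm.E (Suc i) (act W (sw n (Suc i)) w))"
    by (simp only: S_adj[OF i] E_adj[OF i] wm.S_E[OF i])
  ultimately show ?case unfolding wm.J.simps ip_add_left ip_add_right by simp
qed simp_all

lemma op_diagonalizable:
  assumes a: "a \<in> ops n"
  shows "\<exists>cs. distinct cs \<and> (\<forall>v\<in>A. fold (fs.shift (weight_op a)) cs v = 0)"
  using a
proof (cases rule: ops_cases)
  case (1 g i)
  show ?thesis
  proof (rule normal_diagonalizable[of _ _ "weight_op (Inl (inv g, i))"])
    show "weight_op a ` A \<subseteq> A" "weight_op (Inl (inv g, i)) ` A \<subseteq> A"
      using 1 op_A[OF a] op_A[of "Inl (inv g, i)"] by (auto simp: ops_def)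
    show "weight_op a (weight_op (Inl (inv g, i)) v) = weight_op (Inl (inv g, i)) (weight_op a v)" for v
      by (rule op_comm[OF a]) (use 1 in \<open>auto simp: ops_def\<close>)
  qed (use 1 in \<open>simp_all add: wg.fin op_lin Y_adj\<close>)
next
  case (2 i)
  show ?thesis
    by (rule normal_diagonalizable[of _ _ "weight_op a"])
      (use 2 op_A[OF a] in \<open>auto simp: wg.fin op_lin J_adj\<close>)
qed

text \<open>The list contains every eigenvalue on A but may contain other numbers, so the component
  attached to a weight may be zero.\<close>

definition spec :: "('g \<times> nat) + nat \<Rightarrow> complex list" where
  "spec a = (SOME cs. distinct cs \<and> (\<forall>v\<in>A. fold (fs.shift (weight_op a)) cs v = 0))"

lemma spec: "a \<in> ops n \<Longrightarrow> distinct (spec a) \<and> (\<forall>v\<in>A. fold (fs.shift (weight_op a)) (spec a) v = 0)"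
  unfolding spec_def by (rule someI_ex) (rule op_diagonalizable)

abbreviation "weights k \<equiv> PiE (ops k) (\<lambda>a. set (spec a))"

lemma ops_mono: "k \<le> n \<Longrightarrow> ops k \<subseteq> ops n" by (auto simp: ops_def)

lemma weight_decomposition:
  assumes k: "k \<le> n" and U: "fs.subspace U" "U \<subseteq> A" "\<And>a u. a \<in> ops k \<Longrightarrow> u \<in> U \<Longrightarrow> weight_op a u \<in> U"
    and v: "v \<in> U"
  shows "\<exists>w. (\<forall>\<beta>\<in>weights k. w \<beta> \<in> U \<and> (\<forall>a\<in>ops k. weight_op a (w \<beta>) = fscale (\<beta> a) (w \<beta>)))
    \<and> v = (\<Sum>\<beta>\<in>weights k. w \<beta>)"
proof (rule fs.joint_eigen[OF finite_ops op_lin _ _ _ U(1) _ v])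
  have opn: "a \<in> ops n" if "a \<in> ops k" for a using that ops_mono[OF k] by blast
  show "distinct (spec a)" if "a \<in> ops k" for a using spec[OF opn[OF that]] by blast
  show "fold (fs.shift (weight_op a)) (spec a) u = 0" if "a \<in> ops k" "u \<in> U" for a u
    using spec[OF opn[OF that(1)]] U(2) that(2) by blast
  show "weight_op a (weight_op b u) = weight_op b (weight_op a u)" if "a \<in> ops k" "b \<in> ops k" for a b u
    by (rule op_comm) (use that opn in blast)+
  show "weight_op a ` U \<subseteq> U" if "a \<in> ops k" for a using U(3)[OF that] by blast
qed

text \<open>Eigenvalues of g_i have modulus 1 by unitarity, those of J_i are real by
  self-adjointness; in both cases comparing the two expressions of one inner product forces it to
  vanish.\<close>

lemma orthogonal:
  assumes a: "a \<in> ops n" and v: "v \<in> A" "weight_op a v = fscale \<alpha> v" and w: "weight_op a w = fscale \<beta> w"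
    and ne: "\<alpha> \<noteq> \<beta>"
  shows "ipw v w = 0"
proof (cases "v = 0")
  case False
  then have vv: "ipw v v \<noteq> 0" using ip_eq_0[OF wg.fin v(1)] by blast
  show ?thesis using a
  proof (cases rule: ops_cases)
    case (1 g i)
    have u: "ipw (weight_op a x) (weight_op a y) = ipw x y" for x y
      using 1 by (simp add: wg.ip_act pl_carrier)
    have "(cnj \<alpha> * \<alpha>) * ipw v v = 1 * ipw v v"
      using u[of v v] unfolding v(2) ip_scale_left ip_scale_right by (simp only: mult_ac mult_1_left)
    then have 1: "cnj \<alpha> * \<alpha> = 1" using vv unfolding mult_cancel_right by blast
    have "(cnj \<alpha> * \<beta>) * ipw v w = 1 * ipw v w"
      using u[of v w] unfolding v(2) w ip_scale_left ip_scale_right by (simp only: mult_ac mult_1_left)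
    then have "ipw v w = 0 \<or> cnj \<alpha> * \<beta> = cnj \<alpha> * \<alpha>" unfolding mult_cancel_right 1 by blast
    moreover have "cnj \<alpha> \<noteq> 0" using 1 by auto
    ultimately show ?thesis using ne by simp
  next
    case (2 i)
    have u: "ipw (weight_op a x) y = ipw x (weight_op a y)" for x y
      using 2 by (simp add: J_adj)
    have "cnj \<alpha> * ipw v v = \<alpha> * ipw v v" using u[of v v] v(2) by (simp add: ip_scale_left ip_scale_right)
    then have 1: "cnj \<alpha> = \<alpha>" using vv by simp
    have "\<alpha> * ipw v w = \<beta> * ipw v w" using u[of v w] v(2) w 1 by (simp add: ip_scale_left ip_scale_right)
    then show ?thesis using ne by simp
  qed
qed simp

lemma orthogonal_weights:
  assumes "k \<le> n" "v \<in> A" "\<And>a. a \<in> ops k \<Longrightarrow> weight_op a v = fscale (\<alpha> a) v"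
    "\<And>a. a \<in> ops k \<Longrightarrow> weight_op a w = fscale (\<beta> a) w" "a \<in> ops k" "\<alpha> a \<noteq> \<beta> a"
  shows "ipw v w = 0"
  using orthogonal[of a v "\<alpha> a" w "\<beta> a"] assms ops_mono[OF assms(1)] by auto

lemma eigenvalue_character:
  assumes i: "i \<in> {1..n}" and v: "v \<noteq> 0" and ev: "\<And>g. g \<in> carrier G \<Longrightarrow> act W (pl n g i) v = fscale (\<chi> g) v"
  shows "\<exists>q\<in>{1..m}. \<forall>g\<in>carrier G. \<chi> g = \<rho> q g"
proof -
  have inj: "a = b" if "fscale a v = fscale b v" for a b using that v by simp
  have mult: "\<chi> (g \<otimes> h) = \<chi> g * \<chi> h" if "g \<in> carrier G" "h \<in> carrier G" for g h
  proof (rule inj)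
    have "fscale (\<chi> (g \<otimes> h)) v = act W (pl n g i) (act W (pl n h i) v)"
      using that i ev[of "g \<otimes> h"] wm.Y_mult[of g h i v] by simp
    then show "fscale (\<chi> (g \<otimes> h)) v = fscale (\<chi> g * \<chi> h) v"
      using that by (simp add: ev act_fscale mult.commute)
  qed
  have one: "\<chi> \<one> = 1"
    by (rule inj) (use ev[of \<one>] wm.Y_one[of i v] i in simp)
  have "\<chi> g \<noteq> 0" if "g \<in> carrier G" for g
    using mult[of g "inv g"] that one by auto
  then have "restrict \<chi> (carrier G) \<in> linear_characters G"
    using mult by (auto simp: linear_characters_def)
  then obtain q where "q \<in> {1..m}" "restrict \<chi> (carrier G) = \<rho> q"
    using rho unfolding bij_betw_def by blast
  then show ?thesis by (metis restrict_apply')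
qed

definition wfun :: "(nat \<Rightarrow> nat) \<Rightarrow> (nat \<Rightarrow> complex) \<Rightarrow> ('g \<times> nat) + nat \<Rightarrow> complex" where
  "wfun p c a = (case a of Inl (g, i) \<Rightarrow> \<rho> (p i) g | Inr i \<Rightarrow> c i)"

lemma wt_iff: "cm.wt p c v \<longleftrightarrow> (\<forall>a\<in>ops n. weight_op a v = fscale (wfun p c a) v)"
proof
  assume L: "cm.wt p c v"
  show "\<forall>a\<in>ops n. weight_op a v = fscale (wfun p c a) v"
  proof
    fix a assume "a \<in> ops n"
    then show "weight_op a v = fscale (wfun p c a) v"
      by (cases rule: ops_cases) (use L in \<open>simp_all add: cm.wt_def wm.eig_def wfun_def\<close>)
  qed
next
  assume R: "\<forall>a\<in>ops n. weight_op a v = fscale (wfun p c a) v"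
  have "act W (pl n g i) v = fscale (\<rho> (p i) g) v" if "g \<in> carrier G" "i \<in> {1..n}" for g i
    using bspec[OF R, of "Inl (g, i)"] that by (simp add: ops_def wfun_def)
  moreover have "wm.J i v = fscale (c i) v" if "i \<in> {1..n}" for i
    using bspec[OF R, of "Inr i"] that by (simp add: ops_def wfun_def)
  ultimately show "cm.wt p c v" unfolding cm.wt_def wm.eig_def by blast
qed

text \<open>One step of the branching rule. Paired with a delta function in the support of v, the
  fusion operator acts as the identity, whereas on the J_{k+1}-components it has poles 1 / (u - b).
  The eigenvalue c_{k+1} must therefore be a zero of the numerator.\<close>

lemma addable_weight:
  assumes v: "v \<in> A" "v \<noteq> 0" "cm.wt p c v" and p: "p \<in> {1..n} \<rightarrow> {1..m}" and k: "k < n"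
    and \<nu>: "is_path m \<nu> k" "\<And>i. i \<in> {1..k} \<Longrightarrow> position (\<nu> i) = p i \<and> of_int (Defs.content (\<nu> i)) = c i"
  shows "\<exists>\<theta>. addable (\<nu> ` {1..k}) \<theta> \<and> position \<theta> = p (Suc k) \<and> of_int (Defs.content \<theta>) = c (Suc k)"
proof -
  define q where "q = p (Suc k)"
  define D where "D = \<nu> ` {1..k}"
  have q: "q \<in> {1..m}" using p k by (auto simp: q_def)
  have D: "lower D" unfolding D_def by (rule is_path_lower[OF \<nu>(1)])
  obtain L where L: "\<And>p x. L < x \<Longrightarrow> rowlen D p x = 0" using row_bound[OF D] by blast
  obtain h where h: "v h \<noteq> 0" using v(2) by (metis ext zero_fun_apply)
  then have hW: "h \<in> carrier W" using v(1) unfolding supp_in_def by blast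
  have hp: "snd h permutes {1..n}" using hW by (cases h) (auto simp: carrier_wreath)
  \<comment> \<open>z is the point that h sends to k + 1; left multiplication by s_1, ..., s_{k-1}
    and by G^n preserves this.\<close>
  define z where "z = Hilbert_Choice.inv (snd h) (Suc k)"
  have hz: "snd h z = Suc k" unfolding z_def using hp by (simp add: permutes_inverses)
  define U where "U = {u\<in>A. \<forall>x. u x \<noteq> 0 \<longrightarrow> snd x z = Suc k}"
  have subU: "fs.subspace U"
    using subspace_supp_in[of "carrier W"] unfolding U_def
    by (auto simp: fs.subspace_def fscale_def) (metis add_0)
  have YU: "act W (pl n g j) u \<in> U" if "g \<in> carrier G" "u \<in> U" for g j u
  proof -
    have s: "snd (inv\<^bsub>W\<^esub> (pl n g j) \<otimes>\<^bsub>W\<^esub> x) z = snd x z" for x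
      unfolding pl_inv[OF that(1)] by (cases x) (simp add: pl_def mult_wreath' inv_id)
    have "snd x z = Suc k" if x: "act W (pl n g j) u x \<noteq> 0" for x
    proof (cases "x \<in> carrier W")
      case True
      then have "u (inv\<^bsub>W\<^esub> (pl n g j) \<otimes>\<^bsub>W\<^esub> x) \<noteq> 0" using x by (simp add: act_def)
      then have "snd (inv\<^bsub>W\<^esub> (pl n g j) \<otimes>\<^bsub>W\<^esub> x) z = Suc k" using \<open>u \<in> U\<close> unfolding U_def by blast
      then show ?thesis by (simp only: s)
    next
      case False
      then have "u x \<noteq> 0" using x by (simp add: act_def)
      then show ?thesis using \<open>u \<in> U\<close> unfolding U_def by blast
    qed
    then show ?thesis using Y_A[OF that(1), of u j] \<open>u \<in> U\<close> unfolding U_def by blast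
  qed
  have SU: "act W (sw n j) u \<in> U" if j: "1 \<le> j" "j < k" and u: "u \<in> U" for j u
  proof -
    have jn: "j < n" using j k by simp
    have "snd x z = Suc k" if x: "act W (sw n j) u x \<noteq> 0" for x
    proof (cases "x \<in> carrier W")
      case True
      then have "u (sw n j \<otimes>\<^bsub>W\<^esub> x) \<noteq> 0" using x by (simp add: act_def sw_inv[OF j(1) jn])
      then have "snd (sw n j \<otimes>\<^bsub>W\<^esub> x) z = Suc k" using u unfolding U_def by blast
      moreover have "snd (sw n j \<otimes>\<^bsub>W\<^esub> x) z = Transposition.transpose j (Suc j) (snd x z)"
        by (cases x) (simp add: sw_def mult_wreath')
      ultimately show ?thesis using j by (auto simp: Transposition.transpose_def split: if_splits)
    next
      case False
      then have "u x \<noteq> 0" using x by (simp add: act_def)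
      then show ?thesis using u unfolding U_def by blast
    qed
    then show ?thesis using S_A[OF j(1) jn, of u] u unfolding U_def by blast
  qed
  have opU: "weight_op a u \<in> U" if "a \<in> ops k" "u \<in> U" for a u
    using that(1)
  proof (cases rule: ops_cases)
    case (1 g i)
    then show ?thesis using YU that(2) by simp
  next
    case (2 i)
    have "wm.J i u \<in> U" by (rule J_closed[OF subU YU that(2)]) (use SU 2 in auto)
    then show ?thesis using 2 by simp
  qed
  \<comment> \<open>Pairing with \<delta> reads off the value at h, so \<delta> is not orthogonal to
    v.\<close>
  define \<delta> :: "'g wreath \<Rightarrow> complex" where "\<delta> = group_elem h"
  have \<delta>: "\<delta> \<in> U" using hW hz by (auto simp: \<delta>_def U_def supp_in_def group_elem_def split: if_splits)
  have ip\<delta>: "ipw \<delta> u = u h" for u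
    using hW wg.fin by (simp add: ip_def \<delta>_def group_elem_def if_distrib[of cnj] if_distrib[of "\<lambda>x. x * _"] cong: if_cong)
  have UA: "U \<subseteq> A" by (auto simp: U_def)
  \<comment> \<open>The decomposition is made inside U, so that the component Q below keeps the
    support that \<open>fus_support\<close> requires.\<close>
  obtain w where w: "\<And>\<beta>. \<beta> \<in> weights k \<Longrightarrow> w \<beta> \<in> U \<and> (\<forall>a\<in>ops k. weight_op a (w \<beta>) = fscale (\<beta> a) (w \<beta>))"
    and \<delta>w: "\<delta> = (\<Sum>\<beta>\<in>weights k. w \<beta>)"
    using weight_decomposition[OF _ subU UA opU \<delta>] k by (metis less_imp_le)
  have finw: "finite (weights k)" by (intro finite_PiE finite_ops) simp
  define \<beta>0 where "\<beta>0 = restrict (wfun p c) (ops k)"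
  have opsk: "ops k \<subseteq> ops n" using ops_mono k by simp
  have v0: "weight_op a v = fscale (\<beta>0 a) v" if "a \<in> ops k" for a
    using v(3) that opsk unfolding wt_iff \<beta>0_def by auto
  have differ: "\<exists>a\<in>ops k. \<beta> a \<noteq> \<beta>0 a" if "\<beta> \<in> weights k" "\<beta> \<noteq> \<beta>0" for \<beta>
  proof (rule ccontr)
    assume "\<not> ?thesis"
    then have "\<beta> = \<beta>0"
      by (intro extensionalityI[of _ "ops k"]) (use that(1) in \<open>auto simp: \<beta>0_def PiE_def\<close>)
    then show False using that(2) by blast
  qed
  have orth: "ipw (w \<beta>) u = 0" if that': "\<beta> \<in> weights k" "\<beta> \<noteq> \<beta>0" "\<And>a. a \<in> ops k \<Longrightarrow> weight_op a u = fscale (\<beta>0 a) u" for \<beta> u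
  proof -
    obtain a where "a \<in> ops k" "\<beta> a \<noteq> \<beta>0 a" using differ[OF that'(1,2)] by blast
    then show ?thesis using orthogonal_weights[of k "w \<beta>" \<beta> u \<beta>0 a] w[OF that'(1)] UA that'(3) k by auto
  qed
  \<comment> \<open>By orthogonality of weights, \<delta> can be replaced by its component of weight
    \<open>\<beta>0\<close> in a pairing with a vector of that weight.\<close>
  have ip_w: "ipw \<delta> u = (if \<beta>0 \<in> weights k then ipw (w \<beta>0) u else 0)"
    if "\<And>a. a \<in> ops k \<Longrightarrow> weight_op a u = fscale (\<beta>0 a) u" for u
  proof -
    have "ipw \<delta> u = (\<Sum>\<beta>\<in>weights k. ipw (w \<beta>) u)" by (simp add: \<delta>w ip_sum_left)
    also have "\<dots> = (\<Sum>\<beta>\<in>weights k. if \<beta> = \<beta>0 then ipw (w \<beta>0) u else 0)"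
      by (intro sum.cong refl) (use orth that in auto)
    finally show ?thesis using finw by simp
  qed
  have b0: "\<beta>0 \<in> weights k" using ip_w[OF v0] h ip\<delta>[of v] by (auto split: if_splits)
  define Q where "Q = w \<beta>0"
  have Q: "Q \<in> U" "\<And>a. a \<in> ops k \<Longrightarrow> weight_op a Q = fscale (\<beta>0 a) Q"
    using w[OF b0] by (auto simp: Q_def)
  have ipQ: "ipw \<delta> u = ipw Q u" if "\<And>a. a \<in> ops k \<Longrightarrow> weight_op a u = fscale (\<beta>0 a) u" for u
    using ip_w[OF that] b0 by (simp add: Q_def)
  \<comment> \<open>J_{k+1} need not preserve U, so the further splitting of Q takes place in the
    whole weight space of \<open>\<beta>0\<close>.\<close>
  define U' where "U' = {u\<in>A. \<forall>a\<in>ops k. weight_op a u = fscale (\<beta>0 a) u}"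
  have jk: "Inr (Suc k) \<in> ops n" using k by (auto simp: ops_def)
  obtain R where R: "\<And>b. b \<in> set (spec (Inr (Suc k))) \<Longrightarrow> R b \<in> U' \<and> weight_op (Inr (Suc k)) (R b) = fscale b (R b)"
    and QR: "Q = (\<Sum>b\<in>set (spec (Inr (Suc k))). R b)"
  proof -
    have "\<exists>R. (\<forall>b\<in>set (spec (Inr (Suc k))). R b \<in> U' \<and> weight_op (Inr (Suc k)) (R b) = fscale b (R b))
        \<and> Q = (\<Sum>b\<in>set (spec (Inr (Suc k))). R b)"
    proof (rule fs.split_eigen[OF op_lin])
      show "fs.subspace U'"
        using subspace_supp_in[of "carrier W"] unfolding U'_def
        by (auto simp: fs.subspace_def fs.lin_0[OF op_lin] fs.lin_add[OF op_lin] fs.lin_scale[OF op_lin]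
            fs.scale_right_distrib mult.commute)
      show "weight_op (Inr (Suc k)) ` U' \<subseteq> U'"
      proof safe
        fix u assume u: "u \<in> U'"
        have "weight_op a (weight_op (Inr (Suc k)) u) = fscale (\<beta>0 a) (weight_op (Inr (Suc k)) u)" if "a \<in> ops k" for a
          using op_comm[of a "Inr (Suc k)" u] that opsk jk u fs.lin_scale[OF op_lin[of "Inr (Suc k)"]]
          by (auto simp: U'_def)
        then show "weight_op (Inr (Suc k)) u \<in> U'" using u op_A[OF jk] unfolding U'_def by blast
      qed
      show "distinct (spec (Inr (Suc k)))" "Q \<in> U'" "fold (fs.shift (weight_op (Inr (Suc k)))) (spec (Inr (Suc k))) Q = 0"
        using spec[OF jk] Q UA by (auto simp: U'_def)
    qed
    then show ?thesis using that by blast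
  qed
  define C where "C = set (spec (Inr (Suc k)))"
  have RU: "R b \<in> A" "\<And>a. a \<in> ops k \<Longrightarrow> weight_op a (R b) = fscale (\<beta>0 a) (R b)"
    "weight_op (Inr (Suc k)) (R b) = fscale b (R b)" if "b \<in> C" for b
    using R that by (auto simp: U'_def C_def)
  have orthR: "ipw (R b) u = 0" if "b \<in> C" "weight_op (Inr (Suc k)) u = fscale b' u" "b \<noteq> b'" for b b' u
    using orthogonal[OF jk RU(1) RU(3) that(2)] that by blast
  have sumR: "ipw Q u = (if b' \<in> C then ipw (R b') u else 0)" if "weight_op (Inr (Suc k)) u = fscale b' u" for b' u
  proof -
    have "ipw Q u = (\<Sum>b\<in>C. ipw (R b) u)" by (simp add: QR C_def ip_sum_left)
    also have "\<dots> = (\<Sum>b\<in>C. if b = b' then ipw (R b') u else 0)"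
      by (intro sum.cong refl) (use orthR that in auto)
    finally show ?thesis by (simp add: C_def)
  qed
  have vk: "weight_op (Inr (Suc k)) v = fscale (c (Suc k)) v"
    using v(3) k by (auto simp: cm.wt_def)
  \<comment> \<open>v is an eigenvector of J_{k+1} that is not orthogonal to Q, so its eigenvalue
    really occurs in Q.\<close>
  have "ipw Q v \<noteq> 0" using ipQ[OF v0] ip\<delta>[of v] h by simp
  then have bC: "c (Suc k) \<in> C" and Rb: "R (c (Suc k)) \<noteq> 0"
    using sumR[OF vk] by (auto split: if_splits)
  \<comment> \<open>The squared norms of the components; they become the coefficients of the
    poles.\<close>
  define r where "r b = ipw (R b) (R b)" for b
  have rb: "r (c (Suc k)) \<noteq> 0" using Rb ip_eq_0[OF wg.fin RU(1)[OF bC]] by (auto simp: r_def)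
  have ipR: "ipw \<delta> (R b) = r b" if "b \<in> C" for b
    using ipQ[OF RU(2)[OF that]] sumR[OF RU(3)[OF that]] that by (simp add: r_def)
  define f where "f u = wm.ffac k (\<lambda>i. \<rho> (p i)) c (\<rho> q) u" for u
  \<comment> \<open>Infinitely many imaginary points, away from all contents and from the finite
    list C.\<close>
  define X where "X = range (\<lambda>j::nat. Complex 0 (real (Suc j))) - C"
  have Xint: "u \<noteq> of_int i" if "u \<in> X" for u i using that by (auto simp: X_def complex_eq_iff)
  have infX: "infinite X"
    unfolding X_def by (intro Diff_infinite_finite range_inj_infinite) (auto simp: C_def inj_on_def)
  have ff: "f u = rowfrac L (rowlen D q) u" if u: "u \<in> X" for u
  proof -
    have "(\<Prod>i\<in>{1..k}. if wm.same (\<rho> (p i)) (\<rho> q) then 1 - 1 / (u - c i)\<^sup>2 else 1)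
        = (\<Prod>i\<in>{1..k}. if position (\<nu> i) = q then 1 - 1 / (u - of_int (Defs.content (\<nu> i)))\<^sup>2 else 1)"
    proof (intro prod.cong refl)
      fix i assume i: "i \<in> {1..k}"
      then have "p i \<in> {1..m}" using p k by auto
      then have "wm.same (\<rho> (p i)) (\<rho> q) \<longleftrightarrow> p i = q"
        using rho_inject[of "p i" q] q by (auto simp: wm.same_def)
      then show "(if wm.same (\<rho> (p i)) (\<rho> q) then 1 - 1 / (u - c i)\<^sup>2 else 1)
          = (if position (\<nu> i) = q then 1 - 1 / (u - of_int (Defs.content (\<nu> i)))\<^sup>2 else 1)"
        using \<nu>(2)[OF i] by simp
    qed
    also have "\<dots> = (\<Prod>\<theta>\<in>D. if position \<theta> = q then 1 - 1 / (u - of_int (Defs.content \<theta>))\<^sup>2 else 1)"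
      unfolding D_def by (simp only: prod.reindex[OF is_path_inj[OF \<nu>(1)]] o_def)
    also have "\<dots> = (\<Prod>\<theta>\<in>{\<theta>\<in>D. position \<theta> = q}. 1 - 1 / (u - of_int (Defs.content \<theta>))\<^sup>2)"
      by (rule prod.inter_filter[symmetric]) (rule lower_finite[OF D])
    finally show ?thesis
      using prod_resolvent[where D = D and q = q and L = L, OF D L Xint[OF u]] by (simp only: f_def wm.ffac_def)
  qed
  \<comment> \<open>The operator changes Q only where z is sent to at most k, while h sends z to k +
    1; so the pairing with \<delta> does not depend on u.\<close>
  have main: "(\<Sum>b\<in>C. r b * (f u / (u - b))) = ipw \<delta> Q" if u: "u \<in> X" for u
  proof -
    have "wm.fus k c u Q - Q \<in> {v\<in>A. \<forall>x. v x \<noteq> 0 \<longrightarrow> snd x z \<le> k}"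
      by (rule fus_support) (use k Q(1) in \<open>auto simp: U_def\<close>)
    then have "(wm.fus k c u Q - Q) h \<noteq> 0 \<longrightarrow> snd h z \<le> k" by blast
    then have "(wm.fus k c u Q - Q) h = 0" using hz by linarith
    then have 1: "ipw \<delta> (wm.fus k c u Q) = ipw \<delta> Q" by (simp add: ip\<delta>)
    have "wm.fus k c u (R b) = fscale (f u / (u - b)) (R b)" if b: "b \<in> C" for b
      unfolding f_def
    proof (rule wm.fus_eigen[OF k])
      show "wm.is_char (\<rho> q)" by (rule rho_is_char[OF q])
      have "act W (pl n g i) (R b) = fscale (\<rho> (p i) g) (R b)" if "i \<in> {1..n}" "g \<in> carrier G" for i g
        using RU(2)[OF b, of "Inl (g, i)"] that by (simp add: \<beta>0_def wfun_def ops_def)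
      then have eigp: "wm.eig (\<rho> (p i)) i (R b)" if "i \<in> {1..n}" for i
        using that by (simp add: wm.eig_def)
      show "wm.eig (\<rho> q) (Suc k) (R b)" using eigp[of "Suc k"] k by (simp add: q_def)
      show "wm.J (Suc k) (R b) = fscale b (R b)" using RU(3)[OF b] by simp
      show "u \<noteq> b" using u b by (auto simp: X_def)
      fix i assume i: "i \<in> {1..k}"
      have "wm.J i (R b) = fscale (c i) (R b)"
        using RU(2)[OF b, of "Inr i"] i by (simp add: \<beta>0_def wfun_def ops_def)
      moreover have "u \<noteq> c i" using Xint[OF u] \<nu>(2)[OF i] by metis
      moreover have "p i \<in> {1..m}" using p i k by auto
      then have "wm.is_char (\<rho> (p i))" by (rule rho_is_char)
      ultimately show "wm.J i (R b) = fscale (c i) (R b) \<and> wm.eig (\<rho> (p i)) i (R b) \<and> wm.is_char (\<rho> (p i)) \<and> u \<noteq> c i"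
        using eigp[of i] i k by auto
    qed
    then have "wm.fus k c u Q = (\<Sum>b\<in>C. fscale (f u / (u - b)) (R b))"
      by (simp add: QR C_def wm.fus_sum)
    then have "ipw \<delta> (wm.fus k c u Q) = (\<Sum>b\<in>C. f u / (u - b) * r b)"
      by (simp add: ip_sum_right ip_scale_right ipR)
    then show ?thesis using 1 by (simp add: mult.commute)
  qed
  let ?R = "bet (rowlen D q) ` {1..L}" and ?P = "shifted L (rowlen D q)"
  have "c (Suc k) \<in> of_int ` (?P - ?R)"
  proof (rule pole_is_zero[where r = r and f = f and w = "ipw \<delta> Q" and M = "of_int ` (?R - ?P)", OF _ _ _ bC rb infX])
    show "finite C" "finite (of_int ` (?P - ?R) :: complex set)" "finite (of_int ` (?R - ?P) :: complex set)"
      by (auto simp: C_def shifted_def)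
    fix u assume u: "u \<in> X"
    have e: "(\<Prod>z\<in>of_int ` S. u - z) = (\<Prod>z\<in>S. u - of_int z)" for S :: "int set"
      by (subst prod.reindex) (auto simp: inj_on_def)
    have "f u * (\<Prod>z\<in>of_int ` (?R - ?P). u - z) = (\<Prod>z\<in>of_int ` (?P - ?R). u - z)"
      unfolding e ff[OF u] by (rule rowfrac_reduced[OF row_antimono[OF D] Xint[OF u]])
    then show "u \<notin> C \<and> f u * (\<Prod>z\<in>of_int ` (?R - ?P). u - z) = (\<Prod>z\<in>of_int ` (?P - ?R). u - z) \<and>
      (\<Sum>b'\<in>C. r b' * (f u / (u - b'))) = ipw \<delta> Q"
      using main[OF u] u by (auto simp: X_def)
  qed
  then obtain b where b: "c (Suc k) = of_int b" "b \<in> ?P - ?R" by blast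
  then show ?thesis
    using addable_zero[OF D L b(2)] unfolding D_def q_def by metis
qed

theorem weight_path:
  assumes v: "v \<in> A" "v \<noteq> 0" "cm.wt p c v" and p: "p \<in> {1..n} \<rightarrow> {1..m}"
  shows "\<exists>\<nu>. is_path m \<nu> n \<and> (\<forall>i\<in>{1..n}. position (\<nu> i) = p i \<and> of_int (Defs.content (\<nu> i)) = c i)"
proof -
  have "k \<le> n \<Longrightarrow> \<exists>\<nu>. is_path m \<nu> k \<and> (\<forall>i\<in>{1..k}. position (\<nu> i) = p i \<and> of_int (Defs.content (\<nu> i)) = c i)" for k
  proof (induction k)
    case 0
    then show ?case by (auto simp: is_path_def)
  next
    case (Suc k)
    then obtain \<nu> where \<nu>: "is_path m \<nu> k" "\<And>i. i \<in> {1..k} \<Longrightarrow> position (\<nu> i) = p i \<and> of_int (Defs.content (\<nu> i)) = c i"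
      by auto
    obtain \<theta> where \<theta>: "addable (\<nu> ` {1..k}) \<theta>" "position \<theta> = p (Suc k)" "of_int (Defs.content \<theta>) = c (Suc k)"
      using addable_weight[OF v p _ \<nu>] Suc.prems by auto
    define \<nu>' where "\<nu>' = \<nu>(Suc k := \<theta>)"
    have im: "\<nu>' ` {1..k} = \<nu> ` {1..k}" by (intro image_cong) (auto simp: \<nu>'_def)
    have "is_path m \<nu>' k" using \<nu>(1) is_path_cong[of k \<nu>' \<nu> m] by (simp add: \<nu>'_def)
    moreover have "p (Suc k) \<in> {1..m}" using p Suc.prems by auto
    ultimately have "is_path m \<nu>' (Suc k)" unfolding is_path_Suc im using \<theta> by (simp add: \<nu>'_def)
    moreover have "position (\<nu>' i) = p i \<and> of_int (Defs.content (\<nu>' i)) = c i" if "i \<in> {1..Suc k}" for i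
      using \<nu>(2)[of i] \<theta> that by (cases "i = Suc k") (auto simp: \<nu>'_def)
    ultimately show ?case by blast
  qed
  then show ?thesis by blast
qed

end

section \<open>Seminormal modules\<close>

text \<open>An injective numbering of all nodes that extends the order \<open>node_le\<close>; it
  serves to orient the swaps of neighbouring entries.\<close>

definition rk :: "mnode \<Rightarrow> nat" where
  "rk \<theta> = prod_encode (prod_encode (fst \<theta>), snd \<theta>)"

lemma rk_inj: "rk \<theta> = rk \<theta>' \<longleftrightarrow> \<theta> = \<theta>'"
  by (auto simp: rk_def prod_eq_iff)

lemma triangle_less: "a < b \<Longrightarrow> triangle a + a < triangle b"
  by (induction b) (auto simp: less_Suc_eq)

text \<open>The pairing function is \<open>triangle (x + y) + x\<close>, and the summand x never
  reaches the next triangular number.\<close>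

lemma prod_encode_less:
  assumes "x + y < x' + y'" shows "prod_encode (x, y) < prod_encode (x', y')"
  using triangle_less[OF assms] by (simp add: prod_encode_def)

lemma rk_less: assumes "node_le \<theta> \<theta>'" "\<theta> \<noteq> \<theta>'" shows "rk \<theta> < rk \<theta>'"
proof -
  obtain x y p x' y' where \<theta>: "\<theta> = ((x, y), p)" "\<theta>' = ((x', y'), p)"
    using assms(1) by (metis node_le_simp prod.collapse)
  then have "x + y < x' + y'" using assms by auto
  from prod_encode_less[OF this] show ?thesis using \<theta> by (simp add: rk_def prod_encode_less)
qed

definition swapT :: "nat \<Rightarrow> (nat \<Rightarrow> nat list) \<Rightarrow> (mnode \<Rightarrow> nat) \<Rightarrow> nat \<Rightarrow> mnode \<Rightarrow> nat" where
  "swapT m \<Lambda> T i = restrict (Transposition.transpose i (Suc i) \<circ> T) (mnodes m \<Lambda>)"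

section \<open>Swaps of neighbouring entries in standard tableaux\<close>

context
  fixes m n \<Lambda>
  assumes \<Lambda>: "\<Lambda> \<in> multipartitions m n"
begin

abbreviation "SYT \<equiv> standard_tableaux m n \<Lambda>"
abbreviation "nod \<equiv> node_at m \<Lambda>"

text \<open>The swaps that keep the tableau standard.\<close>

definition adm :: "(mnode \<Rightarrow> nat) \<Rightarrow> nat \<Rightarrow> bool" where
  "adm T i \<longleftrightarrow> T \<in> SYT \<and> 1 \<le> i \<and> i < n \<and> \<not> node_le (nod T i) (nod T (Suc i))"

text \<open>The swaps taken downwards. The order \<open>rk\<close> of nodes is total, so that a
  tableau without descents is determined by its shape.\<close>

definition desc :: "(mnode \<Rightarrow> nat) \<Rightarrow> nat \<Rightarrow> bool" where
  "desc T i \<longleftrightarrow> T \<in> SYT \<and> 1 \<le> i \<and> i < n \<and> rk (nod T (Suc i)) < rk (nod T i)"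

lemma desc_adm: "desc T i \<Longrightarrow> adm T i"
  unfolding desc_def adm_def using rk_less[of "nod T i" "nod T (Suc i)"] by (metis less_asym less_irrefl)

lemma adm_swap:
  assumes "adm T i"
  shows "swapT m \<Lambda> T i \<in> SYT"
    and "k \<in> {1..n} \<Longrightarrow> nod (swapT m \<Lambda> T i) k = nod T (Transposition.transpose i (Suc i) k)"
  using tableau_swap[OF \<Lambda>, of T i] assms unfolding adm_def swapT_def by blast+

lemma not_back:
  assumes "T \<in> SYT" "1 \<le> i" "i < j" "j \<le> n" shows "\<not> node_le (nod T j) (nod T i)"
proof
  assume le: "node_le (nod T j) (nod T i)"
  have ij: "i \<in> {1..n}" "j \<in> {1..n}" using assms by auto
  have "T (nod T i) = i" "T (nod T j) = j" using T_node_at[OF \<Lambda> assms(1)] ij by auto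
  moreover have "T (nod T j) < T (nod T i)"
    using std_mono[OF \<Lambda> assms(1) node_at_mem[OF \<Lambda> assms(1) ij(2)] node_at_mem[OF \<Lambda> assms(1) ij(1)] le] calculation assms
    by force
  ultimately show False using assms by simp
qed

lemma adm_adm: assumes "adm T i" shows "adm (swapT m \<Lambda> T i) i"
  using adm_swap[OF assms] assms not_back[of T i "Suc i"] unfolding adm_def by simp

lemma tableau_undefined: assumes "T \<in> SYT" "\<theta> \<notin> mnodes m \<Lambda>" shows "T \<theta> = undefined"
proof -
  have "T \<in> extensional (mnodes m \<Lambda>)" using assms(1) by (simp add: standard_tableaux_def)
  then show ?thesis using assms(2) by (rule extensional_arb)
qed

lemma swap_swap: assumes "T \<in> SYT" shows "swapT m \<Lambda> (swapT m \<Lambda> T i) i = T"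
proof
  fix \<theta> show "swapT m \<Lambda> (swapT m \<Lambda> T i) i \<theta> = T \<theta>"
    using assms by (cases "\<theta> \<in> mnodes m \<Lambda>") (simp_all add: swapT_def tableau_undefined)
qed

lemma swap_far: "Suc i < j \<Longrightarrow> swapT m \<Lambda> (swapT m \<Lambda> T i) j = swapT m \<Lambda> (swapT m \<Lambda> T j) i"
  by (auto simp: swapT_def fun_eq_iff Transposition.transpose_def)

lemma swap_braid: "swapT m \<Lambda> (swapT m \<Lambda> (swapT m \<Lambda> T i) (Suc i)) i
    = swapT m \<Lambda> (swapT m \<Lambda> (swapT m \<Lambda> T (Suc i)) i) (Suc i)"
  by (auto simp: swapT_def fun_eq_iff Transposition.transpose_def)

lemma desc_swap_asc: "desc T i \<Longrightarrow> rk (nod (swapT m \<Lambda> T i) i) < rk (nod (swapT m \<Lambda> T i) (Suc i))"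
  using adm_swap(2)[OF desc_adm, of T i i] adm_swap(2)[OF desc_adm, of T i "Suc i"]
  by (auto simp: desc_def)

lemma asc_swap_desc:
  "adm T i \<Longrightarrow> rk (nod T i) < rk (nod T (Suc i)) \<Longrightarrow> desc (swapT m \<Lambda> T i) i"
  using adm_swap[of T i] by (auto simp: desc_def adm_def)

text \<open>Removing a descent increases \<open>\<Sum> i * rk (node i)\<close>.\<close>

definition disorder :: "(mnode \<Rightarrow> nat) \<Rightarrow> nat" where
  "disorder T = n * (\<Sum>\<theta>\<in>mnodes m \<Lambda>. rk \<theta>) - (\<Sum>i\<in>{1..n}. i * rk (nod T i))"

lemma disorder_bound: assumes "T \<in> SYT"
  shows "(\<Sum>i\<in>{1..n}. i * rk (nod T i)) \<le> n * (\<Sum>\<theta>\<in>mnodes m \<Lambda>. rk \<theta>)"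
proof -
  have "(\<Sum>\<theta>\<in>mnodes m \<Lambda>. rk \<theta>) = (\<Sum>i\<in>{1..n}. rk (nod T i))"
    unfolding node_at_image_all[OF \<Lambda> assms, symmetric]
    by (simp only: sum.reindex[OF node_at_inj[OF \<Lambda> assms]] o_def)
  then show ?thesis by (simp only: sum_distrib_left) (intro sum_mono, auto)
qed

lemma disorder_desc: assumes "desc T i" shows "disorder (swapT m \<Lambda> T i) < disorder T"
proof -
  let ?T = "swapT m \<Lambda> T i"
  have T: "T \<in> SYT" "?T \<in> SYT" using adm_swap(1)[OF desc_adm[OF assms]] assms by (auto simp: desc_def)
  have i: "1 \<le> i" "i < n" and lt: "rk (nod T (Suc i)) < rk (nod T i)" using assms by (auto simp: desc_def)
  have nd: "nod ?T k = nod T (Transposition.transpose i (Suc i) k)" if "k \<in> {1..n}" for k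
    by (rule adm_swap(2)[OF desc_adm[OF assms] that])
  have split: "(\<Sum>k\<in>{1..n}. f k) = f i + (f (Suc i) + (\<Sum>k\<in>{1..n} - {i} - {Suc i}. f k))" for f :: "nat \<Rightarrow> nat"
    using i by (subst sum.remove[of _ i], simp, simp, subst sum.remove[of _ "Suc i"], auto)
  have rest: "(\<Sum>k\<in>{1..n} - {i} - {Suc i}. k * rk (nod ?T k)) = (\<Sum>k\<in>{1..n} - {i} - {Suc i}. k * rk (nod T k))"
    by (intro sum.cong refl) (auto simp: nd)
  obtain a where a: "rk (nod T i) = rk (nod T (Suc i)) + Suc a"
    using lt less_imp_Suc_add by (metis add_Suc_right)
  have "(\<Sum>k\<in>{1..n}. k * rk (nod T k)) < (\<Sum>k\<in>{1..n}. k * rk (nod ?T k))"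
    unfolding split[of "\<lambda>k. k * rk (nod T k)"] split[of "\<lambda>k. k * rk (nod ?T k)"] rest
    using i by (simp add: nd a algebra_simps)
  then show ?thesis using disorder_bound[OF T(1)] disorder_bound[OF T(2)] unfolding disorder_def by linarith
qed

text \<open>Without descents the nodes occur in increasing \<open>rk\<close>, so an entry is the
  number of nodes of at most that rank, which depends on the shape only.\<close>

lemma no_desc_unique:
  assumes "T \<in> SYT" "T' \<in> SYT" "\<And>i. \<not> desc T i" "\<And>i. \<not> desc T' i"
  shows "T = T'"
proof -
  have mono: "rk (nod T i) < rk (nod T j)"
    if T: "T \<in> SYT" "\<And>i. \<not> desc T i" and ij: "1 \<le> i" "i < j" "j \<le> n" for T i j
    using ij(2,3)
  proof (induction j)
    case (Suc j)
    have "nod T j \<noteq> nod T (Suc j)" if "1 \<le> j"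
      using inj_onD[OF node_at_inj[OF \<Lambda> T(1)], of j "Suc j"] Suc.prems that by auto
    then have "rk (nod T j) < rk (nod T (Suc j))" if "1 \<le> j"
      using T(2)[of j] T(1) Suc.prems that rk_inj[of "nod T j" "nod T (Suc j)"] unfolding desc_def by force
    then show ?case using Suc ij(1) by (cases "i = j") force+
  qed simp
  have count: "T \<theta> = card {\<theta>'\<in>mnodes m \<Lambda>. rk \<theta>' \<le> rk \<theta>}"
    if T: "T \<in> SYT" "\<And>i. \<not> desc T i" and \<theta>: "\<theta> \<in> mnodes m \<Lambda>" for T \<theta>
  proof -
    have r: "T \<theta> \<in> {1..n}" by (rule T_range[OF \<Lambda> T(1) \<theta>])
    have "{\<theta>'\<in>mnodes m \<Lambda>. rk \<theta>' \<le> rk \<theta>} = nod T ` {1..T \<theta>}"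
    proof (intro subset_antisym subsetI)
      fix \<theta>' assume "\<theta>' \<in> {\<theta>'\<in>mnodes m \<Lambda>. rk \<theta>' \<le> rk \<theta>}"
      then have \<theta>': "\<theta>' \<in> mnodes m \<Lambda>" "rk \<theta>' \<le> rk \<theta>" by auto
      have r': "T \<theta>' \<in> {1..n}" by (rule T_range[OF \<Lambda> T(1) \<theta>'(1)])
      have "\<not> T \<theta> < T \<theta>'"
        using mono[OF T, of "T \<theta>" "T \<theta>'"] node_at_T[OF \<Lambda> T(1)] \<theta> \<theta>' r r' by auto
      then show "\<theta>' \<in> nod T ` {1..T \<theta>}"
        using r' node_at_T[OF \<Lambda> T(1) \<theta>'(1)] by (intro image_eqI[of _ _ "T \<theta>'"]) auto
    next
      fix \<theta>' assume "\<theta>' \<in> nod T ` {1..T \<theta>}"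
      then obtain i where i: "i \<in> {1..T \<theta>}" "\<theta>' = nod T i" by blast
      have "rk (nod T i) \<le> rk (nod T (T \<theta>))"
        using mono[OF T, of i "T \<theta>"] i r by (cases "i = T \<theta>") auto
      then show "\<theta>' \<in> {\<theta>'\<in>mnodes m \<Lambda>. rk \<theta>' \<le> rk \<theta>}"
        using i r node_at_mem[OF \<Lambda> T(1), of i] node_at_T[OF \<Lambda> T(1) \<theta>] by auto
    qed
    moreover have "inj_on (nod T) {1..T \<theta>}"
      by (rule inj_on_subset[OF node_at_inj[OF \<Lambda> T(1)]]) (use r in auto)
    ultimately show ?thesis by (simp add: card_image)
  qed
  show ?thesis
  proof
    fix \<theta> show "T \<theta> = T' \<theta>"
    proof (cases "\<theta> \<in> mnodes m \<Lambda>")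
      case True
      show ?thesis unfolding count[OF assms(1,3) True] count[OF assms(2,4) True] ..
    next
      case False
      then show ?thesis using tableau_undefined assms(1,2) by metis
    qed
  qed
qed

lemma desc_induct [consumes 1, case_names desc]:
  assumes "T \<in> SYT" and "\<And>T. T \<in> SYT \<Longrightarrow> (\<And>i. desc T i \<Longrightarrow> P (swapT m \<Lambda> T i)) \<Longrightarrow> P T"
  shows "P T"
  using assms(1)
proof (induction "disorder T" arbitrary: T rule: less_induct)
  case less
  show ?case
  proof (rule assms(2)[OF less.prems])
    fix i assume d: "desc T i"
    show "P (swapT m \<Lambda> T i)"
      by (rule less.hyps[OF disorder_desc[OF d] adm_swap(1)[OF desc_adm[OF d]]])
  qed
qed

end

section \<open>The seminormal basis generated by one weight vector\<close>

context wreath_characters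
begin

context
  fixes \<Lambda>
  assumes \<Lambda>: "\<Lambda> \<in> multipartitions m n"
begin

abbreviation "SYT\<^sub>\<Lambda> \<equiv> standard_tableaux m n \<Lambda>"
abbreviation "con T \<equiv> (\<lambda>i. of_int (tab_content m \<Lambda> T i)) :: nat \<Rightarrow> complex"
abbreviation "pos T \<equiv> tab_position m \<Lambda> T"
abbreviation "wtT T \<equiv> cm.wt (pos T) (con T)"
abbreviation "psiT T \<equiv> cm.psi (pos T) (con T)"
abbreviation "sT \<equiv> swapT m \<Lambda>"

lemma pos_range: "T \<in> SYT\<^sub>\<Lambda> \<Longrightarrow> pos T \<in> {1..n} \<rightarrow> {1..m}"
  using tableau_path[OF \<Lambda>] by (auto simp: is_path_def tab_position_def)

lemma sT_weights:
  assumes "adm m n \<Lambda> T i" "k \<in> {1..n}"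
  shows "pos (sT T i) k = (pos T \<circ> cm.tr i) k" "con (sT T i) k = (con T \<circ> cm.tr i) k"
  using adm_swap(2)[OF \<Lambda> assms] by (simp_all add: tab_position_def tab_content_def)

lemma psi_cong:
  assumes "1 \<le> j" "j < n" "\<And>k. k \<in> {1..n} \<Longrightarrow> p k = p' k \<and> c k = c' k"
  shows "cm.psi p c j v = cm.psi p' c' j v"
  using assms(3)[of j] assms(3)[of "Suc j"] assms(1,2) by (simp add: cm.psi_def cm.kap_def)

lemma psi_sT:
  assumes "adm m n \<Lambda> T i" "1 \<le> j" "j < n"
  shows "psiT (sT T i) j v = cm.psi (pos T \<circ> cm.tr i) (con T \<circ> cm.tr i) j v"
  by (rule psi_cong[OF assms(2,3)]) (use sT_weights[OF assms(1)] in auto)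

lemma psi_sT_sT:
  assumes "adm m n \<Lambda> T i" "adm m n \<Lambda> (sT T i) k" "1 \<le> j" "j < n"
  shows "psiT (sT (sT T i) k) j v = cm.psi (pos T \<circ> cm.tr i \<circ> cm.tr k) (con T \<circ> cm.tr i \<circ> cm.tr k) j v"
proof (rule psi_cong[OF assms(3,4)])
  fix l assume l: "l \<in> {1..n}"
  have k: "cm.tr k l \<in> {1..n}" using assms(2) l by (auto simp: adm_def[OF \<Lambda>] Transposition.transpose_def)
  show "pos (sT (sT T i) k) l = (pos T \<circ> cm.tr i \<circ> cm.tr k) l \<and>
      con (sT (sT T i) k) l = (con T \<circ> cm.tr i \<circ> cm.tr k) l"
    using sT_weights[OF assms(2) l] sT_weights[OF assms(1) k] by simp
qed

lemma con_differ:
  assumes T: "T \<in> SYT\<^sub>\<Lambda>" and i: "1 \<le> i" "i < n" and p: "pos T i = pos T (Suc i)"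
  shows "con T i \<noteq> con T (Suc i)"
  using consecutive_content[OF \<Lambda> T i] p unfolding tab_position_def tab_content_def
  by (auto split: if_splits)

text \<open>An admissible swap within one position has axial distance at least 2, so
  \<open>kap\<close> is neither 1 nor -1.\<close>

lemma kap_square:
  assumes "adm m n \<Lambda> T i" shows "1 - (cm.kap (pos T) (con T) i)\<^sup>2 \<noteq> 0"
proof (cases "pos T i = pos T (Suc i)")
  case True
  define d where "d = tab_content m \<Lambda> T (Suc i) - tab_content m \<Lambda> T i"
  have T: "T \<in> SYT\<^sub>\<Lambda>" "1 \<le> i" "i < n" "\<not> node_le (node_at m \<Lambda> T i) (node_at m \<Lambda> T (Suc i))"
    using assms by (auto simp: adm_def[OF \<Lambda>])
  have "\<bar>d\<bar> \<ge> 2"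
    using consecutive_content[OF \<Lambda> T(1-3)] T(4) True by (simp add: d_def tab_content_def tab_position_def)
  then have "2 * 2 \<le> \<bar>d\<bar> * \<bar>d\<bar>" by (intro mult_mono) auto
  then have "d * d \<noteq> 1" by auto
  then have "(of_int (d * d) :: complex) \<noteq> of_int 1" unfolding of_int_eq_iff .
  then have "(of_int d :: complex)\<^sup>2 \<noteq> 1" by (simp add: power2_eq_square)
  moreover have "cm.kap (pos T) (con T) i = 1 / of_int d" using True by (simp add: cm.kap_def d_def)
  moreover have "(of_int d :: complex) \<noteq> 0" using \<open>\<bar>d\<bar> \<ge> 2\<close> by auto
  ultimately show ?thesis by (auto simp: power_divide)
qed (simp add: cm.kap_def)

lemma psi_weight:
  assumes "adm m n \<Lambda> T i" "wtT T v" shows "wtT (sT T i) (psiT T i v)"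
proof -
  have T: "T \<in> SYT\<^sub>\<Lambda>" "1 \<le> i" "i < n" using assms by (auto simp: adm_def[OF \<Lambda>])
  have "cm.wt (pos T \<circ> cm.tr i) (con T \<circ> cm.tr i) (psiT T i v)"
    by (rule cm.psi_wt[OF assms(2) pos_range[OF T(1)] T(2,3)]) (rule con_differ[OF T])
  then show ?thesis
    using cm.wt_cong[of "pos (sT T i)" "pos T \<circ> cm.tr i" "con (sT T i)" "con T \<circ> cm.tr i"]
      sT_weights[OF assms(1)] by blast
qed

lemma psi_back:
  assumes "adm m n \<Lambda> T i"
  shows "psiT (sT T i) i (psiT T i v) = fscale (1 - (cm.kap (pos T) (con T) i)\<^sup>2) v"
  using psi_sT[OF assms, of i] cm.psi_psi[of i "pos T" "con T" v] assms by (simp add: adm_def[OF \<Lambda>])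

text \<open>\<open>psi_back\<close> recovers a nonzero multiple of v.\<close>

lemma psi_nonzero: "adm m n \<Lambda> T i \<Longrightarrow> v \<noteq> 0 \<Longrightarrow> psiT T i v \<noteq> 0"
  using psi_back[of T i v] kap_square[of T i] cm.psi_scale[of _ _ i 0 0] by auto

lemma psi_A: "1 \<le> i \<Longrightarrow> i < n \<Longrightarrow> v \<in> A \<Longrightarrow> cm.psi p c i v \<in> A"
  unfolding cm.psi_def by (intro fs.subspace_diff fs.subspace_scale subspace_supp_in S_A)

text \<open>A relation and not a function: several ascending chains of swaps lead from R to the same
  tableau, and their vectors will agree only up to a scalar.\<close>

inductive gen :: "(mnode \<Rightarrow> nat) \<Rightarrow> ('g wreath \<Rightarrow> complex) \<Rightarrow> (mnode \<Rightarrow> nat) \<Rightarrow> ('g wreath \<Rightarrow> complex) \<Rightarrow> bool"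
  for R v0 where
  base: "gen R v0 R v0"
| step: "gen R v0 T v \<Longrightarrow> adm m n \<Lambda> T i \<Longrightarrow> rk (node_at m \<Lambda> T i) < rk (node_at m \<Lambda> T (Suc i)) \<Longrightarrow>
    gen R v0 (sT T i) (psiT T i v)"

context
  fixes R v0
  assumes R: "R \<in> SYT\<^sub>\<Lambda>" "\<And>i. \<not> desc m n \<Lambda> R i" and v0: "v0 \<in> A" "v0 \<noteq> 0" "wtT R v0"
begin

lemma gen_props: "gen R v0 T v \<Longrightarrow> T \<in> SYT\<^sub>\<Lambda> \<and> v \<in> A \<and> v \<noteq> 0 \<and> wtT T v"
proof (induction rule: gen.induct)
  case base
  show ?case using R v0 by blast
next
  case (step T v i)
  have i: "1 \<le> i" "i < n" using step.hyps(2) by (auto simp: adm_def[OF \<Lambda>])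
  show ?case
    by (intro conjI adm_swap(1)[OF \<Lambda> step.hyps(2)] psi_A[OF i] psi_nonzero[OF step.hyps(2)] psi_weight[OF step.hyps(2)])
      (use step.IH in blast)+
qed

lemma gen_up:
  assumes d: "desc m n \<Lambda> T i" and g: "gen R v0 (sT T i) w"
  shows "gen R v0 T (psiT (sT T i) i w)"
proof -
  have a: "adm m n \<Lambda> T i" by (rule desc_adm[OF \<Lambda> d])
  have "gen R v0 (sT (sT T i) i) (psiT (sT T i) i w)"
    by (rule gen.step[OF g adm_adm[OF \<Lambda> a] desc_swap_asc[OF \<Lambda> d]])
  then show ?thesis using swap_swap[OF \<Lambda>, of T i] d by (simp add: desc_def[OF \<Lambda>])
qed

text \<open>Descents are removed until R is reached, and the vector is transported back up.\<close>

lemma gen_exists: "T \<in> SYT\<^sub>\<Lambda> \<Longrightarrow> \<exists>v. gen R v0 T v"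
proof (induction rule: desc_induct[OF \<Lambda>, consumes 1, case_names desc])
  case (desc T)
  show ?case
  proof (cases "\<exists>i. desc m n \<Lambda> T i")
    case True
    then show ?thesis using desc.IH gen_up by blast
  next
    case False
    then have "T = R" using no_desc_unique[OF \<Lambda> desc.hyps R(1)] R(2) by blast
    then show ?thesis using gen.base by blast
  qed
qed

lemma gen_cases:
  assumes "gen R v0 T v"
  shows "T = R \<and> v = v0 \<or> (\<exists>i w. desc m n \<Lambda> T i \<and> gen R v0 (sT T i) w \<and> v = psiT (sT T i) i w)"
  using assms
proof (cases rule: gen.cases)
  case (step T' w i)
  have "T' \<in> SYT\<^sub>\<Lambda>" using gen_props[OF step(3)] by blast
  then have "sT T i = T'" using swap_swap[OF \<Lambda>] step(1) by simp
  moreover have "desc m n \<Lambda> T i" using asc_swap_desc[OF \<Lambda> step(4,5)] step(1) by simp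
  ultimately show ?thesis using step by blast
qed simp

definition proportional :: "('g wreath \<Rightarrow> complex) \<Rightarrow> ('g wreath \<Rightarrow> complex) \<Rightarrow> bool" where
  "proportional v v' \<longleftrightarrow> (\<exists>a. a \<noteq> 0 \<and> v' = fscale a v)"

lemma proportional_sym: "proportional v v' \<Longrightarrow> proportional v' v"
proof -
  assume "proportional v v'"
  then obtain a where a: "a \<noteq> 0" "v' = fscale a v" by (auto simp: proportional_def)
  then show ?thesis unfolding proportional_def by (intro exI[of _ "1 / a"]) simp
qed

lemma proportional_trans: "proportional u v \<Longrightarrow> proportional v w \<Longrightarrow> proportional u w"
  unfolding proportional_def by (metis fs.scale_scale mult_eq_0_iff)

lemma proportional_psi: "proportional v v' \<Longrightarrow> proportional (cm.psi p c i v) (cm.psi p c i v')"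
  unfolding proportional_def by (metis cm.psi_scale)

text \<open>Local confluence: for two descents of the same tableau, the two vectors agree up to a scalar,
  by the far commutation or by the Yang--Baxter equation.\<close>

lemma gen_confluent_far:
  assumes IH: "\<And>k v v'. desc m n \<Lambda> T k \<Longrightarrow> gen R v0 (sT T k) v \<Longrightarrow> gen R v0 (sT T k) v' \<Longrightarrow> proportional v v'"
    and d: "desc m n \<Lambda> T i" "desc m n \<Lambda> T j" and ij: "Suc i < j"
    and w: "gen R v0 (sT T i) w" "gen R v0 (sT T j) w'"
  shows "proportional (psiT (sT T i) i w) (psiT (sT T j) j w')"
proof -
  have T: "T \<in> SYT\<^sub>\<Lambda>" "1 \<le> i" "j < n" using d by (auto simp: desc_def[OF \<Lambda>])
  have n1: "node_at m \<Lambda> (sT T i) j = node_at m \<Lambda> T j" "node_at m \<Lambda> (sT T i) (Suc j) = node_at m \<Lambda> T (Suc j)"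
    using adm_swap(2)[OF \<Lambda> desc_adm[OF \<Lambda> d(1)], of j] adm_swap(2)[OF \<Lambda> desc_adm[OF \<Lambda> d(1)], of "Suc j"] ij T
    by (auto simp: Transposition.transpose_def)
  have n2: "node_at m \<Lambda> (sT T j) i = node_at m \<Lambda> T i" "node_at m \<Lambda> (sT T j) (Suc i) = node_at m \<Lambda> T (Suc i)"
    using adm_swap(2)[OF \<Lambda> desc_adm[OF \<Lambda> d(2)], of i] adm_swap(2)[OF \<Lambda> desc_adm[OF \<Lambda> d(2)], of "Suc i"] ij T
    by (auto simp: Transposition.transpose_def)
  have S: "sT T i \<in> SYT\<^sub>\<Lambda>" "sT T j \<in> SYT\<^sub>\<Lambda>" using adm_swap(1)[OF \<Lambda> desc_adm[OF \<Lambda>]] d by auto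
  have d1: "desc m n \<Lambda> (sT T i) j" using d(2) S n1 by (simp add: desc_def[OF \<Lambda>])
  have d2: "desc m n \<Lambda> (sT T j) i" using d(1) S n2 by (simp add: desc_def[OF \<Lambda>])
  \<comment> \<open>The common lower tableau, with both swaps carried out.\<close>
  define U where "U = sT (sT T i) j"
  have U2: "U = sT (sT T j) i" unfolding U_def by (rule swap_far[OF \<Lambda> ij])
  have US: "U \<in> SYT\<^sub>\<Lambda>" unfolding U_def by (rule adm_swap(1)[OF \<Lambda> desc_adm[OF \<Lambda> d1]])
  obtain z where z: "gen R v0 U z" using gen_exists[OF US] by blast
  have g1: "gen R v0 (sT T i) (psiT U j z)" using gen_up[OF d1] z unfolding U_def by blast
  have g2: "gen R v0 (sT T j) (psiT U i z)" using gen_up[OF d2] z unfolding U2 by blast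
  have Ui: "sT U i = sT T j" unfolding U2 by (rule swap_swap[OF \<Lambda> S(2)])
  have Uj: "sT U j = sT T i" unfolding U_def by (rule swap_swap[OF \<Lambda> S(1)])
  have a: "adm m n \<Lambda> U i" "adm m n \<Lambda> U j"
    using adm_adm[OF \<Lambda> desc_adm[OF \<Lambda> d2]] adm_adm[OF \<Lambda> desc_adm[OF \<Lambda> d1]] by (simp_all add: U2[symmetric] U_def[symmetric])
  have "psiT (sT T j) j (psiT U i z) = cm.psi (pos U \<circ> cm.tr i) (con U \<circ> cm.tr i) j (psiT U i z)"
    using psi_sT[OF a(1), of j] T ij by (simp add: Ui)
  also have "\<dots> = cm.psi (pos U \<circ> cm.tr j) (con U \<circ> cm.tr j) i (psiT U j z)"
    by (rule cm.psi_far) (use T ij in auto)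
  also have "\<dots> = psiT (sT T i) i (psiT U j z)"
    using psi_sT[OF a(2), of i] T ij by (simp add: Uj)
  finally have eq: "psiT (sT T j) j (psiT U i z) = psiT (sT T i) i (psiT U j z)" .
  have "proportional (psiT (sT T i) i w) (psiT (sT T i) i (psiT U j z))"
    by (intro proportional_psi IH[OF d(1) w(1) g1])
  moreover have "proportional (psiT (sT T j) j (psiT U i z)) (psiT (sT T j) j w')"
    by (intro proportional_psi IH[OF d(2) g2 w(2)])
  ultimately show ?thesis unfolding eq by (rule proportional_trans)
qed

text \<open>Two neighbouring descents mean three consecutive nodes in decreasing \<open>rk\<close>.
  From the tableau U in which they are sorted, the two ways up to T are the two sides of the braid
  relation for \<open>psi\<close>; the induction hypothesis compares them with w and w'.\<close>

lemma gen_confluent_braid: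
  assumes IH: "\<And>k v v'. desc m n \<Lambda> T k \<Longrightarrow> gen R v0 (sT T k) v \<Longrightarrow> gen R v0 (sT T k) v' \<Longrightarrow> proportional v v'"
    and d: "desc m n \<Lambda> T i" "desc m n \<Lambda> T (Suc i)"
    and w: "gen R v0 (sT T i) w" "gen R v0 (sT T (Suc i)) w'"
  shows "proportional (psiT (sT T i) i w) (psiT (sT T (Suc i)) (Suc i) w')"
proof -
  let ?j = "Suc i" and ?k = "Suc (Suc i)" and ?N = "node_at m \<Lambda>"
  have T: "T \<in> SYT\<^sub>\<Lambda>" and i: "1 \<le> i" "?j < n" using d by (auto simp: desc_def[OF \<Lambda>])
  have mem: "i \<in> {1..n}" "?j \<in> {1..n}" "?k \<in> {1..n}" using i by auto
  have rks: "rk (?N T ?j) < rk (?N T i)" "rk (?N T ?k) < rk (?N T ?j)" using d by (auto simp: desc_def[OF \<Lambda>])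
  define T1 where "T1 = sT T i"
  define T2 where "T2 = sT T ?j"
  have S1: "T1 \<in> SYT\<^sub>\<Lambda>" and S2: "T2 \<in> SYT\<^sub>\<Lambda>"
    unfolding T1_def T2_def using adm_swap(1)[OF \<Lambda> desc_adm[OF \<Lambda>]] d by auto
  have N1: "?N T1 i = ?N T ?j" "?N T1 ?j = ?N T i" "?N T1 ?k = ?N T ?k"
    unfolding T1_def using adm_swap(2)[OF \<Lambda> desc_adm[OF \<Lambda> d(1)]] mem by (simp_all add: Transposition.transpose_def)
  have N2: "?N T2 i = ?N T i" "?N T2 ?j = ?N T ?k" "?N T2 ?k = ?N T ?j"
    unfolding T2_def using adm_swap(2)[OF \<Lambda> desc_adm[OF \<Lambda> d(2)]] mem by (simp_all add: Transposition.transpose_def)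
  have d1: "desc m n \<Lambda> T1 ?j" and d2: "desc m n \<Lambda> T2 i"
    using S1 S2 i rks by (auto simp: desc_def[OF \<Lambda>] N1 N2)
  define T1' where "T1' = sT T1 ?j"
  define T2' where "T2' = sT T2 i"
  have S1': "T1' \<in> SYT\<^sub>\<Lambda>" and S2': "T2' \<in> SYT\<^sub>\<Lambda>"
    unfolding T1'_def T2'_def using adm_swap(1)[OF \<Lambda> desc_adm[OF \<Lambda>]] d1 d2 by auto
  have N1': "?N T1' i = ?N T ?j" "?N T1' ?j = ?N T ?k" "?N T1' ?k = ?N T i"
    unfolding T1'_def using adm_swap(2)[OF \<Lambda> desc_adm[OF \<Lambda> d1]] mem N1 by (simp_all add: Transposition.transpose_def)
  have N2': "?N T2' i = ?N T ?k" "?N T2' ?j = ?N T i" "?N T2' ?k = ?N T ?j"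
    unfolding T2'_def using adm_swap(2)[OF \<Lambda> desc_adm[OF \<Lambda> d2]] mem N2 by (simp_all add: Transposition.transpose_def)
  have d1': "desc m n \<Lambda> T1' i" and d2': "desc m n \<Lambda> T2' ?j"
    using S1' S2' i rks by (auto simp: desc_def[OF \<Lambda>] N1' N2')
  define U where "U = sT T1' i"
  have U2: "U = sT T2' ?j"
    unfolding U_def T1'_def T2'_def T1_def T2_def by (rule swap_braid[OF \<Lambda>])
  have US: "U \<in> SYT\<^sub>\<Lambda>" unfolding U_def by (rule adm_swap(1)[OF \<Lambda> desc_adm[OF \<Lambda> d1']])
  have NU: "?N U i = ?N T ?k" "?N U ?j = ?N T ?j" "?N U ?k = ?N T i"
    unfolding U_def using adm_swap(2)[OF \<Lambda> desc_adm[OF \<Lambda> d1']] mem N1' by (simp_all add: Transposition.transpose_def)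
  obtain z where z: "gen R v0 U z" using gen_exists[OF US] by blast
  have g1: "gen R v0 T1 (psiT T1' ?j (psiT U i z))"
    using gen_up[OF d1] gen_up[OF d1'] z unfolding U_def T1'_def by blast
  have g2: "gen R v0 T2 (psiT T2' i (psiT U ?j z))"
    using gen_up[OF d2] gen_up[OF d2'] z unfolding U2 T2'_def by blast
  have b1: "sT U i = T1'" "sT T1' ?j = T1"
    unfolding U_def T1'_def using swap_swap[OF \<Lambda>] S1 S1' T1'_def by auto
  have b2: "sT U ?j = T2'" "sT T2' i = T2"
    unfolding U2 T2'_def using swap_swap[OF \<Lambda>] S2 S2' T2'_def by auto
  have a1: "adm m n \<Lambda> U i" "adm m n \<Lambda> (sT U i) ?j"
    using adm_adm[OF \<Lambda> desc_adm[OF \<Lambda> d1']] adm_adm[OF \<Lambda> desc_adm[OF \<Lambda> d1]] b1 by (simp_all add: U_def T1'_def)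
  have a2: "adm m n \<Lambda> U ?j" "adm m n \<Lambda> (sT U ?j) i"
    using adm_adm[OF \<Lambda> desc_adm[OF \<Lambda> d2']] adm_adm[OF \<Lambda> desc_adm[OF \<Lambda> d2]] b2 by (simp_all add: U2 T2'_def)
  have i': "i < n" "1 \<le> ?j" using i by auto
  have "psiT T1 i (psiT T1' ?j (psiT U i z)) =
     cm.psi (pos U \<circ> cm.tr i \<circ> cm.tr ?j) (con U \<circ> cm.tr i \<circ> cm.tr ?j) i
        (cm.psi (pos U \<circ> cm.tr i) (con U \<circ> cm.tr i) ?j (psiT U i z))"
    using psi_sT[OF a1(1) i'(2) i(2)] psi_sT_sT[OF a1 i(1) i'(1)] by (simp add: b1)
  also have "\<dots> = cm.psi (pos U \<circ> cm.tr ?j \<circ> cm.tr i) (con U \<circ> cm.tr ?j \<circ> cm.tr i) ?j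
        (cm.psi (pos U \<circ> cm.tr ?j) (con U \<circ> cm.tr ?j) i (psiT U ?j z))"
  proof (rule cm.psi_braid[OF i])
    show "con U i \<noteq> con U ?j" if "pos U i = pos U ?j" by (rule con_differ[OF US i(1) i'(1) that])
    show "con U ?j \<noteq> con U ?k" if "pos U ?j = pos U ?k" by (rule con_differ[OF US i'(2) i(2) that])
    \<comment> \<open>The nodes at i and i + 2 in U are consecutive in \<open>T2'\<close>.\<close>
    show "con U i \<noteq> con U ?k" if "pos U i = pos U ?k"
      using con_differ[OF S2' i(1) i'(1)] that by (simp add: tab_position_def tab_content_def NU N2')
  qed
  also have "\<dots> = psiT T2 ?j (psiT T2' i (psiT U ?j z))"
    using psi_sT[OF a2(1) i(1) i'(1)] psi_sT_sT[OF a2 i'(2) i(2)] by (simp add: b2)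
  finally have eq: "psiT T1 i (psiT T1' ?j (psiT U i z)) = psiT T2 ?j (psiT T2' i (psiT U ?j z))" .
  have "proportional (psiT T1 i w) (psiT T1 i (psiT T1' ?j (psiT U i z)))"
    by (intro proportional_psi IH[OF d(1)]) (use w g1 in \<open>simp_all add: T1_def\<close>)
  moreover have "proportional (psiT T2 ?j (psiT T2' i (psiT U ?j z))) (psiT T2 ?j w')"
    by (intro proportional_psi IH[OF d(2)]) (use w g2 in \<open>simp_all add: T2_def\<close>)
  ultimately have "proportional (psiT T1 i w) (psiT T2 ?j w')" unfolding eq by (rule proportional_trans)
  then show ?thesis by (simp only: T1_def T2_def)
qed

text \<open>Newman's argument: removing descents terminates because \<open>disorder\<close> drops,
  and local confluence up to a scalar gives uniqueness up to a scalar.\<close>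

lemma gen_unique: "T \<in> SYT\<^sub>\<Lambda> \<Longrightarrow> gen R v0 T v \<Longrightarrow> gen R v0 T v' \<Longrightarrow> proportional v v'"
proof (induction arbitrary: v v' rule: desc_induct[OF \<Lambda>, consumes 1, case_names desc])
  case (desc T)
  have refl: "proportional u u" for u unfolding proportional_def by (intro exI[of _ 1]) simp
  show ?case
  proof (cases "\<exists>i. desc m n \<Lambda> T i")
    case False
    then have "v = v0" "v' = v0" using gen_cases[OF desc.prems(1)] gen_cases[OF desc.prems(2)] by auto
    then show ?thesis using refl by simp
  next
    case True
    then have "T \<noteq> R" using R(2) by blast
    then obtain i w j w' where i: "desc m n \<Lambda> T i" "gen R v0 (sT T i) w" "v = psiT (sT T i) i w"
      and j: "desc m n \<Lambda> T j" "gen R v0 (sT T j) w'" "v' = psiT (sT T j) j w'"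
      using gen_cases[OF desc.prems(1)] gen_cases[OF desc.prems(2)] by blast
    have IH: "proportional v v'" if "desc m n \<Lambda> T k" "gen R v0 (sT T k) v" "gen R v0 (sT T k) v'" for k v v'
      by (rule desc.IH[OF that])
    have braid: "proportional (psiT (sT T k) k u) (psiT (sT T (Suc k)) (Suc k) u')"
      if "desc m n \<Lambda> T k" "desc m n \<Lambda> T (Suc k)" "gen R v0 (sT T k) u" "gen R v0 (sT T (Suc k)) u'" for k u u'
      by (rule gen_confluent_braid[OF _ that]) (rule IH)
    have far: "proportional (psiT (sT T k) k u) (psiT (sT T l) l u')"
      if "desc m n \<Lambda> T k" "desc m n \<Lambda> T l" "Suc k < l" "gen R v0 (sT T k) u" "gen R v0 (sT T l) u'" for k l u u'
      by (rule gen_confluent_far[OF _ that]) (rule IH)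
    consider "i = j" | "Suc i < j" | "Suc j < i" | "j = Suc i" | "i = Suc j" by linarith
    then show ?thesis
    proof cases
      case 1
      then show ?thesis using proportional_psi[OF IH[OF i(1) i(2)]] i j by blast
    next
      case 2
      show ?thesis unfolding i(3) j(3) by (rule far[OF i(1) j(1) 2 i(2) j(2)])
    next
      case 3
      show ?thesis unfolding i(3) j(3) by (rule proportional_sym[OF far[OF j(1) i(1) 3 j(2) i(2)]])
    next
      case 4
      show ?thesis using braid[of i w w'] i j unfolding 4 by blast
    next
      case 5
      show ?thesis using proportional_sym[OF braid[of j w' w]] i j unfolding 5 by blast
    qed
  qed
qed

definition vS :: "(mnode \<Rightarrow> nat) \<Rightarrow> 'g wreath \<Rightarrow> complex" where
  "vS T = (SOME v. gen R v0 T v)"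

lemma vS_gen: "T \<in> SYT\<^sub>\<Lambda> \<Longrightarrow> gen R v0 T (vS T)"
  unfolding vS_def by (rule someI_ex[OF gen_exists])

lemma vS: "T \<in> SYT\<^sub>\<Lambda> \<Longrightarrow> vS T \<in> A \<and> vS T \<noteq> 0 \<and> wtT T (vS T)"
  using gen_props[OF vS_gen] by blast

lemma gen_vS: "gen R v0 T v \<Longrightarrow> \<exists>a. a \<noteq> 0 \<and> v = fscale a (vS T)"
  using gen_unique[OF _ vS_gen, of T v] gen_props[of T v] by (auto simp: proportional_def)

text \<open>An upward swap extends a generating chain. An inadmissible swap must give 0, as
  otherwise \<open>weight_path\<close> would yield a path that \<open>no_swapped_path\<close>
  excludes.\<close>

lemma psi_vS:
  assumes T: "T \<in> SYT\<^sub>\<Lambda>" and i: "1 \<le> i" "i < n"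
  shows "if adm m n \<Lambda> T i then \<exists>a. psiT T i (vS T) = fscale a (vS (sT T i)) else psiT T i (vS T) = 0"
proof (cases "adm m n \<Lambda> T i")
  case True
  note a = True
  have ne: "nod \<noteq> nod'" if "nod = node_at m \<Lambda> T i" "nod' = node_at m \<Lambda> T (Suc i)" for nod nod'
    using inj_onD[OF node_at_inj[OF \<Lambda> T], of i "Suc i"] i that by auto
  have "\<exists>a. psiT T i (vS T) = fscale a (vS (sT T i))"
  proof (cases "rk (node_at m \<Lambda> T i) < rk (node_at m \<Lambda> T (Suc i))")
    case True
    from gen_vS[OF gen.step[OF vS_gen[OF T] a True]] show ?thesis by blast
  next
    case False
    then have d: "desc m n \<Lambda> T i"
      using ne[OF refl refl] rk_inj[of "node_at m \<Lambda> T i" "node_at m \<Lambda> T (Suc i)"] T i by (auto simp: desc_def[OF \<Lambda>])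
    have S: "sT T i \<in> SYT\<^sub>\<Lambda>" by (rule adm_swap(1)[OF \<Lambda> a])
    \<comment> \<open>The swap is downward: the vector at T comes from the lower tableau up to a
      scalar, and the two intertwiners compose to a scalar.\<close>
    obtain b where b: "b \<noteq> 0" "psiT (sT T i) i (vS (sT T i)) = fscale b (vS T)"
      using gen_vS[OF gen_up[OF d vS_gen[OF S]]] by blast
    have "psiT T i (psiT (sT T i) i (vS (sT T i))) = fscale (1 - (cm.kap (pos (sT T i)) (con (sT T i)) i)\<^sup>2) (vS (sT T i))"
      using psi_back[OF adm_adm[OF \<Lambda> a], of "vS (sT T i)"] swap_swap[OF \<Lambda> T, of i] by simp
    then have "fscale b (psiT T i (vS T)) = fscale (1 - (cm.kap (pos (sT T i)) (con (sT T i)) i)\<^sup>2) (vS (sT T i))"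
      unfolding b(2) cm.psi_scale .
    then have "fscale (1 / b) (fscale b (psiT T i (vS T)))
        = fscale (1 / b) (fscale (1 - (cm.kap (pos (sT T i)) (con (sT T i)) i)\<^sup>2) (vS (sT T i)))" by simp
    then have "psiT T i (vS T) = fscale (1 / b * (1 - (cm.kap (pos (sT T i)) (con (sT T i)) i)\<^sup>2)) (vS (sT T i))"
      using b(1) by (simp only: fs.scale_scale) simp
    then show ?thesis by blast
  qed
  then show ?thesis using True by simp
next
  case False
  then have le: "node_le (node_at m \<Lambda> T i) (node_at m \<Lambda> T (Suc i))" using T i by (simp add: adm_def[OF \<Lambda>])
  have tr: "cm.tr i k \<in> {1..n}" if "k \<in> {1..n}" for k using that i by (auto simp: Transposition.transpose_def)
  have "psiT T i (vS T) = 0"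
  proof (rule ccontr)
    assume ne: "psiT T i (vS T) \<noteq> 0"
    have w: "cm.wt (pos T \<circ> cm.tr i) (con T \<circ> cm.tr i) (psiT T i (vS T))"
      using vS[OF T] by (intro cm.psi_wt[OF _ pos_range[OF T] i] con_differ[OF T i]) auto
    have pr: "pos T \<circ> cm.tr i \<in> {1..n} \<rightarrow> {1..m}"
      using pos_range[OF T] tr by (auto simp: Pi_iff)
    have pA: "psiT T i (vS T) \<in> A" using vS[OF T] by (intro psi_A[OF i]) blast
    obtain \<nu> where \<nu>: "is_path m \<nu> n" "\<And>k. k \<in> {1..n} \<Longrightarrow> position (\<nu> k) = (pos T \<circ> cm.tr i) k \<and>
        of_int (Defs.content (\<nu> k)) = (con T \<circ> cm.tr i) k"
      using weight_path[OF pA ne w pr] by blast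
    show False
    proof (rule no_swapped_path[OF \<Lambda> T i le \<nu>(1)])
      fix k assume "k \<in> {1..n}"
      from \<nu>(2)[OF this] show "position (\<nu> k) = position (node_at m \<Lambda> T (Transposition.transpose i (Suc i) k)) \<and>
        Defs.content (\<nu> k) = Defs.content (node_at m \<Lambda> T (Transposition.transpose i (Suc i) k))"
        by (simp add: tab_position_def tab_content_def)
    qed
  qed
  then show ?thesis using False by simp
qed

definition M :: "('g wreath \<Rightarrow> complex) set" where
  "M = fs.span (vS ` SYT\<^sub>\<Lambda>)"

lemma M_closed_gen:
  assumes x: "fs.lin x" and "\<And>T. T \<in> SYT\<^sub>\<Lambda> \<Longrightarrow> x (vS T) \<in> M" "v \<in> M"
  shows "x v \<in> M"
proof -
  have "fs.subspace {v. x v \<in> M}"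
    using fs.subspace_span[of "vS ` SYT\<^sub>\<Lambda>"] unfolding M_def
    by (auto simp: fs.subspace_def fs.lin_0[OF x] fs.lin_add[OF x] fs.lin_scale[OF x])
  then have "fs.span (vS ` SYT\<^sub>\<Lambda>) \<subseteq> {v. x v \<in> M}"
    by (rule fs.span_minimal[rotated]) (use assms(2) in blast)
  then show ?thesis using assms(3) unfolding M_def by blast
qed

lemma M_S: assumes "1 \<le> i" "i < n" "v \<in> M" shows "act W (sw n i) v \<in> M"
proof (rule M_closed_gen[OF lin_act _ assms(3)])
  fix T assume T: "T \<in> SYT\<^sub>\<Lambda>"
  have b: "vS T' \<in> M" if "T' \<in> SYT\<^sub>\<Lambda>" for T' unfolding M_def using that by (intro fs.span_base) auto
  have "psiT T i (vS T) \<in> M"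
  proof (cases "adm m n \<Lambda> T i")
    case True
    then obtain a where "psiT T i (vS T) = fscale a (vS (sT T i))" using psi_vS[OF T assms(1,2)] by auto
    then show ?thesis using b[OF adm_swap(1)[OF \<Lambda> True]] by (simp add: M_def fs.span_scale)
  next
    case False
    then show ?thesis using psi_vS[OF T assms(1,2)] by (simp add: M_def fs.span_zero)
  qed
  then show "act W (sw n i) (vS T) \<in> M"
    unfolding cm.S_psi[of i "vS T" "pos T" "con T"] using b[OF T] unfolding M_def
    by (intro fs.span_add fs.span_scale)
qed

lemma M_Y: assumes "g \<in> carrier G" "i \<in> {1..n}" "v \<in> M" shows "act W (pl n g i) v \<in> M"
proof (rule M_closed_gen[OF lin_act _ assms(3)])
  fix T assume T: "T \<in> SYT\<^sub>\<Lambda>"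
  have "act W (pl n g i) (vS T) = fscale (\<rho> (pos T i) g) (vS T)"
    using vS[OF T] assms(1,2) unfolding cm.wt_def wm.eig_def by blast
  then show "act W (pl n g i) (vS T) \<in> M"
    using T by (simp add: M_def fs.span_base fs.span_scale)
qed

lemma gen_in_subspace:
  assumes U: "fs.subspace U" "\<And>i u. 1 \<le> i \<Longrightarrow> i < n \<Longrightarrow> u \<in> U \<Longrightarrow> act W (sw n i) u \<in> U" and v: "v0 \<in> U"
  shows "gen R v0 T v \<Longrightarrow> v \<in> U"
proof (induction rule: gen.induct)
  case base
  show ?case by (rule v)
next
  case (step T v i)
  have "1 \<le> i" "i < n" using step.hyps(2) by (auto simp: adm_def[OF \<Lambda>])
  then show ?case unfolding cm.psi_def
    by (intro fs.subspace_diff[OF U(1)] fs.subspace_scale[OF U(1)] U(2) step.IH)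
qed

text \<open>Nonzero intertwiners lead from T down to R inside U, which puts v0 into U; from there
  every basis vector is generated. This is the source of irreducibility.\<close>

lemma vS_connected:
  assumes U: "fs.subspace U" "\<And>i u. 1 \<le> i \<Longrightarrow> i < n \<Longrightarrow> u \<in> U \<Longrightarrow> act W (sw n i) u \<in> U"
    and T: "T \<in> SYT\<^sub>\<Lambda>" "vS T \<in> U" and T': "T' \<in> SYT\<^sub>\<Lambda>"
  shows "vS T' \<in> U"
proof -
  have "T \<in> SYT\<^sub>\<Lambda> \<Longrightarrow> vS T \<in> U \<Longrightarrow> v0 \<in> U" for T
  proof (induction rule: desc_induct[OF \<Lambda>, consumes 1, case_names desc])
    case (desc T)
    show ?case
    proof (cases "\<exists>i. desc m n \<Lambda> T i")
      case True
      then obtain i where d: "desc m n \<Lambda> T i" by blast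
      have a: "adm m n \<Lambda> T i" by (rule desc_adm[OF \<Lambda> d])
      have i: "1 \<le> i" "i < n" using a by (auto simp: adm_def[OF \<Lambda>])
      obtain b where b: "psiT T i (vS T) = fscale b (vS (sT T i))"
        using psi_vS[OF desc.hyps i] a by auto
      have "vS T \<noteq> 0" using vS[OF desc.hyps] by blast
      then have "psiT T i (vS T) \<noteq> 0" by (rule psi_nonzero[OF a])
      then have "b \<noteq> 0" unfolding b by (intro notI) simp
      have "psiT T i (vS T) \<in> U" unfolding cm.psi_def
        by (intro fs.subspace_diff[OF U(1)] fs.subspace_scale[OF U(1)] U(2)[OF i] desc.prems)
      then have "fscale (1 / b) (fscale b (vS (sT T i))) \<in> U" unfolding b by (rule fs.subspace_scale[OF U(1)])
      then have "vS (sT T i) \<in> U" using \<open>b \<noteq> 0\<close> by simp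
      then show ?thesis by (rule desc.IH[OF d])
    next
      case False
      then have "T = R" using no_desc_unique[OF \<Lambda> desc.hyps R(1)] R(2) by blast
      then obtain b where b0: "v0 = fscale b (vS T)" using gen_vS[OF gen.base] by blast
      show ?thesis
        by (rule ssubst[where P = "\<lambda>x. x \<in> U", OF b0]) (rule fs.subspace_scale[OF U(1) desc.prems])
    qed
  qed
  then have v: "v0 \<in> U" using T by blast
  show ?thesis by (rule gen_in_subspace[OF U(1) _ v vS_gen[OF T']]) (rule U(2))
qed

lemma v0_M: "v0 \<in> M"
proof -
  obtain b where b: "v0 = fscale b (vS R)" using gen_vS[OF gen.base] by blast
  have "vS R \<in> M" unfolding M_def by (rule fs.span_base) (use R(1) in blast)
  then have "fscale b (vS R) \<in> M" unfolding M_def by (rule fs.subspace_scale[OF fs.subspace_span])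
  then show ?thesis by (rule ssubst[where P = "\<lambda>x. x \<in> M", OF b])
qed

end

text \<open>Intertwiners of admissible swaps are invertible up to a nonzero scalar, so v can be
  recovered from the vector v0 reached at the bottom.\<close>

lemma descend:
  assumes "T \<in> SYT\<^sub>\<Lambda>" "v \<in> A" "v \<noteq> 0" "wtT T v"
  shows "\<exists>R v0. R \<in> SYT\<^sub>\<Lambda> \<and> (\<forall>i. \<not> desc m n \<Lambda> R i) \<and> v0 \<in> A \<and> v0 \<noteq> 0 \<and> wtT R v0 \<and>
    (\<forall>U. fs.subspace U \<longrightarrow> v0 \<in> U \<longrightarrow> (\<forall>i u. 1 \<le> i \<longrightarrow> i < n \<longrightarrow> u \<in> U \<longrightarrow> act W (sw n i) u \<in> U) \<longrightarrow> v \<in> U)"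
  using assms
proof (induction arbitrary: v rule: desc_induct[OF \<Lambda>, consumes 1, case_names desc])
  case (desc T)
  show ?case
  proof (cases "\<exists>i. desc m n \<Lambda> T i")
    case False
    then show ?thesis using desc by (intro exI[of _ T] exI[of _ v]) simp
  next
    case True
    then obtain i where d: "desc m n \<Lambda> T i" by blast
    have a: "adm m n \<Lambda> T i" by (rule desc_adm[OF \<Lambda> d])
    have i: "1 \<le> i" "i < n" using a by (auto simp: adm_def[OF \<Lambda>])
    let ?v = "psiT T i v" and ?T = "sT T i"
    have "?v \<in> A" "?v \<noteq> 0" "wtT ?T ?v"
      using psi_A[OF i desc.prems(1)] psi_nonzero[OF a desc.prems(2)] psi_weight[OF a desc.prems(3)] by auto
    then obtain R v0 where R: "R \<in> SYT\<^sub>\<Lambda>" "\<forall>i. \<not> desc m n \<Lambda> R i" "v0 \<in> A" "v0 \<noteq> 0" "wtT R v0"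
      and U: "\<And>U. fs.subspace U \<Longrightarrow> v0 \<in> U \<Longrightarrow> (\<forall>i u. 1 \<le> i \<longrightarrow> i < n \<longrightarrow> u \<in> U \<longrightarrow> act W (sw n i) u \<in> U) \<Longrightarrow> ?v \<in> U"
      using desc.IH[OF d, of ?v] by metis
    have "v \<in> U" if sub: "fs.subspace U" "v0 \<in> U" and
      cl: "\<forall>i u. 1 \<le> i \<longrightarrow> i < n \<longrightarrow> u \<in> U \<longrightarrow> act W (sw n i) u \<in> U" for U
    proof -
      let ?k = "1 - (cm.kap (pos T) (con T) i)\<^sup>2"
      have vU: "?v \<in> U" by (rule U[OF sub cl])
      have "psiT ?T i ?v \<in> U"
        unfolding cm.psi_def[of _ _ _ ?v] using cl i vU by (intro fs.subspace_diff[OF sub(1)] fs.subspace_scale[OF sub(1)]) auto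
      then have "fscale ?k v \<in> U" unfolding psi_back[OF a] .
      then have "fscale (1 / ?k) (fscale ?k v) \<in> U" by (rule fs.subspace_scale[OF sub(1)])
      then show ?thesis using kap_square[OF a] by simp
    qed
    then show ?thesis using R by (intro exI[of _ R] exI[of _ v0]) blast
  qed
qed

text \<open>The existential form hides R and v0; what is exported is the weight basis, its
  stability, the connectedness that yields irreducibility, and the membership of v.\<close>

theorem seminormal_module:
  assumes T: "T \<in> SYT\<^sub>\<Lambda>" and v: "v \<in> A" "v \<noteq> 0" "wtT T v"
  shows "\<exists>b. (\<forall>T\<in>SYT\<^sub>\<Lambda>. b T \<in> A \<and> b T \<noteq> 0 \<and> wtT T (b T)) \<and>
    (\<forall>i u. 1 \<le> i \<longrightarrow> i < n \<longrightarrow> u \<in> fs.span (b ` SYT\<^sub>\<Lambda>) \<longrightarrow> act W (sw n i) u \<in> fs.span (b ` SYT\<^sub>\<Lambda>)) \<and>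
    (\<forall>g\<in>carrier G. \<forall>i\<in>{1..n}. \<forall>u\<in>fs.span (b ` SYT\<^sub>\<Lambda>). act W (pl n g i) u \<in> fs.span (b ` SYT\<^sub>\<Lambda>)) \<and>
    (\<forall>U T T'. fs.subspace U \<longrightarrow> (\<forall>i u. 1 \<le> i \<longrightarrow> i < n \<longrightarrow> u \<in> U \<longrightarrow> act W (sw n i) u \<in> U) \<longrightarrow>
      T \<in> SYT\<^sub>\<Lambda> \<longrightarrow> T' \<in> SYT\<^sub>\<Lambda> \<longrightarrow> b T \<in> U \<longrightarrow> b T' \<in> U) \<and>
    v \<in> fs.span (b ` SYT\<^sub>\<Lambda>)"
proof -
  obtain R v0 where R: "R \<in> SYT\<^sub>\<Lambda>" "\<And>i. \<not> desc m n \<Lambda> R i" and v0: "v0 \<in> A" "v0 \<noteq> 0" "wtT R v0"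
    and U: "\<And>U. fs.subspace U \<Longrightarrow> v0 \<in> U \<Longrightarrow>
      \<forall>i u. 1 \<le> i \<longrightarrow> i < n \<longrightarrow> u \<in> U \<longrightarrow> act W (sw n i) u \<in> U \<Longrightarrow> v \<in> U"
    using descend[OF T v] by blast
  note defs = R v0
  let ?b = "vS R v0"
  note M = M_def[OF defs]
  have 1: "\<forall>T\<in>SYT\<^sub>\<Lambda>. ?b T \<in> A \<and> ?b T \<noteq> 0 \<and> wtT T (?b T)" using vS[OF defs] by blast
  have 2: "\<forall>i u. 1 \<le> i \<longrightarrow> i < n \<longrightarrow> u \<in> fs.span (?b ` SYT\<^sub>\<Lambda>) \<longrightarrow> act W (sw n i) u \<in> fs.span (?b ` SYT\<^sub>\<Lambda>)"
    using M_S[OF defs] unfolding M by blast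
  have 3: "\<forall>g\<in>carrier G. \<forall>i\<in>{1..n}. \<forall>u\<in>fs.span (?b ` SYT\<^sub>\<Lambda>). act W (pl n g i) u \<in> fs.span (?b ` SYT\<^sub>\<Lambda>)"
    using M_Y[OF defs] unfolding M by blast
  have 4: "\<forall>U T T'. fs.subspace U \<longrightarrow> (\<forall>i u. 1 \<le> i \<longrightarrow> i < n \<longrightarrow> u \<in> U \<longrightarrow> act W (sw n i) u \<in> U) \<longrightarrow>
      T \<in> SYT\<^sub>\<Lambda> \<longrightarrow> T' \<in> SYT\<^sub>\<Lambda> \<longrightarrow> ?b T \<in> U \<longrightarrow> ?b T' \<in> U"
    using vS_connected[OF defs] by blast
  have 5: "v \<in> fs.span (?b ` SYT\<^sub>\<Lambda>)"
    by (rule U[OF fs.subspace_span _ 2]) (use v0_M[OF defs] in \<open>simp add: M\<close>)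
  show ?thesis by (rule exI[of _ ?b], intro conjI 1 2 3 4 5)
qed

end
end

section \<open>The irreducible representations\<close>

lemma diagram_inject:
  assumes "partition l" "partition l'" "diagram l = diagram l'" shows "l = l'"
proof -
  have nth: "1 \<le> l ! i" if "partition l" "i < length l" for l :: "nat list" and i
    using that nth_mem[of i l] unfolding partition_def by (cases "l ! i") auto
  have len: "{x. (x, 1) \<in> diagram l} = {1..length l}" if "partition l" for l
    using nth[OF that] by (auto simp: diagram_def)
  have "length l = length l'"
    using len[OF assms(1)] len[OF assms(2)] assms(3) by (metis card_atLeastAtMost diff_Suc_1)
  moreover have "l ! i = l' ! i" if i: "i < length l" for i
  proof -
    have row: "{y. (Suc i, y) \<in> diagram k} = {1..k ! i}" if "i < length k" for k
      using that by (auto simp: diagram_def)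
    show ?thesis
      using row[of l] row[of l'] i assms(3) calculation by (metis card_atLeastAtMost diff_Suc_1)
  qed
  ultimately show ?thesis by (rule nth_equalityI)
qed

text \<open>Positions and contents determine the growth path, and the path determines shape and
  filling.\<close>

lemma tableau_weights_inject:
  assumes L: "\<Lambda> \<in> multipartitions m n" "\<Lambda>' \<in> multipartitions m n"
    and T: "T \<in> standard_tableaux m n \<Lambda>" "T' \<in> standard_tableaux m n \<Lambda>'"
    and eq: "\<And>i. i \<in> {1..n} \<Longrightarrow> tab_position m \<Lambda> T i = tab_position m \<Lambda>' T' i \<and>
      tab_content m \<Lambda> T i = tab_content m \<Lambda>' T' i"
  shows "\<Lambda> = \<Lambda>' \<and> T = T'"
proof -
  have nd: "node_at m \<Lambda> T i = node_at m \<Lambda>' T' i" if "i \<in> {1..n}" for i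
    by (rule is_path_unique[OF tableau_path[OF L(1) T(1)] tableau_path[OF L(2) T(2)] _ that])
      (use eq in \<open>simp add: tab_position_def tab_content_def\<close>)
  have nodes: "mnodes m \<Lambda> = mnodes m \<Lambda>'"
    unfolding node_at_image_all[OF L(1) T(1), symmetric] node_at_image_all[OF L(2) T(2), symmetric]
    by (rule image_cong[OF refl nd])
  have "\<Lambda> p = \<Lambda>' p" if p: "p \<in> {1..m}" for p
  proof (rule diagram_inject)
    show "partition (\<Lambda> p)" "partition (\<Lambda>' p)" using L p by (auto simp: multipartitions_def)
    have "diagram (\<Lambda> p) = {\<theta>. (\<theta>, p) \<in> mnodes m \<Lambda>}" for \<Lambda> using p by (auto simp: mnodes_def)
    then show "diagram (\<Lambda> p) = diagram (\<Lambda>' p)" using nodes by simp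
  qed
  moreover have "\<Lambda> \<in> extensional {1..m}" "\<Lambda>' \<in> extensional {1..m}"
    using L by (auto simp: multipartitions_def PiE_def)
  ultimately have LL: "\<Lambda> = \<Lambda>'" by (intro extensionalityI[of _ "{1..m}"])
  have "T \<theta> = T' \<theta>" for \<theta>
  proof (cases "\<theta> \<in> mnodes m \<Lambda>")
    case True
    have r: "T' \<theta> \<in> {1..n}" by (rule T_range[OF L(2) T(2)]) (use True nodes in simp)
    have "T (node_at m \<Lambda> T (T' \<theta>)) = T' \<theta>" by (rule T_node_at[OF L(1) T(1) r])
    then show ?thesis using nd[OF r] node_at_T[OF L(2) T(2), of \<theta>] True nodes by simp
  next
    case False
    then show ?thesis using tableau_undefined[OF L(1) T(1)] tableau_undefined[OF L(2) T(2)] nodes by simp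
  qed
  then show ?thesis using LL by blast
qed

lemma finite_tableaux: "finite (standard_tableaux m n \<Lambda>)"
proof (rule finite_subset)
  show "standard_tableaux m n \<Lambda> \<subseteq> PiE (mnodes m \<Lambda>) (\<lambda>_. {1..n})"
  proof
    fix T assume T: "T \<in> standard_tableaux m n \<Lambda>"
    then have "bij_betw T (mnodes m \<Lambda>) {1..n}" "T \<in> extensional (mnodes m \<Lambda>)"
      by (simp_all add: standard_tableaux_def)
    then show "T \<in> PiE (mnodes m \<Lambda>) (\<lambda>_. {1..n})" by (auto simp: bij_betw_def PiE_iff simp del: split_paired_All split_paired_Ex)
  qed
  show "finite (PiE (mnodes m \<Lambda>) (\<lambda>_. {1..n}))" using card_mnodes by (intro finite_PiE) auto
qed

lemma mat_eqI_vec: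
  assumes "B \<in> carrier_mat d d" "C \<in> carrier_mat d d"
    "\<And>v. v \<in> carrier_vec d \<Longrightarrow> B *\<^sub>v v = (C *\<^sub>v v :: complex vec)"
  shows "B = C"
proof (rule eq_matI)
  fix i j assume ij: "i < dim_row C" "j < dim_col C"
  have "(B *\<^sub>v unit_vec d j) $ i = (C *\<^sub>v unit_vec d j) $ i" using assms(3) by simp
  then show "B $$ (i, j) = C $$ (i, j)" using ij assms(1,2) by (simp add: scalar_prod_right_unit)
qed (use assms in auto)

text \<open>The elements \<open>sw\<close> and \<open>pl\<close> generate the group by products
  alone.\<close>

lemma (in group) wreath_induct:
  assumes h: "h \<in> carrier (wreath_product G n)"
    and one: "P \<one>\<^bsub>wreath_product G n\<^esub>"
    and sw: "\<And>i. 1 \<le> i \<Longrightarrow> i < n \<Longrightarrow> P (sw n i)"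
    and pl: "\<And>g i. g \<in> carrier G \<Longrightarrow> i \<in> {1..n} \<Longrightarrow> P (pl n g i)"
    and mult: "\<And>x y. x \<in> carrier (wreath_product G n) \<Longrightarrow> y \<in> carrier (wreath_product G n) \<Longrightarrow>
      P x \<Longrightarrow> P y \<Longrightarrow> P (x \<otimes>\<^bsub>wreath_product G n\<^esub> y)"
  shows "P h"
proof -
  let ?W = "wreath_product G n"
  define e :: "(nat \<Rightarrow> nat) \<Rightarrow> 'a wreath" where "e \<tau> = (\<lambda>j\<in>{1..n}. \<one>, \<tau>)" for \<tau>
  have ec: "e \<tau> \<in> carrier ?W" if "\<tau> permutes {1..n}" for \<tau> using that by (auto simp: carrier_wreath e_def)
  have em: "e \<sigma> \<otimes>\<^bsub>?W\<^esub> e \<tau> = e (\<sigma> \<circ> \<tau>)" if "\<sigma> permutes {1..n}" for \<sigma> \<tau>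
  proof -
    have "Hilbert_Choice.inv \<sigma> i \<in> {1..n}" if "i \<in> {1..n}" for i
      using permutes_in_image[OF permutes_inv[OF \<open>\<sigma> permutes {1..n}\<close>]] that by blast
    then show ?thesis by (auto simp: mult_wreath' fun_eq_iff e_def)
  qed
  have tp: "Transposition.transpose a b permutes {1..n}" if "a \<in> {1..n}" "b \<in> {1..n}" for a b
    by (rule permutes_swap_id[OF that])
  \<comment> \<open>Longer transpositions arise from neighbouring ones by conjugation.\<close>
  have adj: "P (e (Transposition.transpose a (a + Suc l)))" if "1 \<le> a" "a + Suc l \<le> n" for a l
    using that
  proof (induction l)
    case 0
    then show ?case using sw[of a] by (simp add: sw_def e_def)
  next
    case (Suc l)
    let ?t = "Transposition.transpose (a + Suc l) (Suc (a + Suc l))"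
    let ?u = "Transposition.transpose a (a + Suc l)"
    have c: "?t \<circ> ?u \<circ> ?t = Transposition.transpose a (a + Suc (Suc l))"
      by (auto simp: fun_eq_iff Transposition.transpose_def)
    have p: "?t permutes {1..n}" "?u permutes {1..n}" using Suc.prems by (intro tp; simp)+
    have Pt: "P (e ?t)" using sw[of "a + Suc l"] Suc.prems by (simp add: sw_def e_def)
    have Pu: "P (e ?u)" using Suc by simp
    have "P (e ?t \<otimes>\<^bsub>?W\<^esub> e ?u)" by (rule mult[OF ec[OF p(1)] ec[OF p(2)] Pt Pu])
    then have "P (e (?t \<circ> ?u))" by (simp only: em[OF p(1)])
    then have "P (e (?t \<circ> ?u) \<otimes>\<^bsub>?W\<^esub> e ?t)"
      by (rule mult[OF ec[OF permutes_compose[OF p(2,1)]] ec[OF p(1)] _ Pt])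
    then show ?case by (simp only: em[OF permutes_compose[OF p(2,1)]] c)
  qed
  have tr: "P (e (Transposition.transpose a b))" if ab: "a \<in> {1..n}" "b \<in> {1..n}" "a \<noteq> b" for a b
  proof -
    have less: "P (e (Transposition.transpose a b))" if "a \<in> {1..n}" "b \<in> {1..n}" "a < b" for a b
      using adj[of a "b - Suc a"] that by simp
    show ?thesis using less[of a b] less[of b a] ab by (cases "a < b") (auto simp: transpose_commute)
  qed
  have perm: "P (e \<sigma>)" if "\<sigma> permutes {1..n}" for \<sigma>
    using that
  proof (induction rule: permutes_induct[consumes 1, case_names fin id swap])
    case fin
    show ?case by simp
  next
    case id
    then show ?case using one by (simp add: one_wreath e_def id_def)
  next
    case (swap a b p)
    have "P (e (Transposition.transpose a b) \<otimes>\<^bsub>?W\<^esub> e p)"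
      by (rule mult[OF ec[OF tp] ec tr]) (use swap in auto)
    then show ?case by (simp only: em[OF tp[OF swap.hyps(1,2)]])
  qed
  obtain a \<sigma> where hh: "h = (a, \<sigma>)" by (cases h)
  have a: "a \<in> PiE {1..n} (\<lambda>_. carrier G)" and \<sigma>: "\<sigma> permutes {1..n}"
    using h hh by (auto simp: carrier_wreath)
  \<comment> \<open>The G^n part is built up one coordinate at a time.\<close>
  define r :: "nat \<Rightarrow> 'a wreath" where "r k = (\<lambda>i\<in>{1..n}. if i \<le> k then a i else \<one>, id)" for k
  have ak: "a i \<in> carrier G" if "i \<in> {1..n}" for i using a that by auto
  have base: "P (r k)" if "k \<le> n" for k
    using that
  proof (induction k)
    case 0
    have "r 0 = \<one>\<^bsub>?W\<^esub>" unfolding r_def one_wreath by (auto simp: fun_eq_iff)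
    then show ?case using one by simp
  next
    case (Suc k)
    have xc: "r k \<in> carrier ?W" using ak by (auto simp: r_def carrier_wreath permutes_id)
    have sk: "Suc k \<in> {1..n}" using Suc by simp
    have "r k \<otimes>\<^bsub>?W\<^esub> pl n (a (Suc k)) (Suc k) = r (Suc k)"
      using ak by (auto simp: r_def mult_wreath' pl_def inv_id fun_eq_iff le_Suc_eq)
    moreover have "P (r k \<otimes>\<^bsub>?W\<^esub> pl n (a (Suc k)) (Suc k))"
      by (rule mult[OF xc pl_carrier[OF ak[OF sk]] _ pl[OF ak[OF sk] sk]]) (use Suc in simp)
    ultimately show ?case by simp
  qed
  have "r n = (a, id)"
    using a by (auto simp: r_def fun_eq_iff PiE_iff extensional_def)
  then have "P (a, id)" using base[of n] by simp
  moreover have "(a, id) \<in> carrier ?W" using a by (auto simp: carrier_wreath permutes_id)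
  ultimately have "P ((a, id) \<otimes>\<^bsub>?W\<^esub> e \<sigma>)" using mult[OF _ ec[OF \<sigma>] _ perm[OF \<sigma>]] by blast
  then show ?thesis using wreath_decompose[of a \<sigma> n] h hh by (simp add: e_def)
qed

context wreath_characters
begin

text \<open>The matrices of the module in the basis b. Different tableaux have different weights, so
  the basis is orthogonal and coordinates are quotients of inner products; the same fact makes each
  weight space of the module one-dimensional.\<close>

lemma shape_from_module:
  assumes \<Lambda>: "\<Lambda> \<in> multipartitions m n"
    and b: "\<forall>T\<in>standard_tableaux m n \<Lambda>. b T \<in> A \<and> b T \<noteq> 0 \<and>
      cm.wt (tab_position m \<Lambda> T) (\<lambda>i. of_int (tab_content m \<Lambda> T i)) (b T)"
    and MS: "\<forall>i u. 1 \<le> i \<longrightarrow> i < n \<longrightarrow> u \<in> fs.span (b ` standard_tableaux m n \<Lambda>) \<longrightarrow>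
      act W (sw n i) u \<in> fs.span (b ` standard_tableaux m n \<Lambda>)"
    and MY: "\<forall>g\<in>carrier G. \<forall>i\<in>{1..n}. \<forall>u\<in>fs.span (b ` standard_tableaux m n \<Lambda>).
      act W (pl n g i) u \<in> fs.span (b ` standard_tableaux m n \<Lambda>)"
    and conn: "\<forall>U T T'. fs.subspace U \<longrightarrow> (\<forall>i u. 1 \<le> i \<longrightarrow> i < n \<longrightarrow> u \<in> U \<longrightarrow> act W (sw n i) u \<in> U) \<longrightarrow>
      T \<in> standard_tableaux m n \<Lambda> \<longrightarrow> T' \<in> standard_tableaux m n \<Lambda> \<longrightarrow> b T \<in> U \<longrightarrow> b T' \<in> U"
    and ne: "standard_tableaux m n \<Lambda> \<noteq> {}"
  shows "\<exists>d R. shape_representation G n m \<rho> \<Lambda> d R \<and>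
    (\<forall>a. action W d R a = 0\<^sub>m d d \<longrightarrow> (\<forall>u\<in>fs.span (b ` standard_tableaux m n \<Lambda>). wg.conv a u = 0))"
proof -
  let ?SYT = "standard_tableaux m n \<Lambda>"
  define M where "M = fs.span (b ` ?SYT)"
  have subM: "fs.subspace M" unfolding M_def by (rule fs.subspace_span)
  have MA: "M \<subseteq> A" unfolding M_def by (rule fs.span_minimal[OF _ subspace_supp_in]) (use b in blast)
  have M_act: "act W h u \<in> M" if h: "h \<in> carrier W" and u: "u \<in> M" for h u
  proof -
    have "\<forall>u\<in>M. act W h u \<in> M"
    proof (rule wreath_induct[OF h])
      show "\<forall>u\<in>M. act W \<one>\<^bsub>W\<^esub> u \<in> M" by (simp add: wg.act_one)
      show "\<forall>u\<in>M. act W (sw n i) u \<in> M" if "1 \<le> i" "i < n" for i using MS that unfolding M_def by blast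
      show "\<forall>u\<in>M. act W (pl n g i) u \<in> M" if "g \<in> carrier G" "i \<in> {1..n}" for g i
        using MY that unfolding M_def by blast
      show "\<forall>u\<in>M. act W (x \<otimes>\<^bsub>W\<^esub> y) u \<in> M" if "x \<in> carrier W" "y \<in> carrier W"
        "\<forall>u\<in>M. act W x u \<in> M" "\<forall>u\<in>M. act W y u \<in> M" for x y
        using that by (simp add: wg.act_mult)
    qed
    then show ?thesis using u by blast
  qed
  obtain Ts where Ts: "set Ts = ?SYT" "distinct Ts" using finite_distinct_list[OF finite_tableaux] by blast
  define d where "d = length Ts"
  have idx: "\<exists>j<d. T = Ts ! j" if "T \<in> ?SYT" for T
  proof -
    have "T \<in> set Ts" using that Ts(1) by blast
    then show ?thesis unfolding in_set_conv_nth d_def by blast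
  qed
  have d0: "0 < d" using ne Ts by (auto simp: d_def)
  have TsS: "Ts ! j \<in> ?SYT" if "j < d" for j using that Ts nth_mem[of j Ts] by (simp add: d_def)
  define vb where "vb j = b (Ts ! j)" for j
  define wj where "wj j = wfun (tab_position m \<Lambda> (Ts ! j)) (\<lambda>i. of_int (tab_content m \<Lambda> (Ts ! j) i))" for j
  have vb: "vb j \<in> A" "vb j \<noteq> 0" "vb j \<in> M" if "j < d" for j
    using b TsS[OF that] by (auto simp: vb_def M_def intro: fs.span_base)
  have vbw: "weight_op a (vb j) = fscale (wj j a) (vb j)" if "j < d" "a \<in> ops n" for j a
    using b TsS[OF that(1)] that(2) unfolding vb_def wj_def wt_iff by blast
  have differ: "\<exists>a\<in>ops n. wj i a \<noteq> wj j a" if ij: "i < d" "j < d" "i \<noteq> j" for i j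
  proof (rule ccontr)
    assume "\<not> ?thesis"
    then have eq: "wj i a = wj j a" if "a \<in> ops n" for a using that by blast
    have "tab_position m \<Lambda> (Ts ! i) k = tab_position m \<Lambda> (Ts ! j) k \<and>
        tab_content m \<Lambda> (Ts ! i) k = tab_content m \<Lambda> (Ts ! j) k" if k: "k \<in> {1..n}" for k
    proof
      have "\<rho> (tab_position m \<Lambda> (Ts ! i) k) g = \<rho> (tab_position m \<Lambda> (Ts ! j) k) g" if "g \<in> carrier G" for g
        using eq[of "Inl (g, k)"] that k by (simp add: ops_def wj_def wfun_def)
      then show "tab_position m \<Lambda> (Ts ! i) k = tab_position m \<Lambda> (Ts ! j) k"
        using rho_inject pos_range[OF \<Lambda> TsS[OF ij(1)]] pos_range[OF \<Lambda> TsS[OF ij(2)]] k by blast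
      show "tab_content m \<Lambda> (Ts ! i) k = tab_content m \<Lambda> (Ts ! j) k"
        using eq[of "Inr k"] k by (simp add: ops_def wj_def wfun_def)
    qed
    then have "Ts ! i = Ts ! j" using tableau_weights_inject[OF \<Lambda> \<Lambda> TsS[OF ij(1)] TsS[OF ij(2)]] by blast
    then show False using ij Ts(2) by (simp add: d_def nth_eq_iff_index_eq)
  qed
  have orth: "ipw (vb i) (vb j) = 0" if "i < d" "j < d" "i \<noteq> j" for i j
    using differ[OF that] orthogonal_weights[OF order_refl vb(1)[OF that(1)], of "wj i" "vb j" "wj j"] vbw that by blast
  have orthw: "ipw (vb i) u = 0" if i: "i < d" and u: "\<And>a. a \<in> ops n \<Longrightarrow> weight_op a u = fscale (\<beta> a) u"
    and a: "a \<in> ops n" "wj i a \<noteq> \<beta> a" for i u \<beta> a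
    by (rule orthogonal_weights[OF order_refl vb(1)[OF i] vbw[OF i] u a])
  have nrm: "ipw (vb i) (vb i) \<noteq> 0" if "i < d" for i using ip_eq_0[OF wg.fin vb(1)[OF that]] vb(2)[OF that] by blast
  define \<kappa> where "\<kappa> x = (\<Sum>j\<in>{0..<d}. fscale (x $ j) (vb j))" for x :: "complex vec"
  define crd where "crd u = vec d (\<lambda>i. ipw (vb i) u / ipw (vb i) (vb i))" for u
  have \<kappa>M: "\<kappa> x \<in> M" for x unfolding \<kappa>_def by (intro fs.subspace_sum[OF subM] fs.subspace_scale[OF subM] vb) auto
  have ip\<kappa>: "ipw (vb i) (\<kappa> x) = x $ i * ipw (vb i) (vb i)" if "i < d" for i x
  proof -
    have "ipw (vb i) (\<kappa> x) = (\<Sum>j\<in>{0..<d}. if j = i then x $ i * ipw (vb i) (vb i) else 0)"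
      unfolding \<kappa>_def ip_sum_right ip_scale_right by (intro sum.cong refl) (use orth[OF that] in auto)
    then show ?thesis using that by simp
  qed
  have crd\<kappa>: "crd (\<kappa> x) = x" if "x \<in> carrier_vec d" for x
    by (rule eq_vecI) (use that ip\<kappa> nrm in \<open>auto simp: crd_def\<close>)
  have \<kappa>_inj: "x = y" if "x \<in> carrier_vec d" "y \<in> carrier_vec d" "\<kappa> x = \<kappa> y" for x y
    using crd\<kappa> that by metis
  have \<kappa>_add: "\<kappa> (x + y) = \<kappa> x + \<kappa> y" if "x \<in> carrier_vec d" "y \<in> carrier_vec d" for x y
    using that by (simp add: \<kappa>_def fs.scale_left_distrib sum.distrib)
  have \<kappa>_scale: "\<kappa> (c \<cdot>\<^sub>v x) = fscale c (\<kappa> x)" if "x \<in> carrier_vec d" for c x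
    using that by (simp add: \<kappa>_def fs.scale_sum_right)
  have \<kappa>_unit: "\<kappa> (unit_vec d j) = vb j" if "j < d" for j
  proof -
    have "\<kappa> (unit_vec d j) = (\<Sum>i\<in>{0..<d}. if i = j then vb j else 0)"
      unfolding \<kappa>_def by (intro sum.cong refl) (use that in auto)
    then show ?thesis using that by simp
  qed
  have crd_carrier: "crd u \<in> carrier_vec d" for u by (simp add: crd_def)
  have \<kappa>crd: "\<kappa> (crd u) = u" if "u \<in> M" for u
  proof -
    have crd_add: "crd (u + w) = crd u + crd w" for u w
      by (rule eq_vecI) (auto simp: crd_def ip_add_right add_divide_distrib)
    have crd_scale: "crd (fscale c u) = c \<cdot>\<^sub>v crd u" for c u
      by (rule eq_vecI) (auto simp: crd_def ip_scale_right)
    have "fs.subspace {u. \<kappa> (crd u) = u}"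
      unfolding fs.subspace_def
    proof (intro conjI ballI allI)
      have "crd 0 = 0\<^sub>v d" by (rule eq_vecI) (auto simp: crd_def)
      then show "0 \<in> {u. \<kappa> (crd u) = u}" by (simp add: \<kappa>_def)
      fix u assume "u \<in> {u. \<kappa> (crd u) = u}"
      then have u: "\<kappa> (crd u) = u" by blast
      show "fscale c u \<in> {u. \<kappa> (crd u) = u}" for c
        by (rule CollectI) (simp only: crd_scale \<kappa>_scale[OF crd_carrier] u)
      fix w assume "w \<in> {u. \<kappa> (crd u) = u}"
      then have w: "\<kappa> (crd w) = w" by blast
      show "u + w \<in> {u. \<kappa> (crd u) = u}"
        by (rule CollectI) (simp only: crd_add \<kappa>_add[OF crd_carrier crd_carrier] u w)
    qed
    moreover have "b T \<in> {u. \<kappa> (crd u) = u}" if "T \<in> ?SYT" for T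
    proof -
      obtain j where j: "j < d" "T = Ts ! j" using idx[OF \<open>T \<in> ?SYT\<close>] by blast
      have "crd (\<kappa> (unit_vec d j)) = unit_vec d j" by (rule crd\<kappa>) simp
      then have "\<kappa> (crd (vb j)) = vb j" using \<kappa>_unit[OF j(1)] by simp
      then show ?thesis using j by (simp add: vb_def)
    qed
    then have "b ` ?SYT \<subseteq> {u. \<kappa> (crd u) = u}" by blast
    ultimately have "M \<subseteq> {u. \<kappa> (crd u) = u}" unfolding M_def by (intro fs.span_minimal)
    then show ?thesis using that by blast
  qed
  have \<kappa>_mat: "\<kappa> (B *\<^sub>v x) = (\<Sum>j\<in>{0..<d}. fscale (x $ j) (\<Sum>i\<in>{0..<d}. fscale (B $$ (i, j)) (vb i)))"
    if "B \<in> carrier_mat d d" "x \<in> carrier_vec d" for B x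
  proof -
    have "\<kappa> (B *\<^sub>v x) = (\<Sum>i\<in>{0..<d}. \<Sum>j\<in>{0..<d}. fscale (x $ j) (fscale (B $$ (i, j)) (vb i)))"
      unfolding \<kappa>_def
    proof (intro sum.cong refl)
      fix i assume i: "i \<in> {0..<d}"
      have "(B *\<^sub>v x) $ i = (\<Sum>j\<in>{0..<d}. B $$ (i, j) * x $ j)"
        using that i by (simp add: scalar_prod_def)
      then show "fscale ((B *\<^sub>v x) $ i) (vb i) = (\<Sum>j\<in>{0..<d}. fscale (x $ j) (fscale (B $$ (i, j)) (vb i)))"
        by (simp add: fs.scale_sum_left mult.commute)
    qed
    also have "\<dots> = (\<Sum>j\<in>{0..<d}. \<Sum>i\<in>{0..<d}. fscale (x $ j) (fscale (B $$ (i, j)) (vb i)))" by (rule sum.swap)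
    finally show ?thesis by (simp only: fs.scale_sum_right)
  qed
  define R where "R h = mat d d (\<lambda>(i, j). crd (act W h (vb j)) $ i)" for h
  have R_carrier: "R h \<in> carrier_mat d d" for h by (simp add: R_def)
  have \<kappa>R: "\<kappa> (R h *\<^sub>v x) = act W h (\<kappa> x)" if h: "h \<in> carrier W" and x: "x \<in> carrier_vec d" for h x
  proof -
    have "(\<Sum>i\<in>{0..<d}. fscale (R h $$ (i, j)) (vb i)) = act W h (vb j)" if j: "j \<in> {0..<d}" for j
    proof -
      have "(\<Sum>i\<in>{0..<d}. fscale (R h $$ (i, j)) (vb i)) = \<kappa> (crd (act W h (vb j)))"
        unfolding \<kappa>_def by (intro sum.cong refl) (use j in \<open>simp add: R_def\<close>)
      then show ?thesis using \<kappa>crd[OF M_act[OF h vb(3)]] j by simp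
    qed
    then show ?thesis unfolding \<kappa>_mat[OF R_carrier x] by (simp add: \<kappa>_def act_sum act_fscale)
  qed
  have rep: "representation W d R"
    unfolding representation_def
  proof (intro conjI ballI)
    show "R \<one>\<^bsub>W\<^esub> = 1\<^sub>m d"
    proof (rule mat_eqI_vec[OF R_carrier])
      fix v :: "complex vec" assume v: "v \<in> carrier_vec d"
      have "\<kappa> (R \<one>\<^bsub>W\<^esub> *\<^sub>v v) = \<kappa> v" using v by (simp add: \<kappa>R wg.act_one)
      then show "R \<one>\<^bsub>W\<^esub> *\<^sub>v v = 1\<^sub>m d *\<^sub>v v"
        using \<kappa>_inj[of "R \<one>\<^bsub>W\<^esub> *\<^sub>v v" v] v mult_mat_vec_carrier[OF R_carrier v] by simp
    qed simp
    fix x y assume xy: "x \<in> carrier W" "y \<in> carrier W"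
    show "R (x \<otimes>\<^bsub>W\<^esub> y) = R x * R y"
    proof (rule mat_eqI_vec[OF R_carrier mult_carrier_mat[OF R_carrier R_carrier]])
      fix v :: "complex vec" assume v: "v \<in> carrier_vec d"
      have c: "R x *\<^sub>v (R y *\<^sub>v v) \<in> carrier_vec d" "R (x \<otimes>\<^bsub>W\<^esub> y) *\<^sub>v v \<in> carrier_vec d" "R y *\<^sub>v v \<in> carrier_vec d"
        by (intro mult_mat_vec_carrier[OF R_carrier] v)+
      have "\<kappa> (R (x \<otimes>\<^bsub>W\<^esub> y) *\<^sub>v v) = \<kappa> (R x *\<^sub>v (R y *\<^sub>v v))"
        using xy v c by (simp add: \<kappa>R wg.act_mult)
      then have "R (x \<otimes>\<^bsub>W\<^esub> y) *\<^sub>v v = R x *\<^sub>v (R y *\<^sub>v v)" using \<kappa>_inj c by blast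
      then show "R (x \<otimes>\<^bsub>W\<^esub> y) *\<^sub>v v = R x * R y *\<^sub>v v"
        using assoc_mult_mat_vec[OF R_carrier R_carrier v] by simp
    qed
  qed (rule R_carrier)
  have act_carrier: "action W d R a \<in> carrier_mat d d" for a by (simp add: action_def)
  have \<kappa>_action: "\<kappa> (action W d R a *\<^sub>v x) = wg.conv a (\<kappa> x)" if x: "x \<in> carrier_vec d" for a x
  proof -
    have "\<kappa> (action W d R a *\<^sub>v x) = (\<Sum>j\<in>{0..<d}. fscale (x $ j) (\<Sum>i\<in>{0..<d}. fscale (\<Sum>h\<in>carrier W. a h * R h $$ (i, j)) (vb i)))"
      unfolding \<kappa>_mat[OF act_carrier x] by (intro sum.cong refl arg_cong[of _ _ "fscale _"]) (simp add: action_def)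
    also have "\<dots> = (\<Sum>h\<in>carrier W. fscale (a h) (\<Sum>j\<in>{0..<d}. fscale (x $ j) (\<Sum>i\<in>{0..<d}. fscale (R h $$ (i, j)) (vb i))))"
    proof -
      have "(\<Sum>j\<in>{0..<d}. fscale (x $ j) (\<Sum>i\<in>{0..<d}. fscale (\<Sum>h\<in>carrier W. a h * R h $$ (i, j)) (vb i)))
        = (\<Sum>j\<in>{0..<d}. \<Sum>i\<in>{0..<d}. \<Sum>h\<in>carrier W. fscale (a h * (x $ j * R h $$ (i, j))) (vb i))"
        by (simp add: fs.scale_sum_left fs.scale_sum_right mult_ac)
      also have "\<dots> = (\<Sum>j\<in>{0..<d}. \<Sum>h\<in>carrier W. \<Sum>i\<in>{0..<d}. fscale (a h * (x $ j * R h $$ (i, j))) (vb i))"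
        by (intro sum.cong refl sum.swap)
      also have "\<dots> = (\<Sum>h\<in>carrier W. \<Sum>j\<in>{0..<d}. \<Sum>i\<in>{0..<d}. fscale (a h * (x $ j * R h $$ (i, j))) (vb i))"
        by (rule sum.swap)
      finally show ?thesis by (simp add: fs.scale_sum_right)
    qed
    also have "\<dots> = (\<Sum>h\<in>carrier W. fscale (a h) (act W h (\<kappa> x)))"
      by (intro sum.cong refl arg_cong[of _ _ "fscale _"]) (simp add: \<kappa>R[OF _ x, symmetric] \<kappa>_mat[OF R_carrier x])
    also have "\<dots> = wg.conv a (\<kappa> x)" by (rule wg.conv_act[symmetric]) (use \<kappa>M MA in blast)
    finally show ?thesis .
  qed
  have eigenspace: "v \<in> tableau_eigenspace G n m \<rho> d R \<Lambda> T \<longleftrightarrow> v \<in> carrier_vec d \<and>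
      cm.wt (tab_position m \<Lambda> T) (\<lambda>i. of_int (tab_content m \<Lambda> T i)) (\<kappa> v)" for v and T :: "mnode \<Rightarrow> nat"
  proof (cases "v \<in> carrier_vec d")
    case True
    have kA: "\<kappa> v \<in> A" using \<kappa>M MA by blast
    have iff: "action W d R a *\<^sub>v v = c \<cdot>\<^sub>v v \<longleftrightarrow> wg.conv a (\<kappa> v) = fscale c (\<kappa> v)" for a c
      unfolding \<kappa>_action[OF True, symmetric] \<kappa>_scale[OF True, symmetric]
      using \<kappa>_inj[OF mult_mat_vec_carrier[OF act_carrier True] smult_carrier_vec[THEN iffD2, OF True]] by auto
    have "wg.conv (place G n i g) (\<kappa> v) = act W (pl n g i) (\<kappa> v)" if "g \<in> carrier G" for g i
      by (rule place_conv[OF that kA])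
    moreover have "wg.conv (jm_elem G n i) (\<kappa> v) = wm.J i (\<kappa> v)" if "i \<in> {1..n}" for i
      by (rule jm_conv[OF _ kA]) (use that in simp)
    ultimately show ?thesis
      using True unfolding tableau_eigenspace_def cm.wt_def wm.eig_def mem_Collect_eq iff by simp
  qed (simp add: tableau_eigenspace_def)
  have eig_unit: "tableau_eigenspace G n m \<rho> d R \<Lambda> (Ts ! j) = {c \<cdot>\<^sub>v unit_vec d j | c. True}" if j: "j < d" for j
  proof (intro subset_antisym subsetI)
    fix v :: "complex vec" assume "v \<in> tableau_eigenspace G n m \<rho> d R \<Lambda> (Ts ! j)"
    then have v: "v \<in> carrier_vec d" "\<And>a. a \<in> ops n \<Longrightarrow> weight_op a (\<kappa> v) = fscale (wj j a) (\<kappa> v)"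
      unfolding eigenspace wt_iff wj_def by blast+
    have "v $ i = 0" if i: "i < d" "i \<noteq> j" for i
    proof -
      obtain a where a: "a \<in> ops n" "wj i a \<noteq> wj j a" using differ[OF i(1) j i(2)] by blast
      have "ipw (vb i) (\<kappa> v) = 0" by (rule orthw[OF i(1) v(2) a])
      then show ?thesis using ip\<kappa>[OF i(1), of v] nrm[OF i(1)] by simp
    qed
    then have "v = v $ j \<cdot>\<^sub>v unit_vec d j" by (intro eq_vecI) (use v(1) j in auto)
    then show "v \<in> {c \<cdot>\<^sub>v unit_vec d j | c. True}" by blast
  next
    fix v :: "complex vec" assume "v \<in> {c \<cdot>\<^sub>v unit_vec d j | c. True}"
    then obtain c where v: "v = c \<cdot>\<^sub>v unit_vec d j" by blast
    have "\<kappa> v = fscale c (vb j)" unfolding v by (subst \<kappa>_scale) (simp_all add: \<kappa>_unit[OF j])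
    then show "v \<in> tableau_eigenspace G n m \<rho> d R \<Lambda> (Ts ! j)"
      unfolding eigenspace using b TsS[OF j] cm.wt_scale by (simp add: v vb_def)
  qed
  \<comment> \<open>A nonzero invariant subspace contains a joint eigenvector; orthogonality makes
    it a multiple of a single basis vector, and \<open>conn\<close> then yields all basis
    vectors.\<close>
  have irr: "irreducible_representation W d R"
    unfolding irreducible_representation_def
  proof (intro conjI allI impI rep d0)
    fix W' assume inv: "invariant_subspace W d R W'"
    then have W': "W' \<subseteq> carrier_vec d" "0\<^sub>v d \<in> W'" "\<And>v w. v \<in> W' \<Longrightarrow> w \<in> W' \<Longrightarrow> v + w \<in> W'"
      "\<And>c v. v \<in> W' \<Longrightarrow> c \<cdot>\<^sub>v v \<in> W'" "\<And>x v. x \<in> carrier W \<Longrightarrow> v \<in> W' \<Longrightarrow> R x *\<^sub>v v \<in> W'"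
      unfolding invariant_subspace_def by blast+
    show "W' = {0\<^sub>v d} \<or> W' = carrier_vec d"
    proof (cases "W' = {0\<^sub>v d}")
      case False
      then obtain x where x: "x \<in> W'" "x \<noteq> 0\<^sub>v d" using W'(2) by blast
      define U where "U = \<kappa> ` W'"
      have \<kappa>0: "\<kappa> (0\<^sub>v d) = 0" by (simp add: \<kappa>_def)
      have subU: "fs.subspace U"
        unfolding fs.subspace_def
      proof (intro conjI ballI allI)
        show "0 \<in> U" unfolding U_def using W'(2) \<kappa>0 by (metis imageI)
        fix u assume "u \<in> U"
        then obtain y where y: "y \<in> W'" "u = \<kappa> y" unfolding U_def by blast
        show "fscale c u \<in> U" for c
          unfolding U_def y(2) using \<kappa>_scale[of y c] W'(1,4) y(1) by (metis imageI subsetD)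
        fix w assume "w \<in> U"
        then obtain z where z: "z \<in> W'" "w = \<kappa> z" unfolding U_def by blast
        show "u + w \<in> U"
          unfolding U_def y(2) z(2) using \<kappa>_add[of y z] W'(1,3) y(1) z(1) by (metis imageI subsetD)
      qed
      have UA: "U \<subseteq> A" unfolding U_def using \<kappa>M MA by blast
      have U_act: "act W h u \<in> U" if h: "h \<in> carrier W" and u: "u \<in> U" for h u
      proof -
        obtain y where y: "y \<in> W'" "u = \<kappa> y" using u unfolding U_def by blast
        have "act W h u = \<kappa> (R h *\<^sub>v y)" using \<kappa>R[OF h] W'(1) y by auto
        then show ?thesis unfolding U_def using W'(5)[OF h y(1)] by blast
      qed
      have opU: "weight_op a u \<in> U" if "a \<in> ops n" "u \<in> U" for a u
        using that(1)
      proof (cases rule: ops_cases)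
        case (1 g i)
        then show ?thesis using U_act[OF pl_carrier that(2)] by simp
      next
        case (2 i)
        have "wm.J i u \<in> U"
          by (rule J_closed[OF subU U_act[OF pl_carrier] that(2)]) (use 2 U_act[OF sw_carrier] in auto)
        then show ?thesis using 2 by simp
      qed
      have kx: "\<kappa> x \<in> U" unfolding U_def using x by blast
      obtain w where w: "\<And>\<beta>. \<beta> \<in> weights n \<Longrightarrow> w \<beta> \<in> U \<and> (\<forall>a\<in>ops n. weight_op a (w \<beta>) = fscale (\<beta> a) (w \<beta>))"
        "\<kappa> x = (\<Sum>\<beta>\<in>weights n. w \<beta>)"
        using weight_decomposition[OF order_refl subU UA opU kx] by metis
      have "\<kappa> x \<noteq> 0" using \<kappa>_inj[of x "0\<^sub>v d"] x W'(1) \<kappa>0 by auto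
      then obtain \<beta> where \<beta>: "\<beta> \<in> weights n" "w \<beta> \<noteq> 0" using w(2) by (metis sum.neutral)
      obtain y where y: "y \<in> W'" "w \<beta> = \<kappa> y" using w(1)[OF \<beta>(1)] unfolding U_def by blast
      have yc: "y \<in> carrier_vec d" using W'(1) y by blast
      have "y \<noteq> 0\<^sub>v d" using \<beta>(2) y(2) \<kappa>0 by auto
      then obtain j where j: "j < d" "y $ j \<noteq> 0" using yc by (metis carrier_vecD eq_vecI index_zero_vec)
      have eqj: "wj j a = \<beta> a" if "a \<in> ops n" for a
      proof (rule ccontr)
        assume "wj j a \<noteq> \<beta> a"
        then have "ipw (vb j) (w \<beta>) = 0" using orthw[OF j(1)] w(1)[OF \<beta>(1)] that by blast
        then show False using ip\<kappa>[OF j(1), of y] nrm[OF j(1)] j(2) y(2) by simp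
      qed
      have "y $ i = 0" if i: "i < d" "i \<noteq> j" for i
      proof -
        obtain a where a: "a \<in> ops n" "wj i a \<noteq> wj j a" using differ[OF i(1) j(1) i(2)] by blast
        then have "ipw (vb i) (w \<beta>) = 0" using orthw[OF i(1)] w(1)[OF \<beta>(1)] eqj by metis
        then show ?thesis using ip\<kappa>[OF i(1), of y] nrm[OF i(1)] y(2) by simp
      qed
      then have "(1 / y $ j) \<cdot>\<^sub>v y = unit_vec d j" by (intro eq_vecI) (use yc j in auto)
      then have "unit_vec d j \<in> W'" using W'(4)[OF y(1)] by metis
      then have bj: "b (Ts ! j) \<in> U" unfolding U_def using \<kappa>_unit[OF j(1)] by (metis imageI vb_def)
      have "b T' \<in> U" if "T' \<in> ?SYT" for T'
        using conn subU U_act[OF sw_carrier] TsS[OF j(1)] that bj by blast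
      then have vU: "vb i \<in> U" if "i < d" for i using TsS[OF that] by (simp add: vb_def)
      have "v \<in> W'" if v: "v \<in> carrier_vec d" for v
      proof -
        have "\<kappa> v \<in> U" unfolding \<kappa>_def by (intro fs.subspace_sum[OF subU] fs.subspace_scale[OF subU] vU) auto
        then obtain z where "z \<in> W'" "\<kappa> v = \<kappa> z" unfolding U_def by blast
        then show ?thesis using \<kappa>_inj[OF v, of z] W'(1) by auto
      qed
      then show ?thesis using W'(1) by blast
    qed simp
  qed
  \<comment> \<open>Each summand lies on its own coordinate axis, so the sum collects the
    coordinates.\<close>
  have fsum: "finsum_vec TYPE(complex) d w ?SYT = vec d (\<lambda>j. w (Ts ! j) $ j)"
    if w: "w \<in> (\<Pi>\<^sub>E T\<in>?SYT. tableau_eigenspace G n m \<rho> d R \<Lambda> T)" for w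
  proof (rule eq_vecI)
    have wT: "w (Ts ! j) \<in> {c \<cdot>\<^sub>v unit_vec d j | c. True}" if "j < d" for j
      using PiE_mem[OF w TsS[OF that]] unfolding eig_unit[OF that] .
    have wc: "w \<in> ?SYT \<rightarrow> carrier_vec d" using w unfolding eigenspace[abs_def] by (auto simp: tableau_eigenspace_def)
    fix i assume "i < dim_vec (vec d (\<lambda>j. w (Ts ! j) $ j))"
    then have i: "i < d" by simp
    have "finsum_vec TYPE(complex) d w ?SYT $ i = (\<Sum>T\<in>?SYT. w T $ i)"
      by (rule index_finsum_vec[OF finite_tableaux i wc])
    also have "\<dots> = (\<Sum>T\<in>?SYT. if T = Ts ! i then w (Ts ! i) $ i else 0)"
    proof (intro sum.cong refl)
      fix T assume "T \<in> ?SYT"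
      then obtain j where j: "j < d" "T = Ts ! j" using idx by blast
      obtain c where "w (Ts ! j) = c \<cdot>\<^sub>v unit_vec d j" using wT[OF j(1)] by blast
      then show "w T $ i = (if T = Ts ! i then w (Ts ! i) $ i else 0)"
        using i j Ts(2) by (auto simp: nth_eq_iff_index_eq d_def)
    qed
    finally show "finsum_vec TYPE(complex) d w ?SYT $ i = vec d (\<lambda>j. w (Ts ! j) $ j) $ i"
      using i TsS[OF i] finite_tableaux by simp
  next
    have wc: "w \<in> ?SYT \<rightarrow> carrier_vec d" using w by (auto simp: tableau_eigenspace_def)
    show "dim_vec (finsum_vec TYPE(complex) d w ?SYT) = dim_vec (vec d (\<lambda>j. w (Ts ! j) $ j))"
      using finsum_vec_closed[OF wc] by simp
  qed
  have shape: "shape_representation G n m \<rho> \<Lambda> d R"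
    unfolding shape_representation_def
  proof (intro conjI irr ballI)
    fix T assume "T \<in> ?SYT"
    then obtain j where j: "j < d" "T = Ts ! j" using idx by blast
    show "\<exists>w. w \<noteq> 0\<^sub>v d \<and> tableau_eigenspace G n m \<rho> d R \<Lambda> T = {c \<cdot>\<^sub>v w | c. True} \<and> w \<in> carrier_vec d"
      unfolding j(2) eig_unit[OF j(1)] by (rule exI[of _ "unit_vec d j"]) (use j in simp)
  next
    fix v :: "complex vec" assume v: "v \<in> carrier_vec d"
    define w0 where "w0 = restrict (\<lambda>T. let j = (THE j. j < d \<and> T = Ts ! j) in v $ j \<cdot>\<^sub>v unit_vec d j) ?SYT"
    have w0: "w0 (Ts ! j) = v $ j \<cdot>\<^sub>v unit_vec d j" if "j < d" for j
    proof -
      have "(THE i. i < d \<and> Ts ! j = Ts ! i) = j"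
        by (rule the_equality) (use that Ts(2) in \<open>auto simp: nth_eq_iff_index_eq d_def\<close>)
      then show ?thesis using TsS[OF that] by (simp add: w0_def)
    qed
    have w0P: "w0 \<in> (\<Pi>\<^sub>E T\<in>?SYT. tableau_eigenspace G n m \<rho> d R \<Lambda> T)"
    proof (rule PiE_I)
      fix T assume "T \<in> ?SYT"
      then obtain j where j: "j < d" "T = Ts ! j" using idx by blast
      show "w0 T \<in> tableau_eigenspace G n m \<rho> d R \<Lambda> T" unfolding j(2) eig_unit[OF j(1)] w0[OF j(1)] by blast
    qed (simp add: w0_def)
    show "\<exists>!w. w \<in> (\<Pi>\<^sub>E T\<in>?SYT. tableau_eigenspace G n m \<rho> d R \<Lambda> T) \<and> v = finsum_vec TYPE(complex) d w ?SYT"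
    proof (rule ex1I[of _ w0])
      have "finsum_vec TYPE(complex) d w0 ?SYT = v"
        unfolding fsum[OF w0P] by (rule eq_vecI) (use v w0 in auto)
      then show "w0 \<in> (\<Pi>\<^sub>E T\<in>?SYT. tableau_eigenspace G n m \<rho> d R \<Lambda> T) \<and> v = finsum_vec TYPE(complex) d w0 ?SYT"
        using w0P by simp
      fix w assume w: "w \<in> (\<Pi>\<^sub>E T\<in>?SYT. tableau_eigenspace G n m \<rho> d R \<Lambda> T) \<and> v = finsum_vec TYPE(complex) d w ?SYT"
      show "w = w0"
      proof (rule PiE_ext[OF conjunct1[OF w] w0P])
        fix T assume "T \<in> ?SYT"
        then obtain j where j: "j < d" "T = Ts ! j" using idx by blast
        have "w (Ts ! j) \<in> {c \<cdot>\<^sub>v unit_vec d j | c. True}"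
          using PiE_mem[OF conjunct1[OF w] TsS[OF j(1)]] unfolding eig_unit[OF j(1)] .
        then obtain c where c: "w (Ts ! j) = c \<cdot>\<^sub>v unit_vec d j" by blast
        have "v $ j = w (Ts ! j) $ j" using fsum[OF conjunct1[OF w]] conjunct2[OF w] j(1) by simp
        then have "c = v $ j" using c j(1) by simp
        then show "w T = w0 T" using c w0[OF j(1)] j by simp
      qed
    qed
  qed
  \<comment> \<open>In coordinates the matrix of a is left multiplication by a, so a zero matrix
    annihilates the span.\<close>
  have kill: "wg.conv a u = 0" if a: "action W d R a = 0\<^sub>m d d" and u: "u \<in> M" for a u
  proof -
    have "wg.conv a (\<kappa> (crd u)) = \<kappa> (action W d R a *\<^sub>v crd u)" by (rule \<kappa>_action[OF crd_carrier, symmetric])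
    also have "action W d R a *\<^sub>v crd u = 0\<^sub>v d" unfolding a 
      by (rule eq_vecI) (use crd_carrier[of u] in \<open>auto simp: scalar_prod_left_zero\<close>)
    also have "\<kappa> (0\<^sub>v d) = 0" by (simp add: \<kappa>_def)
    finally show ?thesis using \<kappa>crd[OF u] by simp
  qed
  show ?thesis using shape kill unfolding M_def by blast
qed

text \<open>Decompose 1 into weight vectors. Each nonzero one has the weight of a tableau and lies
  in a seminormal module, on which a acts by 0; hence a = a 1 = 0.\<close>

theorem shape_representations_separate:
  assumes a: "a \<in> A"
    and zero: "\<And>\<Lambda> d R. \<Lambda> \<in> multipartitions m n \<Longrightarrow> shape_representation G n m \<rho> \<Lambda> d R \<Longrightarrow> action W d R a = 0\<^sub>m d d"
  shows "a = 0"
proof -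
  define \<delta> :: "'g wreath \<Rightarrow> complex" where "\<delta> = group_elem \<one>\<^bsub>W\<^esub>"
  have \<delta>: "\<delta> \<in> A" unfolding \<delta>_def by (rule wg.group_elem_closed) simp
  obtain w where w: "\<And>\<beta>. \<beta> \<in> weights n \<Longrightarrow> w \<beta> \<in> A \<and> (\<forall>a\<in>ops n. weight_op a (w \<beta>) = fscale (\<beta> a) (w \<beta>))"
    "\<delta> = (\<Sum>\<beta>\<in>weights n. w \<beta>)"
    using weight_decomposition[OF order_refl subspace_supp_in order_refl op_A \<delta>] by metis
  have "wg.conv a (w \<beta>) = 0" if \<beta>: "\<beta> \<in> weights n" for \<beta>
  proof (cases "w \<beta> = 0")
    case True
    have "wg.conv a 0 = 0"
      by (rule wg.conv_sum_right[of "{}", simplified])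
    then show ?thesis using True by simp
  next
    case False
    have ev: "act W (pl n g i) (w \<beta>) = fscale (\<beta> (Inl (g, i))) (w \<beta>)" if "g \<in> carrier G" "i \<in> {1..n}" for g i
      using bspec[OF conjunct2[OF w(1)[OF \<beta>]], of "Inl (g, i)"] that by (simp add: ops_def)
    have "\<forall>i\<in>{1..n}. \<exists>q\<in>{1..m}. \<forall>g\<in>carrier G. \<beta> (Inl (g, i)) = \<rho> q g"
    proof
      fix i assume i: "i \<in> {1..n}"
      show "\<exists>q\<in>{1..m}. \<forall>g\<in>carrier G. \<beta> (Inl (g, i)) = \<rho> q g"
        by (rule eigenvalue_character[OF i False]) (rule ev[OF _ i])
    qed
    then obtain p where p: "\<And>i. i \<in> {1..n} \<Longrightarrow> p i \<in> {1..m} \<and> (\<forall>g\<in>carrier G. \<beta> (Inl (g, i)) = \<rho> (p i) g)"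
      by metis
    have "weight_op a (w \<beta>) = fscale (wfun p (\<lambda>i. \<beta> (Inr i)) a) (w \<beta>)" if a: "a \<in> ops n" for a
    proof -
      have "wfun p (\<lambda>i. \<beta> (Inr i)) a = \<beta> a"
        using a by (cases rule: ops_cases) (use p in \<open>simp_all add: wfun_def\<close>)
      then show ?thesis using w(1)[OF \<beta>] a by simp
    qed
    then have wt: "cm.wt p (\<lambda>i. \<beta> (Inr i)) (w \<beta>)" unfolding wt_iff by blast
    have pr: "p \<in> {1..n} \<rightarrow> {1..m}" using p by blast
    have wA: "w \<beta> \<in> A" using w(1)[OF \<beta>] by blast
    obtain \<nu> where \<nu>: "is_path m \<nu> n" "\<And>i. i \<in> {1..n} \<Longrightarrow> position (\<nu> i) = p i \<and> of_int (Defs.content (\<nu> i)) = \<beta> (Inr i)"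
      using weight_path[OF wA False wt pr] by blast
    obtain \<Lambda> T where \<Lambda>: "\<Lambda> \<in> multipartitions m n" and T: "T \<in> standard_tableaux m n \<Lambda>"
      and nd: "\<And>i. i \<in> {1..n} \<Longrightarrow> node_at m \<Lambda> T i = \<nu> i"
      using path_tableau[OF \<nu>(1)] by blast
    have "cm.wt (tab_position m \<Lambda> T) (\<lambda>i. of_int (tab_content m \<Lambda> T i)) (w \<beta>)"
      using wt by (subst cm.wt_cong[of _ p _ "\<lambda>i. \<beta> (Inr i)"])
        (use \<nu>(2) nd in \<open>auto simp: tab_position_def tab_content_def\<close>)
    from seminormal_module[OF \<Lambda> T wA False this] obtain b where b:
      "\<forall>T\<in>standard_tableaux m n \<Lambda>. b T \<in> A \<and> b T \<noteq> 0 \<and> cm.wt (tab_position m \<Lambda> T) (\<lambda>i. of_int (tab_content m \<Lambda> T i)) (b T)"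
      "\<forall>i u. 1 \<le> i \<longrightarrow> i < n \<longrightarrow> u \<in> fs.span (b ` standard_tableaux m n \<Lambda>) \<longrightarrow>
        act W (sw n i) u \<in> fs.span (b ` standard_tableaux m n \<Lambda>)"
      "\<forall>g\<in>carrier G. \<forall>i\<in>{1..n}. \<forall>u\<in>fs.span (b ` standard_tableaux m n \<Lambda>).
        act W (pl n g i) u \<in> fs.span (b ` standard_tableaux m n \<Lambda>)"
      "\<forall>U T T'. fs.subspace U \<longrightarrow> (\<forall>i u. 1 \<le> i \<longrightarrow> i < n \<longrightarrow> u \<in> U \<longrightarrow> act W (sw n i) u \<in> U) \<longrightarrow>
        T \<in> standard_tableaux m n \<Lambda> \<longrightarrow> T' \<in> standard_tableaux m n \<Lambda> \<longrightarrow> b T \<in> U \<longrightarrow> b T' \<in> U"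
      "w \<beta> \<in> fs.span (b ` standard_tableaux m n \<Lambda>)"
      by (elim exE conjE) (rule that)
    have "standard_tableaux m n \<Lambda> \<noteq> {}" using T by blast
    from shape_from_module[OF \<Lambda> b(1-4) this] obtain d R where
      "shape_representation G n m \<rho> \<Lambda> d R" "\<And>a u. action W d R a = 0\<^sub>m d d \<Longrightarrow>
        u \<in> fs.span (b ` standard_tableaux m n \<Lambda>) \<Longrightarrow> wg.conv a u = 0" by blast
    then show ?thesis using zero[OF \<Lambda>] b(5) by blast
  qed
  then have "wg.conv a \<delta> = 0" unfolding w(2) by (subst wg.conv_sum_right) (use w(1) in auto)
  then show ?thesis unfolding \<delta>_def using wg.conv_one_right[OF a] by simp
qed

end

section \<open>The idempotent of a tableau\<close>

lemma (in finite_group) action_mult: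
  assumes R: "representation G d R" and b: "b \<in> A"
  shows "action G d R (conv a b) = action G d R a * action G d R b"
proof (rule eq_matI)
  fix i j assume "i < dim_row (action G d R a * action G d R b)" "j < dim_col (action G d R a * action G d R b)"
  then have ij: "i < d" "j < d" by (simp_all add: action_def)
  have Rc: "R x \<in> carrier_mat d d" if "x \<in> carrier G" for x
    using R that unfolding representation_def by blast
  have Rm: "R (y \<otimes> z) $$ (i, j) = (\<Sum>l\<in>{0..<d}. R y $$ (i, l) * R z $$ (l, j))"
    if "y \<in> carrier G" "z \<in> carrier G" for y z
  proof -
    have "R (y \<otimes> z) = R y * R z" using R that unfolding representation_def by blast
    then show ?thesis using Rc[OF that(1)] Rc[OF that(2)] ij by (simp add: scalar_prod_def)
  qed
  have ab: "conv a b x = (\<Sum>y\<in>carrier G. a y * b (inv y \<otimes> x))" if "x \<in> carrier G" for x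
    using that by (simp add: conv_act[OF b] sum_fun_apply fscale_def act_def)
  have "action G d R (conv a b) $$ (i, j) = (\<Sum>x\<in>carrier G. conv a b x * R x $$ (i, j))"
    using ij by (simp add: action_def)
  also have "\<dots> = (\<Sum>x\<in>carrier G. \<Sum>y\<in>carrier G. a y * b (inv y \<otimes> x) * R x $$ (i, j))"
    by (intro sum.cong refl) (simp only: ab sum_distrib_right)
  also have "\<dots> = (\<Sum>y\<in>carrier G. \<Sum>x\<in>carrier G. a y * b (inv y \<otimes> x) * R x $$ (i, j))" by (rule sum.swap)
  also have "\<dots> = (\<Sum>y\<in>carrier G. \<Sum>z\<in>carrier G. a y * b z * R (y \<otimes> z) $$ (i, j))"
  proof (rule sum.cong[OF refl])
    fix y assume y: "y \<in> carrier G"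
    show "(\<Sum>x\<in>carrier G. a y * b (inv y \<otimes> x) * R x $$ (i, j)) = (\<Sum>z\<in>carrier G. a y * b z * R (y \<otimes> z) $$ (i, j))"
      by (rule sum.reindex_bij_witness[of _ "\<lambda>z. y \<otimes> z" "\<lambda>x. inv y \<otimes> x"])
        (use y in \<open>auto simp: m_assoc[symmetric]\<close>)
  qed
  also have "\<dots> = (\<Sum>y\<in>carrier G. \<Sum>z\<in>carrier G. \<Sum>l\<in>{0..<d}. (a y * R y $$ (i, l)) * (b z * R z $$ (l, j)))"
    by (intro sum.cong refl) (simp add: Rm sum_distrib_left mult_ac)
  also have "\<dots> = (\<Sum>y\<in>carrier G. \<Sum>l\<in>{0..<d}. \<Sum>z\<in>carrier G. (a y * R y $$ (i, l)) * (b z * R z $$ (l, j)))"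
    by (intro sum.cong refl sum.swap)
  also have "\<dots> = (\<Sum>l\<in>{0..<d}. \<Sum>y\<in>carrier G. \<Sum>z\<in>carrier G. (a y * R y $$ (i, l)) * (b z * R z $$ (l, j)))"
    by (rule sum.swap)
  also have "\<dots> = (\<Sum>l\<in>{0..<d}. (\<Sum>y\<in>carrier G. a y * R y $$ (i, l)) * (\<Sum>z\<in>carrier G. b z * R z $$ (l, j)))"
    by (simp only: sum_product)
  also have "\<dots> = (action G d R a * action G d R b) $$ (i, j)"
    using ij by (simp add: action_def scalar_prod_def)
  finally show "action G d R (conv a b) $$ (i, j) = (action G d R a * action G d R b) $$ (i, j)" .
qed (simp_all add: action_def)

lemma action_vec:
  assumes "representation H d R" "v \<in> carrier_vec d" "i < d"
  shows "(action H d R a *\<^sub>v v) $ i = (\<Sum>x\<in>carrier H. a x * (R x *\<^sub>v v) $ i)"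
proof -
  have Rc: "R x \<in> carrier_mat d d" if "x \<in> carrier H" for x
    using assms(1) that unfolding representation_def by blast
  have "(action H d R a *\<^sub>v v) $ i = (\<Sum>j\<in>{0..<d}. \<Sum>x\<in>carrier H. a x * (R x $$ (i, j) * v $ j))"
    using assms(2,3) by (simp add: action_def scalar_prod_def sum_distrib_right mult.assoc)
  also have "\<dots> = (\<Sum>x\<in>carrier H. \<Sum>j\<in>{0..<d}. a x * (R x $$ (i, j) * v $ j))" by (rule sum.swap)
  also have "\<dots> = (\<Sum>x\<in>carrier H. a x * (R x *\<^sub>v v) $ i)"
  proof (intro sum.cong refl)
    fix x assume "x \<in> carrier H"
    then show "(\<Sum>j\<in>{0..<d}. a x * (R x $$ (i, j) * v $ j)) = a x * (R x *\<^sub>v v) $ i"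
      using Rc[of x] assms(2,3) by (simp add: scalar_prod_def sum_distrib_left)
  qed
  finally show ?thesis .
qed

lemma action_carrier: "action H d R a \<in> carrier_mat d d"
  by (simp add: action_def)

lemma action_vec_carrier: "v \<in> carrier_vec d \<Longrightarrow> action H d R a *\<^sub>v v \<in> carrier_vec d"
  by (rule mult_mat_vec_carrier[OF action_carrier])

lemma action_vec_scale:
  assumes "representation H d R" "v \<in> carrier_vec d"
  shows "action H d R (fscale c a) *\<^sub>v v = c \<cdot>\<^sub>v (action H d R a *\<^sub>v v)"
proof (rule eq_vecI)
  fix i assume "i < dim_vec (c \<cdot>\<^sub>v (action H d R a *\<^sub>v v))"
  then have i: "i < d" by (simp add: action_def)
  have "(action H d R (fscale c a) *\<^sub>v v) $ i = c * (action H d R a *\<^sub>v v) $ i"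
    unfolding action_vec[OF assms i] by (simp add: fscale_def sum_distrib_left mult.assoc)
  then show "(action H d R (fscale c a) *\<^sub>v v) $ i = (c \<cdot>\<^sub>v (action H d R a *\<^sub>v v)) $ i"
    using i by (simp add: action_def)
qed (simp add: action_def)

lemma action_sum_index:
  assumes "representation H d R" "v \<in> carrier_vec d" "i < d"
  shows "(action H d R (sum f I) *\<^sub>v v) $ i = (\<Sum>x\<in>I. (action H d R (f x) *\<^sub>v v) $ i)"
  unfolding action_vec[OF assms] sum_fun_apply sum_distrib_right by (rule sum.swap)

lemma (in finite_group) action_one:
  assumes R: "representation G d R" and v: "v \<in> carrier_vec d"
  shows "action G d R (group_elem \<one>) *\<^sub>v v = v"
proof (rule eq_vecI)
  fix i assume "i < dim_vec v"
  then have i: "i < d" using v by simp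
  have "(action G d R (group_elem \<one>) *\<^sub>v v) $ i = (\<Sum>x\<in>carrier G. if x = \<one> then (R x *\<^sub>v v) $ i else 0)"
    unfolding action_vec[OF R v i] by (intro sum.cong refl) (simp add: group_elem_def)
  also have "\<dots> = (R \<one> *\<^sub>v v) $ i" using fin by simp
  also have "R \<one> *\<^sub>v v = v" using R v by (simp add: representation_def)
  finally show "(action G d R (group_elem \<one>) *\<^sub>v v) $ i = v $ i" .
qed (use v in \<open>simp add: action_def\<close>)

lemma mult_finsum_vec_zero:
  assumes "finite S" "B \<in> carrier_mat d d"
  shows "w \<in> S \<rightarrow> carrier_vec d \<Longrightarrow> (\<And>x. x \<in> S \<Longrightarrow> B *\<^sub>v w x = 0\<^sub>v d) \<Longrightarrow>
    B *\<^sub>v finsum_vec TYPE(complex) d w S = 0\<^sub>v d"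
  using assms(1)
proof (induction S rule: finite_induct)
  case empty
  show ?case unfolding finsum_vec_empty
    by (rule eq_vecI) (use assms(2) in auto)
next
  case (insert x S)
  have w: "w \<in> S \<rightarrow> carrier_vec d" "w x \<in> carrier_vec d" using insert.prems(1) by auto
  have "finsum_vec TYPE(complex) d w (insert x S) = w x + finsum_vec TYPE(complex) d w S"
    by (rule finsum_vec_insert[OF insert.hyps(1,2) w])
  then have "B *\<^sub>v finsum_vec TYPE(complex) d w (insert x S) = B *\<^sub>v w x + B *\<^sub>v finsum_vec TYPE(complex) d w S"
    using mult_add_distrib_mat_vec[OF assms(2) w(2) finsum_vec_closed[OF w(1)]] by simp
  also have "B *\<^sub>v w x = 0\<^sub>v d" by (rule insert.prems(2)) simp
  also have "B *\<^sub>v finsum_vec TYPE(complex) d w S = 0\<^sub>v d" by (rule insert.IH[OF w(1)]) (use insert.prems(2) in simp)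
  finally show ?case by simp
qed

section \<open>Idempotents attached to weights and to tableaux\<close>

context wreath_characters
begin

fun op_elem :: "('g \<times> nat) + nat \<Rightarrow> 'g wreath \<Rightarrow> complex" where
  "op_elem (Inl (g, i)) = place G n i g"
| "op_elem (Inr i) = jm_elem G n i"

lemma op_elem_A: "b \<in> ops n \<Longrightarrow> op_elem b \<in> A"
  by (erule ops_cases) (simp_all add: place_A jm_A)

lemma op_elem_conv: "b \<in> ops n \<Longrightarrow> v \<in> A \<Longrightarrow> wg.conv (op_elem b) v = weight_op b v"
  by (erule ops_cases) (simp_all add: place_conv jm_conv)

text \<open>Decompose \<open>1\<close> inside the subspace of those \<open>a\<close> that commute with the \<open>g_i\<close> and the
  Jucys--Murphy elements.\<close>

lemma weight_idempotents:
  "\<exists>e. (\<forall>\<beta>\<in>weights n. e \<beta> \<in> A \<and> (\<forall>b\<in>ops n. weight_op b (e \<beta>) = fscale (\<beta> b) (e \<beta>) \<and>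
      wg.conv (e \<beta>) (op_elem b) = weight_op b (e \<beta>))) \<and> group_elem \<one>\<^bsub>W\<^esub> = (\<Sum>\<beta>\<in>weights n. e \<beta>)"
proof -
  define U where "U = {a\<in>A. \<forall>b\<in>ops n. wg.conv a (op_elem b) = weight_op b a}"
  have lin: "weight_op b (x + y) = weight_op b x + weight_op b y" "weight_op b (fscale c x) = fscale c (weight_op b x)"
    for b x y c using op_lin[of b] by (simp_all add: fs.lin_def)
  have sub: "fs.subspace U"
    unfolding fs.subspace_def
  proof (intro conjI ballI allI)
    have "wg.conv 0 (op_elem b) = weight_op b 0" if "b \<in> ops n" for b
      using wg.conv_scale_left[OF op_elem_A[OF that], of 0 0] lin(2)[of b 0 0] by simp
    then show "0 \<in> U" unfolding U_def using fs.subspace_0[OF subspace_supp_in] by blast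
    fix x assume "x \<in> U"
    then have x: "x \<in> A" "\<And>b. b \<in> ops n \<Longrightarrow> wg.conv x (op_elem b) = weight_op b x" unfolding U_def by blast+
    have "wg.conv (fscale c x) (op_elem b) = weight_op b (fscale c x)" if b: "b \<in> ops n" for b c
      by (simp only: wg.conv_scale_left[OF op_elem_A[OF b]] x(2)[OF b] lin)
    then show "fscale c x \<in> U" for c
      unfolding U_def using fs.subspace_scale[OF subspace_supp_in x(1)] by blast
    fix y assume "y \<in> U"
    then have y: "y \<in> A" "\<And>b. b \<in> ops n \<Longrightarrow> wg.conv y (op_elem b) = weight_op b y" unfolding U_def by blast+
    have "wg.conv (x + y) (op_elem b) = weight_op b (x + y)" if b: "b \<in> ops n" for b
      by (simp only: wg.conv_add_left[OF op_elem_A[OF b]] x(2)[OF b] y(2)[OF b] lin)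
    then show "x + y \<in> U"
      unfolding U_def using fs.subspace_add[OF subspace_supp_in x(1) y(1)] by blast
  qed
  have closed: "weight_op b a \<in> U" if b: "b \<in> ops n" and a: "a \<in> U" for a b
  proof -
    have aA: "a \<in> A" and ac: "\<And>c. c \<in> ops n \<Longrightarrow> wg.conv a (op_elem c) = weight_op c a" using a unfolding U_def by blast+
    have "wg.conv (weight_op b a) (op_elem c) = weight_op c (weight_op b a)" if c: "c \<in> ops n" for c
    proof -
      have "wg.conv (weight_op b a) (op_elem c) = wg.conv (op_elem b) (wg.conv a (op_elem c))"
        unfolding op_elem_conv[OF b aA, symmetric] by (rule wg.conv_assoc[OF aA op_elem_A[OF c]])
      then show ?thesis by (simp only: ac[OF c] op_elem_conv[OF b op_A[OF c aA]] op_comm[OF b c])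
    qed
    then show ?thesis unfolding U_def using op_A[OF b aA] by blast
  qed
  have one: "group_elem \<one>\<^bsub>W\<^esub> \<in> A" by (rule wg.group_elem_closed) simp
  have "wg.conv (group_elem \<one>\<^bsub>W\<^esub>) (op_elem b) = weight_op b (group_elem \<one>\<^bsub>W\<^esub>)" if b: "b \<in> ops n" for b
    using wg.conv_one_left[OF op_elem_A[OF b]] wg.conv_one_right[OF op_elem_A[OF b]]
    by (simp only: wg.one_eq op_elem_conv[OF b one, symmetric])
  then have "group_elem \<one>\<^bsub>W\<^esub> \<in> U" unfolding U_def using one by blast
  moreover have "U \<subseteq> A" unfolding U_def by blast
  ultimately obtain e where "\<forall>\<beta>\<in>weights n. e \<beta> \<in> U \<and> (\<forall>b\<in>ops n. weight_op b (e \<beta>) = fscale (\<beta> b) (e \<beta>))"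
    "group_elem \<one>\<^bsub>W\<^esub> = (\<Sum>\<beta>\<in>weights n. e \<beta>)"
    using weight_decomposition[OF order_refl sub _ closed] by metis
  then show ?thesis unfolding U_def by blast
qed

definition widem :: "(('g \<times> nat) + nat \<Rightarrow> complex) \<Rightarrow> 'g wreath \<Rightarrow> complex" where
  "widem = (SOME e. (\<forall>\<beta>\<in>weights n. e \<beta> \<in> A \<and> (\<forall>b\<in>ops n. weight_op b (e \<beta>) = fscale (\<beta> b) (e \<beta>) \<and>
      wg.conv (e \<beta>) (op_elem b) = weight_op b (e \<beta>))) \<and> group_elem \<one>\<^bsub>W\<^esub> = (\<Sum>\<beta>\<in>weights n. e \<beta>))"

lemma widem:
  shows widem_A: "\<beta> \<in> weights n \<Longrightarrow> widem \<beta> \<in> A"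
    and widem_weight: "\<beta> \<in> weights n \<Longrightarrow> b \<in> ops n \<Longrightarrow> weight_op b (widem \<beta>) = fscale (\<beta> b) (widem \<beta>)"
    and widem_conv: "\<beta> \<in> weights n \<Longrightarrow> b \<in> ops n \<Longrightarrow> wg.conv (widem \<beta>) (op_elem b) = fscale (\<beta> b) (widem \<beta>)"
    and widem_sum: "group_elem \<one>\<^bsub>W\<^esub> = (\<Sum>\<beta>\<in>weights n. widem \<beta>)"
proof -
  have *: "(\<forall>\<beta>\<in>weights n. widem \<beta> \<in> A \<and> (\<forall>b\<in>ops n. weight_op b (widem \<beta>) = fscale (\<beta> b) (widem \<beta>) \<and>
      wg.conv (widem \<beta>) (op_elem b) = weight_op b (widem \<beta>))) \<and> group_elem \<one>\<^bsub>W\<^esub> = (\<Sum>\<beta>\<in>weights n. widem \<beta>)"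
    unfolding widem_def by (rule someI_ex[OF weight_idempotents])
  then show "group_elem \<one>\<^bsub>W\<^esub> = (\<Sum>\<beta>\<in>weights n. widem \<beta>)" by blast
  show "\<beta> \<in> weights n \<Longrightarrow> widem \<beta> \<in> A" using * by blast
  show 1: "\<beta> \<in> weights n \<Longrightarrow> b \<in> ops n \<Longrightarrow> weight_op b (widem \<beta>) = fscale (\<beta> b) (widem \<beta>)" using * by blast
  assume b: "\<beta> \<in> weights n" "b \<in> ops n"
  then have "wg.conv (widem \<beta>) (op_elem b) = weight_op b (widem \<beta>)" using * by blast
  then show "wg.conv (widem \<beta>) (op_elem b) = fscale (\<beta> b) (widem \<beta>)" using 1[OF b] by simp
qed

lemma finite_weights: "finite (weights n)"
  by (intro finite_PiE finite_ops) simp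

text \<open>The product of \<open>widem \<beta>\<close> with \<open>op_elem b\<close> on its right
  is computed twice: inside the algebra it gives the factor \<beta> b, by acting on v first it gives
  c b.\<close>

lemma widem_kill:
  assumes R: "representation W d R" and v: "v \<in> carrier_vec d"
    and ev: "\<And>b. b \<in> ops n \<Longrightarrow> action W d R (op_elem b) *\<^sub>v v = c b \<cdot>\<^sub>v v"
    and \<beta>: "\<beta> \<in> weights n" and b: "b \<in> ops n" "\<beta> b \<noteq> c b"
  shows "action W d R (widem \<beta>) *\<^sub>v v = 0\<^sub>v d"
proof -
  let ?y = "action W d R (widem \<beta>) *\<^sub>v v"
  have y: "?y \<in> carrier_vec d" by (rule action_vec_carrier[OF v])
  have "action W d R (wg.conv (widem \<beta>) (op_elem b)) *\<^sub>v v
      = action W d R (widem \<beta>) *\<^sub>v (action W d R (op_elem b) *\<^sub>v v)"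
    unfolding wg.action_mult[OF R op_elem_A[OF b(1)]] by (rule assoc_mult_mat_vec[OF action_carrier action_carrier v])
  also have "\<dots> = c b \<cdot>\<^sub>v ?y"
    unfolding ev[OF b(1)] by (rule mult_mat_vec[OF action_carrier v])
  finally have eq: "\<beta> b \<cdot>\<^sub>v ?y = c b \<cdot>\<^sub>v ?y"
    unfolding widem_conv[OF \<beta> b(1)] action_vec_scale[OF R v] .
  show ?thesis
  proof (rule eq_vecI)
    fix i assume "i < dim_vec (0\<^sub>v d)"
    then have i: "i < d" by simp
    have "(\<beta> b \<cdot>\<^sub>v ?y) $ i = (c b \<cdot>\<^sub>v ?y) $ i" unfolding eq ..
    moreover have "dim_vec ?y = d" using y by (rule carrier_vecD)
    ultimately have "\<beta> b * ?y $ i = c b * ?y $ i" using i by (simp only: index_smult_vec)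
    then show "?y $ i = 0\<^sub>v d $ i" using b(2) i by simp
  qed (simp add: action_def)
qed

lemma eigenspace_op:
  assumes "v \<in> tableau_eigenspace G n m \<rho> d R \<Lambda>' T" "b \<in> ops n"
  shows "action W d R (op_elem b) *\<^sub>v v = wfun (tab_position m \<Lambda>' T) (\<lambda>i. of_int (tab_content m \<Lambda>' T i)) b \<cdot>\<^sub>v v"
  using assms(2)
  by (cases rule: ops_cases) (use assms(1) in \<open>simp_all add: tableau_eigenspace_def wfun_def\<close>)

lemma wfun_differ:
  assumes L: "\<Lambda> \<in> multipartitions m n" "\<Lambda>' \<in> multipartitions m n"
    and T: "T \<in> standard_tableaux m n \<Lambda>" "T' \<in> standard_tableaux m n \<Lambda>'" and ne: "\<Lambda> \<noteq> \<Lambda>' \<or> T \<noteq> T'"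
  shows "\<exists>b\<in>ops n. wfun (tab_position m \<Lambda> T) (\<lambda>i. of_int (tab_content m \<Lambda> T i)) b
    \<noteq> wfun (tab_position m \<Lambda>' T') (\<lambda>i. of_int (tab_content m \<Lambda>' T' i)) b"
proof (rule ccontr)
  assume "\<not> ?thesis"
  then have eq: "wfun (tab_position m \<Lambda> T) (\<lambda>i. of_int (tab_content m \<Lambda> T i)) b
    = wfun (tab_position m \<Lambda>' T') (\<lambda>i. of_int (tab_content m \<Lambda>' T' i)) b" if "b \<in> ops n" for b using that by blast
  have "tab_position m \<Lambda> T k = tab_position m \<Lambda>' T' k \<and> tab_content m \<Lambda> T k = tab_content m \<Lambda>' T' k"
    if k: "k \<in> {1..n}" for k
  proof
    have "\<rho> (tab_position m \<Lambda> T k) g = \<rho> (tab_position m \<Lambda>' T' k) g" if "g \<in> carrier G" for g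
      using eq[of "Inl (g, k)"] that k by (simp add: ops_def wfun_def)
    then show "tab_position m \<Lambda> T k = tab_position m \<Lambda>' T' k"
      using rho_inject pos_range[OF L(1) T(1)] pos_range[OF L(2) T(2)] k by blast
    show "tab_content m \<Lambda> T k = tab_content m \<Lambda>' T' k"
      using eq[of "Inr k"] k by (simp add: ops_def wfun_def)
  qed
  then show False using tableau_weights_inject[OF L T] ne by blast
qed

text \<open>At most one \<beta> satisfies the condition; writing a sum covers the case of none
  without first showing that the weight of T lies in \<open>weights n\<close>.\<close>

definition tidem :: "(nat \<Rightarrow> nat list) \<Rightarrow> (mnode \<Rightarrow> nat) \<Rightarrow> 'g wreath \<Rightarrow> complex" where
  "tidem \<Lambda> T = (\<Sum>\<beta>\<in>{\<beta>\<in>weights n. \<forall>b\<in>ops n.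
     \<beta> b = wfun (tab_position m \<Lambda> T) (\<lambda>i. of_int (tab_content m \<Lambda> T i)) b}. widem \<beta>)"

lemma tidem_A: "tidem \<Lambda> T \<in> A"
  unfolding tidem_def by (rule fs.subspace_sum[OF subspace_supp_in widem_A]) blast

lemma shape_rep: "shape_representation G n m \<rho> \<Lambda>' d R \<Longrightarrow> representation W d R"
  by (simp add: shape_representation_def irreducible_representation_def)

lemma eigenspace_carrier: "v \<in> tableau_eigenspace G n m \<rho> d R \<Lambda>' T \<Longrightarrow> v \<in> carrier_vec d"
  by (simp add: tableau_eigenspace_def)

text \<open>In v = 1 v every component of 1 with another weight drops out by
  \<open>widem_kill\<close>.\<close>

lemma tidem_same:
  assumes R: "representation W d R" and v: "v \<in> tableau_eigenspace G n m \<rho> d R \<Lambda> T"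
  shows "action W d R (tidem \<Lambda> T) *\<^sub>v v = v"
proof (rule eq_vecI)
  let ?w = "wfun (tab_position m \<Lambda> T) (\<lambda>i. of_int (tab_content m \<Lambda> T i))"
  note vc = eigenspace_carrier[OF v]
  fix i assume "i < dim_vec v"
  then have i: "i < d" using vc by simp
  have "v $ i = (action W d R (\<Sum>\<beta>\<in>weights n. widem \<beta>) *\<^sub>v v) $ i"
    unfolding widem_sum[symmetric] wg.action_one[OF R vc] ..
  also have "\<dots> = (\<Sum>\<beta>\<in>weights n. (action W d R (widem \<beta>) *\<^sub>v v) $ i)" by (rule action_sum_index[OF R vc i])
  also have "\<dots> = (\<Sum>\<beta>\<in>{\<beta>\<in>weights n. \<forall>b\<in>ops n. \<beta> b = ?w b}. (action W d R (widem \<beta>) *\<^sub>v v) $ i)"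
  proof (rule sum.mono_neutral_right[OF finite_weights])
    show "\<forall>\<beta>\<in>weights n - {\<beta>\<in>weights n. \<forall>b\<in>ops n. \<beta> b = ?w b}. (action W d R (widem \<beta>) *\<^sub>v v) $ i = 0"
    proof
      fix \<beta> assume "\<beta> \<in> weights n - {\<beta>\<in>weights n. \<forall>b\<in>ops n. \<beta> b = ?w b}"
      then obtain b where b: "\<beta> \<in> weights n" "b \<in> ops n" "\<beta> b \<noteq> ?w b" by blast
      have "action W d R (widem \<beta>) *\<^sub>v v = 0\<^sub>v d" by (rule widem_kill[OF R vc eigenspace_op[OF v] b])
      then show "(action W d R (widem \<beta>) *\<^sub>v v) $ i = 0" using i by simp
    qed
  qed blast
  also have "\<dots> = (action W d R (tidem \<Lambda> T) *\<^sub>v v) $ i"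
    unfolding tidem_def by (rule action_sum_index[OF R vc i, symmetric])
  finally show "(action W d R (tidem \<Lambda> T) *\<^sub>v v) $ i = v $ i" ..
qed (use eigenspace_carrier[OF v] in \<open>simp add: action_def\<close>)

lemma tidem_other:
  assumes L: "\<Lambda> \<in> multipartitions m n" "\<Lambda>' \<in> multipartitions m n"
    and T: "T \<in> standard_tableaux m n \<Lambda>" "T' \<in> standard_tableaux m n \<Lambda>'" and ne: "\<Lambda> \<noteq> \<Lambda>' \<or> T \<noteq> T'"
    and R: "representation W d R" and v: "v \<in> tableau_eigenspace G n m \<rho> d R \<Lambda>' T'"
  shows "action W d R (tidem \<Lambda> T) *\<^sub>v v = 0\<^sub>v d"
proof (rule eq_vecI)
  note vc = eigenspace_carrier[OF v]
  fix i assume "i < dim_vec (0\<^sub>v d)"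
  then have i: "i < d" by simp
  obtain b where b: "b \<in> ops n" "wfun (tab_position m \<Lambda> T) (\<lambda>i. of_int (tab_content m \<Lambda> T i)) b
    \<noteq> wfun (tab_position m \<Lambda>' T') (\<lambda>i. of_int (tab_content m \<Lambda>' T' i)) b"
    using wfun_differ[OF L T ne] by blast
  have "(action W d R (tidem \<Lambda> T) *\<^sub>v v) $ i = 0"
    unfolding tidem_def action_sum_index[OF R vc i]
  proof (rule sum.neutral, rule ballI)
    fix \<beta> assume "\<beta> \<in> {\<beta>\<in>weights n. \<forall>b\<in>ops n.
      \<beta> b = wfun (tab_position m \<Lambda> T) (\<lambda>i. of_int (tab_content m \<Lambda> T i)) b}"
    then have \<beta>: "\<beta> \<in> weights n" "\<beta> b \<noteq> wfun (tab_position m \<Lambda>' T') (\<lambda>i. of_int (tab_content m \<Lambda>' T' i)) b"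
      using b by auto
    have "action W d R (widem \<beta>) *\<^sub>v v = 0\<^sub>v d" by (rule widem_kill[OF R vc eigenspace_op[OF v] \<beta>(1) b(1) \<beta>(2)])
    then show "(action W d R (widem \<beta>) *\<^sub>v v) $ i = 0" using i by simp
  qed
  then show "(action W d R (tidem \<Lambda> T) *\<^sub>v v) $ i = 0\<^sub>v d $ i" using i by simp
qed (simp add: action_def)

lemma shape_zero:
  assumes R: "shape_representation G n m \<rho> \<Lambda>' d R" and B: "B \<in> carrier_mat d d"
    and z: "\<And>T v. T \<in> standard_tableaux m n \<Lambda>' \<Longrightarrow> v \<in> tableau_eigenspace G n m \<rho> d R \<Lambda>' T \<Longrightarrow> B *\<^sub>v v = 0\<^sub>v d"
  shows "B = 0\<^sub>m d d"
proof (rule mat_eqI_vec[OF B])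
  fix v :: "complex vec" assume v: "v \<in> carrier_vec d"
  obtain w where w: "w \<in> (\<Pi>\<^sub>E T\<in>standard_tableaux m n \<Lambda>'. tableau_eigenspace G n m \<rho> d R \<Lambda>' T)"
    "v = finsum_vec TYPE(complex) d w (standard_tableaux m n \<Lambda>')"
    using R v unfolding shape_representation_def by blast
  have wT: "w T \<in> tableau_eigenspace G n m \<rho> d R \<Lambda>' T" if "T \<in> standard_tableaux m n \<Lambda>'" for T
    using w(1) that by blast
  have "B *\<^sub>v v = 0\<^sub>v d"
    unfolding w(2) by (rule mult_finsum_vec_zero[OF finite_tableaux B]) (use wT z eigenspace_carrier in blast)+
  moreover have "0\<^sub>m d d *\<^sub>v v = 0\<^sub>v d" by (rule eq_vecI) (use v in auto)
  ultimately show "B *\<^sub>v v = 0\<^sub>m d d *\<^sub>v v" by simp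
qed simp

text \<open>Any element with the defining property acts like \<open>tidem\<close> on every
  eigenspace of every V, so their difference acts by 0 and vanishes by
  \<open>shape_representations_separate\<close>.\<close>

theorem tableau_idempotent_eq:
  assumes \<Lambda>: "\<Lambda> \<in> multipartitions m n" and T: "T \<in> standard_tableaux m n \<Lambda>"
  shows "tableau_idempotent G n m \<rho> \<Lambda> T = tidem \<Lambda> T"
  unfolding tableau_idempotent_def wg.carrier_group_algebra
proof (rule the_equality, intro conjI allI impI ballI)
  show "tidem \<Lambda> T \<in> A" by (rule tidem_A)
  show "action W d R (tidem \<Lambda> T) *\<^sub>v w = w"
    if "shape_representation G n m \<rho> \<Lambda> d R" "w \<in> tableau_eigenspace G n m \<rho> d R \<Lambda> T" for d R w
    by (rule tidem_same[OF shape_rep[OF that(1)] that(2)])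
  show "action W d R (tidem \<Lambda> T) *\<^sub>v w = 0\<^sub>v d"
    if "shape_representation G n m \<rho> \<Lambda> d R" "T' \<in> standard_tableaux m n \<Lambda> - {T}"
      "w \<in> tableau_eigenspace G n m \<rho> d R \<Lambda> T'" for d R T' w
    by (rule tidem_other[OF \<Lambda> \<Lambda> T _ _ shape_rep[OF that(1)] that(3)]) (use that(2) in auto)
  show "action W d R (tidem \<Lambda> T) = 0\<^sub>m d d"
    if "\<Lambda>' \<in> multipartitions m n - {\<Lambda>}" "shape_representation G n m \<rho> \<Lambda>' d R" for \<Lambda>' d R
    by (rule shape_zero[OF that(2) action_carrier])
      (rule tidem_other[OF \<Lambda> _ T _ _ shape_rep[OF that(2)]], use that(1) in auto)
next
  fix E assume E: "E \<in> A \<and>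
     (\<forall>d R. shape_representation G n m \<rho> \<Lambda> d R \<longrightarrow>
        (\<forall>w\<in>tableau_eigenspace G n m \<rho> d R \<Lambda> T. action W d R E *\<^sub>v w = w) \<and>
        (\<forall>T'\<in>standard_tableaux m n \<Lambda> - {T}. \<forall>w\<in>tableau_eigenspace G n m \<rho> d R \<Lambda> T'. action W d R E *\<^sub>v w = 0\<^sub>v d)) \<and>
     (\<forall>\<Lambda>'\<in>multipartitions m n - {\<Lambda>}. \<forall>d R. shape_representation G n m \<rho> \<Lambda>' d R \<longrightarrow> action W d R E = 0\<^sub>m d d)"
  have diff: "(action W d R (E - tidem \<Lambda> T) *\<^sub>v v) = 0\<^sub>v d"
    if R: "representation W d R" and v: "v \<in> carrier_vec d"
      and eq: "action W d R E *\<^sub>v v = action W d R (tidem \<Lambda> T) *\<^sub>v v" for d R v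
  proof (rule eq_vecI)
    fix i assume "i < dim_vec (0\<^sub>v d)"
    then have i: "i < d" by simp
    have "(action W d R E *\<^sub>v v) $ i = (action W d R (tidem \<Lambda> T) *\<^sub>v v) $ i" unfolding eq ..
    then have "(action W d R (E - tidem \<Lambda> T) *\<^sub>v v) $ i = 0"
      unfolding action_vec[OF R v i] by (simp add: left_diff_distrib sum_subtractf)
    then show "(action W d R (E - tidem \<Lambda> T) *\<^sub>v v) $ i = 0\<^sub>v d $ i" using i by simp
  qed (simp add: action_def)
  have "E - tidem \<Lambda> T = 0"
  proof (rule shape_representations_separate)
    show "E - tidem \<Lambda> T \<in> A" using E fs.subspace_diff[OF subspace_supp_in _ tidem_A] by blast
    fix \<Lambda>' d R assume \<Lambda>': "\<Lambda>' \<in> multipartitions m n" and R: "shape_representation G n m \<rho> \<Lambda>' d R"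
    show "action W d R (E - tidem \<Lambda> T) = 0\<^sub>m d d"
    proof (rule shape_zero[OF R action_carrier], rule diff[OF shape_rep[OF R] eigenspace_carrier])
      fix T' v assume T': "T' \<in> standard_tableaux m n \<Lambda>'" and v: "v \<in> tableau_eigenspace G n m \<rho> d R \<Lambda>' T'"
      show "v \<in> tableau_eigenspace G n m \<rho> d R \<Lambda>' T'" by (rule v)
      consider (same) "\<Lambda>' = \<Lambda>" "T' = T" | (tab) "\<Lambda>' = \<Lambda>" "T' \<noteq> T" | (shape) "\<Lambda>' \<noteq> \<Lambda>" by blast
      then show "action W d R E *\<^sub>v v = action W d R (tidem \<Lambda> T) *\<^sub>v v"
      proof cases
        case same
        then show ?thesis using tidem_same[OF shape_rep[OF R], of v \<Lambda> T] E R v by simp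
      next
        case tab
        have "action W d R E *\<^sub>v v = 0\<^sub>v d" using E R v T' tab by blast
        then show ?thesis using tidem_other[OF \<Lambda> \<Lambda>' T T' _ shape_rep[OF R] v] tab by simp
      next
        case shape
        have "action W d R E = 0\<^sub>m d d" using E R \<Lambda>' shape by blast
        moreover have "0\<^sub>m d d *\<^sub>v v = 0\<^sub>v d" by (rule eq_vecI) (use eigenspace_carrier[OF v] in auto)
        ultimately show ?thesis using tidem_other[OF \<Lambda> \<Lambda>' T T' _ shape_rep[OF R] v] shape by simp
      qed
    qed
  qed
  then show "E = tidem \<Lambda> T" by simp
qed

end

text \<open>The eigenvalue of \<open>t_baxter\<close> at the parameter \<open>v\<close>, where the group element has eigenvalue \<open>x\<close>.\<close>

definition hfun :: "nat \<Rightarrow> 'k::comm_ring_1 \<Rightarrow> 'k \<Rightarrow> 'k" where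
  "hfun q v x = (\<Sum>r<q. v ^ (q - 1 - r) * x ^ r)"

lemma hfun_diff: "(v - x) * hfun q v x = v ^ q - x ^ q"
proof (cases q)
  case (Suc r)
  have "x ^ q - v ^ q = (x - v) * hfun q v x"
    unfolding hfun_def Suc diff_power_eq_sum by (simp add: mult.commute)
  then show ?thesis by (simp add: algebra_simps)
qed (simp add: hfun_def)

lemma hfun_other: "v \<in> unity_roots q \<Longrightarrow> x \<in> unity_roots q \<Longrightarrow> v \<noteq> x \<Longrightarrow> hfun q v x = 0"
  using hfun_diff[of v x q] by (simp add: unity_roots_def)

lemma finite_unity_roots: "0 < q \<Longrightarrow> finite (unity_roots q)"
  unfolding unity_roots_def by (rule finite_roots_unity) simp

text \<open>A common zero with the derivative would be 0, which is not a root; so the roots are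
  simple and the monic polynomial is the product over them.\<close>

lemma unity_polynomial:
  assumes q: "0 < q"
  shows "(\<Prod>x\<in>unity_roots q. [:- x, 1:]) = monom 1 q - 1"
proof -
  let ?p = "monom 1 q - 1 :: complex poly"
  have roots: "{z. poly ?p z = 0} = unity_roots q" by (auto simp: unity_roots_def poly_monom)
  have "rsquarefree ?p"
    unfolding rsquarefree_roots
  proof (intro allI notI)
    fix z assume z: "poly ?p z = 0 \<and> poly (pderiv ?p) z = 0"
    then have "z \<noteq> 0" using q by (auto simp: poly_monom power_0_left)
    then show False using z q by (auto simp: pderiv_diff pderiv_monom poly_monom)
  qed
  then have "smult (lead_coeff ?p) (\<Prod>z | poly ?p z = 0. [:- z, 1:]) = ?p"
    by (rule complex_poly_decompose_rsquarefree)
  moreover have "lead_coeff ?p = 1"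
  proof -
    have "degree ?p = q"
    proof (rule antisym)
      show "degree ?p \<le> q" by (intro degree_diff_le) (auto simp: degree_monom_le)
      show "q \<le> degree ?p" by (rule le_degree) (use q in \<open>simp add: coeff_eq_0\<close>)
    qed
    then show ?thesis using q by (simp add: coeff_eq_0)
  qed
  ultimately show ?thesis unfolding roots by simp
qed

text \<open>As a polynomial in z, \<open>hfun q z v\<close> is (z^q - 1) / (z - v), the product over
  the other roots; it is then evaluated at z = v.\<close>

lemma hfun_same:
  assumes q: "0 < q" and v: "v \<in> unity_roots q"
  shows "hfun q v v = (\<Prod>x\<in>unity_roots q - {v}. v - x)"
proof -
  define P where "P = (\<Sum>r<q. monom (v ^ r) (q - 1 - r))"
  have P: "poly P z = hfun q z v" for z by (simp add: P_def hfun_def poly_sum poly_monom mult.commute)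
  have "[:- v, 1:] * P = [:- v, 1:] * (\<Prod>x\<in>unity_roots q - {v}. [:- x, 1:])"
  proof -
    have "[:- v, 1:] * P = monom 1 q - 1"
    proof (rule poly_eq_poly_eq_iff[THEN iffD1], rule ext)
      fix z
      have "poly ([:- v, 1:] * P) z = (z - v) * hfun q z v" by (simp add: P algebra_simps)
      then show "poly ([:- v, 1:] * P) z = poly (monom 1 q - 1) z"
        using v by (simp add: hfun_diff poly_monom unity_roots_def)
    qed
    also have "\<dots> = [:- v, 1:] * (\<Prod>x\<in>unity_roots q - {v}. [:- x, 1:])"
      unfolding unity_polynomial[OF q, symmetric] by (rule prod.remove[OF finite_unity_roots[OF q] v])
    finally show ?thesis .
  qed
  then have "P = (\<Prod>x\<in>unity_roots q - {v}. [:- x, 1:])" by (subst (asm) mult_left_cancel) simp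
  then show ?thesis unfolding P[symmetric] by (simp add: poly_prod)
qed

lemma (in finite_group) pow_A: "a \<in> A \<Longrightarrow> a [^]\<^bsub>group_algebra G\<^esub> (r::nat) \<in> A"
  for a :: "'x \<Rightarrow> 'k::field"
proof (induction r)
  case 0
  then show ?case using group_elem_closed[of \<one>] by (simp add: nat_pow_def one_eq)
next
  case (Suc r)
  then show ?case using conv_closed[of a "a [^]\<^bsub>group_algebra G\<^esub> r"] by (simp add: nat_pow_def)
qed

lemma (in finite_group) conv_pow:
  fixes a v :: "'x \<Rightarrow> 'k::field"
  assumes a: "a \<in> A" and v: "v \<in> A" and ev: "conv a v = fscale x v"
  shows "conv (a [^]\<^bsub>group_algebra G\<^esub> (r::nat)) v = fscale (x ^ r) v"
proof (induction r)
  case 0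
  show ?case using conv_one_left[OF v] by (simp add: nat_pow_def)
next
  case (Suc r)
  have "a [^]\<^bsub>group_algebra G\<^esub> (Suc r) = conv (a [^]\<^bsub>group_algebra G\<^esub> r) a" by (simp add: nat_pow_def)
  then have "conv (a [^]\<^bsub>group_algebra G\<^esub> (Suc r)) v = conv (a [^]\<^bsub>group_algebra G\<^esub> r) (fscale x v)"
    by (simp only: conv_assoc[OF a v] ev)
  also have "\<dots> = fscale x (fscale (x ^ r) v)" by (simp only: conv_scale_right[OF v] Suc.IH)
  finally show ?case by simp
qed

lemma (in wreath_field) t_A: "g \<in> carrier G \<Longrightarrow> (t_baxter G n q g i v :: 'g wreath \<Rightarrow> 'k) \<in> A"
  unfolding t_baxter_def wg.smult_eq
  by (subst wg.finsum_group_algebra)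
    (auto intro!: fs.subspace_sum fs.subspace_scale subspace_supp_in wg.pow_A place_A)

lemma (in wreath_field) t_conv:
  assumes g: "g \<in> carrier G" and w: "w \<in> A" and ev: "act W (pl n g i) w = fscale x w"
  shows "wg.conv (t_baxter G n q g i v) w = fscale (hfun q v x) w"
proof -
  let ?p = "place G n i g :: 'g wreath \<Rightarrow> 'k"
  note p = place_A[OF g, of i]
  have p1: "wg.conv ?p w = fscale x w" using place_conv[OF g w] ev by simp
  have sA: "fscale c (?p [^]\<^bsub>wreath_algebra G n\<^esub> r) \<in> A" for c and r :: nat
    by (rule fs.subspace_scale[OF subspace_supp_in wg.pow_A[OF p]])
  have "t_baxter G n q g i v = (\<Sum>r<q. fscale (v ^ (q - 1 - r)) (?p [^]\<^bsub>wreath_algebra G n\<^esub> r))"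
    unfolding t_baxter_def wg.smult_eq by (rule wg.finsum_group_algebra[OF _ sA]) simp
  then have "wg.conv (t_baxter G n q g i v) w = (\<Sum>r<q. fscale (v ^ (q - 1 - r)) (fscale (x ^ r) w))"
    by (simp only: wg.conv_sum_left[OF w] wg.conv_scale_left[OF w] wg.conv_pow[OF p w p1])
  then show ?thesis by (simp add: hfun_def fs.scale_sum_left)
qed

lemma foldr_scale:
  assumes "\<And>p c. p \<in> set ps \<Longrightarrow> F p (fscale c w) = fscale (a p * c) w"
  shows "foldr F ps (fscale c w) = fscale ((\<Prod>p\<leftarrow>ps. a p) * c) w"
  using assms by (induction ps) (simp_all add: mult.assoc)

section \<open>Generators of the finite Abelian group\<close>

text \<open>t \<alpha> is any generator of its factor, not necessarily the one with coordinate
  1.\<close>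

locale cyclic_factors = comm_group G for G :: "('g, 'b) monoid_scheme" (structure) +
  fixes N :: nat and k :: "nat \<Rightarrow> nat" and \<phi> :: "'g \<Rightarrow> nat \<Rightarrow> int" and t :: "nat \<Rightarrow> 'g"
  assumes k: "\<forall>\<alpha>\<in>{1..N}. 2 \<le> k \<alpha>"
    and iso: "\<phi> \<in> iso G (product_group {1..N} (\<lambda>\<alpha>. integer_mod_group (k \<alpha>)))"
    and t: "\<forall>\<alpha>\<in>{1..N}. t \<alpha> \<in> carrier G \<and> generate G {t \<alpha>} =
      {g \<in> carrier G. \<forall>\<beta>\<in>{1..N} - {\<alpha>}. \<phi> g \<beta> = \<one>\<^bsub>integer_mod_group (k \<beta>)\<^esub>}"
begin

abbreviation "Z \<alpha> \<equiv> integer_mod_group (k \<alpha>)"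
abbreviation "P \<equiv> product_group {1..N} Z"

lemma Z_group: "group (Z \<alpha>)" by (rule group_integer_mod_group)

lemma P_group: "group P" by (rule product_group) (rule Z_group)

lemma Z_carrier: "\<alpha> \<in> {1..N} \<Longrightarrow> carrier (Z \<alpha>) = {0..<int (k \<alpha>)}"
  using k by (fastforce simp: carrier_integer_mod_group)

lemma \<phi>_bij: "bij_betw \<phi> (carrier G) (carrier P)" using iso by (simp add: iso_def)

lemma \<phi>_mult: "g \<in> carrier G \<Longrightarrow> h \<in> carrier G \<Longrightarrow> \<phi> (g \<otimes> h) = \<phi> g \<otimes>\<^bsub>P\<^esub> \<phi> h"
  using iso unfolding iso_def hom_def by blast

lemma \<phi>_mem: "g \<in> carrier G \<Longrightarrow> \<phi> g \<in> carrier P"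
  using \<phi>_bij by (rule bij_betw_apply)

lemma \<phi>_inj: "g \<in> carrier G \<Longrightarrow> h \<in> carrier G \<Longrightarrow> \<phi> g = \<phi> h \<Longrightarrow> g = h"
  using \<phi>_bij unfolding bij_betw_def inj_on_def by blast

lemma \<phi>_surj: "y \<in> carrier P \<Longrightarrow> \<exists>g\<in>carrier G. \<phi> g = y"
proof -
  assume y: "y \<in> carrier P"
  have "y \<in> \<phi> ` carrier G" unfolding bij_betw_imp_surj_on[OF \<phi>_bij] by (rule y)
  then show ?thesis by blast
qed

lemma finite_G: "finite (carrier G)"
proof -
  have "finite (carrier P)"
    unfolding carrier_product_group by (intro finite_PiE) (simp_all add: Z_carrier)
  then show ?thesis using bij_betw_finite[OF \<phi>_bij] by blast
qed

lemma t_carrier: "\<alpha> \<in> {1..N} \<Longrightarrow> t \<alpha> \<in> carrier G" using t by blast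

text \<open>Coordinate \<alpha> of the power is a multiple of \<open>k \<alpha>\<close>, and the
  other coordinates of t \<alpha> are trivial.\<close>

lemma t_order:
  assumes \<alpha>: "\<alpha> \<in> {1..N}" shows "t \<alpha> [^] k \<alpha> = \<one>"
proof -
  have tc: "t \<alpha> \<in> carrier G" by (rule t_carrier[OF \<alpha>])
  have one: "\<phi> (t \<alpha>) \<beta> = \<one>\<^bsub>Z \<beta>\<^esub>" if "\<beta> \<in> {1..N} - {\<alpha>}" for \<beta>
  proof -
    have "t \<alpha> \<in> generate G {t \<alpha>}" by (rule generate.incl) simp
    then show ?thesis using t \<alpha> that by blast
  qed
  have pow: "\<phi> (t \<alpha> [^] r) \<beta> = \<phi> (t \<alpha>) \<beta> [^]\<^bsub>Z \<beta>\<^esub> r" if \<beta>: "\<beta> \<in> {1..N}" for \<beta> and r :: nat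
  proof (induction r)
    case 0
    interpret h: group_hom G P \<phi>
      by (rule group_hom.intro[OF group_axioms P_group]) (use iso in \<open>simp add: iso_def group_hom_axioms_def\<close>)
    show ?case using \<beta> h.hom_one by simp
  next
    case (Suc r)
    then show ?case using \<beta> tc by (simp add: \<phi>_mult)
  qed
  have "\<phi> (t \<alpha> [^] k \<alpha>) \<beta> = \<one>\<^bsub>Z \<beta>\<^esub>" if \<beta>: "\<beta> \<in> {1..N}" for \<beta>
  proof (cases "\<beta> = \<alpha>")
    case True
    have "\<phi> (t \<alpha>) \<alpha> [^]\<^bsub>Z \<alpha>\<^esub> r = (int r * \<phi> (t \<alpha>) \<alpha>) mod int (k \<alpha>)" for r :: nat
    proof (induction r)
      case 0
      show ?case by simp
    next
      case (Suc r)
      interpret z: group "Z \<alpha>" by (rule Z_group)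
      have "\<phi> (t \<alpha>) \<alpha> [^]\<^bsub>Z \<alpha>\<^esub> Suc r = (int r * \<phi> (t \<alpha>) \<alpha> mod int (k \<alpha>) + \<phi> (t \<alpha>) \<alpha>) mod int (k \<alpha>)"
        by (simp only: z.nat_pow_Suc Suc.IH mult_integer_mod_group)
      then show ?case by (simp add: mod_simps algebra_simps)
    qed
    then show ?thesis using pow[OF \<beta>] True by simp
  next
    case False
    interpret z: group "Z \<beta>" by (rule Z_group)
    show ?thesis using pow[OF \<beta>] one False \<beta> z.nat_pow_one by simp
  qed
  then have "\<phi> (t \<alpha> [^] k \<alpha>) = \<phi> (\<one> [^] (0::nat))"
  proof -
    interpret h: group_hom G P \<phi>
      by (rule group_hom.intro[OF group_axioms P_group]) (use iso in \<open>simp add: iso_def group_hom_axioms_def\<close>)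
    assume a: "\<And>\<beta>. \<beta> \<in> {1..N} \<Longrightarrow> \<phi> (t \<alpha> [^] k \<alpha>) \<beta> = \<one>\<^bsub>Z \<beta>\<^esub>"
    have e: "\<phi> (t \<alpha> [^] k \<alpha>) \<in> extensional {1..N}"
      using \<phi>_mem[OF nat_pow_closed[OF tc]] by (auto simp: carrier_product_group PiE_def)
    have "\<phi> (t \<alpha> [^] k \<alpha>) = (\<lambda>\<beta>\<in>{1..N}. \<one>\<^bsub>Z \<beta>\<^esub>)"
      by (rule extensionalityI[OF e]) (use a in auto)
    then show ?thesis using h.hom_one by simp
  qed
  then show ?thesis using \<phi>_inj[of "t \<alpha> [^] k \<alpha>" \<one>] tc by simp
qed

text \<open>Induction on the number j of leading coordinates that may be nontrivial; the last of
  them is split off as an element of one cyclic factor.\<close>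

lemma generated_induct:
  assumes H: "subgroup H G" and tH: "\<And>\<alpha>. \<alpha> \<in> {1..N} \<Longrightarrow> t \<alpha> \<in> H"
  shows "carrier G \<subseteq> H"
proof -
  have gen: "g \<in> H" if \<alpha>: "\<alpha> \<in> {1..N}" and g: "g \<in> carrier G" "\<forall>\<beta>\<in>{1..N} - {\<alpha>}. \<phi> g \<beta> = \<one>\<^bsub>Z \<beta>\<^esub>" for \<alpha> g
  proof -
    have "g \<in> generate G {t \<alpha>}" using t \<alpha> g by blast
    moreover have "generate G {t \<alpha>} \<subseteq> H" by (rule generate_subgroup_incl[OF _ H]) (use tH[OF \<alpha>] in simp)
    ultimately show ?thesis by blast
  qed
  have "g \<in> H" if "j \<le> N" "g \<in> carrier G" "\<And>\<beta>. \<beta> \<in> {1..N} \<Longrightarrow> j < \<beta> \<Longrightarrow> \<phi> g \<beta> = \<one>\<^bsub>Z \<beta>\<^esub>" for j g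
    using that
  proof (induction j arbitrary: g)
    case 0
    interpret h: group_hom G P \<phi>
      by (rule group_hom.intro[OF group_axioms P_group]) (use iso in \<open>simp add: iso_def group_hom_axioms_def\<close>)
    have e: "\<phi> g \<in> extensional {1..N}"
      using \<phi>_mem[OF 0(2)] by (auto simp: carrier_product_group PiE_def)
    have "\<phi> g = (\<lambda>\<beta>\<in>{1..N}. \<one>\<^bsub>Z \<beta>\<^esub>)" by (rule extensionalityI[OF e]) (use 0(3) in auto)
    then have "\<phi> g = \<phi> \<one>" using h.hom_one by simp
    then have "g = \<one>" using \<phi>_inj 0(2) by simp
    then show ?case using subgroup.one_closed[OF H] by simp
  next
    case (Suc j)
    have gP: "\<phi> g \<beta> \<in> carrier (Z \<beta>)" if "\<beta> \<in> {1..N}" for \<beta>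
      using \<phi>_mem[OF Suc.prems(2)] that by (auto simp: carrier_product_group)
    have oP: "\<one>\<^bsub>Z \<beta>\<^esub> \<in> carrier (Z \<beta>)" for \<beta> using group.is_monoid[OF Z_group] by (rule monoid.one_closed)
    define y where "y = (\<lambda>\<beta>\<in>{1..N}. if \<beta> \<le> j then \<phi> g \<beta> else \<one>\<^bsub>Z \<beta>\<^esub>)"
    define z where "z = (\<lambda>\<beta>\<in>{1..N}. if \<beta> = Suc j then \<phi> g \<beta> else \<one>\<^bsub>Z \<beta>\<^esub>)"
    have "y \<in> carrier P" "z \<in> carrier P" using gP oP by (auto simp: y_def z_def carrier_product_group)
    then obtain a b where a: "a \<in> carrier G" "\<phi> a = y" and b: "b \<in> carrier G" "\<phi> b = z"
      using \<phi>_surj by metis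
    have "a \<in> H" by (rule Suc.IH[OF _ a(1)]) (use Suc.prems(1) a(2) in \<open>auto simp: y_def\<close>)
    moreover have "b \<in> H" by (rule gen[of "Suc j"]) (use Suc.prems(1) b in \<open>auto simp: z_def\<close>)
    ultimately have "a \<otimes> b \<in> H" by (rule subgroup.m_closed[OF H])
    moreover have "\<phi> (a \<otimes> b) = \<phi> g"
    proof -
      have "y \<beta> \<otimes>\<^bsub>Z \<beta>\<^esub> z \<beta> = \<phi> g \<beta>" if \<beta>: "\<beta> \<in> {1..N}" for \<beta>
      proof -
        interpret zz: group "Z \<beta>" by (rule Z_group)
        consider "\<beta> \<le> j" | "\<beta> = Suc j" | "Suc j < \<beta>" by linarith
        then have "y \<beta> = \<phi> g \<beta> \<and> z \<beta> = \<one>\<^bsub>Z \<beta>\<^esub> \<or> y \<beta> = \<one>\<^bsub>Z \<beta>\<^esub> \<and> z \<beta> = \<phi> g \<beta>"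
          by cases (use \<beta> Suc.prems(3)[OF \<beta>] in \<open>simp_all add: y_def z_def\<close>)
        then show ?thesis using zz.l_one[OF gP[OF \<beta>]] zz.r_one[OF gP[OF \<beta>]] by (elim disjE conjE) (simp_all only:)
      qed
      moreover have "\<phi> g \<in> extensional {1..N}"
        using \<phi>_mem[OF Suc.prems(2)] by (auto simp: carrier_product_group PiE_def)
      ultimately show ?thesis
        unfolding \<phi>_mult[OF a(1) b(1)] a(2) b(2) mult_product_group
        by (intro extensionalityI[of _ "{1..N}"]) auto
    qed
    ultimately show ?case using \<phi>_inj[of "a \<otimes> b" g] a(1) b(1) Suc.prems(2) by simp
  qed
  from this[of N] show ?thesis by auto
qed

lemma character_one: "\<chi> \<in> linear_characters G \<Longrightarrow> \<chi> \<one> = 1"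
proof -
  assume c: "\<chi> \<in> linear_characters G"
  have "\<chi> (\<one> \<otimes> \<one>) = \<chi> \<one> * \<chi> \<one>" "\<chi> \<one> \<noteq> 0"
    using c one_closed unfolding linear_characters_def by blast+
  then show ?thesis by simp
qed

lemma character_t_unity:
  assumes c: "\<chi> \<in> linear_characters G" and \<alpha>: "\<alpha> \<in> {1..N}"
  shows "\<chi> (t \<alpha>) \<in> unity_roots (k \<alpha>)"
proof -
  have tc: "t \<alpha> \<in> carrier G" by (rule t_carrier[OF \<alpha>])
  have "\<chi> (t \<alpha> [^] r) = \<chi> (t \<alpha>) ^ r" for r :: nat
  proof (induction r)
    case 0
    show ?case using character_one[OF c] by simp
  next
    case (Suc r)
    have "\<chi> (t \<alpha> [^] r \<otimes> t \<alpha>) = \<chi> (t \<alpha> [^] r) * \<chi> (t \<alpha>)"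
      using c nat_pow_closed[OF tc] tc unfolding linear_characters_def by blast
    then show ?case using Suc by simp
  qed
  from this[of "k \<alpha>"] show ?thesis
    using t_order[OF \<alpha>] character_one[OF c] by (simp add: unity_roots_def)
qed

text \<open>The elements on which the two characters agree form a subgroup that contains the
  generators.\<close>

lemma characters_determined:
  assumes c: "\<chi> \<in> linear_characters G" "\<psi> \<in> linear_characters G"
    and eq: "\<And>\<alpha>. \<alpha> \<in> {1..N} \<Longrightarrow> \<chi> (t \<alpha>) = \<psi> (t \<alpha>)" and g: "g \<in> carrier G"
  shows "\<chi> g = \<psi> g"
proof -
  have m: "\<chi> (a \<otimes> b) = \<chi> a * \<chi> b" "\<psi> (a \<otimes> b) = \<psi> a * \<psi> b" "\<chi> a \<noteq> 0" "\<psi> a \<noteq> 0"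
    if "a \<in> carrier G" "b \<in> carrier G" for a b
    using c that unfolding linear_characters_def by blast+
  let ?H = "{g \<in> carrier G. \<chi> g = \<psi> g}"
  have "subgroup ?H G"
  proof (rule subgroupI)
    show "?H \<noteq> {}" using character_one[OF c(1)] character_one[OF c(2)] one_closed by auto
    fix a assume a: "a \<in> ?H"
    have "\<chi> a * \<chi> (inv a) = 1" "\<psi> a * \<psi> (inv a) = 1"
      using a m(1)[of a "inv a"] m(2)[of a "inv a"] character_one[OF c(1)] character_one[OF c(2)] by simp_all
    then have "\<chi> a * \<chi> (inv a) = \<chi> a * \<psi> (inv a)" using a by simp
    then show "inv a \<in> ?H" using a m(3)[of a a] by simp
  qed (use m in auto)
  then have "carrier G \<subseteq> ?H" by (rule generated_induct) (use eq t_carrier in blast)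
  then show ?thesis using g by blast
qed

end

section \<open>The consecutive evaluations\<close>

text \<open>The same group with rational functions as coefficients; \<open>wm\<close> and
  \<open>kf.wm\<close> are the two copies of the module.\<close>

sublocale wreath_characters \<subseteq> kf: wreath_field G n "TYPE(ratfun)"
proof unfold_locales
  show "finite (carrier G)" by (rule finG)
  show "of_nat (card (carrier G)) \<noteq> (0::ratfun)"
    using cardG rat_const_eq_iff[of "of_nat (card (carrier G))" 0] unfolding rat_const_of_nat rat_const_0 by blast
qed

section \<open>Constant vectors and evaluation of vectors of rational functions\<close>

definition vconst :: "('x \<Rightarrow> complex) \<Rightarrow> 'x \<Rightarrow> ratfun" where
  "vconst v = (\<lambda>x. rat_const (v x))"

lemma vconst_act: "vconst (act H h v) = act H h (vconst v)"
  by (auto simp: vconst_def act_def fun_eq_iff)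

lemma vconst_0 [simp]: "vconst 0 = 0"
  by (simp add: vconst_def fun_eq_iff)

lemma vconst_add: "vconst (v + w) = vconst v + vconst w"
  by (simp add: vconst_def fun_eq_iff rat_const_add)

lemma vconst_fscale: "vconst (fscale c v) = fscale (rat_const c) (vconst v)"
  by (simp add: vconst_def fscale_def fun_eq_iff rat_const_mult)

lemma vconst_sum: "vconst (sum f I) = (\<Sum>i\<in>I. vconst (f i))"
  by (simp add: vconst_def fun_eq_iff sum_fun_apply rat_const_sum)

lemma vconst_supp: "v \<in> supp_in H \<Longrightarrow> vconst v \<in> supp_in H"
  by (simp add: vconst_def supp_in_def)

definition vevals :: "(variable \<rightharpoonup> complex) \<Rightarrow> ('x \<Rightarrow> ratfun) \<Rightarrow> ('x \<Rightarrow> ratfun) \<Rightarrow> bool" where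
  "vevals \<zeta> v w \<longleftrightarrow> (\<forall>x. evals \<zeta> (v x) (w x))"

lemma vevals_act: "vevals \<zeta> v w \<Longrightarrow> vevals \<zeta> (act H h v) (act H h w)"
  by (simp add: vevals_def act_def)

lemma vevals_add: "vevals \<zeta> v w \<Longrightarrow> vevals \<zeta> v' w' \<Longrightarrow> vevals \<zeta> (v + v') (w + w')"
  by (simp add: vevals_def evals_add)

lemma vevals_fscale: "evals \<zeta> c d \<Longrightarrow> vevals \<zeta> v w \<Longrightarrow> vevals \<zeta> (fscale c v) (fscale d w)"
  by (simp add: vevals_def fscale_def evals_mult)

lemma vevals_sum: "(\<And>i. i \<in> I \<Longrightarrow> vevals \<zeta> (f i) (g i)) \<Longrightarrow> vevals \<zeta> (sum f I) (sum g I)"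
  by (simp add: vevals_def sum_fun_apply evals_sum)

lemma vevals_vconst: "vevals \<zeta> (vconst v) (vconst v)"
  by (simp add: vevals_def vconst_def evals_const)

lemma vevals_fold:
  "(\<And>l v w. l \<in> set xs \<Longrightarrow> vevals \<zeta> v w \<Longrightarrow> vevals \<zeta> (f l v) (g l w)) \<Longrightarrow> vevals \<zeta> v w \<Longrightarrow>
    vevals \<zeta> (fold f xs v) (fold g xs w)"
proof (induction xs arbitrary: v w)
  case (Cons l xs)
  have "vevals \<zeta> (f l v) (g l w)" using Cons.prems by simp
  then show ?case using Cons.IH[of "f l v" "g l w"] Cons.prems(1) by simp
qed simp

lemma eval_along_vevals:
  assumes "vevals \<zeta> v w"
  shows "nonsingular_along (\<zeta> # \<zeta>s) v \<longleftrightarrow> nonsingular_along \<zeta>s w"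
    "eval_along (\<zeta> # \<zeta>s) v = eval_along \<zeta>s w"
proof -
  have "rat_nonsingular \<zeta> (v x)" "rat_eval \<zeta> (v x) = w x" for x
    using assms evalsD[of \<zeta> "v x" "w x"] by (simp_all add: vevals_def)
  then show "nonsingular_along (\<zeta> # \<zeta>s) v \<longleftrightarrow> nonsingular_along \<zeta>s w"
    "eval_along (\<zeta> # \<zeta>s) v = eval_along \<zeta>s w" by simp_all
qed

lemma evals_hfun: "evals \<zeta> v (rat_const z) \<Longrightarrow> evals \<zeta> (hfun q v (rat_const x)) (rat_const (hfun q z x))"
  unfolding hfun_def rat_const_sum rat_const_mult rat_const_power
  by (intro evals_sum evals_mult evals_power evals_const)

text \<open>Regularity at the content of the next node: every denominator of \<open>rowrest\<close>
  is a difference that stays nonzero there.\<close>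

lemma evals_rowrest:
  assumes u: "evals \<zeta> u (rat_const (of_int c))" and c: "\<And>a. a \<in> {1..L} \<Longrightarrow> c \<noteq> bet r a" and x: "x \<in> {1..L}"
  shows "evals \<zeta> (rowrest L r x u) (rat_const (rowrest L r x (of_int c)))"
proof -
  have i: "evals \<zeta> (of_int k) (rat_const (of_int k))" for k :: int
    using evals_const[of \<zeta> "of_int k"] by (simp add: rat_const_of_int)
  have n: "evals \<zeta> (of_nat k) (rat_const (of_nat k))" for k :: nat
    using evals_const[of \<zeta> "of_nat k"] by (simp add: rat_const_of_nat)
  have nz: "rat_const (of_int c) - rat_const (of_int (bet r a)) \<noteq> 0" if "a \<in> {1..L}" for a
    using c[OF that] by simp
  show ?thesis
    unfolding rowrest_def rat_const_divide rat_const_mult rat_const_add rat_const_prod rat_const_diff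
    by (intro evals_divide evals_mult evals_prod evals_add evals_diff u i n nz) (use x in auto)
qed

section \<open>The fusion function as an operator\<close>

context wreath_characters
begin

lemma vconst_E: "vconst (wm.E i v) = kf.wm.E i (vconst v)"
  by (simp add: wm.E_def kf.wm.E_def vconst_fscale vconst_sum vconst_act rat_const_divide rat_const_of_nat)

lemma vconst_J: "vconst (wm.J i v) = kf.wm.J i (vconst v)"
proof (induction i v rule: wm.J.induct)
  case (3 i v)
  then show ?case
    unfolding wm.J.simps kf.wm.J.simps by (simp only: vconst_add vconst_act vconst_E)
qed (unfold wm.J.simps kf.wm.J.simps, rule vconst_0, rule vconst_0)

lemma vevals_E:
  assumes "vevals \<zeta> v w" shows "vevals \<zeta> (kf.wm.E i v) (kf.wm.E i w)"
proof -
  have "evals \<zeta> (1 / of_nat (card (carrier G))) (1 / of_nat (card (carrier G)))"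
    using evals_const[of \<zeta> "1 / of_nat (card (carrier G))"] by (simp add: rat_const_divide rat_const_of_nat)
  then show ?thesis unfolding kf.wm.E_def by (intro vevals_fscale vevals_sum vevals_act assms)
qed

lemma vevals_fus:
  assumes "\<And>i. i \<in> {1..l} \<Longrightarrow> evals \<zeta> (c i) (c' i)" "evals \<zeta> u u'" "\<And>i. i \<in> {1..l} \<Longrightarrow> u' \<noteq> c' i" "vevals \<zeta> v w"
  shows "vevals \<zeta> (kf.wm.fus l c u v) (kf.wm.fus l c' u' w)"
  using assms
proof (induction l arbitrary: v w)
  case (Suc l)
  have IH: "vevals \<zeta> (kf.wm.fus l c u (act W (sw n (Suc l)) v)) (kf.wm.fus l c' u' (act W (sw n (Suc l)) w))"
    by (rule Suc.IH) (use Suc.prems in \<open>auto intro: vevals_act\<close>)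
  have "evals \<zeta> (1 / (u - c (Suc l))) (1 / (u' - c' (Suc l)))"
    by (intro evals_divide evals_1 evals_diff Suc.prems(1,2)) (use Suc.prems(3)[of "Suc l"] in auto)
  then show ?case
    unfolding kf.wm.fus.simps kf.wm.bax_def by (intro vevals_add vevals_fscale vevals_E vevals_act IH)
qed simp

text \<open>The recursion of \<open>fus\<close> peels off both ends of the product: the leftmost
  Baxterized factor and the rightmost transposition carry the same index.\<close>

lemma phi_list_conv:
  "l < n \<Longrightarrow> v \<in> kf.A \<Longrightarrow> foldr wg.conv (map (\<lambda>j. s_baxter G n j u (c j)) (rev [1..<Suc l]) @ map (s_elem G n) [1..<Suc l]) v
    = kf.wm.fus l c u v"
proof (induction l arbitrary: v)
  case (Suc l)
  have l: "1 \<le> Suc l" "Suc l < n" using Suc by auto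
  have sv: "act W (sw n (Suc l)) v \<in> kf.A" by (rule kf.S_A[OF l Suc.prems(2)])
  have up: "[1..<Suc (Suc l)] = [1..<Suc l] @ [Suc l]" by simp
  let ?b = "map (\<lambda>j. s_baxter G n j u (c j)) (rev [1..<Suc l])" and ?s = "map (s_elem G n) [1..<Suc l]"
  have "foldr wg.conv (map (\<lambda>j. s_baxter G n j u (c j)) (rev [1..<Suc (Suc l)]) @ map (s_elem G n) [1..<Suc (Suc l)]) v
    = wg.conv (s_baxter G n (Suc l) u (c (Suc l))) (foldr wg.conv (?b @ ?s) (wg.conv (s_elem G n (Suc l)) v))"
    unfolding up by simp
  also have "wg.conv (s_elem G n (Suc l)) v = act W (sw n (Suc l)) v" by (rule kf.s_conv[OF l Suc.prems(2)])
  also have "foldr wg.conv (?b @ ?s) (act W (sw n (Suc l)) v) = kf.wm.fus l c u (act W (sw n (Suc l)) v)"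
    by (rule Suc.IH[OF _ sv]) (use l in simp)
  also have "wg.conv (s_baxter G n (Suc l) u (c (Suc l))) (kf.wm.fus l c u (act W (sw n (Suc l)) v))
    = kf.wm.fus (Suc l) c u v"
    unfolding kf.wm.fus.simps by (rule kf.bax_conv[OF l kf.fus_A[OF _ sv]]) (use l in simp)
  finally show ?case .
qed simp

lemma phi_fun_list: "phi_fun G n (Suc l) = ordered_prod (wreath_algebra G n)
    (map (\<lambda>j. s_baxter G n j (rat_var (UVar (Suc l))) (rat_var (UVar j))) (rev [1..<Suc l]) @ map (s_elem G n) [1..<Suc l])"
  by (simp add: phi_fun_def)

lemma phi_factors_A: "l < n \<Longrightarrow>
  set (map (\<lambda>j. s_baxter G n j u (c j)) (rev [1..<Suc l]) @ map (s_elem G n) [1..<Suc l]) \<subseteq> kf.A"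
proof
  fix x assume l: "l < n" and x: "x \<in> set (map (\<lambda>j. s_baxter G n j u (c j)) (rev [1..<Suc l]) @ map (s_elem G n) [1..<Suc l])"
  then obtain j where j: "1 \<le> j" "j < n" "x = s_baxter G n j u (c j) \<or> x = s_elem G n j" by auto
  then show "x \<in> kf.A" using kf.bax_A[OF j(1,2)] kf.s_A[OF j(1,2)] by metis
qed

lemma phi_A: "l < n \<Longrightarrow> phi_fun G n (Suc l) \<in> kf.A"
  unfolding phi_fun_list by (rule wg.ordered_prod_closed[OF phi_factors_A])

lemma phi_conv:
  assumes "l < n" "v \<in> kf.A"
  shows "wg.conv (phi_fun G n (Suc l)) v = kf.wm.fus l (\<lambda>j. rat_var (UVar j)) (rat_var (UVar (Suc l))) v"
  unfolding phi_fun_list wg.conv_ordered_prod[OF phi_factors_A[OF assms(1)] assms(2)]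
  by (rule phi_list_conv[OF assms])

lemma Gamma_list: "Gamma_fun G n N k t = ordered_prod (wreath_algebra G n)
    (map (\<lambda>(i, \<alpha>). t_baxter G n (k \<alpha>) (t \<alpha>) i (rat_var (VVar i \<alpha>))) (List.product [1..<Suc n] [1..<Suc N]))"
  unfolding Gamma_fun_def product_concat_map by (simp add: map_concat comp_def)

lemma Gamma_factors_A:
  assumes "\<And>\<alpha>. \<alpha> \<in> {1..N} \<Longrightarrow> t \<alpha> \<in> carrier G"
  shows "set (map (\<lambda>(i, \<alpha>). t_baxter G n (k \<alpha>) (t \<alpha>) i (rat_var (VVar i \<alpha>))) (List.product [1..<Suc n] [1..<Suc N])) \<subseteq> kf.A"
  using assms kf.t_A by auto

lemma Gamma_A:
  assumes "\<And>\<alpha>. \<alpha> \<in> {1..N} \<Longrightarrow> t \<alpha> \<in> carrier G" shows "Gamma_fun G n N k t \<in> kf.A"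
  unfolding Gamma_list by (rule wg.ordered_prod_closed[OF Gamma_factors_A[OF assms]])

lemma Gamma_conv:
  assumes t: "\<And>\<alpha>. \<alpha> \<in> {1..N} \<Longrightarrow> t \<alpha> \<in> carrier G" and w: "w \<in> kf.A"
    and ev: "\<And>i \<alpha>. i \<in> {1..n} \<Longrightarrow> \<alpha> \<in> {1..N} \<Longrightarrow> act W (pl n (t \<alpha>) i) w = fscale (x i \<alpha>) w"
  shows "wg.conv (Gamma_fun G n N k t) w = fscale (\<Prod>i\<in>{1..n}. \<Prod>\<alpha>\<in>{1..N}. hfun (k \<alpha>) (rat_var (VVar i \<alpha>)) (x i \<alpha>)) w"
proof -
  let ?L = "List.product [1..<Suc n] [1..<Suc N]"
  let ?F = "\<lambda>(i, \<alpha>). t_baxter G n (k \<alpha>) (t \<alpha>) i (rat_var (VVar i \<alpha>))"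
  let ?a = "\<lambda>(i, \<alpha>). hfun (k \<alpha>) (rat_var (VVar i \<alpha>)) (x i \<alpha>)"
  have setL: "set ?L = {1..n} \<times> {1..N}" by auto
  have "wg.conv (?F p) (fscale c w) = fscale (?a p * c) w" if p: "p \<in> set ?L" for p c
  proof -
    obtain i \<alpha> where ia: "p = (i, \<alpha>)" "i \<in> {1..n}" "\<alpha> \<in> {1..N}" using p unfolding setL by blast
    have "wg.conv (t_baxter G n (k \<alpha>) (t \<alpha>) i (rat_var (VVar i \<alpha>))) w = fscale (?a p) w"
      unfolding ia(1) prod.case by (rule kf.t_conv[OF t[OF ia(3)] w ev[OF ia(2,3)]])
    then show ?thesis using ia(1) by (simp add: wg.conv_scale_right[OF w] mult.commute)
  qed
  from foldr_scale[where F = "\<lambda>p. wg.conv (?F p)" and a = ?a and w = w and c = 1 and ps = ?L, OF this]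
  have "foldr (\<lambda>p. wg.conv (?F p)) ?L w = fscale (\<Prod>p\<leftarrow>?L. ?a p) w"
    by (simp only: mult_1_right fs.scale_one)
  also have "(\<Prod>p\<leftarrow>?L. ?a p) = (\<Prod>p\<in>{1..n} \<times> {1..N}. ?a p)"
    unfolding setL[symmetric] by (rule prod.distinct_set_conv_list[symmetric]) (simp add: distinct_product)
  also have "\<dots> = (\<Prod>i\<in>{1..n}. \<Prod>\<alpha>\<in>{1..N}. hfun (k \<alpha>) (rat_var (VVar i \<alpha>)) (x i \<alpha>))"
    by (rule prod.cartesian_product[symmetric])
  finally have *: "foldr (\<lambda>p. wg.conv (?F p)) ?L w
    = fscale (\<Prod>i\<in>{1..n}. \<Prod>\<alpha>\<in>{1..N}. hfun (k \<alpha>) (rat_var (VVar i \<alpha>)) (x i \<alpha>)) w" .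
  have "set (map ?F ?L) \<subseteq> kf.A" by (rule Gamma_factors_A) (rule t)
  then show ?thesis
    unfolding Gamma_list by (simp only: wg.conv_ordered_prod[OF _ w] foldr_map comp_def *)
qed

lemma rat_is_char: "p \<in> {1..m} \<Longrightarrow> kf.wm.is_char (\<lambda>g. rat_const (\<rho> p g))"
  using rho_is_char[of p] unfolding wm.is_char_def kf.wm.is_char_def
  by (simp add: rat_const_mult[symmetric]) (metis rat_const_0 rat_const_eq_iff)

lemma rat_same:
  assumes "p \<in> {1..m}" "q \<in> {1..m}"
  shows "kf.wm.same (\<lambda>g. rat_const (\<rho> p g)) (\<lambda>g. rat_const (\<rho> q g)) \<longleftrightarrow> p = q"
  using rho_inject[OF assms] by (auto simp: kf.wm.same_def)

lemma vconst_weight: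
  assumes "\<beta> \<in> weights n"
  shows "g \<in> carrier G \<Longrightarrow> i \<in> {1..n} \<Longrightarrow>
      act W (pl n g i) (vconst (widem \<beta>)) = fscale (rat_const (\<beta> (Inl (g, i)))) (vconst (widem \<beta>))"
    "i \<in> {1..n} \<Longrightarrow> kf.wm.J i (vconst (widem \<beta>)) = fscale (rat_const (\<beta> (Inr i))) (vconst (widem \<beta>))"
proof -
  show "act W (pl n g i) (vconst (widem \<beta>)) = fscale (rat_const (\<beta> (Inl (g, i)))) (vconst (widem \<beta>))"
    if "g \<in> carrier G" "i \<in> {1..n}"
    using widem_weight[OF assms, of "Inl (g, i)"] that
    by (simp add: ops_def vconst_act[symmetric] vconst_fscale[symmetric])
  show "kf.wm.J i (vconst (widem \<beta>)) = fscale (rat_const (\<beta> (Inr i))) (vconst (widem \<beta>))" if "i \<in> {1..n}"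
    using widem_weight[OF assms, of "Inr i"] that
    by (simp add: ops_def vconst_J[symmetric] vconst_fscale[symmetric])
qed

end

lemma rowlen_mono:
  assumes "D \<subseteq> D'" "finite D'" shows "rowlen D p x \<le> rowlen D' p x"
  unfolding rowlen_def
proof (rule card_mono)
  have "{y. ((x, y), p) \<in> D'} \<subseteq> (\<lambda>\<theta>. snd (fst \<theta>)) ` D'"
  proof
    fix y assume "y \<in> {y. ((x, y), p) \<in> D'}"
    then have "((x, y), p) \<in> D'" by simp
    then show "y \<in> (\<lambda>\<theta>. snd (fst \<theta>)) ` D'" by (rule image_eqI[rotated]) simp
  qed
  then show "finite {y. ((x, y), p) \<in> D'}" by (rule finite_subset[OF _ finite_imageI[OF assms(2)]])
  show "{y. ((x, y), p) \<in> D} \<subseteq> {y. ((x, y), p) \<in> D'}" using assms(1) by blast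
qed

lemma sum_select:
  assumes "finite I"
  shows "(\<Sum>x\<in>I. fscale (rat_const (if P x then c else 0)) (f x)) = fscale (rat_const c) (\<Sum>x\<in>{x\<in>I. P x}. f x)"
proof -
  have "(\<Sum>x\<in>I. fscale (rat_const (if P x then c else 0)) (f x)) = (\<Sum>x\<in>I. if P x then fscale (rat_const c) (f x) else 0)"
    by (intro sum.cong refl) simp
  also have "\<dots> = (\<Sum>x\<in>{x\<in>I. P x}. fscale (rat_const c) (f x))" by (rule sum.inter_filter[OF assms, symmetric])
  finally show ?thesis by (simp only: fs.scale_sum_right)
qed

section \<open>Evaluation at the contents of a fixed tableau\<close>

locale fusion = wreath_characters G n m \<rho> + cyclic_factors G N k \<phi> t
  for G :: "('g, 'b) monoid_scheme" (structure) and n m \<rho> N k \<phi> t +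
  fixes \<Lambda> :: "nat \<Rightarrow> nat list" and T :: "mnode \<Rightarrow> nat"
  assumes \<Lambda>: "\<Lambda> \<in> multipartitions m n" and T: "T \<in> standard_tableaux m n \<Lambda>"
begin

abbreviation "nd \<equiv> node_at m \<Lambda> T"
abbreviation "pp \<equiv> tab_position m \<Lambda> T"
abbreviation "cc \<equiv> tab_content m \<Lambda> T"

lemma pp_range: "i \<in> {1..n} \<Longrightarrow> pp i \<in> {1..m}"
  using pos_range[OF \<Lambda> T] by blast

lemma char_t: "p \<in> {1..m} \<Longrightarrow> \<alpha> \<in> {1..N} \<Longrightarrow> \<rho> p (t \<alpha>) \<in> unity_roots (k \<alpha>)"
  by (rule character_t_unity[OF rho_linear])

lemma k_pos: "\<alpha> \<in> {1..N} \<Longrightarrow> 0 < k \<alpha>" using k by force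

lemma char_t_inject:
  assumes p: "p \<in> {1..m}" "q \<in> {1..m}" and eq: "\<And>\<alpha>. \<alpha> \<in> {1..N} \<Longrightarrow> \<rho> p (t \<alpha>) = \<rho> q (t \<alpha>)"
  shows "p = q"
  by (rule rho_inject[OF p]) (rule characters_determined[OF rho_linear[OF p(1)] rho_linear[OF p(2)] eq])

lemma prod_nodes: "(\<Prod>\<theta>\<in>mnodes m \<Lambda>. f \<theta>) = (\<Prod>i\<in>{1..n}. f (nd i))"
  unfolding node_at_image_all[OF \<Lambda> T, symmetric] prod.reindex[OF node_at_inj[OF \<Lambda> T]] comp_def ..

text \<open>By \<open>hfun_same\<close>, the first normalising constant is the eigenvalue of the
  evaluated \<Gamma>' on the components with the characters of T.\<close>

lemma F_G_eq: "F_G m N k t \<rho> \<Lambda> = (\<Prod>i\<in>{1..n}. \<Prod>\<alpha>\<in>{1..N}. hfun (k \<alpha>) (\<rho> (pp i) (t \<alpha>)) (\<rho> (pp i) (t \<alpha>)))"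
  unfolding F_G_def prod_nodes tab_position_def[symmetric]
  by (intro prod.cong refl hfun_same[symmetric] char_t pp_range k_pos)

lemma F_G_nonzero: "F_G m N k t \<rho> \<Lambda> \<noteq> 0"
proof -
  have "finite (unity_roots (k \<alpha>))" if "\<alpha> \<in> {1..N}" for \<alpha> by (rule finite_unity_roots[OF k_pos[OF that]])
  then show ?thesis unfolding F_G_def using card_mnodes[of m \<Lambda>] by auto
qed

lemma F_hook_nonzero: "F_hook m \<Lambda> \<noteq> 0"
proof -
  have fin: "finite (mnodes m \<Lambda>)" using card_mnodes by blast
  have "hook_length \<Lambda> \<theta> \<noteq> 0" if \<theta>: "\<theta> \<in> mnodes m \<Lambda>" for \<theta>
  proof -
    obtain x y p where xyp: "\<theta> = ((x, y), p)" by (metis prod.exhaust)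
    let ?H = "{(x', y') \<in> diagram (\<Lambda> p). (x' = x \<and> y \<le> y') \<or> (y' = y \<and> x \<le> x')}"
    have p: "p \<in> {1..m}" and mem: "(x, y) \<in> ?H" using \<theta> by (auto simp: xyp mnodes_def)
    have finH: "finite ?H"
    proof (rule finite_subset)
      show "?H \<subseteq> fst ` mnodes m \<Lambda>" using p by (force simp: mnodes_def)
      show "finite (fst ` mnodes m \<Lambda>)" using fin by simp
    qed
    have ne: "?H \<noteq> {}" using mem by blast
    have "0 < card ?H" unfolding card_gt_0_iff by (intro conjI ne finH)
    moreover have "hook_length \<Lambda> \<theta> = card ?H" unfolding xyp by (rule hook_length.simps)
    ultimately show ?thesis by linarith
  qed
  then show ?thesis unfolding F_hook_def using fin by simp
qed

text \<open>The components that survive once the v variables and u_1, ..., u_j have been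
  evaluated.\<close>

definition Bset :: "nat \<Rightarrow> (('g \<times> nat) + nat \<Rightarrow> complex) set" where
  "Bset j = {\<beta>\<in>weights n. (\<forall>g\<in>carrier G. \<forall>i\<in>{1..n}. \<beta> (Inl (g, i)) = \<rho> (pp i) g) \<and>
     (\<forall>i\<in>{1..j}. \<beta> (Inr i) = of_int (cc i))}"

lemma Bset_weights: "\<beta> \<in> Bset j \<Longrightarrow> \<beta> \<in> weights n" by (simp add: Bset_def)

lemma finite_Bset: "finite (Bset j)" unfolding Bset_def using finite_weights by simp

lemma Bset_Suc: "Bset (Suc j) = {\<beta>\<in>Bset j. \<beta> (Inr (Suc j)) = of_int (cc (Suc j))}"
proof -
  have "{1..Suc j} = insert (Suc j) {1..j}" by auto
  then show ?thesis unfolding Bset_def ball_simps by (simp only: ball_simps) blast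
qed

abbreviation "wv \<beta> \<equiv> vconst (widem \<beta>)"

lemma tidem_Bset: "tidem \<Lambda> T = (\<Sum>\<beta>\<in>Bset n. widem \<beta>)"
proof -
  have "(\<forall>b\<in>ops n. \<beta> b = wfun pp (\<lambda>i. of_int (cc i)) b) \<longleftrightarrow>
    (\<forall>g\<in>carrier G. \<forall>i\<in>{1..n}. \<beta> (Inl (g, i)) = \<rho> (pp i) g) \<and> (\<forall>i\<in>{1..n}. \<beta> (Inr i) = of_int (cc i))" for \<beta>
    unfolding ops_def wfun_def ball_Un ball_simps by auto
  then show ?thesis unfolding tidem_def Bset_def by simp
qed

lemma wv_A: "\<beta> \<in> weights n \<Longrightarrow> wv \<beta> \<in> kf.A" by (rule vconst_supp[OF widem_A])

lemma one_wv: "group_elem \<one>\<^bsub>W\<^esub> = (\<Sum>\<beta>\<in>weights n. wv \<beta>)"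
proof -
  have "group_elem \<one>\<^bsub>W\<^esub> = vconst (group_elem \<one>\<^bsub>W\<^esub>)" by (auto simp: vconst_def group_elem_def fun_eq_iff)
  then show ?thesis unfolding widem_sum vconst_sum .
qed

abbreviation "v_eval \<equiv> v_assignment n N (\<lambda>i \<alpha>. \<rho> (pp i) (t \<alpha>))"

definition hprod :: "(('g \<times> nat) + nat \<Rightarrow> complex) \<Rightarrow> ratfun" where
  "hprod \<beta> = (\<Prod>i\<in>{1..n}. \<Prod>\<alpha>\<in>{1..N}. hfun (k \<alpha>) (rat_var (VVar i \<alpha>)) (rat_const (\<beta> (Inl (t \<alpha>, i)))))"

definition hval :: "(('g \<times> nat) + nat \<Rightarrow> complex) \<Rightarrow> complex" where
  "hval \<beta> = (\<Prod>i\<in>{1..n}. \<Prod>\<alpha>\<in>{1..N}. hfun (k \<alpha>) (\<rho> (pp i) (t \<alpha>)) (\<beta> (Inl (t \<alpha>, i))))"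

lemma hprod_evals: "evals v_eval (hprod \<beta>) (rat_const (hval \<beta>))"
  unfolding hprod_def hval_def rat_const_prod
  by (intro evals_prod evals_hfun evals_var_Some) (simp add: v_assignment_def)

text \<open>For a nonzero component the values at place i form a character \<rho> q; if q is not the
  position in T, some generator separates the two characters and its \<open>hfun\<close> vanishes at
  two different roots of unity. Zero components are excluded, as their \<beta> need not consist of
  characters.\<close>

lemma hval_eq:
  assumes \<beta>: "\<beta> \<in> weights n" and nz: "widem \<beta> \<noteq> 0"
  shows "hval \<beta> = (if \<beta> \<in> Bset 0 then F_G m N k t \<rho> \<Lambda> else 0)"
proof (cases "\<beta> \<in> Bset 0")
  case True
  then have "\<beta> (Inl (t \<alpha>, i)) = \<rho> (pp i) (t \<alpha>)" if "\<alpha> \<in> {1..N}" "i \<in> {1..n}" for \<alpha> i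
    using t_carrier[OF that(1)] that(2) by (simp add: Bset_def)
  then have "hval \<beta> = F_G m N k t \<rho> \<Lambda>" unfolding hval_def F_G_eq by (intro prod.cong refl) simp
  then show ?thesis using True by simp
next
  case False
  then obtain g i where gi: "g \<in> carrier G" "i \<in> {1..n}" "\<beta> (Inl (g, i)) \<noteq> \<rho> (pp i) g"
    using \<beta> unfolding Bset_def by force
  have "act W (pl n h i) (widem \<beta>) = fscale (\<beta> (Inl (h, i))) (widem \<beta>)" if "h \<in> carrier G" for h
    using widem_weight[OF \<beta>, of "Inl (h, i)"] that gi(2) by (simp add: ops_def)
  from eigenvalue_character[OF gi(2) nz this] obtain q where
    q: "q \<in> {1..m}" "\<And>h. h \<in> carrier G \<Longrightarrow> \<beta> (Inl (h, i)) = \<rho> q h" by blast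
  have "q \<noteq> pp i" using gi q(2) by metis
  then obtain \<alpha> where \<alpha>: "\<alpha> \<in> {1..N}" "\<rho> q (t \<alpha>) \<noteq> \<rho> (pp i) (t \<alpha>)"
    using char_t_inject[OF q(1) pp_range[OF gi(2)]] by blast
  have "hfun (k \<alpha>) (\<rho> (pp i) (t \<alpha>)) (\<beta> (Inl (t \<alpha>, i))) = 0"
    unfolding q(2)[OF t_carrier[OF \<alpha>(1)]]
    by (rule hfun_other[OF char_t[OF pp_range[OF gi(2)] \<alpha>(1)] char_t[OF q(1) \<alpha>(1)]]) (use \<alpha>(2) in simp)
  then have "(\<Prod>\<alpha>\<in>{1..N}. hfun (k \<alpha>) (\<rho> (pp i) (t \<alpha>)) (\<beta> (Inl (t \<alpha>, i)))) = 0"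
    using \<alpha>(1) by (intro prod_zero) auto
  then have "hval \<beta> = 0" unfolding hval_def using gi(2) by (intro prod_zero) auto
  then show ?thesis using False by simp
qed

text \<open>1 is expanded into weight components, on each of which \<Gamma>' acts as a
  scalar.\<close>

lemma Gamma_evals:
  "vevals v_eval (wg.conv (Gamma_fun G n N k t) (group_elem \<one>\<^bsub>W\<^esub>))
    (fscale (rat_const (F_G m N k t \<rho> \<Lambda>)) (\<Sum>\<beta>\<in>Bset 0. wv \<beta>))"
proof -
  have "wg.conv (Gamma_fun G n N k t) (wv \<beta>) = fscale (hprod \<beta>) (wv \<beta>)" if \<beta>: "\<beta> \<in> weights n" for \<beta>
    unfolding hprod_def
  proof (rule Gamma_conv[OF _ wv_A[OF \<beta>]])
    show "t \<alpha> \<in> carrier G" if "\<alpha> \<in> {1..N}" for \<alpha> by (rule t_carrier[OF that])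
    show "act W (pl n (t \<alpha>) i) (wv \<beta>) = fscale (rat_const (\<beta> (Inl (t \<alpha>, i)))) (wv \<beta>)"
      if "i \<in> {1..n}" "\<alpha> \<in> {1..N}" for i \<alpha> by (rule vconst_weight(1)[OF \<beta> t_carrier[OF that(2)] that(1)])
  qed
  then have 1: "wg.conv (Gamma_fun G n N k t) (group_elem \<one>\<^bsub>W\<^esub>) = (\<Sum>\<beta>\<in>weights n. fscale (hprod \<beta>) (wv \<beta>))"
    unfolding one_wv by (subst wg.conv_sum_right[OF wv_A]) simp_all
  have B0: "Bset 0 = {\<beta>\<in>weights n. \<beta> \<in> Bset 0}" using Bset_weights by blast
  have "vevals v_eval (\<Sum>\<beta>\<in>weights n. fscale (hprod \<beta>) (wv \<beta>))
    (\<Sum>\<beta>\<in>weights n. fscale (rat_const (if \<beta> \<in> Bset 0 then F_G m N k t \<rho> \<Lambda> else 0)) (wv \<beta>))"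
  proof (rule vevals_sum)
    fix \<beta> assume \<beta>: "\<beta> \<in> weights n"
    show "vevals v_eval (fscale (hprod \<beta>) (wv \<beta>))
      (fscale (rat_const (if \<beta> \<in> Bset 0 then F_G m N k t \<rho> \<Lambda> else 0)) (wv \<beta>))"
    proof (cases "widem \<beta> = 0")
      case True
      then show ?thesis using vevals_vconst[of v_eval 0] by simp
    next
      case False
      show ?thesis
        unfolding hval_eq[OF \<beta> False, symmetric] by (rule vevals_fscale[OF hprod_evals vevals_vconst])
    qed
  qed
  then show ?thesis unfolding 1 sum_select[OF finite_weights] B0[symmetric] .
qed

text \<open>The spectral parameters after the first j of them have been evaluated.\<close>

definition uu :: "nat \<Rightarrow> nat \<Rightarrow> ratfun" where
  "uu j i = (if 1 \<le> i \<and> i \<le> j then rat_const (of_int (cc i)) else rat_var (UVar i))"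

text \<open>A parameter that is still a variable differs from all earlier ones, so the later fusion
  operators stay regular.\<close>

lemma uu_neq: "j < l \<Longrightarrow> i < l \<Longrightarrow> uu j l \<noteq> uu j i"
  using rat_var_neq_const[of "UVar l"] by (auto simp: uu_def rat_var_inject)

text \<open>\<open>fus\<close> with index l - 1 is the action of \<phi>_l.\<close>

definition Fop :: "nat \<Rightarrow> nat \<Rightarrow> ('g wreath \<Rightarrow> ratfun) \<Rightarrow> 'g wreath \<Rightarrow> ratfun" where
  "Fop j l = kf.wm.fus (l - 1) (uu j) (uu j l)"

lemma Fop_evals:
  assumes ev: "\<And>i. i \<in> {1..l} \<Longrightarrow> evals \<zeta> (uu j i) (uu j' i)" and l: "j' < l" "vevals \<zeta> v w"
  shows "vevals \<zeta> (Fop j l v) (Fop j' l w)"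
  unfolding Fop_def
proof (rule vevals_fus)
  show "evals \<zeta> (uu j i) (uu j' i)" if "i \<in> {1..l - 1}" for i by (rule ev) (use that in auto)
  show "evals \<zeta> (uu j l) (uu j' l)" by (rule ev) (use l in auto)
  show "uu j' l \<noteq> uu j' i" if "i \<in> {1..l - 1}" for i by (rule uu_neq) (use l that in auto)
qed (rule l)

lemma phi_fold:
  "\<forall>l\<in>set ls. 1 \<le> l \<and> l \<le> n \<Longrightarrow> w \<in> kf.A \<Longrightarrow>
    fold (\<lambda>l. wg.conv (phi_fun G n l)) ls w = fold (Fop 0) ls w \<and> fold (Fop 0) ls w \<in> kf.A"
proof (induction ls arbitrary: w)
  case (Cons l ls)
  obtain l' where l': "l = Suc l'" "l' < n" using Cons.prems(1) by (cases l) auto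
  have uu0: "uu 0 = (\<lambda>j. rat_var (UVar j))" by (simp add: uu_def fun_eq_iff)
  have eq: "wg.conv (phi_fun G n l) w = Fop 0 l w"
    unfolding l'(1) phi_conv[OF l'(2) Cons.prems(2)] Fop_def uu0 by simp
  have A: "Fop 0 l w \<in> kf.A" unfolding Fop_def by (rule kf.fus_A[OF _ Cons.prems(2)]) (use l' in simp)
  show ?case using Cons.IH[OF _ A] Cons.prems(1) eq by simp
qed simp

text \<open>An element of the algebra is recovered by applying it to 1. The factor \<phi>_1 stands
  next to \<Gamma>' and acts first, which gives a fold in increasing order.\<close>

lemma Phi_eq: "Phi_fun G n N k t = fold (Fop 0) [1..<Suc n] (wg.conv (Gamma_fun G n N k t) (group_elem \<one>\<^bsub>W\<^esub>))"
proof -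
  let ?\<Gamma> = "Gamma_fun G n N k t" and ?o = "group_elem \<one>\<^bsub>W\<^esub> :: 'g wreath \<Rightarrow> ratfun"
  let ?ps = "map (phi_fun G n) (rev [1..<Suc n])"
  have \<Gamma>: "?\<Gamma> \<in> kf.A" by (rule Gamma_A) (rule t_carrier)
  have o: "?o \<in> kf.A" by (rule wg.group_elem_closed) simp
  have \<Gamma>o: "wg.conv ?\<Gamma> ?o \<in> kf.A" by (rule wg.conv_closed[OF o])
  have ps: "set ?ps \<subseteq> kf.A"
  proof
    fix x assume "x \<in> set ?ps"
    then obtain l where l: "1 \<le> l" "l \<le> n" "x = phi_fun G n l" by auto
    then obtain l' where "l = Suc l'" "l' < n" by (cases l) auto
    then show "x \<in> kf.A" using phi_A l(3) by simp
  qed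
  have "Phi_fun G n N k t = wg.conv (wg.conv (ordered_prod (wreath_algebra G n) ?ps) ?\<Gamma>) ?o"
    unfolding Phi_fun_def by (rule wg.conv_one_right[OF wg.conv_closed[OF \<Gamma>], symmetric])
  also have "\<dots> = foldr wg.conv ?ps (wg.conv ?\<Gamma> ?o)"
    unfolding wg.conv_assoc[OF \<Gamma> o] by (rule wg.conv_ordered_prod[OF ps \<Gamma>o])
  also have "\<dots> = fold (\<lambda>l. wg.conv (phi_fun G n l)) [1..<Suc n] (wg.conv ?\<Gamma> ?o)"
    by (simp only: foldr_conv_fold rev_map rev_rev_ident fold_map comp_def)
  also have "\<dots> = fold (Fop 0) [1..<Suc n] (wg.conv ?\<Gamma> ?o)"
    using phi_fold[OF _ \<Gamma>o, of "[1..<Suc n]"] by auto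
  finally show ?thesis .
qed

text \<open>Chosen for the final shape; it also bounds the smaller shapes along the path.\<close>

definition L where "L = (SOME L. \<forall>p x. L < x \<longrightarrow> rowlen (mnodes m \<Lambda>) p x = 0)"

lemma L: "L < x \<Longrightarrow> rowlen (mnodes m \<Lambda>) p x = 0"
  using someI_ex[OF row_bound[OF lower_mnodes[OF \<Lambda>]]] unfolding L_def by blast

abbreviation "rw i \<equiv> rowlen (nd ` {1..<i}) (pp i)"
abbreviation "xx i \<equiv> fst (fst (nd i))"

definition rr :: "nat \<Rightarrow> complex" where
  "rr i = rowrest L (rw i) (xx i) (of_int (cc i))"

lemma prod_rr: "(\<Prod>i\<in>{1..n}. rr i) = F_hook m \<Lambda>"
proof -
  have "(\<Prod>i\<in>{1..n}. rr i) = (\<Prod>p\<in>{1..m}. Hnum L (rowlen (nd ` {1..n}) p))"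
    unfolding rr_def tab_position_def tab_content_def
    by (rule path_hook[OF tableau_path[OF \<Lambda> T]]) (simp only: node_at_image_all[OF \<Lambda> T] L)
  moreover have "F_hook m \<Lambda> = (\<Prod>p\<in>{1..m}. Hnum L (rowlen (mnodes m \<Lambda>) p))" by (rule F_hook_eq[OF \<Lambda>]) (rule L)
  ultimately show ?thesis unfolding node_at_image_all[OF \<Lambda> T] by simp
qed

lemma row_zero: assumes "i \<in> {1..n}" "L < x" shows "rowlen (nd ` {1..<i}) q x = 0"
proof -
  have "nd ` {1..<i} \<subseteq> mnodes m \<Lambda>" using node_at_mem[OF \<Lambda> T] assms(1) by auto
  moreover have "finite (mnodes m \<Lambda>)" using card_mnodes by blast
  ultimately have "rowlen (nd ` {1..<i}) q x \<le> rowlen (mnodes m \<Lambda>) q x" by (rule rowlen_mono)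
  then show ?thesis using L[OF assms(2)] by simp
qed

text \<open>The last claim keeps the remaining fraction regular at the content of node i: the rows
  above end at larger contents, row x itself and the rows below at smaller ones.\<close>

lemma node_facts:
  assumes i: "i \<in> {1..n}"
  shows "lower (nd ` {1..<i})" "xx i \<in> {1..L}" "cc i = bet (rw i) (xx i) + 1"
    "\<And>a. a \<in> {1..L} \<Longrightarrow> cc i \<noteq> bet (rw i) a"
proof -
  let ?D = "nd ` {1..<i}"
  have add: "addable ?D (nd i)" using tableau_path[OF \<Lambda> T] i unfolding is_path_def by blast
  obtain x y p where xyp: "nd i = ((x, y), p)" by (metis prod.exhaust)
  have pp: "pp i = p" and xx: "xx i = x" and cc: "cc i = int y - int x"
    by (simp_all add: xyp tab_position_def position_def tab_content_def Defs.content_def)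
  note ar = addable_row[OF add[unfolded xyp]]
  show low: "lower ?D" using add by (simp add: addable_def)
  have "rowlen (nd ` {1..<Suc i}) p x = Suc (rowlen ?D p x)"
  proof -
    have "nd ` {1..<Suc i} = insert ((x, y), p) ?D" using i xyp by (auto simp: atLeastLessThanSuc)
    then show ?thesis using ar(4)[of p x] by simp
  qed
  moreover have "rowlen (nd ` {1..<Suc i}) p x \<le> rowlen (mnodes m \<Lambda>) p x"
  proof -
    have "nd ` {1..<Suc i} \<subseteq> mnodes m \<Lambda>" using node_at_mem[OF \<Lambda> T] i by auto
    moreover have "finite (mnodes m \<Lambda>)" using card_mnodes by blast
    ultimately show ?thesis by (rule rowlen_mono)
  qed
  ultimately have "x \<le> L" using L[of x p] by (cases "L < x") auto
  then show "xx i \<in> {1..L}" using ar(1) xx by simp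
  show c: "cc i = bet (rw i) (xx i) + 1" unfolding pp xx cc bet_def using ar(2) by simp
  show "cc i \<noteq> bet (rw i) a" if a: "a \<in> {1..L}" for a
  proof (cases "a < x")
    case True
    then have "y \<le> rowlen ?D p a" using ar(3)[of a] a by simp
    then show ?thesis using True unfolding pp cc bet_def by simp
  next
    case False
    then have "rowlen ?D p a \<le> rowlen ?D p x" by (intro row_antimono[OF low ar(1)]) simp
    then show ?thesis using False ar(2) unfolding pp cc bet_def by simp
  qed
qed

lemma var_not_int: "rat_var x \<noteq> of_int z"
  using rat_var_neq_const[of x "of_int z"] by (simp add: rat_const_of_int)

text \<open>The product over earlier entries with the same character is a product over the nodes of
  one position, hence a \<open>rowfrac\<close>; its zero at the content of the next node is split
  off.\<close>

lemma ffac_eq: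
  assumes j: "Suc j \<le> n"
  defines "U \<equiv> rat_var (UVar (Suc j))"
  shows "kf.wm.ffac j (\<lambda>i g. rat_const (\<rho> (pp i) g)) (uu j) (\<lambda>g. rat_const (\<rho> (pp (Suc j)) g)) U
    = (U - of_int (cc (Suc j))) * rowrest L (rw (Suc j)) (xx (Suc j)) U"
proof -
  let ?D = "nd ` {1..<Suc j}" and ?q = "pp (Suc j)"
  have Sj: "Suc j \<in> {1..n}" using j by simp
  note nf = node_facts[OF Sj]
  have inj: "inj_on nd {i\<in>{1..<Suc j}. pp i = ?q}"
    by (rule inj_on_subset[OF node_at_inj[OF \<Lambda> T]]) (use j in auto)
  have img: "nd ` {i\<in>{1..<Suc j}. pp i = ?q} = {\<theta>\<in>?D. position \<theta> = ?q}" by (auto simp: tab_position_def)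
  have "(\<Prod>i\<in>{1..j}. if kf.wm.same (\<lambda>g. rat_const (\<rho> (pp i) g)) (\<lambda>g. rat_const (\<rho> ?q g)) then 1 - 1 / (U - uu j i)\<^sup>2 else 1)
    = (\<Prod>i\<in>{1..<Suc j}. if pp i = ?q then 1 - 1 / (U - of_int (cc i))\<^sup>2 else 1)"
  proof (rule prod.cong)
    fix i assume "i \<in> {1..<Suc j}"
    then have i: "i \<in> {1..n}" "i \<in> {1..j}" using j by auto
    show "(if kf.wm.same (\<lambda>g. rat_const (\<rho> (pp i) g)) (\<lambda>g. rat_const (\<rho> ?q g)) then 1 - 1 / (U - uu j i)\<^sup>2 else 1)
      = (if pp i = ?q then 1 - 1 / (U - of_int (cc i))\<^sup>2 else 1)"
      unfolding rat_same[OF pp_range[OF i(1)] pp_range[OF Sj]] using i(2) by (simp add: uu_def rat_const_of_int)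
  qed auto
  also have "\<dots> = (\<Prod>i\<in>{i\<in>{1..<Suc j}. pp i = ?q}. 1 - 1 / (U - of_int (cc i))\<^sup>2)"
    by (rule prod.inter_filter[symmetric]) simp
  also have "\<dots> = (\<Prod>\<theta>\<in>{\<theta>\<in>?D. position \<theta> = ?q}. 1 - 1 / (U - of_int (Defs.content \<theta>))\<^sup>2)"
    unfolding img[symmetric] prod.reindex[OF inj] comp_def tab_content_def ..
  finally have "kf.wm.ffac j (\<lambda>i g. rat_const (\<rho> (pp i) g)) (uu j) (\<lambda>g. rat_const (\<rho> ?q g)) U
    = U * (\<Prod>\<theta>\<in>{\<theta>\<in>?D. position \<theta> = ?q}. 1 - 1 / (U - of_int (Defs.content \<theta>))\<^sup>2)"
    unfolding kf.wm.ffac_def by (rule arg_cong)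
  also have "\<dots> = rowfrac L (rw (Suc j)) U"
    unfolding U_def by (rule prod_resolvent[OF nf(1)]) (rule row_zero[OF Sj], assumption, rule var_not_int)
  also have "\<dots> = (U - of_int (bet (rw (Suc j)) (xx (Suc j)) + 1)) * rowrest L (rw (Suc j)) (xx (Suc j)) U"
    by (rule rowfrac_rest[OF nf(2)])
  finally show ?thesis unfolding nf(3)[symmetric] .
qed

lemma fus_wv:
  assumes j: "Suc j \<le> n" and \<beta>: "\<beta> \<in> Bset j"
  defines "U \<equiv> rat_var (UVar (Suc j))"
  shows "Fop j (Suc j) (wv \<beta>) = fscale ((U - of_int (cc (Suc j))) * rowrest L (rw (Suc j)) (xx (Suc j)) U
    / (U - rat_const (\<beta> (Inr (Suc j))))) (wv \<beta>)"
proof -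
  have uj: "uu j (Suc j) = U" by (simp add: uu_def U_def)
  have w: "\<beta> \<in> weights n" by (rule Bset_weights[OF \<beta>])
  have eig: "kf.wm.eig (\<lambda>g. rat_const (\<rho> (pp i) g)) i (wv \<beta>)" if i: "i \<in> {1..n}" for i
    unfolding kf.wm.eig_def
  proof
    fix g assume g: "g \<in> carrier G"
    have "\<beta> (Inl (g, i)) = \<rho> (pp i) g" using \<beta> g i by (simp add: Bset_def)
    then show "act W (pl n g i) (wv \<beta>) = fscale (rat_const (\<rho> (pp i) g)) (wv \<beta>)"
      using vconst_weight(1)[OF w g i] by simp
  qed
  have "kf.wm.fus j (uu j) U (wv \<beta>) = fscale (kf.wm.ffac j (\<lambda>i g. rat_const (\<rho> (pp i) g)) (uu j)
    (\<lambda>g. rat_const (\<rho> (pp (Suc j)) g)) U / (U - rat_const (\<beta> (Inr (Suc j))))) (wv \<beta>)"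
  proof (rule kf.wm.fus_eigen)
    show "j < n" using j by simp
    fix i assume i: "i \<in> {1..j}"
    then have i': "i \<in> {1..n}" using j by simp
    have "\<beta> (Inr i) = of_int (cc i)" using \<beta> i by (simp add: Bset_def)
    then have "kf.wm.J i (wv \<beta>) = fscale (uu j i) (wv \<beta>)"
      using vconst_weight(2)[OF w i'] i by (simp add: uu_def)
    moreover have "U \<noteq> uu j i" unfolding uj[symmetric] by (rule uu_neq) (use i in auto)
    ultimately show "kf.wm.J i (wv \<beta>) = fscale (uu j i) (wv \<beta>) \<and> kf.wm.eig (\<lambda>g. rat_const (\<rho> (pp i) g)) i (wv \<beta>)
      \<and> kf.wm.is_char (\<lambda>g. rat_const (\<rho> (pp i) g)) \<and> U \<noteq> uu j i"
      using eig[OF i'] rat_is_char[OF pp_range[OF i']] by blast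
  next
    show "kf.wm.is_char (\<lambda>g. rat_const (\<rho> (pp (Suc j)) g))" by (rule rat_is_char[OF pp_range]) (use j in simp)
    show "kf.wm.eig (\<lambda>g. rat_const (\<rho> (pp (Suc j)) g)) (Suc j) (wv \<beta>)" by (rule eig) (use j in simp)
    show "kf.wm.J (Suc j) (wv \<beta>) = fscale (rat_const (\<beta> (Inr (Suc j)))) (wv \<beta>)"
      by (rule vconst_weight(2)[OF w]) (use j in simp)
    show "U \<noteq> rat_const (\<beta> (Inr (Suc j)))" unfolding U_def by (rule rat_var_neq_const)
  qed
  then show ?thesis unfolding Fop_def uj diff_Suc_1 U_def ffac_eq[OF j] .
qed

text \<open>If b is the content, zero and pole cancel identically before the evaluation and
  \<open>rr\<close> remains; otherwise the denominator is regular and the zero kills the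
  coefficient.\<close>

lemma coefficient_evals:
  assumes j: "Suc j \<le> n"
  defines "U \<equiv> rat_var (UVar (Suc j))"
  shows "evals [UVar (Suc j) \<mapsto> of_int (cc (Suc j))]
    ((U - of_int (cc (Suc j))) * rowrest L (rw (Suc j)) (xx (Suc j)) U / (U - rat_const b))
    (rat_const (if b = of_int (cc (Suc j)) then rr (Suc j) else 0))"
proof -
  let ?\<zeta> = "[UVar (Suc j) \<mapsto> of_int (cc (Suc j)) :: complex]" and ?c = "cc (Suc j)"
  have Sj: "Suc j \<in> {1..n}" using j by simp
  note nf = node_facts[OF Sj]
  have U: "evals ?\<zeta> U (rat_const (of_int ?c))" unfolding U_def by (rule evals_var_Some) simp
  have R: "evals ?\<zeta> (rowrest L (rw (Suc j)) (xx (Suc j)) U) (rat_const (rr (Suc j)))"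
    unfolding rr_def by (rule evals_rowrest[OF U nf(4) nf(2)])
  show ?thesis
  proof (cases "b = of_int ?c")
    case True
    have "U - of_int ?c \<noteq> 0" using var_not_int[of "UVar (Suc j)" ?c] by (simp add: U_def)
    then show ?thesis using R True by (simp add: rat_const_of_int)
  next
    case False
    have "evals ?\<zeta> ((U - of_int ?c) * rowrest L (rw (Suc j)) (xx (Suc j)) U / (U - rat_const b))
      ((rat_const (of_int ?c) - rat_const (of_int ?c)) * rat_const (rr (Suc j)) / (rat_const (of_int ?c) - rat_const b))"
      unfolding rat_const_of_int[of ?c, symmetric]
      by (intro evals_divide evals_mult evals_diff U R evals_const) (use False in auto)
    then show ?thesis using False by simp
  qed
qed

definition CC :: "nat \<Rightarrow> complex" where "CC j = F_G m N k t \<rho> \<Lambda> * (\<Prod>i\<in>{1..j}. rr i)"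

text \<open>The function after the v variables and u_1, ..., u_j have been evaluated: the fusion
  operators still to come, applied to the surviving components with the constant collected so
  far.\<close>

definition XX :: "nat \<Rightarrow> 'g wreath \<Rightarrow> ratfun" where
  "XX j = fold (Fop j) [Suc j..<Suc n] (fscale (rat_const (CC j)) (\<Sum>\<beta>\<in>Bset j. wv \<beta>))"

lemma XX_0: "vevals v_eval (Phi_fun G n N k t) (XX 0)"
proof -
  have "evals v_eval (uu 0 i) (uu 0 i)" for i
    unfolding uu_def by (simp add: evals_var_None evals_const v_assignment_def)
  then have "vevals v_eval (fold (Fop 0) [1..<Suc n] (wg.conv (Gamma_fun G n N k t) (group_elem \<one>\<^bsub>W\<^esub>)))
    (fold (Fop 0) [1..<Suc n] (fscale (rat_const (F_G m N k t \<rho> \<Lambda>)) (\<Sum>\<beta>\<in>Bset 0. wv \<beta>)))"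
    by (intro vevals_fold[OF _ Gamma_evals] Fop_evals) auto
  then show ?thesis unfolding Phi_eq XX_def CC_def by simp
qed

text \<open>Only the first remaining operator needs a cancellation. In the later ones u_{j+1} is
  subtracted from a parameter that is still a variable, so evaluation passes through them.\<close>

lemma XX_Suc:
  assumes j: "Suc j \<le> n" shows "vevals [UVar (Suc j) \<mapsto> of_int (cc (Suc j))] (XX j) (XX (Suc j))"
proof -
  let ?\<zeta> = "[UVar (Suc j) \<mapsto> of_int (cc (Suc j)) :: complex]"
  let ?U = "rat_var (UVar (Suc j))"
  let ?K = "\<lambda>\<beta>. (?U - of_int (cc (Suc j))) * rowrest L (rw (Suc j)) (xx (Suc j)) ?U / (?U - rat_const (\<beta> (Inr (Suc j))))"
  have uu: "evals ?\<zeta> (uu j i) (uu (Suc j) i)" for i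
    by (cases "i = Suc j") (auto simp: uu_def intro: evals_const evals_var_None evals_var_Some)
  have "Fop j (Suc j) (fscale (rat_const (CC j)) (\<Sum>\<beta>\<in>Bset j. wv \<beta>))
    = fscale (rat_const (CC j)) (\<Sum>\<beta>\<in>Bset j. Fop j (Suc j) (wv \<beta>))"
    unfolding Fop_def kf.wm.fus_scale kf.wm.fus_sum ..
  also have "\<dots> = fscale (rat_const (CC j)) (\<Sum>\<beta>\<in>Bset j. fscale (?K \<beta>) (wv \<beta>))"
    by (intro arg_cong[of _ _ "fscale _"] sum.cong refl fus_wv[OF j])
  finally have F: "Fop j (Suc j) (fscale (rat_const (CC j)) (\<Sum>\<beta>\<in>Bset j. wv \<beta>)) = \<dots>" .
  have "vevals ?\<zeta> (fscale (rat_const (CC j)) (\<Sum>\<beta>\<in>Bset j. fscale (?K \<beta>) (wv \<beta>)))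
    (fscale (rat_const (CC j)) (\<Sum>\<beta>\<in>Bset j.
      fscale (rat_const (if \<beta> (Inr (Suc j)) = of_int (cc (Suc j)) then rr (Suc j) else 0)) (wv \<beta>)))"
    by (intro vevals_fscale[OF evals_const] vevals_sum vevals_fscale[OF coefficient_evals[OF j]] vevals_vconst)
  also have "fscale (rat_const (CC j)) (\<Sum>\<beta>\<in>Bset j.
      fscale (rat_const (if \<beta> (Inr (Suc j)) = of_int (cc (Suc j)) then rr (Suc j) else 0)) (wv \<beta>))
    = fscale (rat_const (CC (Suc j))) (\<Sum>\<beta>\<in>Bset (Suc j). wv \<beta>)"
    unfolding sum_select[OF finite_Bset] Bset_Suc[symmetric] fs.scale_scale
    by (simp add: CC_def rat_const_mult[symmetric] mult.assoc)
  finally have start: "vevals ?\<zeta> (Fop j (Suc j) (fscale (rat_const (CC j)) (\<Sum>\<beta>\<in>Bset j. wv \<beta>)))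
    (fscale (rat_const (CC (Suc j))) (\<Sum>\<beta>\<in>Bset (Suc j). wv \<beta>))"
    unfolding F .
  have up: "[Suc j..<Suc n] = Suc j # [Suc (Suc j)..<Suc n]" by (rule upt_conv_Cons) (use j in simp)
  show ?thesis
    unfolding XX_def up fold_simps by (rule vevals_fold[OF Fop_evals[OF uu] start]) auto
qed

lemma XX_n: "XX n = fscale (rat_const (F_G m N k t \<rho> \<Lambda> * F_hook m \<Lambda>)) (vconst (tidem \<Lambda> T))"
  by (simp only: XX_def CC_def prod_rr tidem_Bset vconst_sum) simp

text \<open>Induction downwards from n, as each evaluation turns \<open>XX j\<close> into
  \<open>XX (Suc j)\<close>.\<close>

lemma consecutive_evaluation:
  assumes "j \<le> n"
  shows "nonsingular_along (map (\<lambda>i. [UVar i \<mapsto> of_int (cc i)]) [Suc j..<Suc n]) (XX j) \<and>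
    eval_along (map (\<lambda>i. [UVar i \<mapsto> of_int (cc i)]) [Suc j..<Suc n]) (XX j) = XX n"
  using assms
proof (induction rule: inc_induct)
  case base
  show ?case by simp
next
  case (step j)
  have j: "Suc j \<le> n" using step.hyps by simp
  have up: "[Suc j..<Suc n] = Suc j # [Suc (Suc j)..<Suc n]" by (rule upt_conv_Cons) (use j in simp)
  show ?case
    unfolding up list.map eval_along_vevals[OF XX_Suc[OF j]] by (rule step.IH)
qed

theorem fusion_procedure:
  "nonsingular_along (evaluation_sequence n m N t \<rho> \<Lambda> T) (Phi_fun G n N k t) \<and>
    vconst (tableau_idempotent G n m \<rho> \<Lambda> T) = fscale (rat_const (1 / (F_G m N k t \<rho> \<Lambda> * F_hook m \<Lambda>)))
      (eval_along (evaluation_sequence n m N t \<rho> \<Lambda> T) (Phi_fun G n N k t))"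
proof
  have seq: "evaluation_sequence n m N t \<rho> \<Lambda> T = v_eval # map (\<lambda>i. [UVar i \<mapsto> of_int (cc i)]) [Suc 0..<Suc n]"
    by (simp only: evaluation_sequence_def One_nat_def)
  note start = eval_along_vevals[OF XX_0]
  show "nonsingular_along (evaluation_sequence n m N t \<rho> \<Lambda> T) (Phi_fun G n N k t)"
    unfolding seq start using consecutive_evaluation[of 0] by blast
  have "eval_along (evaluation_sequence n m N t \<rho> \<Lambda> T) (Phi_fun G n N k t) = XX n"
    unfolding seq start using consecutive_evaluation[of 0] by blast
  moreover have "rat_const (1 / (F_G m N k t \<rho> \<Lambda> * F_hook m \<Lambda>)) * rat_const (F_G m N k t \<rho> \<Lambda> * F_hook m \<Lambda>) = 1"
    unfolding rat_const_mult[symmetric] using F_G_nonzero F_hook_nonzero by simp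
  ultimately show "vconst (tableau_idempotent G n m \<rho> \<Lambda> T) = fscale (rat_const (1 / (F_G m N k t \<rho> \<Lambda> * F_hook m \<Lambda>)))
      (eval_along (evaluation_sequence n m N t \<rho> \<Lambda> T) (Phi_fun G n N k t))"
    by (simp only: XX_n fs.scale_scale fs.scale_one tableau_idempotent_eq[OF \<Lambda> T])
qed

end

theorem mainTheorem2:
  fixes G :: "('g, 'b) monoid_scheme"
    and N n m :: nat
    and k :: "nat \<Rightarrow> nat"
    and t :: "nat \<Rightarrow> 'g"
    and \<phi> :: "'g \<Rightarrow> nat \<Rightarrow> int"
    and \<rho> :: "nat \<Rightarrow> 'g \<Rightarrow> complex"
    and \<Lambda> :: "nat \<Rightarrow> nat list"
    and T :: "mnode \<Rightarrow> nat"
  assumes "comm_group G"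
    and "\<forall>\<alpha>\<in>{1..N}. 2 \<le> k \<alpha>"
    and "\<phi> \<in> iso G (product_group {1..N} (\<lambda>\<alpha>. integer_mod_group (k \<alpha>)))"
    and "\<forall>\<alpha>\<in>{1..N}. t \<alpha> \<in> carrier G \<and>
           generate G {t \<alpha>} =
             {g \<in> carrier G. \<forall>\<beta>\<in>{1..N} - {\<alpha>}. \<phi> g \<beta> = \<one>\<^bsub>integer_mod_group (k \<beta>)\<^esub>}"
    and "m = (\<Prod>\<alpha>\<in>{1..N}. k \<alpha>)"
    and "bij_betw \<rho> {1..m} (linear_characters G)"
    and "1 \<le> n"
    and "\<Lambda> \<in> multipartitions m n"
    and "T \<in> standard_tableaux m n \<Lambda>"
  shows "nonsingular_along (evaluation_sequence n m N t \<rho> \<Lambda> T) (Phi_fun G n N k t) \<and>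
    (\<lambda>x. rat_const (tableau_idempotent G n m \<rho> \<Lambda> T x)) =
      rat_const (1 / (F_G m N k t \<rho> \<Lambda> * F_hook m \<Lambda>)) \<odot>\<^bsub>wreath_algebra G n\<^esub>
        eval_along (evaluation_sequence n m N t \<rho> \<Lambda> T) (Phi_fun G n N k t)"
proof -
  interpret cf: cyclic_factors G N k \<phi> t
    by (intro cyclic_factors.intro cyclic_factors_axioms.intro assms(1-4))
  \<comment> \<open>G is finite and contains its unit, so its order is nonzero in the complex
    numbers.\<close>
  have "wreath_field_axioms TYPE(complex) G"
    by (rule wreath_field_axioms.intro) (use cf.finite_G cf.one_closed in \<open>auto simp: card_eq_0_iff\<close>)
  then interpret wreath_characters G n m \<rho>
    by (intro wreath_characters.intro wreath_field.intro wreath_characters_axioms.intro assms(1,6))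
  interpret fusion G n m \<rho> N k \<phi> t \<Lambda> T
    by unfold_locales (rule assms(8,9))+
  show ?thesis
    using fusion_procedure unfolding vconst_def wg.smult_eq .
qed

end
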